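(* Let $n\ge 2$ be an integer, let $q$ be a complex number which is not a root of unity ($q=1$ is allowed), let $p$ be an arbitrary complex number, let $M\in\mathbb Z$, and let $0\le s\le n-1$ with $M\equiv s \pmod n$. With the notation of the context: (a) For all integers $r\ge k\ge 0$, every $w\in F_M^k$ can be written uniquely as $w=f_r\wedge|M-s-nr\rangle$ with $f_r\in V_M^{s+nr,k}$. (b) For each generator $x\in\{E_\epsilon,F_\epsilon,K_\epsilon^{\pm1}: 0\le\epsilon\le n-1\}$ of $U_q'(\widehat{\mathfrak{sl}}_n)$ and each $w=f_r\wedge|M-s-nr\rangle\in F_M^k$ ($r\geq k$), the vector $$x.w:=(x^{(s+nr)}f_r)\wedge|M-s-nr\rangle$$ does not depend on the choice of $r\ge k$; extended linearly to $F_M=\bigoplus_{k\ge0}F_M^k$, these formulas define an action $U_0$ of $U_q'(\widehat{\mathfrak{sl}}_n)$ on $F_M$ (a level-0 action) which preserves each $F_M^k$. (c) For each $l\in\mathbb Z\setminus\{0\}$ the vector $$g_l.w:=(g_l^{(s+nr)}f_r)\wedge|M-s-nr\rangle\qquad(r\ge k)$$ does not depend on the choice of $r\ge k$; the resulting operators $g_l$ on $F_M$ commute with each other and with the action $U_0$.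
   Context: **Quantum affine algebra.** $U_q'(\widehat{\mathfrak{sl}}_n)$ is the unital associative $\mathbb C$-algebra with generators $E_i,F_i,K_i^{\pm1}$ ($i=0,\dots,n-1$) and relations $K_iK_i^{-1}=K_i^{-1}K_i=1$, $K_iK_j=K_jK_i$, $K_iE_jK_i^{-1}=q^{a_{ij}}E_j$, $K_iF_jK_i^{-1}=q^{-a_{ij}}F_j$, $[E_i,F_j]=\delta_{ij}\frac{K_i-K_i^{-1}}{q-q^{-1}}$, the $q$-Serre relations for the $E_i$ and for the $F_i$, where $(a_{ij})$ is the affine Cartan matrix of type $A^{(1)}_{n-1}$, together with $K_0K_1\cdots K_{n-1}=1$ ("level 0"). **Operators on Laurent polynomials.** For $N\ge1$, on $\mathbb C[z_1^{\pm1},\dots,z_N^{\pm1}]$ let $K_{i,j}$ be the permutation of $z_i$ and $z_j$, $g_{i,j}=\frac{q^{-1}z_i-qz_j}{z_i-z_j}(K_{i,j}-I)+q$, $\xi_{i,j}=K_{i,j}g_{i,j}$, $p^{D_i}f(z_1,\dots,z_i,\dots,z_N)=f(z_1,\dots,pz_i,\dots,z_N)$, and $$Y_i^{(N)}=\xi_{i,i+1}^{-1}\cdots\xi_{i,N}^{-1}\,p^{D_i}\,\xi_{1,i}\cdots\xi_{i-1,i}\qquad(1\le i\le N).$$ **$q$-wedge product.** $V=\mathbb C^n$ has basis $v_1,\dots,v_n$; $V(z)=\mathbb C[z^{\pm1}]\otimes V$; $u_k:=z^mv_\epsilon$ for $k=\epsilon-nm$, $1\le\epsilon\le n$. $\otimes^NV(z)$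 is identified with $\mathbb C[z_1^{\pm1},\dots,z_N^{\pm1}]\otimes(\otimes^NV)$. With matrix units $E^{\epsilon,\epsilon'}v_\alpha=\delta_{\epsilon',\alpha}v_\epsilon$, put $$S=-q^{-1}\sum_{\epsilon}E^{\epsilon,\epsilon}\otimes E^{\epsilon,\epsilon}+(q-q^{-1})\sum_{\epsilon<\epsilon'}E^{\epsilon,\epsilon}\otimes E^{\epsilon',\epsilon'}-\sum_{\epsilon\ne\epsilon'}E^{\epsilon,\epsilon'}\otimes E^{\epsilon',\epsilon},$$ and let $S_{i,i+1}$ be $S$ acting in factors $i,i+1$ of $\otimes^NV$. Let $\Omega=\sum_{i=1}^{N-1}\mathrm{Ker}(g_{i,i+1}+S_{i,i+1}^{-1})$, $\wedge^NV(z)=\otimes^NV(z)/\Omega$, $\Lambda$ the quotient map, $u_{k_1}\wedge\cdots\wedge u_{k_N}=\Lambda(u_{k_1}\otimes\cdots\otimes u_{k_N})$. It is known (Kashiwara–Miwa–Stern) that the normally ordered wedges ($k_1>\cdots>k_N$) form a basis of $\wedge^NV(z)$. Let $\mathcal M_N^n$ be the set of $\mathbf m=(m_1\le\cdots\le m_N)\in\mathbb Z^N$ in which no value occurs more than $n$ times, and $\mathcal E(\mathbf m)$ the set of $\mathbf e=(\epsilon_1,\dots,\epsilon_N)\in\{1,\dots,n\}^N$ with $\epsilon_i>\epsilon_{i+1}$ whenever $m_i=m_{i+1}$. Then the normally ordered wedges are exactly $w(\mathbf m,\mathbf e)=z^{m_1}v_{\epsilon_1}\wedge\cdots\wedge z^{m_N}v_{\epsilon_N}$,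 $\mathbf m\in\mathcal M_N^n$, $\mathbf e\in\mathcal E(\mathbf m)$. **Action $U_0^{(N)}$ and Hamiltonians on $\wedge^NV(z)$.** Let $y_i=q^{1-N}Y_i^{(N)}$, let $E_i^{\epsilon,\epsilon'}$ be $E^{\epsilon,\epsilon'}$ acting in the $i$-th factor of $\otimes^NV$, and $K_i^\epsilon=q^{E_i^{\epsilon,\epsilon}-E_i^{\epsilon+1,\epsilon+1}}$ (upper indices modulo $n$, so $0$ means $n$). For $0\le\epsilon\le n-1$ put $$K_\epsilon^{(N)}=K_1^\epsilon\cdots K_N^\epsilon,\quad E_\epsilon^{(N)}=\sum_{i=1}^Ny_i^{-\delta_{0,\epsilon}}E_i^{\epsilon,\epsilon+1}K_{i+1}^\epsilon\cdots K_N^\epsilon,\quad F_\epsilon^{(N)}=\sum_{i=1}^Ny_i^{\delta_{0,\epsilon}}(K_1^\epsilon)^{-1}\cdots(K_{i-1}^\epsilon)^{-1}E_i^{\epsilon+1,\epsilon},$$ and $h_l^{(N)}=\sum_{i=1}^N(q^{1-N}Y_i^{(N)})^l$, $l\in\mathbb Z\setminus\{0\}$. These operators preserve $\Omega$, hence act on $\wedge^NV(z)$; the first family is a $U_q'(\widehat{\mathfrak{sl}}_n)$-action, denoted $U_0^{(N)}$ ($x\mapsto x^{(N)}$), and commutes with the commuting operators $h_l^{(N)}$. **Truncated spaces.** Put $m^0=(s-M)/n$, and for $i\ge1$ let $m_i^0$ be the $i$-th entry of the sequence consisting of $s$ copies of $m^0$, then $n$ copies of $m^0+1$, then $n$ copies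 of $m^0+2$, and so on. For $r\ge0$ let $V_M^{s+nr}\subset\wedge^{s+nr}V(z)$ be the span of the $w(\mathbf m,\mathbf e)$ with $\mathbf m\in\mathcal M_{s+nr}^n$, $\mathbf e\in\mathcal E(\mathbf m)$, $m_{s+nr}\le m_{s+nr}^0$. The degree is $|w(\mathbf m,\mathbf e)|=\sum_{i=1}^{s+nr}(m_i^0-m_i)$, and $V_M^{s+nr,k}$ is the span of those $w(\mathbf m,\mathbf e)\in V_M^{s+nr}$ of degree $k$. (For $s=r=0$ the wedge product is empty: $V_M^{0}=V_M^{0,0}=\mathbb C$, with $E_\epsilon,F_\epsilon,h_l$ acting as $0$ and $K_\epsilon$ as $1$.) The operators $x^{(s+nr)}$ and $h_l^{(s+nr)}$ preserve $V_M^{s+nr,k}$. Put $g_l^{(N)}=h_l^{(N)}-\Big(\sum_{j=1}^Np^{lm_j^0}q^{2l(1-j)}\Big)I$ for $N=s+nr$. **Fock space.** $F_M$ is the vector space with basis the normally ordered semi-infinite wedges $u_{k_1}\wedge u_{k_2}\wedge\cdots$, $k_1>k_2>\cdots$, $k_i=M-i+1$ for $i\gg1$. $|M\rangle=u_M\wedge u_{M-1}\wedge\cdots$. Writing a normally ordered wedge as $w=z^{m_1}v_{\epsilon_1}\wedge z^{m_2}v_{\epsilon_2}\wedge\cdots$, its degree is $|w|=\sum_{i\ge1}(m_i^0-m_i)$; $F_M^k$ is the span of normally ordered wedges of degree $k$. For a normally ordered wedge $f\in V_M^{s+nr}$, $f\wedge|M-s-nr\rangle$ is the (normally ordered) concatenation,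 extended linearly in $f$.
   Formalization: p and q are taken nonzero (p^{D_i}, Y_i^{-1}, q^{-1} are undefined otherwise); at q=1, where (K_i-K_i^{-1})/(q-q^{-1}) is 0/0, the relations are read as their limit: K_i=1, H_i=[E_i,F_i] with the classical level-0 affine relations. *)

theory Defs
  imports
    Complex_Main
    "HOL-Library.Poly_Mapping"
    "HOL-Library.Function_Algebras"
    "HOL-Library.Stream"
    "HOL-Combinatorics.Transposition"
    "HOL-Algebra.QuotRing"
begin

text \<open>
  Inverses of operators are written \<^term>\<open>inv_into UNIV T\<close>: the bare
  \<open>inv\<close> is taken by the group inverse of HOL-Algebra.
\<close>

section \<open>Linear algebra on finitely supported functions\<close>

definition smul :: "complex \<Rightarrow> ('a \<Rightarrow>\<^sub>0 complex) \<Rightarrow> ('a \<Rightarrow>\<^sub>0 complex)" where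
  "smul c f = Poly_Mapping.map (\<lambda>x. c * x) f"

definition lin_endo :: "('a \<Rightarrow>\<^sub>0 complex) set \<Rightarrow> (('a \<Rightarrow>\<^sub>0 complex) \<Rightarrow> ('a \<Rightarrow>\<^sub>0 complex)) \<Rightarrow> bool" where
  "lin_endo W T \<longleftrightarrow>
     (\<forall>w\<in>W. T w \<in> W) \<and>
     (\<forall>v\<in>W. \<forall>w\<in>W. T (v + w) = T v + T w) \<and>
     (\<forall>c. \<forall>w\<in>W. T (smul c w) = smul c (T w))"

definition op_prod :: "('a \<Rightarrow> 'a) list \<Rightarrow> 'a \<Rightarrow> 'a" where
  "op_prod Ts = foldr (\<circ>) Ts id"

definition op_zpow :: "('a \<Rightarrow> 'a) \<Rightarrow> int \<Rightarrow> 'a \<Rightarrow> 'a" where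
  "op_zpow T l = (if 0 \<le> l then T ^^ nat l else inv_into UNIV T ^^ nat (- l))"


section \<open>The quantum affine algebra at level 0\<close>

datatype gen = GenE nat | GenF nat | GenK nat | GenKinv nat

definition gens :: "nat \<Rightarrow> gen set" where
  "gens n = (\<Union>i\<in>{..<n}. {GenE i, GenF i, GenK i, GenKinv i})"

text \<open>
  Words form a monoid under concatenation (written additively), so that the convolution
  product of \<^theory>\<open>HOL-Library.Poly_Mapping\<close> makes the finitely supported functions on
  words the free associative unital algebra.
\<close>

datatype 'g word = Word (letters: "'g list")

instantiation word :: (type) monoid_add
begin

definition zero_word :: "'a word" where "zero_word = Word []"

definition plus_word :: "'a word \<Rightarrow> 'a word \<Rightarrow> 'a word" where
  "plus_word u v = Word (letters u @ letters v)"

instance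
  by standard (simp_all add: zero_word_def plus_word_def)

end

type_synonym free_elt = "gen word \<Rightarrow>\<^sub>0 complex"

definition letter :: "gen \<Rightarrow> free_elt" where
  "letter x = Poly_Mapping.single (Word [x]) 1"

definition scalar :: "complex \<Rightarrow> free_elt" where
  "scalar c = Poly_Mapping.single 0 c"

definition free_alg :: "nat \<Rightarrow> free_elt ring" where
  "free_alg n = \<lparr>carrier = {a. \<forall>u\<in>Poly_Mapping.keys a. set (letters u) \<subseteq> gens n},
     mult = (*), one = 1, zero = 0, add = (+)\<rparr>"

text \<open>The two neighbours of a node coincide for \<open>n = 2\<close>, which gives the entry \<open>-2\<close>.\<close>

definition cartan :: "nat \<Rightarrow> nat \<Rightarrow> nat \<Rightarrow> int" where
  "cartan n i j = (if i = j then 2 else 0)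
     - (if i = (j + 1) mod n then 1 else 0) - (if j = (i + 1) mod n then 1 else 0)"

text \<open>
  \<open>[k] = (q\<^sup>k - q\<^sup>-\<^sup>k) / (q - q\<^sup>-\<^sup>1)\<close> written as a sum, so that it also covers \<open>q = 1\<close>.
\<close>

definition qint :: "complex \<Rightarrow> nat \<Rightarrow> complex" where
  "qint q k = (\<Sum>i<k. q powi (int k - 1 - 2 * int i))"

definition qfact :: "complex \<Rightarrow> nat \<Rightarrow> complex" where
  "qfact q k = (\<Prod>i=1..k. qint q i)"

definition qbinom :: "complex \<Rightarrow> nat \<Rightarrow> nat \<Rightarrow> complex" where
  "qbinom q m t = qfact q m / (qfact q t * qfact q (m - t))"

definition serre :: "complex \<Rightarrow> nat \<Rightarrow> free_elt \<Rightarrow> free_elt \<Rightarrow> free_elt" where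
  "serre q m x y = (\<Sum>t\<le>m. scalar ((- 1) ^ t * qbinom q m t) * x ^ (m - t) * y * x ^ t)"

abbreviation gE :: "nat \<Rightarrow> free_elt" where "gE i \<equiv> letter (GenE i)"
abbreviation gF :: "nat \<Rightarrow> free_elt" where "gF i \<equiv> letter (GenF i)"
abbreviation gK :: "nat \<Rightarrow> free_elt" where "gK i \<equiv> letter (GenK i)"
abbreviation gKinv :: "nat \<Rightarrow> free_elt" where "gKinv i \<equiv> letter (GenKinv i)"

definition common_relators :: "nat \<Rightarrow> complex \<Rightarrow> free_elt set" where
  "common_relators n q =
     (\<Union>i\<in>{..<n}. {gK i * gKinv i - 1, gKinv i * gK i - 1}) \<union>
     (\<Union>i\<in>{..<n}. \<Union>j\<in>{..<n}.
        {gK i * gK j - gK j * gK i,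
         gK i * gE j * gKinv i - scalar (q powi cartan n i j) * gE j,
         gK i * gF j * gKinv i - scalar (q powi (- cartan n i j)) * gF j}) \<union>
     (\<Union>i\<in>{..<n}. \<Union>j\<in>{..<n} - {i}.
        {serre q (nat (1 - cartan n i j)) (gE i) (gE j),
         serre q (nat (1 - cartan n i j)) (gF i) (gF j)}) \<union>
     {prod_list (map gK [0..<n]) - 1}"

definition EF_relators :: "nat \<Rightarrow> complex \<Rightarrow> free_elt set" where
  "EF_relators n q =
     (\<Union>i\<in>{..<n}. \<Union>j\<in>{..<n}.
        {gE i * gF j - gF j * gE i
           - (if i = j then scalar (1 / (q - inverse q)) * (gK i - gKinv i) else 0)})"

text \<open>
  At \<open>q = 1\<close> the fraction \<open>(K\<^sub>i - K\<^sub>i\<^sup>-\<^sup>1) / (q - q\<^sup>-\<^sup>1)\<close> is read as its limit, the Cartan element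
  \<open>H\<^sub>i\<close> with \<open>K\<^sub>i = q^H\<^sub>i\<close>. Since \<open>H\<^sub>i = [E\<^sub>i, F\<^sub>i]\<close> needs no separate generator, these relators
  say \<open>K\<^sub>i = 1\<close>, \<open>[E\<^sub>i, F\<^sub>j] = 0\<close> for \<open>i \<noteq> j\<close>, the limits of the relations between the \<open>K\<^sub>i\<close> and
  \<open>K\<^sub>j, E\<^sub>j, F\<^sub>j\<close>, and level 0. With the Serre relations they present the enveloping algebra of
  the affine algebra of type A without derivation, modulo its central element.
\<close>

definition gH :: "nat \<Rightarrow> free_elt" where
  "gH i = gE i * gF i - gF i * gE i"

definition classical_relators :: "nat \<Rightarrow> free_elt set" where
  "classical_relators n =
     (\<Union>i\<in>{..<n}. {gK i - 1}) \<union>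
     (\<Union>i\<in>{..<n}. \<Union>j\<in>{..<n} - {i}. {gE i * gF j - gF j * gE i}) \<union>
     (\<Union>i\<in>{..<n}. \<Union>j\<in>{..<n}.
        {gH i * gH j - gH j * gH i,
         gH i * gE j - gE j * gH i - scalar (of_int (cartan n i j)) * gE j,
         gH i * gF j - gF j * gH i + scalar (of_int (cartan n i j)) * gF j}) \<union>
     {\<Sum>i<n. gH i}"

definition relators :: "nat \<Rightarrow> complex \<Rightarrow> free_elt set" where
  "relators n q = common_relators n q \<union> (if q = 1 then classical_relators n else EF_relators n q)"

definition rel_ideal :: "nat \<Rightarrow> complex \<Rightarrow> free_elt set" where
  "rel_ideal n q = genideal (free_alg n) (relators n q)"

definition Uq :: "nat \<Rightarrow> complex \<Rightarrow> free_elt set ring" where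
  "Uq n q = FactRing (free_alg n) (rel_ideal n q)"

definition Uq_class :: "nat \<Rightarrow> complex \<Rightarrow> free_elt \<Rightarrow> free_elt set" where
  "Uq_class n q a = a_r_coset (free_alg n) (rel_ideal n q) a"

text \<open>Unitality is the case \<open>c = 1\<close> of the last clause.\<close>

definition Uq_action ::
  "nat \<Rightarrow> complex \<Rightarrow> ('a \<Rightarrow>\<^sub>0 complex) set \<Rightarrow> (free_elt set \<Rightarrow> ('a \<Rightarrow>\<^sub>0 complex) \<Rightarrow> ('a \<Rightarrow>\<^sub>0 complex)) \<Rightarrow> bool" where
  "Uq_action n q W \<rho> \<longleftrightarrow>
     (\<forall>a\<in>carrier (Uq n q). lin_endo W (\<rho> a)) \<and>
     (\<forall>a\<in>carrier (Uq n q). \<forall>b\<in>carrier (Uq n q). \<forall>w\<in>W.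
        \<rho> (a \<otimes>\<^bsub>Uq n q\<^esub> b) w = \<rho> a (\<rho> b w) \<and>
        \<rho> (a \<oplus>\<^bsub>Uq n q\<^esub> b) w = \<rho> a w + \<rho> b w) \<and>
     (\<forall>c. \<forall>w\<in>W. \<rho> (Uq_class n q (scalar c)) w = smul c w)"


section \<open>Operators on Laurent polynomials\<close>

text \<open>
  Laurent polynomials in \<open>z\<^sub>1, z\<^sub>2, \<dots>\<close>. The operators below are defined on this whole ring and
  preserve each \<open>laurents N\<close>.
\<close>

type_synonym laurent = "(nat \<Rightarrow>\<^sub>0 int) \<Rightarrow>\<^sub>0 complex"

definition laurents :: "nat \<Rightarrow> laurent set" where
  "laurents N = {f. \<forall>m\<in>Poly_Mapping.keys f. Poly_Mapping.keys m \<subseteq> {1..N}}"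

definition zvar :: "nat \<Rightarrow> laurent" where
  "zvar i = Poly_Mapping.single (Poly_Mapping.single i 1) 1"

definition swap_op :: "nat \<Rightarrow> nat \<Rightarrow> laurent \<Rightarrow> laurent" where
  "swap_op i j f = Poly_Mapping.map_key (Poly_Mapping.map_key (transpose i j)) f"

definition g_op :: "complex \<Rightarrow> nat \<Rightarrow> nat \<Rightarrow> laurent \<Rightarrow> laurent" where
  "g_op q i j f =
     (THE h. (zvar i - zvar j) * h = (smul (inverse q) (zvar i) - smul q (zvar j)) * (swap_op i j f - f))
     + smul q f"

definition xi_op :: "complex \<Rightarrow> nat \<Rightarrow> nat \<Rightarrow> laurent \<Rightarrow> laurent" where
  "xi_op q i j = swap_op i j \<circ> g_op q i j"

definition pD_op :: "complex \<Rightarrow> nat \<Rightarrow> laurent \<Rightarrow> laurent" where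
  "pD_op p i f = Poly_Mapping.mapp (\<lambda>m c. p powi Poly_Mapping.lookup m i * c) f"

definition Y_op :: "complex \<Rightarrow> complex \<Rightarrow> nat \<Rightarrow> nat \<Rightarrow> laurent \<Rightarrow> laurent" where
  "Y_op q p N i =
     op_prod (map (\<lambda>j. inv_into UNIV (xi_op q i j)) [i + 1..<N + 1])
     \<circ> pD_op p i
     \<circ> op_prod (map (\<lambda>j. xi_op q j i) [1..<i])"

definition y_op :: "complex \<Rightarrow> complex \<Rightarrow> nat \<Rightarrow> nat \<Rightarrow> laurent \<Rightarrow> laurent" where
  "y_op q p N i f = smul (q powi (1 - int N)) (Y_op q p N i f)"


section \<open>The tensor product and the finite wedge product\<close>

text \<open>
  \<open>\<complex>[z\<^sub>1\<^sup>\<plusminus>\<^sup>1, \<dots>, z\<^sub>N\<^sup>\<plusminus>\<^sup>1] \<otimes> (\<otimes>\<^sup>N V)\<close> is represented by the coefficient functions with respect to the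
  basis \<open>v\<^bsub>e\<^esub> = v\<^bsub>e ! 0\<^esub> \<otimes> \<dots> \<otimes> v\<^bsub>e ! (N - 1)\<^esub>\<close>; tensor factor \<open>i\<close> (counted from 1) is list
  position \<open>i - 1\<close>.
\<close>

type_synonym tensor = "nat list \<Rightarrow> laurent"

definition colours :: "nat \<Rightarrow> nat \<Rightarrow> nat list set" where
  "colours n N = {e. length e = N \<and> set e \<subseteq> {1..n}}"

definition tensors :: "nat \<Rightarrow> nat \<Rightarrow> tensor set" where
  "tensors n N = {\<phi>. (\<forall>e\<in>colours n N. \<phi> e \<in> laurents N) \<and> (\<forall>e. e \<notin> colours n N \<longrightarrow> \<phi> e = 0)}"

definition tsmul :: "complex \<Rightarrow> tensor \<Rightarrow> tensor" where
  "tsmul c \<phi> = (\<lambda>e. smul c (\<phi> e))"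

definition on_laurent :: "(laurent \<Rightarrow> laurent) \<Rightarrow> tensor \<Rightarrow> tensor" where
  "on_laurent T \<phi> = (\<lambda>e. T (\<phi> e))"

text \<open>\<open>munit i a b\<close> is \<open>E\<^sup>a\<^sup>,\<^sup>b\<close>, sending \<open>v\<^sub>b\<close> to \<open>v\<^sub>a\<close>, in factor \<open>i\<close>.\<close>

definition munit :: "nat \<Rightarrow> nat \<Rightarrow> nat \<Rightarrow> tensor \<Rightarrow> tensor" where
  "munit i a b \<phi> = (\<lambda>e. if e ! (i - 1) = a then \<phi> (e[i - 1 := b]) else 0)"

definition S_op :: "complex \<Rightarrow> nat \<Rightarrow> nat \<Rightarrow> tensor \<Rightarrow> tensor" where
  "S_op q n i \<phi> =
     tsmul (- inverse q) (\<Sum>a\<in>{1..n}. munit i a a (munit (i + 1) a a \<phi>))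
     + tsmul (q - inverse q)
         (\<Sum>(a, b)\<in>{(a, b). a \<in> {1..n} \<and> b \<in> {1..n} \<and> a < b}. munit i a a (munit (i + 1) b b \<phi>))
     - (\<Sum>(a, b)\<in>{(a, b). a \<in> {1..n} \<and> b \<in> {1..n} \<and> a \<noteq> b}. munit i a b (munit (i + 1) b a \<phi>))"

definition gS_kernel :: "complex \<Rightarrow> nat \<Rightarrow> nat \<Rightarrow> nat \<Rightarrow> tensor set" where
  "gS_kernel q n N i = {\<phi> \<in> tensors n N.
     on_laurent (g_op q i (i + 1)) \<phi> + inv_into (tensors n N) (S_op q n i) \<phi> = 0}"

definition Omega :: "complex \<Rightarrow> nat \<Rightarrow> nat \<Rightarrow> tensor set" where
  "Omega q n N = {(\<Sum>i\<in>{1..<N}. \<omega> i) | \<omega>. \<forall>i\<in>{1..<N}. \<omega> i \<in> gS_kernel q n N i}"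

text \<open>Elements of \<open>\<and>\<^sup>N V(z)\<close> are cosets of \<open>\<Omega>\<close>; \<open>Lam\<close> is the quotient map \<open>\<Lambda>\<close>.\<close>

definition Lam :: "complex \<Rightarrow> nat \<Rightarrow> nat \<Rightarrow> tensor \<Rightarrow> tensor set" where
  "Lam q n N \<phi> = {\<psi> \<in> tensors n N. \<psi> - \<phi> \<in> Omega q n N}"

text \<open>The operator on the quotient induced by an operator \<open>X\<close> that preserves \<open>\<Omega>\<close>.\<close>

definition induced :: "complex \<Rightarrow> nat \<Rightarrow> nat \<Rightarrow> (tensor \<Rightarrow> tensor) \<Rightarrow> tensor set \<Rightarrow> tensor set" where
  "induced q n N X A = the_elem ((\<lambda>\<phi>. Lam q n N (X \<phi>)) ` A)"

text \<open>\<open>u\<^sub>k = z\<^sup>m v\<^sub>\<epsilon>\<close> with \<open>\<epsilon> = col n k\<close> and \<open>m = zexp n k\<close>, so that \<open>k = \<epsilon> - n m\<close> and \<open>1 \<le> \<epsilon> \<le> n\<close>.\<close>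

definition col :: "nat \<Rightarrow> int \<Rightarrow> nat" where
  "col n k = nat ((k - 1) mod int n) + 1"

definition zexp :: "nat \<Rightarrow> int \<Rightarrow> int" where
  "zexp n k = (int (col n k) - k) div int n"

definition u_tensor :: "nat \<Rightarrow> int list \<Rightarrow> tensor" where
  "u_tensor n ks = (\<lambda>e. if e = map (col n) ks
     then Poly_Mapping.single (\<Sum>i<length ks. Poly_Mapping.single (i + 1) (zexp n (ks ! i))) 1
     else 0)"

definition wedge_comb :: "complex \<Rightarrow> nat \<Rightarrow> nat \<Rightarrow> (int list \<Rightarrow>\<^sub>0 complex) \<Rightarrow> tensor set" where
  "wedge_comb q n N c =
     Lam q n N (\<Sum>ks\<in>Poly_Mapping.keys c. tsmul (Poly_Mapping.lookup c ks) (u_tensor n ks))"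

definition normal_lists :: "nat \<Rightarrow> int list set" where
  "normal_lists N = {ks. length ks = N \<and> sorted_wrt (>) ks}"

text \<open>Coordinates with respect to the basis of normally ordered wedges.\<close>

definition wedge_coords :: "complex \<Rightarrow> nat \<Rightarrow> nat \<Rightarrow> tensor set \<Rightarrow> (int list \<Rightarrow>\<^sub>0 complex)" where
  "wedge_coords q n N f =
     (THE c. Poly_Mapping.keys c \<subseteq> normal_lists N \<and> wedge_comb q n N c = f)"


section \<open>The generators and Hamiltonians on the tensor product\<close>

text \<open>The sequence \<open>m\<^sub>i\<^sup>0\<close> for \<open>i \<ge> 1\<close>.\<close>

definition m0 :: "nat \<Rightarrow> nat \<Rightarrow> int \<Rightarrow> nat \<Rightarrow> int" where
  "m0 n s M i = (int s - M) div int n + (if i \<le> s then 0 else 1 + int ((i - s - 1) div n))"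

text \<open>Upper indices are read modulo \<open>n\<close> with representatives \<open>1, \<dots>, n\<close>.\<close>

definition cyc :: "nat \<Rightarrow> nat \<Rightarrow> nat" where
  "cyc n \<epsilon> = (if \<epsilon> mod n = 0 then n else \<epsilon> mod n)"

definition Kloc_op :: "complex \<Rightarrow> nat \<Rightarrow> nat \<Rightarrow> nat \<Rightarrow> tensor \<Rightarrow> tensor" where
  "Kloc_op q n i \<epsilon> \<phi> = (\<lambda>e. smul
     (q powi ((if e ! (i - 1) = cyc n \<epsilon> then 1 else 0) - (if e ! (i - 1) = cyc n (\<epsilon> + 1) then 1 else 0)))
     (\<phi> e))"

definition K_op :: "complex \<Rightarrow> nat \<Rightarrow> nat \<Rightarrow> nat \<Rightarrow> tensor \<Rightarrow> tensor" where
  "K_op q n N \<epsilon> = op_prod (map (\<lambda>i. Kloc_op q n i \<epsilon>) [1..<N + 1])"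

definition E_op :: "complex \<Rightarrow> complex \<Rightarrow> nat \<Rightarrow> nat \<Rightarrow> nat \<Rightarrow> tensor \<Rightarrow> tensor" where
  "E_op q p n N \<epsilon> \<phi> = (\<Sum>i\<in>{1..N}.
     on_laurent (op_zpow (y_op q p N i) (if \<epsilon> = 0 then - 1 else 0))
       (munit i (cyc n \<epsilon>) (cyc n (\<epsilon> + 1))
         (op_prod (map (\<lambda>j. Kloc_op q n j \<epsilon>) [i + 1..<N + 1]) \<phi>)))"

definition F_op :: "complex \<Rightarrow> complex \<Rightarrow> nat \<Rightarrow> nat \<Rightarrow> nat \<Rightarrow> tensor \<Rightarrow> tensor" where
  "F_op q p n N \<epsilon> \<phi> = (\<Sum>i\<in>{1..N}.
     on_laurent (op_zpow (y_op q p N i) (if \<epsilon> = 0 then 1 else 0))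
       (op_prod (map (\<lambda>j. inv_into UNIV (Kloc_op q n j \<epsilon>)) [1..<i])
         (munit i (cyc n (\<epsilon> + 1)) (cyc n \<epsilon>) \<phi>)))"

definition gen_op :: "complex \<Rightarrow> complex \<Rightarrow> nat \<Rightarrow> gen \<Rightarrow> nat \<Rightarrow> tensor \<Rightarrow> tensor" where
  "gen_op q p n x N = (case x of
       GenE \<epsilon> \<Rightarrow> E_op q p n N \<epsilon>
     | GenF \<epsilon> \<Rightarrow> F_op q p n N \<epsilon>
     | GenK \<epsilon> \<Rightarrow> K_op q n N \<epsilon>
     | GenKinv \<epsilon> \<Rightarrow> inv_into UNIV (K_op q n N \<epsilon>))"

definition h_op :: "complex \<Rightarrow> complex \<Rightarrow> int \<Rightarrow> nat \<Rightarrow> tensor \<Rightarrow> tensor" where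
  "h_op q p l N \<phi> = (\<Sum>i\<in>{1..N}. on_laurent (op_zpow (y_op q p N i) l) \<phi>)"

definition ham_op :: "complex \<Rightarrow> complex \<Rightarrow> nat \<Rightarrow> nat \<Rightarrow> int \<Rightarrow> int \<Rightarrow> nat \<Rightarrow> tensor \<Rightarrow> tensor" where
  "ham_op q p n s M l N \<phi> = h_op q p l N \<phi>
     - tsmul (\<Sum>j\<in>{1..N}. p powi (l * m0 n s M j) * q powi (2 * l * (1 - int j))) \<phi>"


section \<open>Truncated spaces and Fock space\<close>

definition fin_degree :: "nat \<Rightarrow> nat \<Rightarrow> int \<Rightarrow> int list \<Rightarrow> int" where
  "fin_degree n s M ks = (\<Sum>i\<in>{1..length ks}. m0 n s M i - zexp n (ks ! (i - 1)))"

text \<open>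
  \<open>V\<^sub>M\<^sup>N\<^sup>,\<^sup>k\<close> for \<open>N = s + n r\<close>. The pairs \<open>(\<^bold>m, \<^bold>e)\<close> indexing normally ordered wedges are encoded
  by the strictly decreasing lists of the \<open>k\<^sub>i = \<epsilon>\<^sub>i - n m\<^sub>i\<close>.
\<close>

definition trunc_space :: "complex \<Rightarrow> nat \<Rightarrow> nat \<Rightarrow> int \<Rightarrow> nat \<Rightarrow> nat \<Rightarrow> tensor set set" where
  "trunc_space q n s M N k = wedge_comb q n N `
     {c. \<forall>ks\<in>Poly_Mapping.keys c. ks \<in> normal_lists N
           \<and> (ks \<noteq> [] \<longrightarrow> zexp n (last ks) \<le> m0 n s M N)
           \<and> fin_degree n s M ks = int k}"

text \<open>The semi-infinite wedge \<open>u\<^bsub>k\<^sub>1\<^esub> \<and> u\<^bsub>k\<^sub>2\<^esub> \<and> \<dots>\<close> is the stream of the \<open>k\<^sub>i\<close>, and \<open>k\<^sub>i\<^sub>+\<^sub>1\<close> is its entry \<open>!! i\<close>.\<close>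

type_synonym fock = "int stream \<Rightarrow>\<^sub>0 complex"

definition normal_streams :: "int \<Rightarrow> int stream set" where
  "normal_streams M =
     {ks. (\<forall>i. ks !! i > ks !! Suc i) \<and> (\<exists>i\<^sub>0. \<forall>i\<ge>i\<^sub>0. ks !! i = M - int i)}"

definition vac :: "int \<Rightarrow> int stream" where
  "vac M = siterate (\<lambda>k. k - 1) M"

definition fock_degree :: "nat \<Rightarrow> nat \<Rightarrow> int \<Rightarrow> int stream \<Rightarrow> int" where
  "fock_degree n s M ks = Sum_any (\<lambda>i. m0 n s M (Suc i) - zexp n (ks !! i))"

definition Fock :: "int \<Rightarrow> fock set" where
  "Fock M = {w. Poly_Mapping.keys w \<subseteq> normal_streams M}"

definition Fock_deg :: "nat \<Rightarrow> nat \<Rightarrow> int \<Rightarrow> nat \<Rightarrow> fock set" where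
  "Fock_deg n s M k = {w \<in> Fock M. \<forall>ks\<in>Poly_Mapping.keys w. fock_degree n s M ks = int k}"

text \<open>\<open>wedge_vac q n N f M'\<close> is \<open>f \<and> |M'\<rangle>\<close>.\<close>

definition wedge_vac :: "complex \<Rightarrow> nat \<Rightarrow> nat \<Rightarrow> tensor set \<Rightarrow> int \<Rightarrow> fock" where
  "wedge_vac q n N f M' =
     (\<Sum>ks\<in>Poly_Mapping.keys (wedge_coords q n N f).
        Poly_Mapping.single (ks @- vac M') (Poly_Mapping.lookup (wedge_coords q n N f) ks))"


section \<open>Operators on Fock space\<close>

text \<open>
  For a family \<open>X N\<close> of operators on the tensor products: \<open>level_op q n s M X k r w\<close> is
  \<open>(X (s + n r) f\<^sub>r) \<and> |M - s - n r\<rangle>\<close>, where \<open>w = f\<^sub>r \<and> |M - s - n r\<rangle>\<close> has degree \<open>k\<close>.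
\<close>

definition level_op ::
  "complex \<Rightarrow> nat \<Rightarrow> nat \<Rightarrow> int \<Rightarrow> (nat \<Rightarrow> tensor \<Rightarrow> tensor) \<Rightarrow> nat \<Rightarrow> nat \<Rightarrow> fock \<Rightarrow> fock" where
  "level_op q n s M X k r w =
     (let N = s + n * r;
          f = (THE f. f \<in> trunc_space q n s M N k \<and> w = wedge_vac q n N f (M - int N))
      in wedge_vac q n N (induced q n N (X N) f) (M - int N))"

definition hom_component :: "nat \<Rightarrow> nat \<Rightarrow> int \<Rightarrow> nat \<Rightarrow> fock \<Rightarrow> fock" where
  "hom_component n s M k w =
     (\<Sum>ks\<in>{ks \<in> Poly_Mapping.keys w. fock_degree n s M ks = int k}.
        Poly_Mapping.single ks (Poly_Mapping.lookup w ks))"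

text \<open>
  The extension of \<^const>\<open>level_op\<close> to the direct sum of the degree \<open>k\<close> parts, with the choice \<open>r = k\<close>.
\<close>

definition fock_op ::
  "complex \<Rightarrow> nat \<Rightarrow> nat \<Rightarrow> int \<Rightarrow> (nat \<Rightarrow> tensor \<Rightarrow> tensor) \<Rightarrow> fock \<Rightarrow> fock" where
  "fock_op q n s M X w = Sum_any (\<lambda>k. level_op q n s M X k k (hom_component n s M k w))"

end

theory Submission
  imports Defs
begin

text \<open>
  The formulas for \<open>E\<close>, \<open>F\<close>, \<open>K\<close> are iterated coproducts of one-site representations twisted by the commuting
  operators \<open>y\<^sub>i\<close>, so the defining relations follow from those on one site; the affine Hecke relations between
  the \<open>y\<^sub>i\<close> and \<open>g\<^sub>j\<close> show that all operators preserve \<open>\<Omega>\<close>. Normally ordered wedges span by straightening and are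
  independent because a \<open>q\<close>-symmetriser kills \<open>\<Omega>\<close> but not their leading terms.

  Passing from \<open>N = s + n r\<close> to \<open>N + n\<close> attaches the block \<open>z\<^sup>c v\<^sub>n \<otimes> \<dots> \<otimes> z\<^sup>c v\<^sub>1\<close>. The operators \<open>y\<^sub>i\<close> with \<open>i \<le> N\<close> are unchanged,
  and those on the block are scalars, up to tensors with fewer than \<open>n\<close> exponents equal to \<open>c\<close>. In degree at most
  \<open>r\<close> no normally ordered wedge has such exponents, so these corrections vanish in the wedge product. On the
  block \<open>E\<close> and \<open>F\<close> repeat a colour and hence vanish, \<open>K\<close> is trivial, and \<open>h\<^sub>l\<close> contributes the constant subtracted in \<open>g\<^sub>l\<close>.
\<close>

text \<open>The operators \<open>g_ij\<close> are defined through a division, so each identity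
  between them is reduced to one in the domain of Laurent polynomials by clearing factors
  \<open>z_i - z_j\<close>. The products \<open>X_i = g_i S_i\<close> satisfy the braid relations,
  but as products of two commuting Hecke generators they admit the three eigenvalues
  \<open>q^2\<close>, \<open>-1\<close>, \<open>q^-2\<close>, so no Hecke algebra antisymmetriser is
  at hand. Leading terms are measured by the sum of squares of the exponents, which strict
  interpolation between two exponents lowers. The same convexity makes straightening terminate and
  makes the exponents with fewer than \<open>n\<close> entries equal to the maximum a closed set,
  which confines the errors made by attaching a block. The condition \<open>k \<le> r\<close> enters
  through one estimate (\<open>deficit\<close>): a normally ordered wedge differing from the vacuum
  at a late position exceeds it at all earlier ones, and one position in each block then costs at
  least \<open>1\<close> in degree. The constants in \<open>g_l\<close> arise by collecting a factor
  \<open>q\<close> or \<open>q^-1\<close> from each \<open>xi\<close> in \<open>y_i\<close>.\<close>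

abbreviation "lookup \<equiv> Poly_Mapping.lookup"
abbreviation "keys \<equiv> Poly_Mapping.keys"
abbreviation "single \<equiv> Poly_Mapping.single"

type_synonym exps = "nat \<Rightarrow>\<^sub>0 int"

section \<open>The ring of additive endomorphisms\<close>

text \<open>On function types the product is already the pointwise one, so composition gets a type
  of its own. Operator identities then become ring equations open to rewriting. Only additivity is
  built in; linearity over the complex numbers is stated separately as \<open>linop\<close>.\<close>

typedef (overloaded) 'a endo = "{f :: 'a::ab_group_add \<Rightarrow> 'a. \<forall>x y. f (x + y) = f x + f y}"
  morphisms app Endo
  by (rule exI[of _ id]) simp

setup_lifting type_definition_endo

instantiation endo :: (ab_group_add) "{zero, one, plus, minus, uminus, times}"
begin
lift_definition zero_endo :: "'a endo" is "\<lambda>_. 0" by simp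
lift_definition one_endo :: "'a endo" is "\<lambda>x. x" by simp
lift_definition plus_endo :: "'a endo \<Rightarrow> 'a endo \<Rightarrow> 'a endo" is "\<lambda>S T x. S x + T x" by (simp add: ac_simps)
lift_definition minus_endo :: "'a endo \<Rightarrow> 'a endo \<Rightarrow> 'a endo" is "\<lambda>S T x. S x - T x" by (simp add: algebra_simps)
lift_definition uminus_endo :: "'a endo \<Rightarrow> 'a endo" is "\<lambda>S x. - S x" by simp
lift_definition times_endo :: "'a endo \<Rightarrow> 'a endo \<Rightarrow> 'a endo" is "\<lambda>S T x. S (T x)" by simp
instance ..
end

instance endo :: (ab_group_add) ring
  by standard (transfer; auto simp: algebra_simps fun_eq_iff)+

instance endo :: (ab_group_add) monoid_mult
  by standard (transfer; simp)+

instance endo :: ("{ab_group_add, zero_neq_one}") ring_1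
proof
  show "(0::'a endo) \<noteq> 1"
    by transfer (metis zero_neq_one)
qed

lemma app_arg_add: "app T (x + y) = app T x + app T y" by transfer simp
lemma app_op_add: "app (S + T) x = app S x + app T x" by transfer simp
lemma app_op_minus: "app (S - T) x = app S x - app T x" by transfer simp
lemma app_op_uminus: "app (- T) x = - app T x" by transfer simp
lemma app_mult: "app (S * T) x = app S (app T x)" by transfer simp
lemma app_1 [simp]: "app 1 x = x" by transfer simp
lemma app_op_0 [simp]: "app 0 x = 0" by transfer simp

interpretation app: additive "app T" for T
  by standard (rule app_arg_add)

lemmas app_arg_0 [simp] = app.zero
lemmas app_arg_minus = app.diff
lemmas app_arg_uminus = app.minus
lemmas app_arg_sum = app.sum

lemma app_op_sum: "app (\<Sum>i\<in>I. T i) x = (\<Sum>i\<in>I. app (T i) x)"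
  by (induction I rule: infinite_finite_induct) (simp_all add: app_op_add)

lemma endo_eqI: "(\<And>x. app S x = app T x) \<Longrightarrow> S = T"
  by transfer auto

lemma app_Endo: "(\<And>x y. f (x + y) = f x + f y) \<Longrightarrow> app (Endo f) = f"
  by (simp add: Endo_inverse)

lemma op_prod_app: "op_prod (map (\<lambda>i. app (T i)) is) = app (prod_list (map T is))"
  by (induction "is") (auto simp: op_prod_def fun_eq_iff app_mult)

lemma app_power: "app (T ^ k) = app T ^^ k"
  by (induction k) (auto simp: fun_eq_iff app_mult)

lemma inv_app:
  assumes "S * T = 1" "T * S = 1"
  shows "inv_into UNIV (app S) = app T"
proof (rule inv_equality)
  show "app T (app S x) = x" "app S (app T y) = y" for x y
    using assms by (simp_all flip: app_mult)
qed

text \<open>As \<open>op_zpow\<close>, with the inverse \<open>a'\<close> supplied explicitly.\<close>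

definition zpw :: "'a::monoid_mult \<Rightarrow> 'a \<Rightarrow> int \<Rightarrow> 'a" where
  "zpw a a' l = (if 0 \<le> l then a ^ nat l else a' ^ nat (- l))"

lemma op_zpow_app:
  assumes "S * T = 1" "T * S = 1"
  shows "op_zpow (app S) l = app (zpw S T l)"
  using inv_app[OF assms] by (simp add: op_zpow_def zpw_def app_power)


section \<open>Operators on Laurent polynomials\<close>

lemma pm_sum_singles: "f = (\<Sum>k\<in>keys f. single k (lookup f k))"
  by (rule poly_mapping_eqI)
     (auto simp: lookup_sum lookup_single when_def sum.delta in_keys_iff)

lemma pm_induct [case_names single add]:
  assumes "\<And>k v. P (single k v)" "\<And>f g. P f \<Longrightarrow> P g \<Longrightarrow> P (f + g)"
  shows "P (f :: 'a \<Rightarrow>\<^sub>0 'b::comm_monoid_add)"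
proof -
  have "P (\<Sum>k\<in>A. single k (lookup f k))" if "finite A" for A
    using that
  proof induction
    case empty
    show ?case using assms(1)[of undefined 0] by simp
  qed (auto intro: assms)
  then show ?thesis using pm_sum_singles[of f] by (metis finite_keys)
qed

lemma smul_conv: "smul c f = single 0 c * (f :: 'a::monoid_add \<Rightarrow>\<^sub>0 complex)"
  unfolding smul_def using mult_map_scale_conv_mult[of c f] by simp

lemma lookup_smul [simp]: "lookup (smul c f) k = c * lookup f k"
  unfolding smul_def by (simp add: Poly_Mapping.map.rep_eq when_def)

lemma smul_add: "smul c (f + g) = smul c f + smul c g"
  by (rule poly_mapping_eqI) (simp add: lookup_add algebra_simps)
lemma smul_single [simp]: "smul c (single k v) = single k (c * v)"
  by (rule poly_mapping_eqI) (simp add: lookup_single when_def)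
lemma smul_smul [simp]: "smul c (smul d f) = smul (c * d) f"
  by (rule poly_mapping_eqI) simp
lemma smul_1 [simp]: "smul 1 f = f" by (rule poly_mapping_eqI) simp
lemma smul_0 [simp]: "smul 0 f = 0" by (rule poly_mapping_eqI) simp
lemma smul_0r [simp]: "smul c 0 = 0" by (rule poly_mapping_eqI) simp
lemma smul_add_left: "smul (c + d) f = smul c f + smul d f"
  by (rule poly_mapping_eqI) (simp add: lookup_add algebra_simps)
lemma smul_diff_left: "smul (c - d) f = smul c f - smul d f"
  by (rule poly_mapping_eqI) (simp add: lookup_minus algebra_simps)
lemma smul_minus_left: "smul (- c) f = - smul c f"
  by (rule poly_mapping_eqI) simp
lemma smul_diff: "smul c (f - g) = smul c f - smul c g"
  by (rule poly_mapping_eqI) (simp add: lookup_minus algebra_simps)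
lemma smul_uminus: "smul c (- f) = - smul c f"
  by (rule poly_mapping_eqI) simp
lemma smul_sum: "smul c (\<Sum>i\<in>I. f i) = (\<Sum>i\<in>I. smul c (f i))"
  by (rule poly_mapping_eqI) (simp add: lookup_sum sum_distrib_left)
lemma smul_sum_left: "smul (\<Sum>i\<in>I. c i) f = (\<Sum>i\<in>I. smul (c i) f)"
  by (rule poly_mapping_eqI) (simp add: lookup_sum sum_distrib_right)

definition scL :: "complex \<Rightarrow> laurent endo" where "scL c = Endo (smul c)"

lemma app_scL [simp]: "app (scL c) = smul c"
  unfolding scL_def by (rule app_Endo) (simp add: smul_add)

lemma scL_mult: "scL c * scL d = scL (c * d)" by (rule endo_eqI) (simp add: app_mult)
lemma scL_add: "scL c + scL d = scL (c + d)" by (rule endo_eqI) (simp add: app_op_add smul_add_left)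
lemma scL_1 [simp]: "scL 1 = 1" by (rule endo_eqI) simp
lemma scL_0 [simp]: "scL 0 = 0" by (rule endo_eqI) simp

section \<open>Monomials, interpolation between two exponents, and exact division by
  \<open>z_i - z_j\<close>\<close>

abbreviation Z :: "exps \<Rightarrow> laurent" where "Z m \<equiv> single m 1"

text \<open>Moves \<open>t\<close> units of degree from \<open>z_j\<close> to \<open>z_i\<close>.
  Every monomial that \<open>g_ij\<close> produces from \<open>z^m\<close> is of this form, with
  \<open>t\<close> between \<open>0\<close> and \<open>m_j - m_i\<close>.\<close>

definition shift :: "nat \<Rightarrow> nat \<Rightarrow> int \<Rightarrow> exps \<Rightarrow> exps" where
  "shift i j t m = m + single i t - single j t"

lemma lookup_shift: "i \<noteq> j \<Longrightarrow> lookup (shift i j t m) k =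
   lookup m k + (if k = i then t else if k = j then - t else 0)"
  by (simp add: shift_def lookup_add lookup_minus lookup_single when_def)

lemma shift_0 [simp]: "shift i j 0 m = m"
  by (simp add: shift_def)

abbreviation pmswap :: "nat \<Rightarrow> nat \<Rightarrow> exps \<Rightarrow> exps" where
  "pmswap i j \<equiv> Poly_Mapping.map_key (transpose i j)"

lemma lookup_pmswap: "lookup (pmswap i j m) k = lookup m (transpose i j k)"
  by (simp add: map_key.rep_eq)

lemma pmswap_invol [simp]: "pmswap i j (pmswap i j m) = m"
  by (rule poly_mapping_eqI) (simp add: lookup_pmswap)

lemma inj_pmswap: "inj (pmswap i j)"
  by (metis injI pmswap_invol)

lemma lookup_swap_op: "lookup (swap_op i j f) m = lookup f (pmswap i j m)"
  by (simp add: swap_op_def map_key.rep_eq inj_pmswap)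

lemma swap_op_single [simp]: "swap_op i j (single m c) = single (pmswap i j m) c"
  by (rule poly_mapping_eqI) (auto simp: lookup_swap_op lookup_single when_def)

lemma swap_op_add: "swap_op i j (f + g) = swap_op i j f + swap_op i j g"
  by (rule poly_mapping_eqI) (simp add: lookup_swap_op lookup_add)

lemma swap_op_smul: "swap_op i j (smul c f) = smul c (swap_op i j f)"
  by (rule poly_mapping_eqI) (simp add: lookup_swap_op)

lemma pmswap_add: "pmswap i j (m + m') = pmswap i j m + pmswap i j m'"
  by (rule poly_mapping_eqI) (simp add: lookup_pmswap lookup_add)

lemma additive_mult_extend:
  fixes f g :: "'a::monoid_add \<Rightarrow>\<^sub>0 complex"
  assumes add: "\<And>f g. \<theta> (f + g) = \<theta> f + \<theta> g"
    and mon: "\<And>m c m' c'. \<theta> (single m c * single m' c')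
       = \<theta> (single m c) * \<theta> (single m' c')"
  shows "\<theta> (f * g) = \<theta> f * (\<theta> g :: 'b::ring)"
proof (induction f rule: pm_induct)
  case (single k v)
  show ?case
    by (induction g rule: pm_induct) (simp_all add: mon add distrib_left)
qed (simp_all add: add distrib_right)

lemma swap_op_mult: "swap_op i j (f * g) = swap_op i j f * swap_op i j g"
  by (rule additive_mult_extend) (simp_all add: swap_op_add mult_single pmswap_add)

lemma pD_op_single [simp]: "pD_op p i (single m c) = single m (p powi lookup m i * c)"
  by (rule poly_mapping_eqI) (auto simp: pD_op_def lookup_mapp lookup_single when_def in_keys_iff split: if_splits)

lemma lookup_pD_op: "lookup (pD_op p i f) m = p powi lookup m i * lookup f m"
  by (auto simp: pD_op_def lookup_mapp when_def in_keys_iff)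

lemma pD_op_add: "pD_op p i (f + g) = pD_op p i f + pD_op p i g"
  by (rule poly_mapping_eqI) (simp add: lookup_pD_op lookup_add algebra_simps)

text \<open>Exponents have either sign, and \<open>p powi\<close> is additive in them once
  \<open>p \<noteq> 0\<close>.\<close>

lemma pD_op_mult: "p \<noteq> 0 \<Longrightarrow> pD_op p i (f * g) = pD_op p i f * pD_op p i g"
  by (rule additive_mult_extend) (simp_all add: pD_op_add mult_single lookup_add power_int_add mult_ac)

lemma zvar_mult_Z: "zvar i * Z m = Z (m + single i 1)"
  by (simp add: zvar_def mult_single add.commute)

lemma zvar_neq: "i \<noteq> j \<Longrightarrow> zvar i - zvar j \<noteq> 0"
proof
  assume "i \<noteq> j" "zvar i - zvar j = 0"
  then have "lookup (zvar i) (single i 1) = lookup (zvar j) (single i (1::int))"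
    by simp
  with \<open>i \<noteq> j\<close> show False
    by (simp add: zvar_def lookup_single when_def) (metis lookup_single_eq lookup_single_not_eq zero_neq_one)
qed

lemma pmswap_shift:
  "i \<noteq> j \<Longrightarrow> pmswap i j m = shift i j (lookup m j - lookup m i) m"
  by (rule poly_mapping_eqI) (auto simp: lookup_pmswap lookup_shift transpose_def)

lemma int_telescope: "(\<Sum>t\<in>{a..<b}. f (t + 1) - f t) = f b - f a" if "a \<le> b" for f :: "int \<Rightarrow> 'a::ab_group_add"
  using that
proof (induction b rule: int_ge_induct)
  case (step b)
  have "{a..<b + 1} = insert b {a..<b}" using step by auto
  then show ?case using step by simp
qed simp

text \<open>The quotient of \<open>K_ij z^m - z^m\<close> by \<open>z_i - z_j\<close> as a geometric
  sum. At most one of the two sums is nonempty, according to the sign of \<open>d\<close>.\<close>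

definition divdiff :: "nat \<Rightarrow> nat \<Rightarrow> exps \<Rightarrow> laurent" where
  "divdiff i j m = (let d = lookup m j - lookup m i in
     (\<Sum>t\<in>{0..<d}. Z (shift i j t m - single j 1))
     - (\<Sum>t\<in>{d..<0}. Z (shift i j t m - single j 1)))"

lemma zvar_shift:
  "zvar j * Z (shift i j t m - single j 1) = Z (shift i j t m)"
  "zvar i * Z (shift i j t m - single j 1) = Z (shift i j (t + 1) m)"
  by (simp_all add: zvar_mult_Z shift_def single_add algebra_simps)

text \<open>Multiplication by \<open>z_i\<close> and by \<open>z_j\<close> carries each summand to
  two consecutive shifts of \<open>m\<close>, so the sum telescopes.\<close>

lemma divdiff: "i \<noteq> j \<Longrightarrow> (zvar i - zvar j) * divdiff i j m = swap_op i j (Z m) - Z m"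
proof -
  assume ij: "i \<noteq> j"
  define d where "d = lookup m j - lookup m i"
  have *: "(zvar i - zvar j) * (\<Sum>t\<in>{a..<b}. Z (shift i j t m - single j 1))
    = Z (shift i j b m) - Z (shift i j a m)" if "a \<le> b" for a b
    by (simp add: sum_distrib_left left_diff_distrib zvar_shift int_telescope[OF that, of "\<lambda>t. Z (shift i j t m)"])
  show ?thesis
    using *[of 0 d] *[of d 0] ij
    by (cases "d \<ge> 0") (simp_all add: divdiff_def Let_def d_def[symmetric] pmswap_shift right_diff_distrib)
qed

lemma g_op_exists:
  assumes "i \<noteq> j"
  shows "\<exists>h. (zvar i - zvar j) * h = swap_op i j f - f"
proof (induction f rule: pm_induct)
  case (single k v)
  have "(zvar i - zvar j) * smul v (divdiff i j k) = smul v (swap_op i j (Z k) - Z k)"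
    by (simp only: divdiff[OF assms, symmetric] smul_conv mult_ac)
  then show ?case by (intro exI[of _ "smul v (divdiff i j k)"]) (simp add: smul_diff)
next
  case (add f g)
  then obtain h h' where "(zvar i - zvar j) * h = swap_op i j f - f" "(zvar i - zvar j) * h' = swap_op i j g - g"
    by blast
  then have "(zvar i - zvar j) * (h + h') = swap_op i j (f + g) - (f + g)"
    by (simp add: swap_op_add distrib_left)
  then show ?case ..
qed

abbreviation CC :: "complex \<Rightarrow> laurent" where "CC c \<equiv> single 0 c"

text \<open>Existence of the quotient and cancellation in a domain resolve the definite description
  in \<open>g_op\<close>. From here on \<open>g\<close> is handled only through this equation
  without denominators, in which \<open>f\<close> and its transposed image occur linearly.\<close>

lemma g_op_char:
  assumes "i \<noteq> j"
  shows "G = g_op q i j f \<longleftrightarrow>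
    (zvar i - zvar j) * G = CC (q - inverse q) * zvar i * f + (CC (inverse q) * zvar i - CC q * zvar j) * swap_op i j f"
    (is "_ \<longleftrightarrow> _ = ?r")
proof -
  obtain h0 where h0: "(zvar i - zvar j) * h0 = swap_op i j f - f"
    using g_op_exists[OF assms] by blast
  define h where "h = (smul (inverse q) (zvar i) - smul q (zvar j)) * h0"
  have h: "(zvar i - zvar j) * h = (smul (inverse q) (zvar i) - smul q (zvar j)) * (swap_op i j f - f)"
    by (simp add: h_def h0[symmetric] mult_ac)
  have "(THE h. (zvar i - zvar j) * h = (smul (inverse q) (zvar i) - smul q (zvar j)) * (swap_op i j f - f)) = h"
    by (rule the_equality, rule h) (metis h mult_left_cancel zvar_neq[OF assms])
  then have g: "g_op q i j f = h + smul q f" by (simp add: g_op_def)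
  have "(zvar i - zvar j) * g_op q i j f = ?r"
    unfolding g distrib_left h by (simp only: smul_conv single_diff) (simp add: algebra_simps)
  then show ?thesis using zvar_neq[OF assms] by (metis mult_left_cancel)
qed

lemmas g_op_mult = g_op_char[THEN iffD1, OF _ refl]

lemma g_op_add:
  assumes "i \<noteq> j"
  shows "g_op q i j (f + g) = g_op q i j f + g_op q i j g"
proof (rule sym, subst g_op_char[OF assms])
  show "(zvar i - zvar j) * (g_op q i j f + g_op q i j g) = CC (q - inverse q) * zvar i * (f + g)
     + (CC (inverse q) * zvar i - CC q * zvar j) * swap_op i j (f + g)"
    unfolding distrib_left[of "zvar i - zvar j"] g_op_mult[OF assms] swap_op_add by (simp only: algebra_simps)
qed

lemma g_op_smul: "i \<noteq> j \<Longrightarrow> g_op q i j (smul c f) = smul c (g_op q i j f)"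
proof (rule sym, subst g_op_char, assumption)
  assume ij: "i \<noteq> j"
  have "(zvar i - zvar j) * smul c (g_op q i j f) = CC c * ((zvar i - zvar j) * g_op q i j f)"
    by (simp only: smul_conv mult_ac)
  also have "\<dots> = CC (q - inverse q) * zvar i * smul c f
     + (CC (inverse q) * zvar i - CC q * zvar j) * swap_op i j (smul c f)"
    by (simp only: g_op_mult[OF ij] swap_op_smul) (simp only: smul_conv distrib_left mult_ac)
  finally show "(zvar i - zvar j) * smul c (g_op q i j f) = CC (q - inverse q) * zvar i * smul c f
     + (CC (inverse q) * zvar i - CC q * zvar j) * swap_op i j (smul c f)" .
qed

text \<open>The asymmetry is essential later: the untransposed monomial appears only when
  \<open>m_j \<le> m_i\<close>, and all remaining terms interpolate strictly between the two
  exponents.\<close>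

lemma g_op_Z:
  assumes "i \<noteq> j"
  shows "g_op q i j (Z m) = (let d = lookup m j - lookup m i in
    if d > 0 then smul (inverse q) (Z (pmswap i j m)) + smul (inverse q - q) (\<Sum>t\<in>{0<..<d}. Z (shift i j t m))
    else if d = 0 then smul q (Z m)
    else smul (q - inverse q) (Z m) + smul q (Z (pmswap i j m)) + smul (q - inverse q) (\<Sum>t\<in>{d<..<0}. Z (shift i j t m)))"
proof -
  define d where "d = lookup m j - lookup m i"
  have *: "g_op q i j (Z m) = (smul (inverse q) (zvar i) - smul q (zvar j)) * divdiff i j m + smul q (Z m)"
  proof (rule sym, subst g_op_char[OF assms])
    let ?c = "smul (inverse q) (zvar i) - smul q (zvar j)"
    have "(zvar i - zvar j) * (?c * divdiff i j m + smul q (Z m))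
      = ?c * (swap_op i j (Z m) - Z m) + (zvar i - zvar j) * smul q (Z m)"
      by (simp only: distrib_left mult.left_commute[of "zvar i - zvar j"] divdiff[OF assms])
    also have "\<dots> = CC (q - inverse q) * zvar i * Z m
       + (CC (inverse q) * zvar i - CC q * zvar j) * swap_op i j (Z m)"
      by (simp only: smul_conv single_diff) (simp only: algebra_simps)
    finally show "(zvar i - zvar j) * (?c * divdiff i j m + smul q (Z m)) = CC (q - inverse q) * zvar i * Z m
       + (CC (inverse q) * zvar i - CC q * zvar j) * swap_op i j (Z m)" .
  qed
  have **: "(smul (inverse q) (zvar i) - smul q (zvar j)) * (\<Sum>t\<in>I. Z (shift i j t m - single j 1))
    = smul (inverse q) (\<Sum>t\<in>I. Z (shift i j (t + 1) m)) - smul q (\<Sum>t\<in>I. Z (shift i j t m))" for I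
    by (simp add: sum_distrib_left left_diff_distrib smul_conv mult.assoc zvar_shift sum_subtractf)
  have sh: "(\<Sum>t\<in>{a..<b}. Z (shift i j (t + 1) m)) = (\<Sum>t\<in>{a<..b}. Z (shift i j t m))" for a b
    by (rule sum.reindex_bij_witness[of _ "\<lambda>t. t - 1" "\<lambda>t. t + 1"]) auto
  have sp: "Z (pmswap i j m) = Z (shift i j d m)" by (simp add: pmswap_shift[OF assms] d_def)
  have l: "{a..<b} = insert a {a<..<b}" "{a<..b} = insert b {a<..<b}" if "a < b" for a b :: int
    using that by auto
  consider "d > 0" | "d = 0" | "d < 0" by linarith
  then show ?thesis
  proof cases
    case 1
    have "g_op q i j (Z m) = (smul (inverse q) (zvar i) - smul q (zvar j)) *
        (\<Sum>t\<in>{0..<d}. Z (shift i j t m - single j 1)) + smul q (Z m)"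
      using 1 by (simp add: * divdiff_def Let_def d_def[symmetric])
    also have "\<dots> = smul (inverse q) (Z (pmswap i j m)) + smul (inverse q - q) (\<Sum>t\<in>{0<..<d}. Z (shift i j t m))"
      unfolding ** sh sp using 1 by (simp add: l smul_add smul_diff_left del: smul_single)
    finally show ?thesis using 1 by (simp add: d_def[symmetric])
  next
    case 2
    then show ?thesis by (simp add: * divdiff_def Let_def d_def[symmetric])
  next
    case 3
    have "g_op q i j (Z m) = - ((smul (inverse q) (zvar i) - smul q (zvar j)) *
        (\<Sum>t\<in>{d..<0}. Z (shift i j t m - single j 1))) + smul q (Z m)"
      using 3 by (simp add: * divdiff_def Let_def d_def[symmetric])
    also have "\<dots> = smul (q - inverse q) (Z m) + smul q (Z (pmswap i j m)) + smul (q - inverse q) (\<Sum>t\<in>{d<..<0}. Z (shift i j t m))"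
      unfolding ** sh sp using 3 by (simp add: l smul_add smul_diff_left del: smul_single)
    finally show ?thesis using 3 by (simp add: d_def[symmetric])
  qed
qed

lemma zvar_Z: "zvar k = Z (single k 1)" by (simp add: zvar_def)

lemma pmswap_single [simp]: "pmswap i j (single k c) = single (transpose i j k) c"
  by (rule poly_mapping_eqI) (auto simp: lookup_pmswap lookup_single when_def transpose_def)

lemma swap_op_zvar [simp]: "swap_op i j (zvar k) = zvar (transpose i j k)"
  by (simp add: zvar_Z)

text \<open>The defining equation of \<open>g\<close> is homogeneous in the two variables, so a ring
  homomorphism that renames them and scales both by the same \<open>c\<close> carries it into itself
  up to the factor \<open>c\<close>, which cancels.\<close>

lemma g_op_conj:
  assumes add: "\<And>f g. \<theta> (f + g) = \<theta> f + \<theta> g" and mult: "\<And>f g. \<theta> (f * g) = \<theta> f * \<theta> g"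
    and sc: "\<And>a. \<theta> (CC a) = CC a" and c: "c \<noteq> 0"
    and z: "\<theta> (zvar i) = CC c * zvar k" "\<theta> (zvar j) = CC c * zvar l"
    and K: "\<And>f. \<theta> (swap_op i j f) = swap_op k l (\<theta> f)"
    and ij: "i \<noteq> j" "k \<noteq> l"
  shows "\<theta> (g_op q i j f) = g_op q k l (\<theta> f)"
proof (subst g_op_char[OF ij(2)])
  interpret additive \<theta> by standard (rule add)
  have c': "CC c \<noteq> 0" using c by (metis lookup_single_eq lookup_zero)
  have "\<theta> ((zvar i - zvar j) * g_op q i j f) = CC c * ((zvar k - zvar l) * \<theta> (g_op q i j f))"
    by (simp add: mult diff z algebra_simps)
  moreover have "\<theta> ((zvar i - zvar j) * g_op q i j f) = CC c * (CC (q - inverse q) * zvar k * \<theta> f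
     + (CC (inverse q) * zvar k - CC q * zvar l) * swap_op k l (\<theta> f))"
    unfolding g_op_mult[OF ij(1)] by (simp only: mult add diff z sc K) (simp only: algebra_simps)
  ultimately show "(zvar k - zvar l) * \<theta> (g_op q i j f) = CC (q - inverse q) * zvar k * \<theta> f
     + (CC (inverse q) * zvar k - CC q * zvar l) * swap_op k l (\<theta> f)"
    using c' by (metis mult_left_cancel)
qed

lemma g_op_lin:
  assumes ij: "i \<noteq> j" and h: "swap_op i j h = h"
  shows "g_op q i j (h * f) = h * g_op q i j f"
proof (rule sym, subst g_op_char[OF ij])
  have "(zvar i - zvar j) * (h * g_op q i j f) = h * ((zvar i - zvar j) * g_op q i j f)"
    by (simp only: mult_ac)
  also have "\<dots> = CC (q - inverse q) * zvar i * (h * f) + (CC (inverse q) * zvar i - CC q * zvar j) * swap_op i j (h * f)"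
    unfolding g_op_mult[OF ij] by (simp only: swap_op_mult h) (simp only: algebra_simps)
  finally show "(zvar i - zvar j) * (h * g_op q i j f) = CC (q - inverse q) * zvar i * (h * f)
     + (CC (inverse q) * zvar i - CC q * zvar j) * swap_op i j (h * f)" .
qed

text \<open>The Hecke relation with operators replaced by unknowns: \<open>G\<close> stands for
  \<open>g f\<close>, \<open>GG\<close> for \<open>g (g f)\<close>, primes for images under the
  transposition, and \<open>r\<close> for \<open>q^-1\<close>. What remains is a polynomial identity
  in a domain.\<close>

lemma quadratic_idom:
  fixes a b q r f f' G G' GG :: "'a::idom"
  assumes "a \<noteq> b" "q * r = 1"
    and "(a - b) * G = (q - r) * a * f + (r * a - q * b) * f'"
    and "(b - a) * G' = (q - r) * b * f' + (r * b - q * a) * f"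
    and "(a - b) * GG = (q - r) * a * G + (r * a - q * b) * G'"
  shows "GG = f + (q - r) * G"
proof -
  have G': "(a - b) * G' = - ((q - r) * b * f' + (r * b - q * a) * f)"
    unfolding assms(4)[symmetric] by (simp add: algebra_simps)
  have "(a - b) * ((a - b) * GG) = (q - r) * a * ((a - b) * G) + (r * a - q * b) * ((a - b) * G')"
    unfolding assms(5) by (simp add: algebra_simps)
  also have "\<dots> = (a - b) * (q * r * (a - b) * f + (q - r) * ((a - b) * G))"
    unfolding assms(3) G' by (simp add: algebra_simps)
  also have "\<dots> = (a - b) * ((a - b) * (f + (q - r) * G))"
    unfolding assms(2) by (simp add: algebra_simps)
  finally show ?thesis using \<open>a \<noteq> b\<close> by simp
qed

text \<open>The braid relation in the same style, with \<open>a, b, c\<close> for the three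
  variables. Digits record transpositions in order of composition, so \<open>f21\<close> is
  \<open>K2 (K1 f)\<close>; \<open>G1, H, L\<close> are the values along \<open>g1 g2 g1\<close> and
  \<open>G2, H', R\<close> those along \<open>g2 g1 g2\<close>.\<close>

lemma braid_idom:
  fixes a b c q r f f1 f2 f12 f21 f121 G1 K2G1 K1G1 K12G1 H K1H L G2 K1G2 K2G2 K21G2 H' K2H' R :: "'a::idom"
  assumes ne: "a \<noteq> b" "b \<noteq> c" "a \<noteq> c"
    and G1: "(a - b) * G1 = (q - r) * a * f + (r * a - q * b) * f1"
    and K2G1: "(a - c) * K2G1 = (q - r) * a * f2 + (r * a - q * c) * f21"
    and H: "(b - c) * H = (q - r) * b * G1 + (r * b - q * c) * K2G1"
    and K1G1: "(b - a) * K1G1 = (q - r) * b * f1 + (r * b - q * a) * f"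
    and K12G1: "(b - c) * K12G1 = (q - r) * b * f12 + (r * b - q * c) * f121"
    and K1H: "(a - c) * K1H = (q - r) * a * K1G1 + (r * a - q * c) * K12G1"
    and L: "(a - b) * L = (q - r) * a * H + (r * a - q * b) * K1H"
    and G2: "(b - c) * G2 = (q - r) * b * f + (r * b - q * c) * f2"
    and K1G2: "(a - c) * K1G2 = (q - r) * a * f1 + (r * a - q * c) * f12"
    and H': "(a - b) * H' = (q - r) * a * G2 + (r * a - q * b) * K1G2"
    and K2G2: "(c - b) * K2G2 = (q - r) * c * f2 + (r * c - q * b) * f"
    and K21G2: "(a - b) * K21G2 = (q - r) * a * f21 + (r * a - q * b) * f121"
    and K2H': "(a - c) * K2H' = (q - r) * a * K2G2 + (r * a - q * c) * K21G2"
    and R: "(b - c) * R = (q - r) * b * H' + (r * b - q * c) * K2H'"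
  shows "L = R"
proof -
  \<comment> \<open>Multiplied by this common denominator, each intermediate value is a polynomial
    combination of the six images of \<open>f\<close> under the symmetric group.\<close>
  let ?D = "(a - b) * (a - c) * (b - c)"
  have h: "?D * H = (a - c) * (q - r) * b * ((q - r) * a * f + (r * a - q * b) * f1)
       + (a - b) * (r * b - q * c) * ((q - r) * a * f2 + (r * a - q * c) * f21)"
  proof -
    have "?D * H = (a - b) * (a - c) * ((b - c) * H)" by (simp only: mult_ac)
    from this[unfolded H] show ?thesis unfolding G1[symmetric] K2G1[symmetric] by (rule trans) (simp add: algebra_simps)
  qed
  have k: "?D * K1H = - (b - c) * (q - r) * a * ((q - r) * b * f1 + (r * b - q * a) * f)
       + (a - b) * (r * a - q * c) * ((q - r) * b * f12 + (r * b - q * c) * f121)"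
  proof -
    have "?D * K1H = (a - b) * (b - c) * ((a - c) * K1H)" by (simp only: mult_ac)
    from this[unfolded K1H] show ?thesis unfolding K1G1[symmetric] K12G1[symmetric] by (rule trans) (simp add: algebra_simps)
  qed
  have l: "?D * ((a - b) * L) = (q - r) * a * (?D * H) + (r * a - q * b) * (?D * K1H)"
    unfolding L by (simp add: algebra_simps)
  have h': "?D * H' = (a - c) * (q - r) * a * ((q - r) * b * f + (r * b - q * c) * f2)
       + (b - c) * (r * a - q * b) * ((q - r) * a * f1 + (r * a - q * c) * f12)"
  proof -
    have "?D * H' = (a - c) * (b - c) * ((a - b) * H')" by (simp only: mult_ac)
    from this[unfolded H'] show ?thesis unfolding G2[symmetric] K1G2[symmetric] by (rule trans) (simp add: algebra_simps)
  qed
  have k': "?D * K2H' = - (a - b) * (q - r) * a * ((q - r) * c * f2 + (r * c - q * b) * f)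
       + (b - c) * (r * a - q * c) * ((q - r) * a * f21 + (r * a - q * b) * f121)"
  proof -
    have "?D * K2H' = (a - b) * (b - c) * ((a - c) * K2H')" by (simp only: mult_ac)
    from this[unfolded K2H'] show ?thesis unfolding K2G2[symmetric] K21G2[symmetric] by (rule trans) (simp add: algebra_simps)
  qed
  have r: "?D * ((b - c) * R) = (q - r) * b * (?D * H') + (r * b - q * c) * (?D * K2H')"
    unfolding R by (simp add: algebra_simps)
  have "(?D * (a - b) * (b - c)) * L = (b - c) * (?D * ((a - b) * L))" by (simp add: algebra_simps)
  also have "\<dots> = (a - b) * (?D * ((b - c) * R))"
    unfolding l r h k h' k' by (simp add: algebra_simps)
  also have "\<dots> = (?D * (a - b) * (b - c)) * R" by (simp add: algebra_simps)
  finally show ?thesis using ne by simp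
qed

section \<open>Hecke, braid and intertwining relations for \<open>g\<close>, the transpositions and
  the scalings\<close>

definition gL :: "complex \<Rightarrow> nat \<Rightarrow> nat \<Rightarrow> laurent endo" where "gL q i j = Endo (g_op q i j)"
definition KL :: "nat \<Rightarrow> nat \<Rightarrow> laurent endo" where "KL i j = Endo (swap_op i j)"
definition pL :: "complex \<Rightarrow> nat \<Rightarrow> laurent endo" where "pL p i = Endo (pD_op p i)"
text \<open>The inverse of \<open>g\<close>, read off from the Hecke relation
  \<open>g^2 = 1 + (q - q^-1) g\<close>.\<close>

definition giL :: "complex \<Rightarrow> nat \<Rightarrow> nat \<Rightarrow> laurent endo" where "giL q i j = gL q i j - scL (q - inverse q)"

lemma app_gL: "i \<noteq> j \<Longrightarrow> app (gL q i j) = g_op q i j"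
  unfolding gL_def by (rule app_Endo) (rule g_op_add)
lemma app_KL [simp]: "app (KL i j) = swap_op i j"
  unfolding KL_def by (rule app_Endo) (rule swap_op_add)
lemma app_pL [simp]: "app (pL p i) = pD_op p i"
  unfolding pL_def by (rule app_Endo) (rule pD_op_add)

lemma scL_comm:
  "i \<noteq> j \<Longrightarrow> gL q i j * scL c = scL c * gL q i j" "KL i j * scL c = scL c * KL i j" "pL p i * scL c = scL c * pL p i"
  by (rule endo_eqI; simp add: app_mult app_gL g_op_smul swap_op_smul)+
     (rule poly_mapping_eqI, simp add: lookup_pD_op)

lemma scL_giL: "i \<noteq> j \<Longrightarrow> giL q i j * scL c = scL c * giL q i j"
  by (simp add: giL_def left_diff_distrib right_diff_distrib scL_comm scL_mult mult.commute)

lemma KL_invol: "KL i j * KL i j = 1"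
  by (rule endo_eqI, rule poly_mapping_eqI) (simp add: app_mult lookup_swap_op)

lemma KL_sym: "KL i j = KL j i"
  by (rule endo_eqI, rule poly_mapping_eqI) (simp add: lookup_swap_op transpose_commute)

lemma KL_KL: "KL i j * KL k l = KL (transpose i j k) (transpose i j l) * KL i j"
proof (rule endo_eqI, rule poly_mapping_eqI)
  fix f m
  have "pmswap k l (pmswap i j m) = pmswap i j (pmswap (transpose i j k) (transpose i j l) m)"
    by (rule poly_mapping_eqI) (auto simp: lookup_pmswap transpose_def)
  then show "lookup (app (KL i j * KL k l) f) m
      = lookup (app (KL (transpose i j k) (transpose i j l) * KL i j) f) m"
    by (simp add: app_mult lookup_swap_op)
qed

lemma KL_gL:
  assumes "k \<noteq> l"
  shows "KL i j * gL q k l = gL q (transpose i j k) (transpose i j l) * KL i j"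
proof (rule endo_eqI)
  fix f
  have ne: "transpose i j k \<noteq> transpose i j l" using assms by (metis transpose_involutory)
  have "swap_op i j (g_op q k l f) = g_op q (transpose i j k) (transpose i j l) (swap_op i j f)"
  proof (rule g_op_conj[where c = 1])
    show "swap_op i j (swap_op k l f) = swap_op (transpose i j k) (transpose i j l) (swap_op i j f)" for f
      using arg_cong[OF KL_KL[of i j k l], of "\<lambda>T. app T f"] by (simp add: app_mult)
    show "swap_op i j (CC a) = CC a" for a
      using swap_op_single[of i j 0 a] by (metis add_0_left map_key_zero pmswap_single single_zero)
  qed (simp_all add: swap_op_add swap_op_mult assms ne)
  then show "app (KL i j * gL q k l) f = app (gL q (transpose i j k) (transpose i j l) * KL i j) f"
    by (simp add: app_mult app_gL assms ne)
qed

lemma pD_op_CC [simp]: "pD_op p i (CC a) = CC a" by simp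

lemma pD_op_zvar: "pD_op p i (zvar k) = (if i = k then CC p * zvar k else zvar k)"
  by (simp add: zvar_Z lookup_single when_def mult_single)

lemma KL_pL: "KL i j * pL p k = pL p (transpose i j k) * KL i j"
  by (rule endo_eqI, rule poly_mapping_eqI)
     (simp add: app_mult lookup_swap_op lookup_pD_op lookup_pmswap)

lemma pL_pL: "pL p i * pL p j = pL p j * pL p i"
  by (rule endo_eqI, rule poly_mapping_eqI) (simp add: app_mult lookup_pD_op)

lemma pL_inv: "p \<noteq> 0 \<Longrightarrow> pL p i * pL (inverse p) i = 1" "p \<noteq> 0 \<Longrightarrow> pL (inverse p) i * pL p i = 1"
  by (rule endo_eqI, rule poly_mapping_eqI,
      simp add: app_mult lookup_pD_op power_int_inverse flip: mult.assoc)+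

lemma pL_gL:
  assumes "i \<notin> {k, l}" "k \<noteq> l" "p \<noteq> 0"
  shows "pL p i * gL q k l = gL q k l * pL p i"
proof (rule endo_eqI)
  fix f
  have "pD_op p i (g_op q k l f) = g_op q k l (pD_op p i f)"
  proof (rule g_op_conj[where c = 1])
    show "pD_op p i (swap_op k l f) = swap_op k l (pD_op p i f)" for f
      using arg_cong[OF KL_pL[of k l p i], of "\<lambda>T. app T f"] assms by (simp add: app_mult)
  qed (use assms in \<open>auto simp add: pD_op_add pD_op_mult pD_op_zvar\<close>)
  then show "app (pL p i * gL q k l) f = app (gL q k l * pL p i) f"
    by (simp add: app_mult app_gL assms)
qed

text \<open>Scaling both variables by \<open>p\<close> multiplies the defining equation of
  \<open>g_ij\<close> by \<open>p\<close>; this is the case \<open>c = p\<close> of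
  \<open>g_op_conj\<close>.\<close>

lemma pLpL_gL:
  assumes "i \<noteq> j" "p \<noteq> 0"
  shows "pL p i * pL p j * gL q i j = gL q i j * (pL p i * pL p j)"
proof (rule endo_eqI)
  fix f
  have "pD_op p i (pD_op p j (g_op q i j f)) = g_op q i j (pD_op p i (pD_op p j f))"
  proof (rule g_op_conj[where c = p and \<theta> = "\<lambda>f. pD_op p i (pD_op p j f)"])
    show "pD_op p i (pD_op p j (swap_op i j f)) = swap_op i j (pD_op p i (pD_op p j f))" for f
      using assms by (intro poly_mapping_eqI) (simp add: lookup_swap_op lookup_pD_op lookup_pmswap)
  qed (use assms in \<open>auto simp add: pD_op_add pD_op_mult pD_op_zvar\<close>)
  then show "app (pL p i * pL p j * gL q i j) f = app (gL q i j * (pL p i * pL p j)) f"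
    by (simp add: app_mult app_gL assms)
qed

lemma gL_quadratic:
  assumes ij: "i \<noteq> j" and q: "q \<noteq> 0"
  shows "gL q i j * gL q i j = 1 + scL (q - inverse q) * gL q i j"
proof (rule endo_eqI)
  fix f
  note k = arg_cong[OF g_op_mult[OF ij, of q f], of "swap_op i j"]
  have "g_op q i j (g_op q i j f) = f + (CC q - CC (inverse q)) * g_op q i j f"
  proof (rule quadratic_idom[where a = "zvar i" and b = "zvar j" and f' = "swap_op i j f" and G' = "swap_op i j (g_op q i j f)"])
    have inv: "swap_op i j (swap_op i j f) = f" "swap_op i j (CC a) = CC a" for a
      using arg_cong[OF KL_invol[of i j], of "\<lambda>T. app T f"] by (simp_all add: app_mult)
    show "(zvar j - zvar i) * swap_op i j (g_op q i j f) =
      (CC q - CC (inverse q)) * zvar j * swap_op i j f + (CC (inverse q) * zvar j - CC q * zvar i) * f"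
      using k by (simp add: swap_op_mult swap_op_add inv single_diff additive.diff[of "swap_op i j"] additive_def del: swap_op_single)
    show "zvar i \<noteq> zvar j" using zvar_neq[OF ij] by auto
  qed (use g_op_mult[OF ij] q in \<open>simp_all add: single_diff mult_single\<close>)
  then show "app (gL q i j * gL q i j) f = app (1 + scL (q - inverse q) * gL q i j) f"
    by (simp add: app_mult app_op_add app_gL ij smul_conv single_diff)
qed

lemma gL_inv:
  assumes "i \<noteq> j" "q \<noteq> 0"
  shows "gL q i j * giL q i j = 1" "giL q i j * gL q i j = 1"
  using assms by (simp_all add: giL_def left_diff_distrib right_diff_distrib gL_quadratic scL_comm)

lemma swap_op_CC: "swap_op i j (CC a) = CC a" by simp

lemma swap_op_minus: "swap_op i j (f - g) = swap_op i j f - swap_op i j g"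
  by (rule poly_mapping_eqI) (simp add: lookup_swap_op lookup_minus)

lemma swap_swap: "swap_op i j (swap_op k l f) = swap_op (transpose i j k) (transpose i j l) (swap_op i j f)"
  using arg_cong[OF KL_KL[of i j k l], of "\<lambda>T. app T f"] by (simp add: app_mult)

lemma swap_invol [simp]: "swap_op i j (swap_op i j f) = f"
  using arg_cong[OF KL_invol[of i j], of "\<lambda>T. app T f"] by (simp add: app_mult)

lemma gL_braid:
  assumes d: "i \<noteq> j" "j \<noteq> k" "i \<noteq> k"
  shows "gL q i j * gL q j k * gL q i j = gL q j k * gL q i j * gL q j k"
proof (rule endo_eqI)
  fix f
  let ?K1 = "swap_op i j" and ?K2 = "swap_op j k" and ?g1 = "g_op q i j" and ?g2 = "g_op q j k"
  note M1 = g_op_mult[OF d(1), of q] and M2 = g_op_mult[OF d(2), of q]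
  have b: "?K1 (?K2 (?K1 h)) = ?K2 (?K1 (?K2 h))" for h
    using d by (simp add: swap_swap[of i j j k] swap_swap[of j k i k] swap_swap[of j k i j])
  note S = swap_op_mult swap_op_add swap_op_minus swap_op_CC swap_op_zvar swap_invol
  have t: "transpose i j i = j" "transpose i j j = i" "transpose i j k = k"
     "transpose j k i = i" "transpose j k j = k" "transpose j k k = j" using d by auto
  have ne: "zvar i \<noteq> zvar j" "zvar j \<noteq> zvar k" "zvar i \<noteq> zvar k"
    using zvar_neq d by auto
  \<comment> \<open>The fourteen inputs of \<open>braid_idom\<close>: the defining equations of the
    six values of \<open>g\<close> along the two words, and eight images of them under words in
    \<open>K1\<close> and \<open>K2\<close>.\<close>
  have e1: "(zvar i - zvar j) * (?g1 f) = (CC q - CC (inverse q)) * zvar i * f + (CC (inverse q) * zvar i - CC q * zvar j) * (?K1 f)"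
    using M1[of f] by (simp only: S t single_diff)
  have e2: "(zvar i - zvar k) * (?K2 (?g1 f)) = (CC q - CC (inverse q)) * zvar i * (?K2 f) + (CC (inverse q) * zvar i - CC q * zvar k) * (?K2 (?K1 f))"
    using arg_cong[OF M1[of f], of ?K2] by (simp only: S t single_diff)
  have e3: "(zvar j - zvar k) * (?g2 (?g1 f)) = (CC q - CC (inverse q)) * zvar j * (?g1 f) + (CC (inverse q) * zvar j - CC q * zvar k) * (?K2 (?g1 f))"
    using M2[of "?g1 f"] by (simp only: S t single_diff)
  have e4: "(zvar j - zvar i) * (?K1 (?g1 f)) = (CC q - CC (inverse q)) * zvar j * (?K1 f) + (CC (inverse q) * zvar j - CC q * zvar i) * f"
    using arg_cong[OF M1[of f], of ?K1] by (simp only: S t single_diff)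
  have e5: "(zvar j - zvar k) * (?K1 (?K2 (?g1 f))) = (CC q - CC (inverse q)) * zvar j * (?K1 (?K2 f)) + (CC (inverse q) * zvar j - CC q * zvar k) * (?K1 (?K2 (?K1 f)))"
    using arg_cong[OF arg_cong[OF M1[of f], of ?K2], of ?K1] by (simp only: S t single_diff)
  have e6: "(zvar i - zvar k) * (?K1 (?g2 (?g1 f))) = (CC q - CC (inverse q)) * zvar i * (?K1 (?g1 f)) + (CC (inverse q) * zvar i - CC q * zvar k) * (?K1 (?K2 (?g1 f)))"
    using arg_cong[OF M2[of "?g1 f"], of ?K1] by (simp only: S t single_diff)
  have e7: "(zvar i - zvar j) * (?g1 (?g2 (?g1 f))) = (CC q - CC (inverse q)) * zvar i * (?g2 (?g1 f)) + (CC (inverse q) * zvar i - CC q * zvar j) * (?K1 (?g2 (?g1 f)))"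
    using M1[of "?g2 (?g1 f)"] by (simp only: S t single_diff)
  have e8: "(zvar j - zvar k) * (?g2 f) = (CC q - CC (inverse q)) * zvar j * f + (CC (inverse q) * zvar j - CC q * zvar k) * (?K2 f)"
    using M2[of f] by (simp only: S t single_diff)
  have e9: "(zvar i - zvar k) * (?K1 (?g2 f)) = (CC q - CC (inverse q)) * zvar i * (?K1 f) + (CC (inverse q) * zvar i - CC q * zvar k) * (?K1 (?K2 f))"
    using arg_cong[OF M2[of f], of ?K1] by (simp only: S t single_diff)
  have e10: "(zvar i - zvar j) * (?g1 (?g2 f)) = (CC q - CC (inverse q)) * zvar i * (?g2 f) + (CC (inverse q) * zvar i - CC q * zvar j) * (?K1 (?g2 f))"
    using M1[of "?g2 f"] by (simp only: S t single_diff)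
  have e11: "(zvar k - zvar j) * (?K2 (?g2 f)) = (CC q - CC (inverse q)) * zvar k * (?K2 f) + (CC (inverse q) * zvar k - CC q * zvar j) * f"
    using arg_cong[OF M2[of f], of ?K2] by (simp only: S t single_diff)
  have e12: "(zvar i - zvar j) * (?K2 (?K1 (?g2 f))) = (CC q - CC (inverse q)) * zvar i * (?K2 (?K1 f)) + (CC (inverse q) * zvar i - CC q * zvar j) * (?K1 (?K2 (?K1 f)))"
    using arg_cong[OF arg_cong[OF M2[of f], of ?K1], of ?K2] by (simp only: S t single_diff b)
  have e13: "(zvar i - zvar k) * (?K2 (?g1 (?g2 f))) = (CC q - CC (inverse q)) * zvar i * (?K2 (?g2 f)) + (CC (inverse q) * zvar i - CC q * zvar k) * (?K2 (?K1 (?g2 f)))"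
    using arg_cong[OF M1[of "?g2 f"], of ?K2] by (simp only: S t single_diff)
  have e14: "(zvar j - zvar k) * (?g2 (?g1 (?g2 f))) = (CC q - CC (inverse q)) * zvar j * (?g1 (?g2 f)) + (CC (inverse q) * zvar j - CC q * zvar k) * (?K2 (?g1 (?g2 f)))"
    using M2[of "?g1 (?g2 f)"] by (simp only: S t single_diff)
  have "?g1 (?g2 (?g1 f)) = ?g2 (?g1 (?g2 f))"
    by (rule braid_idom[OF ne e1 e2 e3 e4 e5 e6 e7 e8 e9 e10 e11 e12 e13 e14])
  then show "app (gL q i j * gL q j k * gL q i j) f = app (gL q j k * gL q i j * gL q j k) f"
    by (simp add: app_mult app_gL d)
qed

text \<open>The variables \<open>z_k, z_l\<close> are invariant under the exchange of
  \<open>z_i\<close> and \<open>z_j\<close>, so \<open>g_ij\<close> is linear over them and commutes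
  with the other transposition; hence it preserves the equation that characterises
  \<open>g_kl\<close>.\<close>

lemma gL_far:
  assumes "i \<noteq> j" "k \<noteq> l" "{i, j} \<inter> {k, l} = {}"
  shows "gL q i j * gL q k l = gL q k l * gL q i j"
proof (rule endo_eqI)
  fix f
  have KL': "KL k l * gL q i j = gL q i j * KL k l" using KL_gL[OF assms(1), of k l q] assms by auto
  have K: "swap_op k l (g_op q i j f) = g_op q i j (swap_op k l f)" for f
    using arg_cong[OF KL', of "\<lambda>T. app T f"] by (simp add: app_mult app_gL assms)
  have s: "swap_op i j (CC a) = CC a" "swap_op i j (zvar k) = zvar k" "swap_op i j (zvar l) = zvar l" for a
    using assms by auto
  have "(zvar k - zvar l) * g_op q i j (g_op q k l f) = g_op q i j ((zvar k - zvar l) * g_op q k l f)"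
    by (rule g_op_lin[symmetric]) (use assms in \<open>simp_all add: swap_op_minus s\<close>)
  also have "\<dots> = CC (q - inverse q) * zvar k * g_op q i j f + (CC (inverse q) * zvar k - CC q * zvar l) * g_op q i j (swap_op k l f)"
    unfolding g_op_mult[OF assms(2)] g_op_add[OF assms(1)]
    by (intro arg_cong2[of _ _ _ _ "(+)"] g_op_lin assms) (simp_all only: swap_op_mult swap_op_minus s)
  finally have "g_op q i j (g_op q k l f) = g_op q k l (g_op q i j f)"
    unfolding K[symmetric] by (simp only: g_op_char[OF assms(2)])
  then show "app (gL q i j * gL q k l) f = app (gL q k l * gL q i j) f"
    by (simp add: app_mult app_gL assms)
qed

section \<open>Commuting Dunkl--Cherednik operators\<close>

definition xiL :: "complex \<Rightarrow> nat \<Rightarrow> nat \<Rightarrow> laurent endo" where "xiL q i j = KL i j * gL q i j"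
definition xiiL :: "complex \<Rightarrow> nat \<Rightarrow> nat \<Rightarrow> laurent endo" where "xiiL q i j = giL q i j * KL i j"

lemma app_xiL: "i \<noteq> j \<Longrightarrow> app (xiL q i j) = xi_op q i j"
  by (simp add: fun_eq_iff xiL_def xi_op_def app_mult app_gL)

lemma cancel_left: "a * b = 1 \<Longrightarrow> a * (b * c) = (c :: 'a::monoid_mult)"
  by (simp flip: mult.assoc)

lemma xi_inv:
  assumes "i \<noteq> j" "q \<noteq> 0"
  shows "xiL q i j * xiiL q i j = 1" "xiiL q i j * xiL q i j = 1"
  using assms by (simp_all add: xiL_def xiiL_def mult.assoc cancel_left[OF gL_inv(1)] cancel_left[OF KL_invol] KL_invol gL_inv)

lemma commute_mult_right:
  fixes x :: "'a::monoid_mult"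
  shows "x * a = a * x \<Longrightarrow> x * b = b * x \<Longrightarrow> x * (a * b) = a * b * x"
  by (metis mult.assoc)

lemma commute_mult_left:
  fixes x :: "'a::monoid_mult"
  shows "a * x = x * a \<Longrightarrow> b * x = x * b \<Longrightarrow> a * b * x = x * (a * b)"
  by (metis mult.assoc)

lemma comm_left:
  fixes x :: "'a::monoid_mult"
  shows "x * y = z * w \<Longrightarrow> x * (y * v) = z * (w * v)"
  by (metis mult.assoc)

lemma KL_giL:
  assumes "k \<noteq> l"
  shows "KL i j * giL q k l = giL q (transpose i j k) (transpose i j l) * KL i j"
  by (simp add: giL_def left_diff_distrib right_diff_distrib KL_gL assms scL_comm)

lemma KL_xiL:
  assumes "k \<noteq> l"
  shows "KL i j * xiL q k l = xiL q (transpose i j k) (transpose i j l) * KL i j"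
  unfolding xiL_def
  by (simp only: mult.assoc[symmetric] KL_KL[of i j k l]) (simp only: mult.assoc KL_gL[OF assms])

lemma KL_xiiL:
  assumes "k \<noteq> l"
  shows "KL i j * xiiL q k l = xiiL q (transpose i j k) (transpose i j l) * KL i j"
  unfolding xiiL_def
  by (simp only: mult.assoc[symmetric] KL_giL[OF assms]) (simp only: mult.assoc KL_KL[of i j k l])

lemma commute_prod_list:
  "(\<And>x. x \<in> set xs \<Longrightarrow> a * f x = f x * a) \<Longrightarrow> a * prod_list (map f xs) = prod_list (map f xs) * (a :: 'a::monoid_mult)"
proof (induction xs)
  case (Cons x xs)
  have "a * (f x * prod_list (map f xs)) = f x * (a * prod_list (map f xs))"
    using Cons.prems[of x] by (simp flip: mult.assoc)
  then show ?case using Cons by (simp add: mult.assoc)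
qed simp

lemma intertwine_prod_list:
  "(\<And>x. x \<in> set xs \<Longrightarrow> a * f x = g x * a) \<Longrightarrow> a * prod_list (map f xs) = prod_list (map g xs) * (a :: 'a::monoid_mult)"
proof (induction xs)
  case (Cons x xs)
  have "a * (f x * prod_list (map f xs)) = g x * (a * prod_list (map f xs))"
    using Cons.prems[of x] by (simp flip: mult.assoc)
  then show ?case using Cons by (simp add: mult.assoc)
qed simp

lemma inverse_prod_list:
  assumes "\<And>x. x \<in> set xs \<Longrightarrow> f x * g x = (1 :: 'a::monoid_mult)"
  shows "prod_list (map f xs) * prod_list (map g (rev xs)) = 1"
  using assms
proof (induction xs)
  case (Cons x xs)
  have "f x * prod_list (map f xs) * (prod_list (map g (rev xs)) * g x)
     = f x * (prod_list (map f xs) * prod_list (map g (rev xs))) * g x" by (simp only: mult.assoc)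
  then show ?case using Cons by (simp add: mult.assoc)
qed simp

lemma commute_inverse:
  fixes a :: "'a::monoid_mult"
  assumes "a * b = b * a" "b * b' = 1" "b' * b = 1"
  shows "a * b' = b' * a"
  by (metis assms mult.assoc mult_1_left mult_1_right)

definition YL :: "complex \<Rightarrow> complex \<Rightarrow> nat \<Rightarrow> nat \<Rightarrow> laurent endo" where
  "YL q p N i = prod_list (map (\<lambda>j. xiiL q i j) [i + 1..<N + 1]) * pL p i * prod_list (map (\<lambda>j. xiL q j i) [1..<i])"

definition YiL :: "complex \<Rightarrow> complex \<Rightarrow> nat \<Rightarrow> nat \<Rightarrow> laurent endo" where
  "YiL q p N i = prod_list (map (\<lambda>j. xiiL q j i) (rev [1..<i])) * pL (inverse p) i
     * prod_list (map (\<lambda>j. xiL q i j) (rev [i + 1..<N + 1]))"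

lemma mult_inverse3:
  fixes a :: "'a::monoid_mult"
  assumes "a * a' = 1" "b * b' = 1" "c * c' = 1"
  shows "a * b * c * (c' * b' * a') = 1"
  by (simp add: mult.assoc cancel_left[OF assms(3)] cancel_left[OF assms(2)] assms(1))

lemma YL_inv:
  assumes "q \<noteq> 0" "p \<noteq> 0"
  shows "YL q p N i * YiL q p N i = 1" "YiL q p N i * YL q p N i = 1"
proof -
  show "YL q p N i * YiL q p N i = 1"
    unfolding YL_def YiL_def
    by (rule mult_inverse3) (auto intro!: inverse_prod_list xi_inv pL_inv assms simp del: upt_Suc)
  have "prod_list (map f (rev xs)) * prod_list (map g xs) = (1 :: laurent endo)"
    if "\<And>x. x \<in> set xs \<Longrightarrow> f x * g x = 1" for f g xs
    using inverse_prod_list[of "rev xs" f g] that by simp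
  note r = this
  show "YiL q p N i * YL q p N i = 1"
    unfolding YL_def YiL_def
    by (rule mult_inverse3) (auto intro!: r xi_inv pL_inv assms simp del: upt_Suc)
qed

lemma Y_op_app:
  assumes "q \<noteq> 0" "1 \<le> i"
  shows "Y_op q p N i = app (YL q p N i)"
proof -
  have "inv_into UNIV (xi_op q i j) = app (xiiL q i j)" if "i < j" for j
    using inv_app[OF xi_inv(1,2)[of i j q]] that assms by (simp add: app_xiL)
  then have 1: "map (\<lambda>j. inv_into UNIV (xi_op q i j)) [i + 1..<N + 1] = map (\<lambda>j. app (xiiL q i j)) [i + 1..<N + 1]"
    by (simp del: upt_Suc)
  have 2: "map (\<lambda>j. xi_op q j i) [1..<i] = map (\<lambda>j. app (xiL q j i)) [1..<i]"
    by (simp add: app_xiL)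
  show ?thesis
    unfolding Y_op_def 1 2 op_prod_app YL_def by (simp add: fun_eq_iff app_mult)
qed

text \<open>With all transpositions moved to the left, the two sides differ by a braid relation
  between transpositions and one between \<open>g_ij\<close> and \<open>g_jk\<close>. This is the
  Yang-Baxter equation.\<close>

lemma xi_ybe:
  assumes d: "i \<noteq> j" "j \<noteq> k" "i \<noteq> k"
  shows "xiL q i j * xiL q i k * xiL q j k = xiL q j k * xiL q i k * xiL q i j"
proof -
  have t: "transpose i j i = j" "transpose i j j = i" "transpose i j k = k"
     "transpose j k i = i" "transpose j k j = k" "transpose j k k = j"
     "transpose i k i = k" "transpose i k j = j" "transpose i k k = i" using d by auto
  have c1: "gL q i j * KL i k = KL i k * gL q k j" "gL q k j * KL j k = KL j k * gL q j k"
     "gL q i k * KL j k = KL j k * gL q i j"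
    using KL_gL[of k j i k q] KL_gL[of j k j k q] KL_gL[of i j j k q] d by (simp_all add: t)
  have c2: "gL q j k * KL i k = KL i k * gL q j i" "gL q j i * KL i j = KL i j * gL q i j"
     "gL q i k * KL i j = KL i j * gL q j k"
    using KL_gL[of j i i k q] KL_gL[of i j i j q] KL_gL[of j k i j q] d by (simp_all add: t)
  have a: "x * y = z * w \<Longrightarrow> x * (y * v) = z * (w * v)" for x y z w v :: "laurent endo"
    by (metis mult.assoc)
  have "xiL q i j * xiL q i k * xiL q j k = KL i j * KL i k * KL j k * (gL q j k * gL q i j * gL q j k)"
    by (simp add: xiL_def mult.assoc a[OF c1(1)] a[OF c1(2)] a[OF c1(3)])
  moreover have "xiL q j k * xiL q i k * xiL q i j = KL j k * KL i k * KL i j * (gL q i j * gL q j k * gL q i j)"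
    by (simp add: xiL_def mult.assoc a[OF c2(1)] a[OF c2(2)] a[OF c2(3)])
  moreover have "KL i j * KL i k * KL j k = KL j k * KL i k * KL i j"
  proof -
    have "KL i j * KL i k * KL j k = KL j k * KL i j * KL j k"
      using KL_KL[of i j i k] by (simp add: t)
    also have "\<dots> = KL j k * (KL i k * KL i j)"
      using KL_KL[of i k i j] KL_KL[of i j j k] by (simp add: t mult.assoc KL_sym)
    finally show ?thesis by (simp add: mult.assoc)
  qed
  ultimately show ?thesis by (simp only: gL_braid[OF d])
qed

text \<open>The Yang-Baxter equation multiplied on both sides by inverses, in the shape met when
  \<open>Y_1\<close> and \<open>Y_2\<close> are interchanged.\<close>

lemma xi_ybe':
  assumes d: "i \<noteq> j" "j \<noteq> k" "i \<noteq> k" and q: "q \<noteq> 0"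
  shows "xiiL q i k * xiiL q j k * xiL q i j = xiL q i j * xiiL q j k * xiiL q i k"
proof -
  have "xiiL q i k * xiiL q j k * (xiL q j k * xiL q i k * xiL q i j) * xiiL q j k * xiiL q i k
     = xiiL q i k * xiiL q j k * (xiL q i j * xiL q i k * xiL q j k) * xiiL q j k * xiiL q i k"
    by (simp only: xi_ybe[OF d])
  then show ?thesis using d q
    by (simp add: mult.assoc xi_inv cancel_left[OF xi_inv(1)] cancel_left[OF xi_inv(2)])
qed

lemma xi_far:
  assumes d: "i \<noteq> j" "k \<noteq> l" "{i, j} \<inter> {k, l} = {}" and q: "q \<noteq> 0"
  shows "xiiL q i j * xiiL q k l = xiiL q k l * xiiL q i j"
proof -
  have "xiiL q i j * giL q k l = giL q k l * xiiL q i j"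
  proof -
    have c: "gL q i j * gL q k l = gL q k l * gL q i j" by (rule gL_far[OF d])
    have 1: "giL q i j * giL q k l = giL q k l * giL q i j"
      using c d by (simp add: giL_def left_diff_distrib right_diff_distrib scL_comm scL_mult mult.commute)
    have 2: "KL i j * giL q k l = giL q k l * KL i j"
      using KL_giL[OF d(2), of i j q] d by auto
    show ?thesis unfolding xiiL_def by (rule commute_mult_left[OF 1 2])
  qed
  moreover have "xiiL q i j * KL k l = KL k l * xiiL q i j"
    using KL_xiiL[OF d(1), of k l q] d by auto
  ultimately show ?thesis unfolding xiiL_def[of q k l] by (rule commute_mult_right)
qed

lemma pL_xiiL:
  assumes "i \<notin> {k, l}" "k \<noteq> l" "p \<noteq> 0"
  shows "pL p i * xiiL q k l = xiiL q k l * pL p i"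
proof -
  have "pL p i * giL q k l = giL q k l * pL p i"
    using assms by (simp add: giL_def left_diff_distrib right_diff_distrib scL_comm pL_gL)
  moreover have "pL p i * KL k l = KL k l * pL p i"
    using KL_pL[of k l p i] assms by auto
  ultimately show ?thesis unfolding xiiL_def by (rule commute_mult_right)
qed

text \<open>The transposition of \<open>i\<close> and \<open>i + 1\<close> carries the factors of
  \<open>Y_(i+1)\<close> to those of \<open>Y_i\<close>, apart from the one
  \<open>xi_(i,i+1)\<close> that stands at the right end in the former and, inverted, at the left
  end in the latter. These two supply the factors \<open>g\<close>.\<close>

lemma YL_Suc:
  assumes i: "1 \<le> i" "i < N" and q: "q \<noteq> 0" and p: "p \<noteq> 0"
  shows "YL q p N (Suc i) = gL q i (Suc i) * YL q p N i * gL q i (Suc i)"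
proof -
  let ?K = "KL i (Suc i)"
  define A where "A = prod_list (map (\<lambda>j. xiiL q i j) [Suc i + 1..<N + 1])"
  define B where "B = prod_list (map (\<lambda>j. xiL q j i) [1..<i])"
  define A' where "A' = prod_list (map (\<lambda>j. xiiL q (Suc i) j) [Suc i + 1..<N + 1])"
  define B' where "B' = prod_list (map (\<lambda>j. xiL q j (Suc i)) [1..<i])"
  have Y: "YL q p N i = xiiL q i (Suc i) * A * pL p i * B"
    unfolding YL_def A_def B_def using i by (simp add: upt_conv_Cons mult.assoc del: upt_Suc)
  have Y': "YL q p N (Suc i) = A' * pL p (Suc i) * (B' * xiL q i (Suc i))"
    unfolding YL_def A'_def B'_def using i by (simp add: mult.assoc)
  have 1: "?K * A' = A * ?K"
    unfolding A_def A'_def by (rule intertwine_prod_list) (use KL_xiiL in \<open>auto simp: transpose_def\<close>)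
  have 2: "?K * B' = B * ?K"
    unfolding B_def B'_def by (rule intertwine_prod_list) (use KL_xiL in \<open>auto simp: transpose_def\<close>)
  have 3: "?K * pL p (Suc i) = pL p i * ?K" using KL_pL[of i "Suc i" p "Suc i"] by simp
  have "YL q p N (Suc i) = ?K * (?K * (A' * pL p (Suc i) * (B' * xiL q i (Suc i))))"
    unfolding Y' by (simp add: cancel_left[OF KL_invol])
  also have "?K * (A' * pL p (Suc i) * (B' * xiL q i (Suc i))) = A * pL p i * B * (?K * xiL q i (Suc i))"
    by (simp only: mult.assoc comm_left[OF 1] comm_left[OF 2] comm_left[OF 3])
  also have "?K * xiL q i (Suc i) = gL q i (Suc i)"
    by (simp add: xiL_def cancel_left[OF KL_invol])
  also have "?K * (A * pL p i * B * gL q i (Suc i)) = gL q i (Suc i) * YL q p N i * gL q i (Suc i)"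
    unfolding Y by (simp add: xiiL_def mult.assoc cancel_left[OF gL_inv(1)] q)
  finally show ?thesis .
qed

text \<open>Neither factor is claimed to commute with \<open>g_jk\<close>; their product does, since
  pulling out the transpositions leaves the two sides of the braid relation.\<close>

lemma xixi_g:
  assumes d: "i \<noteq> j" "j \<noteq> k" "i \<noteq> k" and q: "q \<noteq> 0"
  shows "xiiL q i j * xiiL q i k * gL q j k = gL q j k * (xiiL q i j * xiiL q i k)"
proof -
  have t: "transpose i j i = j" "transpose i j j = i" "transpose i j k = k"
     "transpose i k i = k" "transpose i k j = j" "transpose i k k = i" using d by auto
  have a: "x * y = z * w \<Longrightarrow> x * (y * v) = z * (w * v)" for x y z w v :: "laurent endo"
    by (metis mult.assoc)
  have c1: "gL q i j * KL i k = KL i k * gL q k j" "gL q k j * KL i j = KL i j * gL q k i"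
    using KL_gL[of k j i k q] KL_gL[of k i i j q] d by (simp_all add: t)
  have c1': "gL q i j * KL i k = KL i k * gL q k j"
     using KL_gL[of k j i k q] d by (simp_all add: t)
  have c2: "gL q j k * KL i k = KL i k * gL q j i" "gL q j i * KL i j = KL i j * gL q i j"
      using KL_gL[of j i i k q] KL_gL[of i j i j q] d by (simp_all add: t)
  have c4: "gL q i k * KL i j = KL i j * gL q j k" using KL_gL[of j k i j q] d by (simp_all add: t)
  have c5: "KL i j * gL q i k = gL q j k * KL i j" using KL_gL[of i k i j q] d by (simp_all add: t)
  have L: "xiL q i k * xiL q i j * gL q j k = KL i k * KL i j * (gL q j k * gL q i j * gL q j k)"
    by (simp add: xiL_def mult.assoc a[OF c4])
  have R: "gL q j k * (xiL q i k * xiL q i j) = KL i k * KL i j * (gL q i j * gL q j k * gL q i j)"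
    by (simp add: xiL_def mult.assoc a[OF c2(1)] a[OF c2(2)] a[OF c4])
  have E: "xiL q i k * xiL q i j * gL q j k = gL q j k * (xiL q i k * xiL q i j)"
    unfolding L R by (simp only: gL_braid[OF d])
  have inv: "(xiL q i k * xiL q i j) * (xiiL q i j * xiiL q i k) = 1"
     "(xiiL q i j * xiiL q i k) * (xiL q i k * xiL q i j) = 1"
    using d q by (simp_all add: mult.assoc xi_inv cancel_left[OF xi_inv(1)] cancel_left[OF xi_inv(2)])
  show ?thesis using commute_inverse[OF E[symmetric] inv] by simp
qed

text \<open>All factors of \<open>Y_1\<close> commute with \<open>g_i\<close> one by one, except
  those for \<open>j = i\<close> and \<open>j = i + 1\<close>, which are adjacent and are covered
  together by \<open>xixi_g\<close>.\<close>

lemma YL1_gL: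
  assumes i: "2 \<le> i" "i < N" and q: "q \<noteq> 0" and p: "p \<noteq> 0"
  shows "YL q p N 1 * gL q i (Suc i) = gL q i (Suc i) * YL q p N 1"
proof -
  let ?g = "gL q i (Suc i)"
  have s: "[1 + 1..<N + 1] = [2..<i] @ [i, Suc i] @ [Suc (Suc i)..<N + 1]"
  proof -
    have "[2..<N + 1] = [2..<i] @ [i..<N + 1]" using i upt_add_eq_append[of 2 i "N + 1 - i"] by simp
    then show ?thesis using i by (simp add: upt_conv_Cons numeral_2_eq_2 del: upt_Suc)
  qed
  have comm: "?g * xiiL q 1 j = xiiL q 1 j * ?g" if "j \<noteq> 1" "j \<noteq> i" "j \<noteq> Suc i" for j
  proof -
    have d: "(1::nat) \<noteq> j" "i \<noteq> Suc i" "{1, j} \<inter> {i, Suc i} = {}" using that i by auto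
    have "?g * giL q 1 j = giL q 1 j * ?g"
      using gL_far[OF d] by (simp add: giL_def left_diff_distrib right_diff_distrib scL_comm)
    moreover have "?g * KL 1 j = KL 1 j * ?g" using KL_gL[of i "Suc i" 1 j q] d by auto
    ultimately show ?thesis unfolding xiiL_def by (rule commute_mult_right)
  qed
  define A where "A = prod_list (map (\<lambda>j. xiiL q 1 j) [2..<i])"
  define B where "B = prod_list (map (\<lambda>j. xiiL q 1 j) [Suc (Suc i)..<N + 1])"
  have Y: "YL q p N 1 = A * (xiiL q 1 i * xiiL q 1 (Suc i)) * B * pL p 1"
    unfolding YL_def s A_def B_def by (simp add: mult.assoc)
  have 1: "?g * A = A * ?g" unfolding A_def by (rule commute_prod_list) (use i comm in auto)
  have 2: "?g * B = B * ?g" unfolding B_def by (rule commute_prod_list) (use i comm in auto)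
  have 3: "?g * pL p 1 = pL p 1 * ?g" using pL_gL[of 1 i "Suc i" p q] i p by auto
  have 4: "?g * (xiiL q 1 i * xiiL q 1 (Suc i)) = xiiL q 1 i * xiiL q 1 (Suc i) * ?g"
    using xixi_g[of 1 i "Suc i" q] i q by simp
  show ?thesis unfolding Y by (rule sym) (intro commute_mult_right 1 2 3 4)
qed

text \<open>The factor \<open>xi_12\<close> is carried through the remaining factors by the
  Yang-Baxter equation and through \<open>p^(D_1) p^(D_2)\<close> by homogeneity, until it meets its
  inverse.\<close>

lemma YL1_YL2:
  assumes N: "2 \<le> N" and q: "q \<noteq> 0" and p: "p \<noteq> 0"
  shows "YL q p N 1 * YL q p N 2 = YL q p N 2 * YL q p N 1"
proof -
  define A where "A k = prod_list (map (\<lambda>j. xiiL q 1 j) [3..<k])" for k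
  define B where "B k = prod_list (map (\<lambda>j. xiiL q 2 j) [3..<k])" for k
  let ?x = "xiL q 1 2" and ?x' = "xiiL q 1 2"
  have inv: "?x * ?x' = 1" "?x' * ?x = 1" using xi_inv q by auto
  have Y1: "YL q p N 1 = ?x' * A (N + 1) * pL p 1"
    unfolding YL_def A_def using N by (simp add: upt_conv_Cons numeral_2_eq_2 numeral_3_eq_3 mult.assoc del: upt_Suc)
  have Y2: "YL q p N 2 = B (N + 1) * pL p 2 * ?x"
    unfolding YL_def B_def by (simp add: upt_conv_Cons numeral_2_eq_2 numeral_3_eq_3 mult.assoc)
  \<comment> \<open>Induction on the number of variables beyond the second: one Yang-Baxter move per
    variable, after sorting factors that share no index.\<close>
  have ABx: "A (3 + k) * B (3 + k) * ?x = ?x * (B (3 + k) * A (3 + k))" for k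
  proof (induction k)
    case 0
    show ?case by (simp add: A_def B_def)
  next
    case (Suc k)
    let ?a = "xiiL q 1 (3 + k)" and ?b = "xiiL q 2 (3 + k)"
    have A: "A (3 + Suc k) = A (3 + k) * ?a" and B: "B (3 + Suc k) = B (3 + k) * ?b"
      using upt_Suc_append[of 3 "3 + k"] by (simp_all add: A_def B_def del: upt_Suc)
    have aB: "?a * B (3 + k) = B (3 + k) * ?a" and bA: "?b * A (3 + k) = A (3 + k) * ?b"
      unfolding A_def B_def by (auto intro!: commute_prod_list xi_far q)
    have y: "?a * ?b * ?x = ?x * ?b * ?a" by (rule xi_ybe') (use q in auto)
    have "A (3 + k) * ?a * (B (3 + k) * ?b) * ?x = A (3 + k) * B (3 + k) * (?a * ?b * ?x)"
      by (simp only: mult.assoc comm_left[OF aB])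
    also have "\<dots> = (A (3 + k) * B (3 + k) * ?x) * (?b * ?a)" unfolding y by (simp only: mult.assoc)
    also have "\<dots> = ?x * (B (3 + k) * ?b * (A (3 + k) * ?a))"
      unfolding Suc by (simp only: mult.assoc comm_left[OF bA])
    finally show ?case unfolding A B .
  qed
  from ABx[of "N - 2"] N have AB: "A (N + 1) * B (N + 1) * ?x = ?x * (B (N + 1) * A (N + 1))" by simp
  have pB: "pL p 1 * B (N + 1) = B (N + 1) * pL p 1" and pA: "pL p 2 * A (N + 1) = A (N + 1) * pL p 2"
    unfolding A_def B_def by (auto intro!: commute_prod_list pL_xiiL p simp del: upt_Suc)
  have px: "pL p 1 * pL p 2 * ?x = ?x * (pL p 1 * pL p 2)"
  proof -
    have 1: "KL 1 2 * pL p 1 = pL p 2 * KL 1 2" "KL 1 2 * pL p 2 = pL p 1 * KL 1 2"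
      using KL_pL[of 1 2 p 1] KL_pL[of 1 2 p 2] by simp_all
    have "pL p 1 * pL p 2 * KL 1 2 = KL 1 2 * (pL p 2 * pL p 1)"
      by (simp only: mult.assoc comm_left[OF 1(1)] comm_left[OF 1(2)] 1)
    then have 2: "pL p 1 * pL p 2 * KL 1 2 = KL 1 2 * (pL p 1 * pL p 2)" by (simp only: pL_pL)
    have 3: "pL p 1 * pL p 2 * gL q 1 2 = gL q 1 2 * (pL p 1 * pL p 2)" using pLpL_gL[of 1 2 p q] p by simp
    show ?thesis unfolding xiL_def by (rule commute_mult_right[OF 2 3])
  qed
  have "YL q p N 1 * YL q p N 2 = ?x' * (A (N + 1) * B (N + 1) * (pL p 1 * pL p 2 * ?x))"
    unfolding Y1 Y2 by (simp only: mult.assoc comm_left[OF pB])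
  also have "\<dots> = ?x' * (A (N + 1) * B (N + 1) * ?x) * (pL p 1 * pL p 2)" unfolding px by (simp only: mult.assoc)
  also have "\<dots> = B (N + 1) * A (N + 1) * (pL p 2 * pL p 1)"
    unfolding AB pL_pL[of p 1 2] by (simp only: mult.assoc cancel_left[OF inv(2)])
  also have "\<dots> = B (N + 1) * pL p 2 * (A (N + 1) * pL p 1)" by (simp only: mult.assoc comm_left[OF pA])
  also have "\<dots> = YL q p N 2 * YL q p N 1" unfolding Y1 Y2 by (simp only: mult.assoc cancel_left[OF inv(1)])
  finally show ?thesis .
qed

text \<open>The affine Hecke algebra: all commutations follow from those of \<open>Y 1\<close>.\<close>

lemma affine_hecke_commute:
  fixes g Y :: "nat \<Rightarrow> 'a::monoid_mult"
  assumes Suc: "\<And>i. 1 \<le> i \<Longrightarrow> i < N \<Longrightarrow> Y (Suc i) = g i * Y i * g i"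
    and Y1: "\<And>i. 2 \<le> i \<Longrightarrow> i < N \<Longrightarrow> Y 1 * g i = g i * Y 1"
    and Y12: "2 \<le> N \<Longrightarrow> Y 1 * Y 2 = Y 2 * Y 1"
    and far: "\<And>i j. 1 \<le> i \<Longrightarrow> Suc i < j \<Longrightarrow> j < N \<Longrightarrow> g i * g j = g j * g i"
    and braid: "\<And>i. 1 \<le> i \<Longrightarrow> Suc i < N \<Longrightarrow> g i * g (Suc i) * g i = g (Suc i) * g i * g (Suc i)"
  shows "\<And>i j. 1 \<le> i \<Longrightarrow> i \<le> N \<Longrightarrow> 1 \<le> j \<Longrightarrow> j < N \<Longrightarrow> j \<noteq> i \<Longrightarrow> Suc j \<noteq> i \<Longrightarrow> Y i * g j = g j * Y i"
    and "\<And>i j. 1 \<le> i \<Longrightarrow> i \<le> N \<Longrightarrow> 1 \<le> j \<Longrightarrow> j \<le> N \<Longrightarrow> Y i * Y j = Y j * Y i"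
proof -
  have up: "Y i * g j = g j * Y i" if "1 \<le> i" "i < j" "j < N" for i j
    using that
  proof (induction i rule: nat_induct_at_least)
    case base
    then show ?case using Y1 by simp
  next
    case (Suc i)
    then have "Y i * g j = g j * Y i" "g i * g j = g j * g i" using far by auto
    moreover have "Y (Suc i) = g i * Y i * g i" using assms(1)[of i] Suc by auto
    ultimately show ?case by (simp add: commute_mult_left)
  qed
  \<comment> \<open>In \<open>g_(j+1) g_j Y_j g_j g_(j+1)\<close> the braid relation turns a right
    factor \<open>g_j\<close> into \<open>g_(j+1)\<close>, which passes \<open>Y_j\<close> and is
    turned back into a left factor \<open>g_j\<close> by the braid relation on the other
    side.\<close>
  have low0: "Y (Suc (Suc j)) * g j = g j * Y (Suc (Suc j))" if "1 \<le> j" "Suc (Suc j) \<le> N" for j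
  proof -
    have e: "Y (Suc (Suc j)) = g (Suc j) * (g j * Y j * g j) * g (Suc j)"
      using Suc[of j] Suc[of "Suc j"] that by simp
    have b: "g j * g (Suc j) * g j = g (Suc j) * g j * g (Suc j)" using braid that by simp
    have c: "Y j * g (Suc j) = g (Suc j) * Y j" using up that by simp
    have "Y (Suc (Suc j)) * g j = g (Suc j) * g j * Y j * (g j * g (Suc j) * g j)"
      unfolding e by (simp only: mult.assoc)
    also have "\<dots> = g (Suc j) * g j * (Y j * g (Suc j)) * g j * g (Suc j)" unfolding b by (simp only: mult.assoc)
    also have "\<dots> = (g (Suc j) * g j * g (Suc j)) * Y j * g j * g (Suc j)" unfolding c by (simp only: mult.assoc)
    also have "\<dots> = g j * Y (Suc (Suc j))" unfolding b[symmetric] e by (simp only: mult.assoc)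
    finally show ?thesis .
  qed
  have low: "Y i * g j = g j * Y i" if "1 \<le> j" "Suc (Suc j) \<le> i" "i \<le> N" for i j
    using that(2,3)
  proof (induction i rule: nat_induct_at_least)
    case base
    then show ?case using low0 that by simp
  next
    case (Suc i)
    then have "Y i * g j = g j * Y i" "g j * g i = g i * g j" using far that by auto
    moreover have "Y (Suc i) = g i * Y i * g i" using assms(1)[of i] Suc that by auto
    ultimately show ?case by (simp add: commute_mult_left)
  qed
  show Yg: "Y i * g j = g j * Y i" if "1 \<le> i" "i \<le> N" "1 \<le> j" "j < N" "j \<noteq> i" "Suc j \<noteq> i" for i j
    using up[of i j] low[of j i] that by linarith
  have Y1j: "Y 1 * Y j = Y j * Y 1" if "1 \<le> j" "j \<le> N" for j
    using that
  proof (induction j rule: nat_induct_at_least)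
    case (Suc j)
    show ?case
    proof (cases "j = 1")
      case True
      then show ?thesis using Y12 Suc by (simp add: numeral_2_eq_2)
    next
      case False
      then have "Y 1 * g j = g j * Y 1" "Y (Suc j) = g j * Y j * g j" using Y1 assms(1) Suc by auto
      then show ?thesis using Suc by (simp add: commute_mult_right)
    qed
  qed simp
  have le: "Y i * Y j = Y j * Y i" if "1 \<le> i" "i \<le> j" "j \<le> N" for i j
    using that
  proof (induction i arbitrary: j rule: nat_induct_at_least)
    case base
    then show ?case using Y1j by simp
  next
    case (Suc i)
    show ?case
    proof (cases "j = Suc i")
      case False
      then have "Y i * Y j = Y j * Y i" "Y j * g i = g i * Y j" "Y (Suc i) = g i * Y i * g i"
        using Suc Yg[of j i] assms(1)[of i] by auto
      then show ?thesis by (simp add: commute_mult_left)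
    qed simp
  qed
  show "Y i * Y j = Y j * Y i" if "1 \<le> i" "i \<le> N" "1 \<le> j" "j \<le> N" for i j
    using le[of i j] le[of j i] that by (metis nat_le_linear)
qed

definition yL :: "complex \<Rightarrow> complex \<Rightarrow> nat \<Rightarrow> nat \<Rightarrow> laurent endo" where
  "yL q p N i = scL (q powi (1 - int N)) * YL q p N i"
definition yiL :: "complex \<Rightarrow> complex \<Rightarrow> nat \<Rightarrow> nat \<Rightarrow> laurent endo" where
  "yiL q p N i = scL (q powi (int N - 1)) * YiL q p N i"

lemma sc_xi: "i \<noteq> j \<Longrightarrow> scL c * xiL q i j = xiL q i j * scL c" "i \<noteq> j \<Longrightarrow> scL c * xiiL q i j = xiiL q i j * scL c"
  unfolding xiL_def xiiL_def by (simp_all add: commute_mult_right scL_comm scL_giL)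

lemma sc_YL: "scL c * YL q p N i = YL q p N i * scL c" "scL c * YiL q p N i = YiL q p N i * scL c"
proof -
  have 1: "scL c * prod_list (map (\<lambda>j. xiL q i j) js) = prod_list (map (\<lambda>j. xiL q i j) js) * scL c"
    "scL c * prod_list (map (\<lambda>j. xiL q j i) js) = prod_list (map (\<lambda>j. xiL q j i) js) * scL c"
    "scL c * prod_list (map (\<lambda>j. xiiL q i j) js) = prod_list (map (\<lambda>j. xiiL q i j) js) * scL c"
    "scL c * prod_list (map (\<lambda>j. xiiL q j i) js) = prod_list (map (\<lambda>j. xiiL q j i) js) * scL c"
    if "i \<notin> set js" for js by (rule commute_prod_list, rule sc_xi, use that in blast)+
  show "scL c * YL q p N i = YL q p N i * scL c" "scL c * YiL q p N i = YiL q p N i * scL c"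
    unfolding YL_def YiL_def
    using 1(2)[of "[1..<i]"] 1(3)[of "[i+1..<N+1]"] 1(4)[of "rev [1..<i]"] 1(1)[of "rev [i+1..<N+1]"]
    by (simp_all add: commute_mult_right scL_comm del: upt_Suc)
qed

lemma yL_inv:
  assumes "q \<noteq> 0" "p \<noteq> 0"
  shows "yL q p N i * yiL q p N i = 1" "yiL q p N i * yL q p N i = 1"
proof -
  have "scL a * Y * (scL b * Y') = scL (a * b) * (Y * Y')" if "scL b * Y = Y * scL b" for a b Y Y'
    by (simp only: mult.assoc comm_left[OF that[symmetric]]) (simp add: scL_mult flip: mult.assoc)
  note * = this
  show "yL q p N i * yiL q p N i = 1" "yiL q p N i * yL q p N i = 1"
    unfolding yL_def yiL_def *[OF sc_YL(1)] *[OF sc_YL(2)]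
    by (simp_all add: YL_inv assms flip: power_int_add)
qed

lemma y_op_app:
  assumes "q \<noteq> 0" "1 \<le> i"
  shows "y_op q p N i = app (yL q p N i)"
  by (simp add: fun_eq_iff y_op_def yL_def app_mult Y_op_app[OF assms])

lemma yL_Suc:
  assumes "1 \<le> i" "i < N" "q \<noteq> 0" "p \<noteq> 0"
  shows "yL q p N (Suc i) = gL q i (Suc i) * yL q p N i * gL q i (Suc i)"
proof -
  have "gL q i (Suc i) * (scL c * Y) = scL c * (gL q i (Suc i) * Y)" for c Y
    by (rule comm_left) (simp add: scL_comm)
  note * = this
  show ?thesis
    unfolding yL_def YL_Suc[OF assms] mult.assoc * ..
qed

lemma
  assumes q: "q \<noteq> 0" and p: "p \<noteq> 0"
  shows yL_gL: "\<lbrakk>1 \<le> i; i \<le> N; 1 \<le> j; j < N; j \<noteq> i; Suc j \<noteq> i\<rbrakk> \<Longrightarrow> yL q p N i * gL q j (Suc j) = gL q j (Suc j) * yL q p N i"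
    and yL_yL: "\<lbrakk>1 \<le> i; i \<le> N; 1 \<le> j; j \<le> N\<rbrakk> \<Longrightarrow> yL q p N i * yL q p N j = yL q p N j * yL q p N i"
proof -
  have c: "yL q p N 1 * X = X * yL q p N 1" if "YL q p N 1 * X = X * YL q p N 1" "scL (q powi (1 - int N)) * X = X * scL (q powi (1 - int N))" for X
    unfolding yL_def using that by (simp add: commute_mult_left)
  have 12: "yL q p N 1 * yL q p N 2 = yL q p N 2 * yL q p N 1" if "2 \<le> N"
    unfolding yL_def
    by (intro commute_mult_left commute_mult_right sc_YL[symmetric] sc_YL YL1_YL2 that q p refl)
  have YL1g: "yL q p N 1 * gL q i (Suc i) = gL q i (Suc i) * yL q p N 1" if "2 \<le> i" "i < N" for i
    by (rule c) (use that q p in \<open>simp_all add: YL1_gL[simplified] scL_comm\<close>)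
  note YL1g = this this[simplified] and 12 = 12 12[simplified]
  note * = affine_hecke_commute[where Y = "yL q p N" and g = "\<lambda>i. gL q i (Suc i)" and N = N, OF yL_Suc[OF _ _ q p]]
  show "\<lbrakk>1 \<le> i; i \<le> N; 1 \<le> j; j < N; j \<noteq> i; Suc j \<noteq> i\<rbrakk> \<Longrightarrow> yL q p N i * gL q j (Suc j) = gL q j (Suc j) * yL q p N i"
    by (rule *(1)) (auto intro!: YL1g 12 gL_far gL_braid)
  show "\<lbrakk>1 \<le> i; i \<le> N; 1 \<le> j; j \<le> N\<rbrakk> \<Longrightarrow> yL q p N i * yL q p N j = yL q p N j * yL q p N i"
    by (rule *(2)) (auto intro!: YL1g 12 gL_far gL_braid)
qed

section \<open>The coproduct and the defining relations\<close>

text \<open>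
  The Serre sums for \<open>a\<^sub>i\<^sub>j = -1, -2\<close>, with \<open>Q = q\<close> and \<open>Q' = q\<^sup>-\<^sup>1\<close> central ring elements, are additive
  under the \<open>q\<close>-commutations between the two summands of a coproduct.
\<close>

definition serre2 :: "'a::ring_1 \<Rightarrow> 'a \<Rightarrow> 'a \<Rightarrow> 'a \<Rightarrow> 'a" where
  "serre2 Q Q' x y = x * x * y - (Q + Q') * (x * y * x) + y * x * x"

definition serre3 :: "'a::ring_1 \<Rightarrow> 'a \<Rightarrow> 'a \<Rightarrow> 'a \<Rightarrow> 'a" where
  "serre3 Q Q' x y = x * x * x * y - (Q * Q + 1 + Q' * Q') * (x * x * y * x)
     + (Q * Q + 1 + Q' * Q') * (x * y * x * x) - y * x * x * x"

text \<open>The three \<open>q\<close>-commutations move \<open>b, d\<close> to the left of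
  \<open>a, c\<close>. In this order the mixed terms cancel, and the two pure parts are the Serre
  sums of the summands.\<close>

lemma serre2_coproduct:
  fixes a :: "'a::ring_1"
  assumes Q: "Q * Q' = 1" "Q' * Q = 1"
    and cQ: "\<And>x. x \<in> {a, b, c, d} \<Longrightarrow> x * Q = Q * x" "\<And>x. x \<in> {a, b, c, d} \<Longrightarrow> x * Q' = Q' * x"
    and r: "a * b = Q * (Q * (b * a))" "a * d = Q' * (d * a)" "c * b = Q' * (b * c)"
    and S: "serre2 Q Q' a c = 0" "serre2 Q Q' b d = 0"
  shows "serre2 Q Q' (a + b) (c + d) = 0"
proof -
  have q: "Q * (Q' * x) = x" "Q' * (Q * x) = x" for x by (simp_all flip: mult.assoc add: Q)
  have c1: "a * Q = Q * a" "b * Q = Q * b" "c * Q = Q * c" "d * Q = Q * d"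
    "a * Q' = Q' * a" "b * Q' = Q' * b" "c * Q' = Q' * c" "d * Q' = Q' * d" using cQ by auto
  have S': "a * (a * c) = (Q + Q') * (a * c * a) - c * a * a" "b * (b * d) = (Q + Q') * (b * d * b) - d * b * b"
    using S unfolding serre2_def by (simp_all add: algebra_simps)
  show ?thesis
    unfolding serre2_def
    by (simp add: distrib_left distrib_right right_diff_distrib left_diff_distrib mult.assoc Q q c1 c1[THEN comm_left, unfolded mult.assoc] r
      r[THEN comm_left, unfolded mult.assoc] S'[unfolded mult.assoc])
qed

lemma serre3_coproduct:
  fixes a :: "'a::ring_1"
  assumes Q: "Q * Q' = 1" "Q' * Q = 1"
    and cQ: "\<And>x. x \<in> {a, b, c, d} \<Longrightarrow> x * Q = Q * x" "\<And>x. x \<in> {a, b, c, d} \<Longrightarrow> x * Q' = Q' * x"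
    and r: "a * b = Q * (Q * (b * a))" "a * d = Q' * (Q' * (d * a))" "c * b = Q' * (Q' * (b * c))"
    and S: "serre3 Q Q' a c = 0" "serre3 Q Q' b d = 0"
  shows "serre3 Q Q' (a + b) (c + d) = 0"
proof -
  have q: "Q * (Q' * x) = x" "Q' * (Q * x) = x" for x by (simp_all flip: mult.assoc add: Q)
  have c1: "a * Q = Q * a" "b * Q = Q * b" "c * Q = Q * c" "d * Q = Q * d"
    "a * Q' = Q' * a" "b * Q' = Q' * b" "c * Q' = Q' * c" "d * Q' = Q' * d" using cQ by auto
  have S': "a * (a * (a * c)) = (Q * Q + 1 + Q' * Q') * (a * (a * (c * a)) - a * (c * (a * a))) + c * (a * (a * a))"
      "b * (b * (b * d)) = (Q * Q + 1 + Q' * Q') * (b * (b * (d * b)) - b * (d * (b * b))) + d * (b * (b * b))"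
    using S unfolding serre3_def by (simp_all add: algebra_simps)
  show ?thesis
    unfolding serre3_def
    by (simp add: distrib_left distrib_right right_diff_distrib left_diff_distrib mult.assoc Q q c1 c1[THEN comm_left, unfolded mult.assoc] r
      r[THEN comm_left, unfolded mult.assoc] S'[unfolded mult.assoc])
qed

text \<open>Scalars enter through a map \<open>sc\<close>, so that the same sum makes sense for
  endomorphisms of tensors, where complex numbers are not ring elements.\<close>

definition serreR :: "(complex \<Rightarrow> 'a::ring_1) \<Rightarrow> complex \<Rightarrow> nat \<Rightarrow> 'a \<Rightarrow> 'a \<Rightarrow> 'a" where
  "serreR sc q m x y = (\<Sum>t\<le>m. sc ((- 1) ^ t * qbinom q m t) * x ^ (m - t) * y * x ^ t)"

definition scalar_hom :: "(complex \<Rightarrow> 'a::ring_1) \<Rightarrow> bool" where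
  "scalar_hom sc \<longleftrightarrow> sc 1 = 1 \<and> (\<forall>a b. sc (a + b) = sc a + sc b \<and> sc (a * b) = sc a * sc b)"

definition generic_q :: "complex \<Rightarrow> bool" where
  "generic_q q \<longleftrightarrow> q \<noteq> 0 \<and> (q = 1 \<or> (\<forall>j>0. q ^ j \<noteq> 1))"

text \<open>As \<open>1 - a_ij\<close> is at most \<open>3\<close>, the Serre sums divide only by
  \<open>[2]\<close> and \<open>[3]\<close>. A zero of these would satisfy \<open>q^4 = 1\<close> or
  \<open>q^6 = 1\<close>; at \<open>q = 1\<close> they are \<open>2\<close> and
  \<open>3\<close>.\<close>

lemma qints:
  assumes "generic_q q"
  shows "q + inverse q \<noteq> 0" "q * q + 1 + inverse q * inverse q \<noteq> 0"
    "qint q 1 = 1" "qint q 2 = q + inverse q" "qint q 3 = q * q + 1 + inverse q * inverse q"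
proof -
  have qnz: "q \<noteq> 0" using assms by (simp add: generic_q_def)
  have "q * q + 1 \<noteq> 0"
  proof
    assume "q * q + 1 = 0"
    then have "q * q = - 1" by (simp add: eq_neg_iff_add_eq_0)
    then have "q ^ 4 = 1" by (metis mult_minus1 minus_minus power2_eq_square power_even_eq numeral_Bit0 mult_2)
    then show False using assms \<open>q * q + 1 = 0\<close> by (auto simp: generic_q_def)
  qed
  then show "q + inverse q \<noteq> 0" using qnz by (simp add: field_simps)
  have "q * q * (q * q) + q * q + 1 \<noteq> 0"
  proof
    assume a: "q * q * (q * q) + q * q + 1 = 0"
    have "q ^ 6 - 1 = (q * q - 1) * (q * q * (q * q) + q * q + 1)"
      by (simp add: algebra_simps power_numeral_reduce)
    then have "q ^ 6 = 1" using a by simp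
    then show False using assms a by (auto simp: generic_q_def)
  qed
  then show "q * q + 1 + inverse q * inverse q \<noteq> 0" using qnz by (simp add: field_simps)
  show "qint q 1 = 1" "qint q 2 = q + inverse q" "qint q 3 = q * q + 1 + inverse q * inverse q"
    using qnz by (simp_all add: qint_def eval_nat_numeral power_int_def)
qed

lemma serreR_cases:
  assumes q: "generic_q q" and sc: "scalar_hom sc"
  shows "serreR sc q 1 x y = x * y - y * x"
    and "serreR sc q 2 x y = serre2 (sc q) (sc (inverse q)) x y"
    and "serreR sc q 3 x y = serre3 (sc q) (sc (inverse q)) x y"
proof -
  have sc0: "sc 0 = 0" using sc unfolding scalar_hom_def by (metis add_cancel_right_right)
  have scm: "sc (- a) = - sc a" for a
    using sc sc0 unfolding scalar_hom_def by (metis add.right_inverse eq_neg_iff_add_eq_0 add.commute)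
  have sc1: "sc 1 = 1" "sc (a + b) = sc a + sc b" "sc (a * b) = sc a * sc b" for a b
    using sc unfolding scalar_hom_def by auto
  note qi = qints[OF q]
  have f: "qfact q 0 = 1" "qfact q 1 = 1" "qfact q 2 = q + inverse q"
    "qfact q 3 = (q + inverse q) * (q * q + 1 + inverse q * inverse q)"
    using qi(3-5) by (simp_all add: qfact_def numeral_2_eq_2 numeral_3_eq_3)
  have b: "qbinom q 1 0 = 1" "qbinom q 1 1 = 1" "qbinom q 2 0 = 1" "qbinom q 2 1 = q + inverse q" "qbinom q 2 2 = 1"
    "qbinom q 3 0 = 1" "qbinom q 3 1 = q * q + 1 + inverse q * inverse q"
    "qbinom q 3 2 = q * q + 1 + inverse q * inverse q" "qbinom q 3 3 = 1"
    unfolding qbinom_def using f qi(1,2) by (simp_all add: numeral_2_eq_2[symmetric])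
  have s: "{..1} = {0, 1::nat}" "{..2} = {0, 1, 2::nat}" "{..3} = {0, 1, 2, 3::nat}" by auto
  show "serreR sc q 1 x y = x * y - y * x"
    unfolding serreR_def s using b by (simp add: sc1 scm)
  show "serreR sc q 2 x y = serre2 (sc q) (sc (inverse q)) x y"
    unfolding serreR_def s using b(3-5) by (simp add: sc1 scm serre2_def power2_eq_square mult.assoc)
  show "serreR sc q 3 x y = serre3 (sc q) (sc (inverse q)) x y"
    unfolding serreR_def s using b(6-9) by (simp add: sc1 scm serre3_def power2_eq_square power3_eq_cube mult.assoc)
qed

text \<open>The defining relations as equations in a ring, with \<open>L i\<close> for the inverse
  of \<open>K i\<close>. Conjugation is rewritten as \<open>K E = q^a E K\<close>, which serves as a
  rewrite rule.\<close>

definition Uq_rels_common :: "nat \<Rightarrow> complex \<Rightarrow> (complex \<Rightarrow> 'a::ring_1) \<Rightarrow> (nat \<Rightarrow> 'a) \<Rightarrow> (nat \<Rightarrow> 'a) \<Rightarrow> (nat \<Rightarrow> 'a) \<Rightarrow> (nat \<Rightarrow> 'a) \<Rightarrow> bool" where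
  "Uq_rels_common n q sc E F K L \<longleftrightarrow>
     (\<forall>i<n. K i * L i = 1 \<and> L i * K i = 1) \<and>
     (\<forall>i<n. \<forall>j<n. K i * K j = K j * K i \<and>
        K i * E j = sc (q powi cartan n i j) * (E j * K i) \<and>
        K i * F j = sc (q powi (- cartan n i j)) * (F j * K i)) \<and>
     (\<forall>i<n. \<forall>j<n. i \<noteq> j \<longrightarrow> serreR sc q (nat (1 - cartan n i j)) (E i) (E j) = 0 \<and>
        serreR sc q (nat (1 - cartan n i j)) (F i) (F j) = 0) \<and>
     prod_list (map K [0..<n]) = 1"

definition Uq_rels_EF :: "nat \<Rightarrow> complex \<Rightarrow> (complex \<Rightarrow> 'a::ring_1) \<Rightarrow> (nat \<Rightarrow> 'a) \<Rightarrow> (nat \<Rightarrow> 'a) \<Rightarrow> (nat \<Rightarrow> 'a) \<Rightarrow> (nat \<Rightarrow> 'a) \<Rightarrow> bool" where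
  "Uq_rels_EF n q sc E F K L \<longleftrightarrow> (\<forall>i<n. \<forall>j<n.
     E i * F j - F j * E i = (if i = j then sc (1 / (q - inverse q)) * (K i - L i) else 0))"

definition Uq_rels_classical :: "nat \<Rightarrow> (complex \<Rightarrow> 'a::ring_1) \<Rightarrow> (nat \<Rightarrow> 'a) \<Rightarrow> (nat \<Rightarrow> 'a) \<Rightarrow> (nat \<Rightarrow> 'a) \<Rightarrow> bool" where
  "Uq_rels_classical n sc E F K \<longleftrightarrow> (let H = (\<lambda>i. E i * F i - F i * E i) in
     (\<forall>i<n. K i = 1) \<and>
     (\<forall>i<n. \<forall>j<n. i \<noteq> j \<longrightarrow> E i * F j = F j * E i) \<and>
     (\<forall>i<n. \<forall>j<n. H i * H j = H j * H i \<and>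
        H i * E j - E j * H i = sc (of_int (cartan n i j)) * E j \<and>
        H i * F j - F j * H i = - (sc (of_int (cartan n i j)) * F j)) \<and>
     (\<Sum>i<n. H i) = 0)"

lemma cartan_sym: "cartan n i j = cartan n j i"
  by (simp add: cartan_def)

lemma cartan_self: "n \<ge> 2 \<Longrightarrow> i < n \<Longrightarrow> cartan n i i = 2"
proof -
  assume "n \<ge> 2" "i < n"
  then have "i \<noteq> (i + 1) mod n" by (cases "i + 1 < n") (auto simp: not_less le_Suc_eq)
  then show ?thesis by (auto simp: cartan_def)
qed

lemma cartan_off: "i \<noteq> j \<Longrightarrow> cartan n i j = 0 \<or> cartan n i j = - 1 \<or> cartan n i j = - 2"
  by (simp add: cartan_def)

lemma prod_list_commuting:
  assumes "\<And>i j. i \<in> set xs \<Longrightarrow> j \<in> set xs \<Longrightarrow> g i * f j = f j * (g i :: 'a::monoid_mult)"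
  shows "prod_list (map (\<lambda>i. f i * g i) xs) = prod_list (map f xs) * prod_list (map g xs)"
  using assms
proof (induction xs)
  case (Cons x xs)
  have "g x * prod_list (map f xs) = prod_list (map f xs) * g x"
    by (rule commute_prod_list) (use Cons.prems in auto)
  note * = this comm_left[OF this]
  have IH: "prod_list (map (\<lambda>i. f i * g i) xs) = prod_list (map f xs) * prod_list (map g xs)"
    by (rule Cons.IH) (use Cons.prems in auto)
  show ?case by (simp add: IH mult.assoc *)
qed simp

section \<open>Compatibility of the relations with the coproduct of two commuting families\<close>

context
  fixes n :: nat and q :: complex and sc :: "complex \<Rightarrow> 'a::ring_1"
    and E F K L E' F' K' L' :: "nat \<Rightarrow> 'a"
  assumes n: "n \<ge> 2" and q: "generic_q q" and sc: "scalar_hom sc"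
    and R: "Uq_rels_common n q sc E F K L" and R': "Uq_rels_common n q sc E' F' K' L'"
    and comm: "\<And>i j x y. i < n \<Longrightarrow> j < n \<Longrightarrow> x \<in> {E i, F i, K i, L i} \<Longrightarrow> y \<in> {E' j, F' j, K' j, L' j} \<Longrightarrow> y * x = x * y"
    and cent: "\<And>i x c. i < n \<Longrightarrow> x \<in> {E i, F i, K i, L i, E' i, F' i, K' i, L' i} \<Longrightarrow> x * sc c = sc c * x"
begin

private lemma qnz: "q \<noteq> 0" using q by (simp add: generic_q_def)

private lemma scm: "sc a * sc b = sc (a * b)" "sc 1 = 1" using sc unfolding scalar_hom_def by auto

private lemma inv: "i < n \<Longrightarrow> K i * L i = 1" "i < n \<Longrightarrow> L i * K i = 1" "i < n \<Longrightarrow> K' i * L' i = 1" "i < n \<Longrightarrow> L' i * K' i = 1"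
  using R R' by (auto simp: Uq_rels_common_def)

private lemma KK: "i < n \<Longrightarrow> j < n \<Longrightarrow> K i * K j = K j * K i" "i < n \<Longrightarrow> j < n \<Longrightarrow> K' i * K' j = K' j * K' i"
  using R R' by (auto simp: Uq_rels_common_def)

private lemma KEF:
  assumes "i < n" "j < n"
  shows "K i * E j = sc (q powi cartan n i j) * (E j * K i)" "K' i * E' j = sc (q powi cartan n i j) * (E' j * K' i)"
    "K i * F j = sc (q powi (- cartan n i j)) * (F j * K i)" "K' i * F' j = sc (q powi (- cartan n i j)) * (F' j * K' i)"
  using R R' assms by (auto simp: Uq_rels_common_def)

private lemma L_conj:
  fixes k l x :: 'a
  assumes "k * l = 1" "l * k = 1" "k * x = sc c * (x * k)" "l * sc (inverse c) = sc (inverse c) * l" "c \<noteq> 0"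
  shows "l * x = sc (inverse c) * (x * l)"
proof -
  have "sc (inverse c) * (k * x) = x * k"
    unfolding assms(3) using assms(5) by (simp add: scm flip: mult.assoc)
  then have "l * (x * k) * l = l * (sc (inverse c) * (k * x)) * l" by simp
  also have "\<dots> = sc (inverse c) * (x * l)"
    by (simp add: mult.assoc comm_left[OF assms(4)] cancel_left[OF assms(2)])
  finally show ?thesis by (simp add: mult.assoc assms(1))
qed

private lemma LF_comm:
  assumes "i < n" "j < n"
  shows "L i * E j = sc (q powi (- cartan n i j)) * (E j * L i)" "L i * F j = sc (q powi cartan n i j) * (F j * L i)"
  using L_conj[OF inv(1,2) KEF(1)] L_conj[OF inv(1,2) KEF(3)] cent[OF assms(1)] assms qnz
  by (simp_all add: power_int_minus)

private lemma LL: "i < n \<Longrightarrow> j < n \<Longrightarrow> L i * L j = L j * L i"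
  using commute_inverse[OF commute_inverse[OF KK(1) inv(1,2), symmetric] inv(1,2)] by metis

text \<open>Oriented for the simplifier: primed factors move to the right of unprimed ones. Each
  rule comes in a plain form and in one for right-nested products.\<close>

private lemma cm:
  assumes "i < n" "j < n"
  shows "E' j * E i = E i * E' j" "E' j * (E i * z) = E i * (E' j * z)"
    "E' j * F i = F i * E' j" "E' j * (F i * z) = F i * (E' j * z)"
    "E' j * K i = K i * E' j" "E' j * (K i * z) = K i * (E' j * z)"
    "E' j * L i = L i * E' j" "E' j * (L i * z) = L i * (E' j * z)"
    "F' j * E i = E i * F' j" "F' j * (E i * z) = E i * (F' j * z)"
    "F' j * F i = F i * F' j" "F' j * (F i * z) = F i * (F' j * z)"
    "F' j * K i = K i * F' j" "F' j * (K i * z) = K i * (F' j * z)"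
    "F' j * L i = L i * F' j" "F' j * (L i * z) = L i * (F' j * z)"
    "K' j * E i = E i * K' j" "K' j * (E i * z) = E i * (K' j * z)"
    "K' j * F i = F i * K' j" "K' j * (F i * z) = F i * (K' j * z)"
    "K' j * K i = K i * K' j" "K' j * (K i * z) = K i * (K' j * z)"
    "K' j * L i = L i * K' j" "K' j * (L i * z) = L i * (K' j * z)"
    "L' j * E i = E i * L' j" "L' j * (E i * z) = E i * (L' j * z)"
    "L' j * F i = F i * L' j" "L' j * (F i * z) = F i * (L' j * z)"
    "L' j * K i = K i * L' j" "L' j * (K i * z) = K i * (L' j * z)"
    "L' j * L i = L i * L' j" "L' j * (L i * z) = L i * (L' j * z)"
  by (rule comm[OF assms] comm_left[OF comm[OF assms]]; simp)+

private lemma ce: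
  assumes "i < n"
  shows "E i * sc c = sc c * E i" "E i * (sc c * z) = sc c * (E i * z)"
    "F i * sc c = sc c * F i" "F i * (sc c * z) = sc c * (F i * z)"
    "K i * sc c = sc c * K i" "K i * (sc c * z) = sc c * (K i * z)"
    "L i * sc c = sc c * L i" "L i * (sc c * z) = sc c * (L i * z)"
    "E' i * sc c = sc c * E' i" "E' i * (sc c * z) = sc c * (E' i * z)"
    "F' i * sc c = sc c * F' i" "F' i * (sc c * z) = sc c * (F' i * z)"
    "K' i * sc c = sc c * K' i" "K' i * (sc c * z) = sc c * (K' i * z)"
    "L' i * sc c = sc c * L' i" "L' i * (sc c * z) = sc c * (L' i * z)"
  by (rule cent[OF assms] comm_left[OF cent[OF assms]]; simp)+

text \<open>The Cartan relations hold factor by factor. The Serre relations mix the families, but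
  only through the \<open>q\<close>-commutations \<open>EK\<close> and \<open>FL\<close> of the two
  summands.\<close>

lemma Uq_common_coproduct:
  "Uq_rels_common n q sc (\<lambda>i. E i * K' i + E' i) (\<lambda>i. F i + L i * F' i) (\<lambda>i. K i * K' i) (\<lambda>i. L i * L' i)"
proof -
  have 1: "K i * K' i * (L i * L' i) = 1" "L i * L' i * (K i * K' i) = 1" if "i < n" for i
    using that by (simp_all add: mult.assoc cm[OF that that] cancel_left inv)
  have 2: "K i * K' i * (K j * K' j) = K j * K' j * (K i * K' i)" if "i < n" "j < n" for i j
    using that KK[OF that] comm_left[OF KK(1)[OF that]] by (simp add: mult.assoc cm[OF that] cm[OF that(2,1)])
  have 3: "K i * K' i * (E j * K' j + E' j) = sc (q powi cartan n i j) * ((E j * K' j + E' j) * (K i * K' i))"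
    if "i < n" "j < n" for i j
    using that KK(2)[OF that] comm_left[OF KEF(1)[OF that], unfolded mult.assoc] KEF(2)[OF that]
    by (simp add: distrib_left distrib_right mult.assoc cm[OF that] cm[OF that(2,1)] ce[OF that(1)])
  have 4: "K i * K' i * (F j + L j * F' j) = sc (q powi (- cartan n i j)) * ((F j + L j * F' j) * (K i * K' i))"
    if "i < n" "j < n" for i j
  proof -
    have KL: "L j * K i = K i * L j" using commute_inverse[OF KK(1)[OF that] inv(1,2)[OF that(2)]] by simp
    show ?thesis
      using that comm_left[OF KEF(3)[OF that], unfolded mult.assoc] KEF(4)[OF that] comm_left[OF KL]
      by (simp add: distrib_left distrib_right mult.assoc cm[OF that] cm[OF that(2,1)] ce[OF that(1)] ce[OF that(2)])
  qed
  have 5: "serreR sc q (nat (1 - cartan n i j)) (E i * K' i + E' i) (E j * K' j + E' j) = 0"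
      "serreR sc q (nat (1 - cartan n i j)) (F i + L i * F' i) (F j + L j * F' j) = 0"
    if ij: "i < n" "j < n" "i \<noteq> j" for i j
  proof -
    have S: "serreR sc q (nat (1 - cartan n i j)) (E i) (E j) = 0" "serreR sc q (nat (1 - cartan n i j)) (F i) (F j) = 0"
      "serreR sc q (nat (1 - cartan n i j)) (E' i) (E' j) = 0" "serreR sc q (nat (1 - cartan n i j)) (F' i) (F' j) = 0"
      using R R' ij by (auto simp: Uq_rels_common_def)
    let ?Q = "sc q" and ?Q' = "sc (inverse q)"
    have Q: "?Q * ?Q' = 1" "?Q' * ?Q = 1" using qnz by (simp_all add: scm)
    note cms = cm[OF ij(1) ij(1)] cm[OF ij(1) ij(2)] cm[OF ij(2) ij(1)] cm[OF ij(2) ij(2)] ce[OF ij(1)] ce[OF ij(2)]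
    have KK': "K' j * K' i = K' i * K' j" "L j * L i = L i * L j" using KK(2) LL ij by auto
    have KK'': "K' j * (K' i * z) = K' i * (K' j * z)" "L j * (L i * z) = L i * (L j * z)" for z
      using KK' by (auto intro: comm_left)
    have aii: "cartan n i i = 2" and aji: "cartan n j i = cartan n i j"
      using cartan_self n ij cartan_sym by auto
    have sQ: "sc (q powi 2) = ?Q * ?Q" "sc (q powi - 1) = ?Q'" "sc (q powi - 2) = ?Q' * ?Q'"
      using qnz by (simp_all add: scm power_int_minus power2_eq_square power_int_def)
    have EK: "E i * K' i * E' i = sc (q powi 2) * (E' i * (E i * K' i))"
      "E i * K' i * E' j = sc (q powi cartan n i j) * (E' j * (E i * K' i))"
      "E j * K' j * E' i = sc (q powi cartan n i j) * (E' i * (E j * K' j))"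
      using KEF(2)[OF ij(1) ij(1)] KEF(2)[OF ij(1,2)] KEF(2)[OF ij(2,1)] aii aji by (simp_all add: mult.assoc cms)
    have FL: "L i * F' i * F i = sc (q powi 2) * (F i * (L i * F' i))"
      "L i * F' i * F j = sc (q powi cartan n i j) * (F j * (L i * F' i))"
      "L j * F' j * F i = sc (q powi cartan n i j) * (F i * (L j * F' j))"
      using comm_left[OF LF_comm(2)[OF ij(1) ij(1)]] comm_left[OF LF_comm(2)[OF ij(1,2)]] comm_left[OF LF_comm(2)[OF ij(2,1)]] aii aji
      by (simp_all add: mult.assoc cms)
    have cen: "x * ?Q = ?Q * x" "x * ?Q' = ?Q' * x" if "x \<in> {E i * K' i, E' i, E j * K' j, E' j} \<union> {L i * F' i, F i, L j * F' j, F j}" for x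
      using that by (auto simp: mult.assoc cms)
    consider "cartan n i j = 0" | "cartan n i j = - 1" | "cartan n i j = - 2" using cartan_off[OF ij(3)] by blast
    \<comment> \<open>The summands of \<open>F\<close> are taken in the opposite order, so that
      their \<open>q\<close>-commutations have the same exponents as those of \<open>E\<close> and
      the same lemma on Serre sums applies.\<close>
    then have "serreR sc q (nat (1 - cartan n i j)) (E i * K' i + E' i) (E j * K' j + E' j) = 0 \<and>
        serreR sc q (nat (1 - cartan n i j)) (L i * F' i + F i) (L j * F' j + F j) = 0"
    proof cases
      case 1
      then have m: "nat (1 - cartan n i j) = 1" by simp
      have "E i * E j = E j * E i" "E' i * E' j = E' j * E' i" "F i * F j = F j * F i" "F' i * F' j = F' j * F' i"
        using S[unfolded m serreR_cases(1)[OF q sc]] by simp_all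
      moreover from this have "E j * (E i * z) = E i * (E j * z)" "F' j * (F' i * z) = F' i * (F' j * z)" for z
        by (auto intro: comm_left)
      ultimately show ?thesis
        using EK[unfolded 1] FL[unfolded 1] unfolding m serreR_cases(1)[OF q sc]
        by (simp add: distrib_left distrib_right mult.assoc cms KK' KK'' scm)
    next
      case 2
      then have m: "nat (1 - cartan n i j) = 2" by simp
      note S2 = S[unfolded m serreR_cases(2)[OF q sc]]
      show ?thesis unfolding m serreR_cases(2)[OF q sc]
      proof (intro conjI serre2_coproduct Q)
        \<comment> \<open>The \<open>K'\<close> commute with the unprimed family and with each
          other, so they leave the Serre sum without any power of \<open>q\<close>.\<close>
        have "serre2 ?Q ?Q' (E i * K' i) (E j * K' j) = serre2 ?Q ?Q' (E i) (E j) * (K' i * K' i * K' j)"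
          by (simp add: serre2_def distrib_left distrib_right right_diff_distrib left_diff_distrib mult.assoc cms KK' KK'')
        then show "serre2 ?Q ?Q' (E i * K' i) (E j * K' j) = 0" using S2 by simp
        have "serre2 ?Q ?Q' (L i * F' i) (L j * F' j) = L i * L i * L j * serre2 ?Q ?Q' (F' i) (F' j)"
          by (simp add: serre2_def distrib_left distrib_right right_diff_distrib left_diff_distrib mult.assoc cms KK' KK'')
        then show "serre2 ?Q ?Q' (L i * F' i) (L j * F' j) = 0" using S2 by simp
      qed (use S2 EK[unfolded 2 sQ] FL[unfolded 2 sQ] cen in \<open>auto simp: mult.assoc\<close>)
    next
      case 3
      then have m: "nat (1 - cartan n i j) = 3" by simp
      note S2 = S[unfolded m serreR_cases(3)[OF q sc]]
      show ?thesis unfolding m serreR_cases(3)[OF q sc]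
      proof (intro conjI serre3_coproduct Q)
        have "serre3 ?Q ?Q' (E i * K' i) (E j * K' j) = serre3 ?Q ?Q' (E i) (E j) * (K' i * K' i * K' i * K' j)"
          by (simp add: serre3_def distrib_left distrib_right right_diff_distrib left_diff_distrib mult.assoc cms KK' KK'')
        then show "serre3 ?Q ?Q' (E i * K' i) (E j * K' j) = 0" using S2 by simp
        have "serre3 ?Q ?Q' (L i * F' i) (L j * F' j) = L i * L i * L i * L j * serre3 ?Q ?Q' (F' i) (F' j)"
          by (simp add: serre3_def distrib_left distrib_right right_diff_distrib left_diff_distrib mult.assoc cms KK' KK'')
        then show "serre3 ?Q ?Q' (L i * F' i) (L j * F' j) = 0" using S2 by simp
      qed (use S2 EK[unfolded 3 sQ] FL[unfolded 3 sQ] cen in \<open>auto simp: mult.assoc\<close>)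
    qed
    then show "serreR sc q (nat (1 - cartan n i j)) (E i * K' i + E' i) (E j * K' j + E' j) = 0"
      "serreR sc q (nat (1 - cartan n i j)) (F i + L i * F' i) (F j + L j * F' j) = 0"
      by (simp_all add: add.commute)
  qed
  have 6: "prod_list (map (\<lambda>i. K i * K' i) [0..<n]) = 1"
    using R R' by (subst prod_list_commuting) (auto simp: Uq_rels_common_def intro: comm)
  show ?thesis unfolding Uq_rels_common_def by (intro conjI allI impI) (rule 1 2 3 4 5 6; assumption)+
qed

text \<open>In the cross term the powers \<open>q^a\<close> and \<open>q^-a\<close> cancel, so the
  commutator is \<open>[E, F] K' + L [E', F']\<close>. The Cartan parts telescope:
  \<open>(K - L) K' + L (K' - L') = K K' - L L'\<close>.\<close>

lemma Uq_EF_coproduct: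
  assumes "Uq_rels_EF n q sc E F K L" "Uq_rels_EF n q sc E' F' K' L'"
  shows "Uq_rels_EF n q sc (\<lambda>i. E i * K' i + E' i) (\<lambda>i. F i + L i * F' i) (\<lambda>i. K i * K' i) (\<lambda>i. L i * L' i)"
  unfolding Uq_rels_EF_def
proof (intro allI impI)
  fix i j assume ij: "i < n" "j < n"
  note cms = cm[OF ij(1) ij(1)] cm[OF ij(1) ij(2)] cm[OF ij(2) ij(1)] cm[OF ij(2) ij(2)] ce[OF ij(1)] ce[OF ij(2)]
  have cross: "E i * K' i * (L j * F' j) = L j * F' j * (E i * K' i)"
    using comm_left[OF LF_comm(1)[OF ij(2,1)]] KEF(4)[OF ij] cartan_sym[of n i j]
    by (simp add: mult.assoc cms)
  have "(E i * K' i + E' i) * (F j + L j * F' j) - (F j + L j * F' j) * (E i * K' i + E' i)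
      = (E i * F j - F j * E i) * K' i + L j * (E' i * F' j - F' j * E' i)"
    unfolding distrib_left distrib_right cross by (simp add: left_diff_distrib right_diff_distrib mult.assoc cms)
  also have "\<dots> = (if i = j then sc (1 / (q - inverse q)) * (K i * K' i - L i * L' i) else 0)"
    using assms ij by (auto simp: Uq_rels_EF_def left_diff_distrib right_diff_distrib mult.assoc cms)
  finally show "(E i * K' i + E' i) * (F j + L j * F' j) - (F j + L j * F' j) * (E i * K' i + E' i)
      = (if i = j then sc (1 / (q - inverse q)) * (K i * K' i - L i * L' i) else 0)" .
qed

text \<open>At \<open>q = 1\<close> all Cartan factors are \<open>1\<close>, the coproduct is the
  primitive one, and \<open>H\<close> is additive.\<close>

lemma Uq_classical_coproduct:
  assumes c: "Uq_rels_classical n sc E F K" "Uq_rels_classical n sc E' F' K'"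
  shows "Uq_rels_classical n sc (\<lambda>i. E i * K' i + E' i) (\<lambda>i. F i + L i * F' i) (\<lambda>i. K i * K' i)"
proof -
  have K: "K i = 1" "K' i = 1" "L i = 1" if "i < n" for i
    using c that inv(1)[OF that] by (auto simp: Uq_rels_classical_def Let_def)
  define H where "H i = E i * F i - F i * E i" for i
  define H' where "H' i = E' i * F' i - F' i * E' i" for i
  have H: "(E i + E' i) * (F i + F' i) - (F i + F' i) * (E i + E' i) = H i + H' i" if "i < n" for i
    by (simp add: H_def H'_def distrib_left distrib_right cm[OF that that])
  have cH: "H' i * x = x * H' i" if "i < n" "j < n" "x \<in> {E j, F j}" for i j x
    using that by (auto simp: H'_def left_diff_distrib right_diff_distrib mult.assoc cm[OF that(2,1)])
  have cH': "y * H i = H i * y" if "i < n" "j < n" "y \<in> {E' j, F' j}" for i j y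
    using that by (auto simp: H_def left_diff_distrib right_diff_distrib mult.assoc cm[OF that(1,2)])
  have cHH: "H' j * H i = H i * H' j" if "i < n" "j < n" for i j
    using commute_mult_right[OF cH[OF that(2,1)] cH[OF that(2,1)]] by (simp add: H_def left_diff_distrib right_diff_distrib)
  have r: "H i * H j = H j * H i" "H i * E j - E j * H i = sc (of_int (cartan n i j)) * E j"
     "H i * F j - F j * H i = - (sc (of_int (cartan n i j)) * F j)"
     "H' i * H' j = H' j * H' i" "H' i * E' j - E' j * H' i = sc (of_int (cartan n i j)) * E' j"
     "H' i * F' j - F' j * H' i = - (sc (of_int (cartan n i j)) * F' j)" if "i < n" "j < n" for i j
    using c that by (auto simp: Uq_rels_classical_def Let_def H_def H'_def)
  have "(\<Sum>i<n. H i) = 0" "(\<Sum>i<n. H' i) = 0" using c by (auto simp: Uq_rels_classical_def Let_def H_def H'_def)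
  then have s: "(\<Sum>i<n. (E i * K' i + E' i) * (F i + L i * F' i) - (F i + L i * F' i) * (E i * K' i + E' i)) = 0"
    by (simp add: K H sum.distrib)
  have o: "E i * F j = F j * E i" "E' i * F' j = F' j * E' i" if "i < n" "j < n" "i \<noteq> j" for i j
    using c that by (auto simp: Uq_rels_classical_def Let_def)
  have 1: "(H i + H' i) * (E j + E' j) - (E j + E' j) * (H i + H' i) = sc (of_int (cartan n i j)) * (E j + E' j)"
    "(H i + H' i) * (F j + F' j) - (F j + F' j) * (H i + H' i) = - (sc (of_int (cartan n i j)) * (F j + F' j))"
    if "i < n" "j < n" for i j
  proof -
    have e: "(H i + H' i) * (x + y) - (x + y) * (H i + H' i)
      = (H i * x - x * H i) + (H' i * y - y * H' i) + (H' i * x - x * H' i) + (H i * y - y * H i)" for x y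
      by (simp add: algebra_simps)
    show "(H i + H' i) * (E j + E' j) - (E j + E' j) * (H i + H' i) = sc (of_int (cartan n i j)) * (E j + E' j)"
      "(H i + H' i) * (F j + F' j) - (F j + F' j) * (H i + H' i) = - (sc (of_int (cartan n i j)) * (F j + F' j))"
      unfolding e r[OF that] using cH[OF that] cH'[OF that] by (simp_all add: distrib_left)
  qed
  have 2: "(H i + H' i) * (H j + H' j) = (H j + H' j) * (H i + H' i)" if "i < n" "j < n" for i j
    using r(1,4)[OF that] cHH[OF that] cHH[OF that(2,1)] by (simp add: distrib_left distrib_right)
  have 3: "(E i + E' i) * (F j + F' j) = (F j + F' j) * (E i + E' i)" if "i < n" "j < n" "i \<noteq> j" for i j
    using o[OF that] cm[OF that(1,2)] cm[OF that(2,1)] by (simp add: distrib_left distrib_right)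
  show ?thesis unfolding Uq_rels_classical_def Let_def
    using s by (auto simp: K H 1 2 3)
qed

end

section \<open>Operators on tensors with arbitrary colourings\<close>

text \<open>
  Replacing colour lists by colourings of all of \<open>\<nat>\<close> makes every tensor operator total, so that the relations
  become equations in a ring of endomorphisms.
\<close>

type_synonym ften = "(nat \<Rightarrow> nat) \<Rightarrow> laurent"

text \<open>Complex linearity, expressed inside the ring as commutation with scalars.\<close>

definition linop :: "laurent endo \<Rightarrow> bool" where
  "linop T \<longleftrightarrow> (\<forall>c. T * scL c = scL c * T)"

definition lft :: "laurent endo \<Rightarrow> ften endo" where "lft T = Endo (\<lambda>\<phi> f. app T (\<phi> f))"
definition MU :: "nat \<Rightarrow> nat \<Rightarrow> nat \<Rightarrow> ften endo" where
  "MU i a b = Endo (\<lambda>\<phi> f. if f i = a then \<phi> (f(i := b)) else 0)"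
definition DG :: "((nat \<Rightarrow> nat) \<Rightarrow> complex) \<Rightarrow> ften endo" where
  "DG c = Endo (\<lambda>\<phi> f. smul (c f) (\<phi> f))"
definition scF :: "complex \<Rightarrow> ften endo" where "scF c = DG (\<lambda>_. c)"

lemma app_lft: "app (lft T) \<phi> f = app T (\<phi> f)"
  unfolding lft_def by (subst app_Endo) (auto simp: app_arg_add)
lemma app_MU: "app (MU i a b) \<phi> f = (if f i = a then \<phi> (f(i := b)) else 0)"
  unfolding MU_def by (subst app_Endo) auto
lemma app_DG: "app (DG c) \<phi> f = smul (c f) (\<phi> f)"
  unfolding DG_def by (subst app_Endo) (auto simp: smul_add)
lemma app_scF: "app (scF c) \<phi> f = smul c (\<phi> f)"
  by (simp add: scF_def app_DG)

lemmas app_ften = app_lft app_MU app_DG app_scF app_mult app_op_add app_op_minus app_op_uminus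

lemma sum_apply: "(\<Sum>i\<in>I. F i) x = (\<Sum>i\<in>I. F i x)" for F :: "'i \<Rightarrow> 'x \<Rightarrow> 'y::comm_monoid_add"
  by (induction I rule: infinite_finite_induct) auto

lemma ften_eqI: "(\<And>\<phi> f. app S \<phi> f = app T \<phi> f) \<Longrightarrow> S = (T :: ften endo)"
  by (rule endo_eqI) (rule ext)

lemma linop_smul: "linop T \<Longrightarrow> app T (smul c f) = smul c (app T f)"
  unfolding linop_def by (metis app_mult app_scL)

lemma linop_simps [simp]: "linop 1" "linop (scL c)" "linop (KL i j)" "i \<noteq> j \<Longrightarrow> linop (gL q i j)" "i \<noteq> j \<Longrightarrow> linop (giL q i j)"
  by (auto simp: linop_def scL_comm scL_giL scL_mult mult.commute)

lemma linop_mult: "linop S \<Longrightarrow> linop T \<Longrightarrow> linop (S * T)"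
  unfolding linop_def by (simp add: commute_mult_left)

lemma linop_yL: "linop (yL q p N i)" "linop (yiL q p N i)"
  unfolding yL_def yiL_def by (rule linop_mult, simp, simp add: linop_def sc_YL)+

lemma lft_mult: "lft (S * T) = lft S * lft T" by (rule ften_eqI) (simp add: app_ften)
lemma lft_1 [simp]: "lft 1 = 1" by (rule ften_eqI) (simp add: app_ften)
lemma lft_sc: "lft (scL c) = scF c" by (rule ften_eqI) (simp add: app_ften)
lemma lft_minus: "lft (S - T) = lft S - lft T" by (rule ften_eqI) (simp add: app_ften)
lemma lft_add: "lft (S + T) = lft S + lft T" by (rule ften_eqI) (simp add: app_ften)

lemma lft_MU: "lft T * MU i a b = MU i a b * lft T"
  by (rule ften_eqI) (simp add: app_ften)
lemma lft_DG: "linop T \<Longrightarrow> lft T * DG c = DG c * lft T"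
  by (rule ften_eqI) (simp add: app_ften linop_smul)
lemma lft_scF: "linop T \<Longrightarrow> lft T * scF c = scF c * lft T"
  unfolding scF_def by (rule lft_DG)
lemma DG_DG: "DG c * DG d = DG (\<lambda>f. c f * d f)" by (rule ften_eqI) (simp add: app_ften)
lemma DG_1 [simp]: "DG (\<lambda>_. 1) = 1" by (rule ften_eqI) (simp add: app_ften)
lemma DG_comm: "DG c * DG d = DG d * DG c" by (simp add: DG_DG mult.commute)
lemma scF_DG: "DG d * scF c = scF c * DG d" unfolding scF_def by (rule DG_comm)
lemma scF_MU: "MU i a b * scF c = scF c * MU i a b"
  by (rule ften_eqI) (simp add: app_ften)
lemma scalar_hom_scF: "scalar_hom scF"
  unfolding scalar_hom_def scF_def
  by (auto simp: DG_DG intro!: ften_eqI) (simp add: app_ften smul_add_left)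
lemma MU_MU: "MU i a b * MU i c d = (if b = c then MU i a d else 0)"
  by (rule ften_eqI) (simp add: app_ften)
lemma MU_MU_far: "i \<noteq> j \<Longrightarrow> MU i a b * MU j c d = MU j c d * MU i a b"
  by (rule ften_eqI) (simp add: app_ften fun_upd_twist)
lemma MU_DG: "(\<And>f x. c (f(i := x)) = c f) \<Longrightarrow> MU i a b * DG c = DG c * MU i a b"
  by (rule ften_eqI) (simp add: app_ften)
lemma DG_MU: "h b \<noteq> 0 \<Longrightarrow> DG (\<lambda>f. h (f i)) * MU i a b = scF (h a / h b) * (MU i a b * DG (\<lambda>f. h (f i)))"
  by (rule ften_eqI) (simp add: app_ften)

definition wt :: "nat \<Rightarrow> nat \<Rightarrow> nat \<Rightarrow> int" where
  "wt n \<epsilon> x = (if x = cyc n \<epsilon> then 1 else 0) - (if x = cyc n (\<epsilon> + 1) then 1 else 0)"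

lemma cyc_eq: "n > 0 \<Longrightarrow> cyc n a = cyc n b \<longleftrightarrow> a mod n = b mod n"
  using mod_less_divisor[of n a] mod_less_divisor[of n b] by (auto simp: cyc_def simp del: mod_less_divisor)

lemma cyc_neq: "n \<ge> 2 \<Longrightarrow> cyc n a \<noteq> cyc n (a + 1)"
  by (subst cyc_eq) (auto simp: mod_Suc split: if_splits)

lemma cyc_range: "n > 0 \<Longrightarrow> cyc n a \<in> {1..n}"
  using mod_less_divisor[of n a] by (auto simp: cyc_def simp del: mod_less_divisor)

text \<open>The left side is the weight of the one-site root vector for node \<open>j\<close> with
  respect to node \<open>i\<close>. For \<open>n = 2\<close> both neighbours of a node coincide and
  contribute twice.\<close>

lemma wt_cartan:
  assumes "n \<ge> 2" "i < n" "j < n"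
  shows "wt n i (cyc n j) - wt n i (cyc n (j + 1)) = cartan n i j"
  using assms cyc_eq[of n j i] cyc_eq[of n j "i + 1"] cyc_eq[of n "j + 1" i] cyc_eq[of n "j + 1" "i + 1"]
  unfolding wt_def cartan_def by (auto simp: mod_Suc split: if_splits)

text \<open>Each colour is counted with opposite signs at two consecutive nodes of the cycle. This
  is the source of level 0.\<close>

lemma wt_sum: "(\<Sum>\<epsilon><n. wt n \<epsilon> x) = 0"
proof -
  have "(\<Sum>\<epsilon><n. wt n \<epsilon> x) = (\<Sum>\<epsilon><n. (if x = cyc n \<epsilon> then 1 else 0) - (if x = cyc n (Suc \<epsilon>) then 1 else 0 :: int))"
    by (simp add: wt_def)
  also have "\<dots> = 0" by (subst sum_lessThan_telescope') (simp add: cyc_def)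
  finally show ?thesis .
qed

text \<open>The evaluation form of the vector representation at site \<open>i\<close>, with the
  spectral parameter replaced by an operator \<open>y\<close>, whose inverse \<open>y'\<close>
  accompanies the affine raising operator.\<close>

definition eS :: "nat \<Rightarrow> laurent endo \<Rightarrow> nat \<Rightarrow> nat \<Rightarrow> ften endo" where
  "eS n y' i \<epsilon> = lft (if \<epsilon> = 0 then y' else 1) * MU i (cyc n \<epsilon>) (cyc n (\<epsilon> + 1))"
definition fS :: "nat \<Rightarrow> laurent endo \<Rightarrow> nat \<Rightarrow> nat \<Rightarrow> ften endo" where
  "fS n y i \<epsilon> = lft (if \<epsilon> = 0 then y else 1) * MU i (cyc n (\<epsilon> + 1)) (cyc n \<epsilon>)"
definition kS :: "nat \<Rightarrow> complex \<Rightarrow> nat \<Rightarrow> nat \<Rightarrow> ften endo" where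
  "kS n q i \<epsilon> = DG (\<lambda>f. q powi wt n \<epsilon> (f i))"
definition lS :: "nat \<Rightarrow> complex \<Rightarrow> nat \<Rightarrow> nat \<Rightarrow> ften endo" where
  "lS n q i \<epsilon> = DG (\<lambda>f. q powi - wt n \<epsilon> (f i))"

lemma prod_list_DG: "q \<noteq> 0 \<Longrightarrow> prod_list (map (\<lambda>x. DG (\<lambda>f. q powi a x f)) xs) = DG (\<lambda>f. q powi (\<Sum>x\<leftarrow>xs. a x f))"
  by (induction xs) (auto simp: DG_DG power_int_add)

lemma Uq_common_zero:
  assumes "n \<ge> 2" "q \<noteq> 0"
  shows "Uq_rels_common n q scF (\<lambda>_. 0) (\<lambda>_. 0) (\<lambda>_. 1) (\<lambda>_. 1)"
proof -
  have "serreR scF q m 0 0 = 0" for m unfolding serreR_def by simp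
  moreover have "prod_list (map (\<lambda>_. 1 :: ften endo) xs) = 1" for xs :: "nat list" by (induction xs) auto
  ultimately show ?thesis by (simp add: Uq_rels_common_def)
qed

section \<open>The relations on one site\<close>

context
  fixes n :: nat and q :: complex and y y' :: "laurent endo" and i :: nat
  assumes n: "n \<ge> 2" and q: "generic_q q" and y: "linop y" "linop y'" "y * y' = 1" "y' * y = 1"
begin

private lemma q_nz: "q \<noteq> 0" using q by (simp add: generic_q_def)

private lemma ee: "eS n y' i a * eS n y' i b = (if cyc n (a + 1) = cyc n b then
    lft ((if a = 0 then y' else 1) * (if b = 0 then y' else 1)) * MU i (cyc n a) (cyc n (b + 1)) else 0)"
  unfolding eS_def lft_mult by (simp add: mult.assoc comm_left[OF lft_MU[symmetric]] MU_MU)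

private lemma ff: "fS n y i a * fS n y i b = (if cyc n (b + 1) = cyc n a then
    lft ((if a = 0 then y else 1) * (if b = 0 then y else 1)) * MU i (cyc n (a + 1)) (cyc n b) else 0)"
  unfolding fS_def lft_mult by (simp add: mult.assoc comm_left[OF lft_MU[symmetric]] MU_MU)

private lemma efs:
  assumes "a < n" "b < n"
  shows "eS n y' i a * fS n y i b = (if a = b then MU i (cyc n a) (cyc n a) else 0)"
    and "fS n y i b * eS n y' i a = (if a = b then MU i (cyc n (a + 1)) (cyc n (a + 1)) else 0)"
proof -
  have "cyc n (a + 1) = cyc n (b + 1) \<longleftrightarrow> a = b" "cyc n a = cyc n b \<longleftrightarrow> a = b"
    using assms n by (auto simp: cyc_eq mod_Suc split: if_splits)
  moreover have "lft y * (lft y' * z) = z" "lft y' * (lft y * z) = z" for z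
    by (simp_all add: y flip: mult.assoc lft_mult)
  ultimately show "eS n y' i a * fS n y i b = (if a = b then MU i (cyc n a) (cyc n a) else 0)"
    "fS n y i b * eS n y' i a = (if a = b then MU i (cyc n (a + 1)) (cyc n (a + 1)) else 0)"
    unfolding eS_def fS_def by (auto simp: mult.assoc comm_left[OF lft_MU[symmetric]] MU_MU)
qed

private lemma nilp:
  assumes "a < n" "b < n" "a \<noteq> b"
  shows "eS n y' i a * eS n y' i a = 0" "fS n y i a * fS n y i a = 0"
    "n \<ge> 3 \<Longrightarrow> eS n y' i a * eS n y' i b * eS n y' i a = 0" "n \<ge> 3 \<Longrightarrow> fS n y i a * fS n y i b * fS n y i a = 0"
    "cartan n a b = 0 \<Longrightarrow> eS n y' i a * eS n y' i b = 0" "cartan n a b = 0 \<Longrightarrow> fS n y i a * fS n y i b = 0"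
proof -
  show "eS n y' i a * eS n y' i a = 0" "fS n y i a * fS n y i a = 0"
    using cyc_neq[OF n, of a] by (auto simp: ee ff)
  have 3: "cyc n (a + 1) \<noteq> cyc n b \<or> cyc n (b + 1) \<noteq> cyc n a" if "n \<ge> 3"
    using that assms by (auto simp: cyc_eq mod_Suc split: if_splits)
  then show "eS n y' i a * eS n y' i b * eS n y' i a = 0" if "n \<ge> 3"
  proof (cases "cyc n (a + 1) = cyc n b")
    case True
    then show ?thesis using 3[OF that] unfolding mult.assoc by (simp add: ee[of b a])
  qed (simp add: ee)
  show "fS n y i a * fS n y i b * fS n y i a = 0" if "n \<ge> 3"
  proof (cases "cyc n (b + 1) = cyc n a")
    case True
    then show ?thesis using 3[OF that] unfolding mult.assoc by (simp add: ff[of b a])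
  qed (simp add: ff)
  have c: "cyc n (a + 1) \<noteq> cyc n b" "cyc n (b + 1) \<noteq> cyc n a" if "cartan n a b = 0"
    using that assms by (auto simp: cartan_def cyc_eq split: if_splits)
  show "cartan n a b = 0 \<Longrightarrow> eS n y' i a * eS n y' i b = 0" "cartan n a b = 0 \<Longrightarrow> fS n y i a * fS n y i b = 0"
    using c by (auto simp: ee ff)
qed

text \<open>Every term of the Serre sum vanishes separately. The only one without a square of
  \<open>x a\<close> is \<open>x a * x b * x a\<close>, in the case of Cartan entry
  \<open>-1\<close>; that entry forces \<open>n \<ge> 3\<close>, where this product is zero as
  well.\<close>

private lemma serre_nilp:
  assumes ab: "a < n" "b < n" "a \<noteq> b"
    and x: "\<And>c. c < n \<Longrightarrow> x c * x c = (0 :: ften endo)"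
    and x3: "\<And>a b. \<lbrakk>a < n; b < n; a \<noteq> b; n \<ge> 3\<rbrakk> \<Longrightarrow> x a * x b * x a = 0"
    and x2: "\<And>a b. \<lbrakk>a < n; b < n; a \<noteq> b; cartan n a b = 0\<rbrakk> \<Longrightarrow> x a * x b = 0"
  shows "serreR scF q (nat (1 - cartan n a b)) (x a) (x b) = 0"
proof -
  have xx: "x a * x a = 0" "x a * (x a * z) = 0" for z
    using x[OF ab(1)] by (simp_all flip: mult.assoc)
  consider "cartan n a b = 0" | "cartan n a b = - 1" | "cartan n a b = - 2" using cartan_off[OF ab(3)] by blast
  then show ?thesis
  proof cases
    case 1
    then have "nat (1 - cartan n a b) = 1" by simp
    then show ?thesis using x2[of a b] x2[of b a] ab 1 cartan_sym[of n a b]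
      by (simp only: serreR_cases(1)[OF q scalar_hom_scF]) simp
  next
    case 2
    then have m: "nat (1 - cartan n a b) = 2" by simp
    have "n \<noteq> 2"
    proof
      assume "n = 2"
      with ab have "(a = 0 \<and> b = 1) \<or> (a = 1 \<and> b = 0)" by auto
      then show False using 2 \<open>n = 2\<close> by (auto simp: cartan_def)
    qed
    then have "x a * x b * x a = 0" using x3 ab n by simp
    then show ?thesis unfolding m serreR_cases(2)[OF q scalar_hom_scF] serre2_def
      by (simp add: mult.assoc xx)
  next
    case 3
    then have m: "nat (1 - cartan n a b) = 3" by simp
    show ?thesis unfolding m serreR_cases(3)[OF q scalar_hom_scF] serre3_def
      by (simp add: mult.assoc xx)
  qed
qed

private lemma MU_DGh:
  assumes "h c \<noteq> 0" "linop T"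
  shows "DG (\<lambda>f. h (f i)) * (lft T * MU i a c) = scF (h a / h c) * (lft T * MU i a c * DG (\<lambda>f. h (f i)))"
  unfolding mult.assoc comm_left[OF lft_DG[OF assms(2), symmetric]] DG_MU[where h = h and b = c, OF assms(1)]
  by (simp add: comm_left[OF lft_scF[OF assms(2)]])

lemma site_common: "Uq_rels_common n q scF (eS n y' i) (fS n y i) (kS n q i) (lS n q i)"
proof -
  have 1: "kS n q i a * lS n q i a = 1" "lS n q i a * kS n q i a = 1" for a
    using q_nz by (simp_all add: kS_def lS_def DG_DG flip: power_int_add)
  have 2: "kS n q i a * kS n q i b = kS n q i b * kS n q i a" for a b
    unfolding kS_def by (rule DG_comm)
  have l: "linop (if b = 0 then y' else 1)" "linop (if b = 0 then y else 1)" for b :: nat using y by auto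
  have 3: "kS n q i a * eS n y' i b = scF (q powi cartan n a b) * (eS n y' i b * kS n q i a)"
    "kS n q i a * fS n y i b = scF (q powi - cartan n a b) * (fS n y i b * kS n q i a)" if "a < n" "b < n" for a b
    unfolding kS_def eS_def fS_def wt_cartan[OF n that, symmetric]
    using MU_DGh[of "\<lambda>x. q powi wt n a x", OF _ l(1)] MU_DGh[of "\<lambda>x. q powi wt n a x", OF _ l(2)] q_nz
    by (simp_all add: power_int_diff)
  have 4: "serreR scF q (nat (1 - cartan n a b)) (eS n y' i a) (eS n y' i b) = 0"
    "serreR scF q (nat (1 - cartan n a b)) (fS n y i a) (fS n y i b) = 0" if "a < n" "b < n" "a \<noteq> b" for a b
  proof -
    have n1: "eS n y' i c * eS n y' i c = 0" "fS n y i c * fS n y i c = 0" for c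
      using cyc_neq[OF n, of c] by (auto simp: ee ff)
    show "serreR scF q (nat (1 - cartan n a b)) (eS n y' i a) (eS n y' i b) = 0"
      by (rule serre_nilp[OF that]) (use n1 nilp in auto)
    show "serreR scF q (nat (1 - cartan n a b)) (fS n y i a) (fS n y i b) = 0"
      by (rule serre_nilp[OF that]) (use n1 nilp in auto)
  qed
  have 5: "prod_list (map (kS n q i) [0..<n]) = 1"
  proof -
    have "(\<Sum>\<epsilon>\<leftarrow>[0..<n]. wt n \<epsilon> (f i)) = (\<Sum>\<epsilon><n. wt n \<epsilon> (f i))" for f
      by (subst sum_list_distinct_conv_sum_set) (auto simp: atLeast0LessThan)
    then show ?thesis
      using prod_list_DG[OF q_nz, of "\<lambda>\<epsilon> f. wt n \<epsilon> (f i)"] by (simp add: kS_def[abs_def] wt_sum)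
  qed
  show ?thesis unfolding Uq_rels_common_def
    by (intro conjI allI impI) (rule 1 2 3 4 5; assumption)+
qed

lemma site_EF: "q \<noteq> 1 \<Longrightarrow> Uq_rels_EF n q scF (eS n y' i) (fS n y i) (kS n q i) (lS n q i)"
  unfolding Uq_rels_EF_def
proof (intro allI impI)
  fix a b assume q1: "q \<noteq> 1" and ab: "a < n" "b < n"
  have "q ^ 2 \<noteq> 1" using q q1 by (auto simp: generic_q_def)
  then have d: "q - inverse q \<noteq> 0" using q_nz by (auto simp: field_simps power2_eq_square)
  have "scF (1 / (q - inverse q)) * (kS n q i a - lS n q i a) = MU i (cyc n a) (cyc n a) - MU i (cyc n (a + 1)) (cyc n (a + 1))"
  proof (rule ften_eqI)
    fix \<phi> :: ften and f
    \<comment> \<open>The weight is \<open>-1\<close>, \<open>0\<close> or \<open>1\<close>, and on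
      these three values the \<open>q\<close>-number of an integer is the integer itself.\<close>
    have "1 / (q - inverse q) * (q powi wt n a (f i) - q powi - wt n a (f i)) = of_int (wt n a (f i))"
      using d cyc_neq[OF n, of a] by (auto simp: wt_def power_int_minus divide_simps) (simp add: algebra_simps)
    then have "smul (1 / (q - inverse q)) (smul (q powi wt n a (f i)) (\<phi> f) - smul (q powi - wt n a (f i)) (\<phi> f))
      = smul (of_int (wt n a (f i))) (\<phi> f)"
      by (simp add: smul_diff_left[symmetric])
    then show "app (scF (1 / (q - inverse q)) * (kS n q i a - lS n q i a)) \<phi> f
       = app (MU i (cyc n a) (cyc n a) - MU i (cyc n (a + 1)) (cyc n (a + 1))) \<phi> f"
      using cyc_neq[OF n, of a] by (auto simp: app_ften kS_def lS_def wt_def smul_minus_left fun_upd_idem)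
  qed
  then show "eS n y' i a * fS n y i b - fS n y i b * eS n y' i a
      = (if a = b then scF (1 / (q - inverse q)) * (kS n q i a - lS n q i a) else 0)"
    unfolding efs(1)[OF ab] efs(2)[OF ab] by auto
qed

text \<open>Here \<open>[E, F]\<close> is the diagonal operator with entries \<open>wt\<close>, and
  the relations express its weights and their vanishing sum.\<close>

lemma site_classical: "q = 1 \<Longrightarrow> Uq_rels_classical n scF (eS n y' i) (fS n y i) (kS n q i)"
proof -
  assume q1: "q = 1"
  define d where "d a = DG (\<lambda>f. of_int (wt n a (f i)))" for a
  have H: "eS n y' i a * fS n y i a - fS n y i a * eS n y' i a = d a" if "a < n" for a
    unfolding efs[OF that that] d_def using cyc_neq[OF n, of a]
    by (intro ften_eqI) (auto simp: app_ften wt_def smul_minus_left fun_upd_idem)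
  have dMU: "d a * (lft T * MU i b c) - lft T * MU i b c * d a = scF (of_int (wt n a b - wt n a c)) * (lft T * MU i b c)"
    if "linop T" for T a b c
    by (rule ften_eqI) (simp add: d_def app_ften linop_smul[OF that] smul_diff_left)
  have l: "linop (if b = 0 then y' else 1)" "linop (if b = 0 then y else 1)" for b :: nat using y by auto
  have 1: "d a * eS n y' i b - eS n y' i b * d a = scF (of_int (cartan n a b)) * eS n y' i b"
     "d a * fS n y i b - fS n y i b * d a = - (scF (of_int (cartan n a b)) * fS n y i b)" if "a < n" "b < n" for a b
    unfolding eS_def fS_def dMU[OF l(1)] dMU[OF l(2)] wt_cartan[OF n that, symmetric]
    by (auto intro!: ften_eqI simp: app_ften smul_diff_left)
  have 2: "d a * d b = d b * d a" for a b unfolding d_def by (rule DG_comm)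
  have "(\<Sum>a<n. d a) = DG (\<lambda>f. of_int (\<Sum>a<n. wt n a (f i)))"
    by (rule ften_eqI) (simp add: d_def app_op_sum app_DG smul_sum_left sum_apply)
  then have 3: "(\<Sum>a<n. d a) = 0" by (auto intro!: ften_eqI simp: wt_sum app_DG)
  have 4: "(\<Sum>a<n. eS n y' i a * fS n y i a - fS n y i a * eS n y' i a) = 0"
    using 3 by (simp add: H)
  have off: "eS n y' i a * fS n y i b = fS n y i b * eS n y' i a" if "a < n" "b < n" "a \<noteq> b" for a b
    using that by (simp add: efs)
  show ?thesis unfolding Uq_rels_classical_def Let_def
    using 4 off by (auto simp: H 1 2 kS_def q1)
qed

end

section \<open>The relations on the tensor product\<close>

text \<open>Closed form of the iterated coproduct. The recursions \<open>EF_Suc\<close>,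
  \<open>FF_Suc\<close>, \<open>KF_Suc\<close> and \<open>LF_Suc\<close> identify adding the last
  site with one application of it.\<close>

definition EF :: "nat \<Rightarrow> complex \<Rightarrow> (nat \<Rightarrow> laurent endo) \<Rightarrow> nat \<Rightarrow> nat \<Rightarrow> ften endo" where
  "EF n q y' m \<epsilon> = (\<Sum>i\<in>{1..m}. eS n (y' i) i \<epsilon> * DG (\<lambda>f. q powi (\<Sum>k\<in>{i<..m}. wt n \<epsilon> (f k))))"
definition FF :: "nat \<Rightarrow> complex \<Rightarrow> (nat \<Rightarrow> laurent endo) \<Rightarrow> nat \<Rightarrow> nat \<Rightarrow> ften endo" where
  "FF n q y m \<epsilon> = (\<Sum>i\<in>{1..m}. DG (\<lambda>f. q powi - (\<Sum>k\<in>{1..<i}. wt n \<epsilon> (f k))) * fS n (y i) i \<epsilon>)"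
definition KF :: "nat \<Rightarrow> complex \<Rightarrow> nat \<Rightarrow> nat \<Rightarrow> ften endo" where
  "KF n q m \<epsilon> = DG (\<lambda>f. q powi (\<Sum>k\<in>{1..m}. wt n \<epsilon> (f k)))"
definition LF :: "nat \<Rightarrow> complex \<Rightarrow> nat \<Rightarrow> nat \<Rightarrow> ften endo" where
  "LF n q m \<epsilon> = DG (\<lambda>f. q powi - (\<Sum>k\<in>{1..m}. wt n \<epsilon> (f k)))"

lemma EF_Suc:
  assumes "q \<noteq> 0"
  shows "EF n q y' (Suc m) \<epsilon> = EF n q y' m \<epsilon> * kS n q (Suc m) \<epsilon> + eS n (y' (Suc m)) (Suc m) \<epsilon>"
proof -
  have "{i<..Suc m} = insert (Suc m) {i<..m}" if "i \<in> {1..m}" for i using that by auto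
  then have "eS n (y' i) i \<epsilon> * DG (\<lambda>f. q powi (\<Sum>k\<in>{i<..Suc m}. wt n \<epsilon> (f k)))
    = eS n (y' i) i \<epsilon> * DG (\<lambda>f. q powi (\<Sum>k\<in>{i<..m}. wt n \<epsilon> (f k))) * kS n q (Suc m) \<epsilon>" if "i \<in> {1..m}" for i
    using assms that by (simp add: kS_def mult.assoc DG_DG power_int_add[symmetric] add.commute)
  then show ?thesis unfolding EF_def sum_distrib_right by simp
qed

lemma FF_Suc: "FF n q y (Suc m) \<epsilon> = FF n q y m \<epsilon> + LF n q m \<epsilon> * fS n (y (Suc m)) (Suc m) \<epsilon>"
  by (simp add: FF_def LF_def atLeastLessThanSuc_atLeastAtMost)

lemma KF_Suc: "q \<noteq> 0 \<Longrightarrow> KF n q (Suc m) \<epsilon> = KF n q m \<epsilon> * kS n q (Suc m) \<epsilon>"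
  by (simp add: KF_def kS_def DG_DG power_int_add[symmetric])

lemma LF_Suc: "q \<noteq> 0 \<Longrightarrow> LF n q (Suc m) \<epsilon> = LF n q m \<epsilon> * lS n q (Suc m) \<epsilon>"
  by (simp add: LF_def lS_def DG_DG power_int_add[symmetric])

lemma eS_cent: "linop y \<Longrightarrow> eS n y i \<epsilon> * scF c = scF c * eS n y i \<epsilon>" "linop y \<Longrightarrow> fS n y i \<epsilon> * scF c = scF c * fS n y i \<epsilon>"
  by (auto simp: eS_def fS_def scF_MU lft_scF intro!: commute_mult_left)

lemma site_DG:
  assumes "linop y" "\<And>f x. c (f(i := x)) = c f"
  shows "eS n y i \<epsilon> * DG c = DG c * eS n y i \<epsilon>" "fS n y i \<epsilon> * DG c = DG c * fS n y i \<epsilon>"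
  using assms by (auto simp: eS_def fS_def MU_DG lft_DG intro!: commute_mult_left)

lemma site_site:
  assumes "i \<noteq> j" "y * z = z * (y :: laurent endo)"
  shows "eS n y i a * eS n z j b = eS n z j b * eS n y i a" "eS n y i a * fS n z j b = fS n z j b * eS n y i a"
    "fS n y i a * eS n z j b = eS n z j b * fS n y i a" "fS n y i a * fS n z j b = fS n z j b * fS n y i a"
proof -
  have l: "lft (if a = 0 then y else 1) * lft (if b = 0 then z else 1) = lft (if b = 0 then z else 1) * lft (if a = 0 then y else 1)"
    using assms(2) by (simp flip: lft_mult)
  have "(lft (if a = 0 then y else 1) * MU i s t) * (lft (if b = 0 then z else 1) * MU j u v)
     = (lft (if b = 0 then z else 1) * MU j u v) * (lft (if a = 0 then y else 1) * MU i s t)" for s t u v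
    by (intro commute_mult_left commute_mult_right l lft_MU lft_MU[symmetric] MU_MU_far assms)
  then show "eS n y i a * eS n z j b = eS n z j b * eS n y i a" "eS n y i a * fS n z j b = fS n z j b * eS n y i a"
    "fS n y i a * eS n z j b = eS n z j b * fS n y i a" "fS n y i a * fS n z j b = fS n z j b * fS n y i a"
    unfolding eS_def fS_def by blast+
qed

text \<open>Induction on the number of sites. Each \<open>y i\<close> may act on all variables; the
  families attached to different sites still commute because the \<open>y i\<close> commute with
  each other and leave colours alone.\<close>

theorem Uq_rels_tensor:
  assumes n: "n \<ge> 2" and q: "generic_q q"
    and lin: "\<And>i. i \<in> {1..m} \<Longrightarrow> linop (y i) \<and> linop (y' i) \<and> y i * y' i = 1 \<and> y' i * y i = 1"
    and yy: "\<And>i j. i \<in> {1..m} \<Longrightarrow> j \<in> {1..m} \<Longrightarrow> y i * y j = y j * y i"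
  shows "Uq_rels_common n q scF (EF n q y' m) (FF n q y m) (KF n q m) (LF n q m)" (is ?A)
    and "q \<noteq> 1 \<Longrightarrow> Uq_rels_EF n q scF (EF n q y' m) (FF n q y m) (KF n q m) (LF n q m)"
    and "q = 1 \<Longrightarrow> Uq_rels_classical n scF (EF n q y' m) (FF n q y m) (KF n q m)"
proof -
  have q_nz: "q \<noteq> 0" using q by (simp add: generic_q_def)
  have "?A \<and> (q \<noteq> 1 \<longrightarrow> Uq_rels_EF n q scF (EF n q y' m) (FF n q y m) (KF n q m) (LF n q m))
    \<and> (q = 1 \<longrightarrow> Uq_rels_classical n scF (EF n q y' m) (FF n q y m) (KF n q m))"
    using lin yy
  proof (induction m)
    case 0
    have z: "EF n q y' 0 = (\<lambda>_. 0)" "FF n q y 0 = (\<lambda>_. 0)" "KF n q 0 = (\<lambda>_. 1)" "LF n q 0 = (\<lambda>_. 1)"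
      by (auto simp: EF_def FF_def KF_def LF_def)
    show ?case unfolding z using Uq_common_zero[OF n q_nz]
      by (simp add: Uq_rels_EF_def Uq_rels_classical_def)
  next
    case (Suc m)
    let ?s = "Suc m"
    note l = Suc.prems(1)[of "Suc m", simplified]
    have IH: "Uq_rels_common n q scF (EF n q y' m) (FF n q y m) (KF n q m) (LF n q m)"
       "q \<noteq> 1 \<Longrightarrow> Uq_rels_EF n q scF (EF n q y' m) (FF n q y m) (KF n q m) (LF n q m)"
       "q = 1 \<Longrightarrow> Uq_rels_classical n scF (EF n q y' m) (FF n q y m) (KF n q m)"
      using Suc by auto
    have li: "linop (y i)" "linop (y' i)" if "i \<in> {1..?s}" for i using Suc.prems(1)[OF that] by auto
    have yc: "y ?s * y i = y i * y ?s" "y' ?s * y i = y i * y' ?s" "y ?s * y' i = y' i * y ?s" "y' ?s * y' i = y' i * y' ?s"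
      if "i \<in> {1..m}" for i
    proof -
      have a: "y ?s * y i = y i * y ?s" using Suc.prems(2) that by auto
      have i: "y i * y' i = 1" "y' i * y i = 1" using Suc.prems(1)[of i] that by auto
      show b: "y ?s * y' i = y' i * y ?s" using commute_inverse[OF a i] .
      show "y ?s * y i = y i * y ?s" by (fact a)
      show "y' ?s * y i = y i * y' ?s" "y' ?s * y' i = y' i * y' ?s"
        using commute_inverse[OF a[symmetric], of "y' ?s"] commute_inverse[OF b[symmetric], of "y' ?s"] l by auto
    qed
    have comm: "s * t = t * s" if "t \<in> {EF n q y' m i, FF n q y m i, KF n q m i, LF n q m i}"
      "s \<in> {eS n (y' ?s) ?s j, fS n (y ?s) ?s j, kS n q ?s j, lS n q ?s j}" for i j s t
    proof -
      have sd: "s * DG c = DG c * s" if "\<And>f x. c (f(?s := x)) = c f" for c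
        using \<open>s \<in> _\<close> site_DG[of "y' ?s" c ?s, OF _ that] site_DG[of "y ?s" c ?s, OF _ that] l
        by (auto simp: kS_def lS_def DG_comm)
      have d: "(\<Sum>k\<in>A. wt n a ((f(?s := x)) k)) = (\<Sum>k\<in>A. wt n a (f k))" if "?s \<notin> A" for A a f x
        by (rule sum.cong) (use that in auto)
      have se: "s * eS n (y' k) k i = eS n (y' k) k i * s" "s * fS n (y k) k i = fS n (y k) k i * s" if k: "k \<in> {1..m}" for k
      proof -
        have ks: "k \<noteq> ?s" "?s \<noteq> k" using k by auto
        have li': "linop (y k)" "linop (y' k)" using li k by auto
        have dd: "\<And>f x. q powi wt n j ((f(k := x)) ?s) = q powi wt n j (f ?s)" "\<And>f x. q powi - wt n j ((f(k := x)) ?s) = q powi - wt n j (f ?s)"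
          using ks by auto
        show "s * eS n (y' k) k i = eS n (y' k) k i * s" "s * fS n (y k) k i = fS n (y k) k i * s"
          using \<open>s \<in> _\<close> site_site[OF ks(2) yc(1)[OF k]] site_site[OF ks(2) yc(2)[OF k]] site_site[OF ks(2) yc(3)[OF k]]
            site_site[OF ks(2) yc(4)[OF k]] site_DG[where c = "\<lambda>f. q powi wt n j (f ?s)", OF li'(1) dd(1)]
            site_DG[where c = "\<lambda>f. q powi wt n j (f ?s)", OF li'(2) dd(1)]
            site_DG[where c = "\<lambda>f. q powi - wt n j (f ?s)", OF li'(1) dd(2)]
            site_DG[where c = "\<lambda>f. q powi - wt n j (f ?s)", OF li'(2) dd(2)]
          by (auto simp: kS_def lS_def)
      qed
      have "s * EF n q y' m i = EF n q y' m i * s" unfolding EF_def sum_distrib_left sum_distrib_right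
        by (intro sum.cong refl commute_mult_right se sd) (auto simp: d)
      moreover have "s * FF n q y m i = FF n q y m i * s" unfolding FF_def sum_distrib_left sum_distrib_right
        by (intro sum.cong refl commute_mult_right se sd) (auto simp: d)
      moreover have "s * KF n q m i = KF n q m i * s" "s * LF n q m i = LF n q m i * s"
        unfolding KF_def LF_def by (intro sd; simp add: d)+
      ultimately show ?thesis using that(1) by auto
    qed
    have cent: "x * scF c = scF c * x" if "x \<in> {EF n q y' m i, FF n q y m i, KF n q m i, LF n q m i,
        eS n (y' ?s) ?s i, fS n (y ?s) ?s i, kS n q ?s i, lS n q ?s i}" for x c i
    proof -
      have "EF n q y' m i * scF c = scF c * EF n q y' m i" "FF n q y m i * scF c = scF c * FF n q y m i"
        unfolding EF_def FF_def sum_distrib_left sum_distrib_right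
        by (intro sum.cong refl commute_mult_left scF_DG eS_cent li; simp)+
      then show ?thesis using that l by (auto simp: eS_cent KF_def LF_def kS_def lS_def scF_DG)
    qed
    note sc = site_common[OF n q, of "y ?s" "y' ?s" ?s] site_EF[OF n q, of "y ?s" "y' ?s" ?s] site_classical[OF n q, of "y ?s" "y' ?s" ?s]
    have E: "EF n q y' ?s = (\<lambda>i. EF n q y' m i * kS n q ?s i + eS n (y' ?s) ?s i)"
      "FF n q y ?s = (\<lambda>i. FF n q y m i + LF n q m i * fS n (y ?s) ?s i)"
      "KF n q ?s = (\<lambda>i. KF n q m i * kS n q ?s i)" "LF n q ?s = (\<lambda>i. LF n q m i * lS n q ?s i)"
      using q_nz by (auto simp: EF_Suc FF_Suc KF_Suc LF_Suc)
    note hyps = n q scalar_hom_scF IH(1) sc(1)[OF l[THEN conjunct1] l[THEN conjunct2, THEN conjunct1]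
        l[THEN conjunct2, THEN conjunct2, THEN conjunct1] l[THEN conjunct2, THEN conjunct2, THEN conjunct2]]
    show ?case unfolding E
    proof (intro conjI impI)
      show "Uq_rels_common n q scF (\<lambda>i. EF n q y' m i * kS n q ?s i + eS n (y' ?s) ?s i)
         (\<lambda>i. FF n q y m i + LF n q m i * fS n (y ?s) ?s i) (\<lambda>i. KF n q m i * kS n q ?s i) (\<lambda>i. LF n q m i * lS n q ?s i)"
        by (rule Uq_common_coproduct[OF hyps]) (erule comm cent, assumption?)+
      show "Uq_rels_EF n q scF (\<lambda>i. EF n q y' m i * kS n q ?s i + eS n (y' ?s) ?s i)
         (\<lambda>i. FF n q y m i + LF n q m i * fS n (y ?s) ?s i) (\<lambda>i. KF n q m i * kS n q ?s i) (\<lambda>i. LF n q m i * lS n q ?s i)"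
        if "q \<noteq> 1"
        by (rule Uq_EF_coproduct[OF hyps]) (use IH(2) sc(2) l that in \<open>auto intro: comm cent\<close>)
      show "Uq_rels_classical n scF (\<lambda>i. EF n q y' m i * kS n q ?s i + eS n (y' ?s) ?s i)
         (\<lambda>i. FF n q y m i + LF n q m i * fS n (y ?s) ?s i) (\<lambda>i. KF n q m i * kS n q ?s i)"
        if "q = 1"
        by (rule Uq_classical_coproduct[OF hyps]) (use IH(3) sc(3) l that in \<open>auto intro: comm cent\<close>)
    qed
  qed
  then show ?A "q \<noteq> 1 \<Longrightarrow> Uq_rels_EF n q scF (EF n q y' m) (FF n q y m) (KF n q m) (LF n q m)"
    "q = 1 \<Longrightarrow> Uq_rels_classical n scF (EF n q y' m) (FF n q y m) (KF n q m)" by auto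
qed

section \<open>The Hecke operators on tensors\<close>

abbreviation swf :: "nat \<Rightarrow> (nat \<Rightarrow> nat) \<Rightarrow> (nat \<Rightarrow> nat)" where
  "swf i f \<equiv> f(i := f (Suc i), Suc i := f i)"

text \<open>The matrix \<open>S\<close> acting on coefficient functions: the new coefficient at a
  colouring is read off from the old ones at it and at its exchange.\<close>

definition ST :: "complex \<Rightarrow> nat \<Rightarrow> ften endo" where
  "ST q i = Endo (\<lambda>\<phi> f. if f i = f (Suc i) then smul (- inverse q) (\<phi> f)
     else (if f i < f (Suc i) then smul (q - inverse q) (\<phi> f) else 0) - \<phi> (swf i f))"

lemma app_ST: "app (ST q i) \<phi> f = (if f i = f (Suc i) then smul (- inverse q) (\<phi> f)
     else (if f i < f (Suc i) then smul (q - inverse q) (\<phi> f) else 0) - \<phi> (swf i f))"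
  unfolding ST_def by (subst app_Endo) (auto simp: smul_add)

definition STi :: "complex \<Rightarrow> nat \<Rightarrow> ften endo" where "STi q i = ST q i - scF (q - inverse q)"

text \<open>Writing the colouring as an update at the two sites lets the simplifier compare both
  sides as functions of two explicit colours.\<close>

lemma ften_eqI2:
  assumes "\<And>\<phi> h x y. app S \<phi> (h(i := x, Suc i := y)) = app T \<phi> (h(i := x, Suc i := y))"
  shows "S = (T :: ften endo)"
proof (rule ften_eqI)
  fix \<phi> :: ften and f
  show "app S \<phi> f = app T \<phi> f" using assms[of \<phi> f "f i" "f (Suc i)"] by simp
qed

lemma ften_eqI3:
  assumes "\<And>\<phi> h x y z. app S \<phi> (h(i := x, Suc i := y, Suc (Suc i) := z)) = app T \<phi> (h(i := x, Suc i := y, Suc (Suc i) := z))"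
  shows "S = (T :: ften endo)"
proof (rule ften_eqI)
  fix \<phi> :: ften and f
  show "app S \<phi> f = app T \<phi> f" using assms[of \<phi> f "f i" "f (Suc i)" "f (Suc (Suc i))"] by simp
qed

lemma upd_twist:
  "h(Suc i := y, i := x) = h(i := x, Suc i := y)" "h(Suc (Suc i) := y, i := x) = h(i := x, Suc (Suc i) := y)"
  by (auto simp: fun_eq_iff)

lemma lft_ST: "linop T \<Longrightarrow> lft T * ST q i = ST q i * lft T"
  by (rule ften_eqI) (simp add: app_ften app_ST linop_smul app_arg_minus)

lemma ST_scF: "ST q i * scF c = scF c * ST q i"
  unfolding lft_sc[symmetric] by (rule lft_ST[symmetric]) simp

lemma ST_quadratic:
  assumes "q \<noteq> 0"
  shows "ST q i * ST q i = 1 + scF (q - inverse q) * ST q i"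
  by (rule ften_eqI2[where i = i], rule poly_mapping_eqI)
     (use assms in \<open>auto simp: app_ften app_ST upd_twist lookup_add lookup_minus field_simps\<close>)

lemma ST_inv:
  assumes "q \<noteq> 0"
  shows "ST q i * STi q i = 1" "STi q i * ST q i = 1"
  using assms by (simp_all add: STi_def right_diff_distrib left_diff_distrib ST_quadratic ST_scF)

text \<open>A finite check over the relative orders of the three colours involved, since
  \<open>S\<close> depends on colours only through comparisons.\<close>

lemma ST_braid:
  assumes "q \<noteq> 0"
  shows "ST q i * ST q (Suc i) * ST q i = ST q (Suc i) * ST q i * ST q (Suc i)"
proof (rule ften_eqI3[where i = i], rule poly_mapping_eqI)
  fix \<phi> h x y z k
  show "lookup (app (ST q i * ST q (Suc i) * ST q i) \<phi> (h(i := x, Suc i := y, Suc (Suc i) := z))) k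
     = lookup (app (ST q (Suc i) * ST q i * ST q (Suc i)) \<phi> (h(i := x, Suc i := y, Suc (Suc i) := z))) k"
    by (cases x y rule: linorder_cases; cases y z rule: linorder_cases; cases x z rule: linorder_cases)
       (use assms in \<open>simp_all add: app_ften app_ST upd_twist lookup_add lookup_minus\<close>,
        use assms in \<open>simp_all add: field_simps\<close>)
qed

lemma ST_far: "Suc i < j \<Longrightarrow> ST q i * ST q j = ST q j * ST q i"
proof (rule ften_eqI)
  fix \<phi> :: ften and f assume "Suc i < j"
  moreover from this have "swf i (swf j f) = swf j (swf i f)" by (auto simp: fun_eq_iff)
  ultimately show "app (ST q i * ST q j) \<phi> f = app (ST q j * ST q i) \<phi> f"
    by (simp add: app_ften app_ST smul_diff smul_uminus mult.commute)
qed

lemma ST_MU: "k \<noteq> i \<Longrightarrow> k \<noteq> Suc i \<Longrightarrow> ST q i * MU k a b = MU k a b * ST q i"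
proof (rule ften_eqI)
  fix \<phi> :: ften and f assume "k \<noteq> i" "k \<noteq> Suc i"
  moreover from this have "(swf i f)(k := b) = swf i (f(k := b))" by (auto simp: fun_eq_iff)
  ultimately show "app (ST q i * MU k a b) \<phi> f = app (MU k a b * ST q i) \<phi> f"
    by (simp add: app_ften app_ST)
qed

lemma ST_DG: "(\<And>f. c (swf i f) = c f) \<Longrightarrow> ST q i * DG c = DG c * ST q i"
  by (rule ften_eqI) (simp add: app_ften app_ST smul_diff mult.commute)

text \<open>Consecutive colours cannot be separated by a third one, so the finite root vectors commute with \<open>S\<close>.\<close>

lemma ST_E_finite:
  assumes q: "q \<noteq> 0" and h: "h a = q" "h (Suc a) = inverse q" "\<And>x. x \<noteq> a \<Longrightarrow> x \<noteq> Suc a \<Longrightarrow> h x = 1"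
  shows "ST q i * (MU i a (Suc a) * DG (\<lambda>f. h (f (Suc i))) + MU (Suc i) a (Suc a))
    = (MU i a (Suc a) * DG (\<lambda>f. h (f (Suc i))) + MU (Suc i) a (Suc a)) * ST q i"
proof (rule ften_eqI2[where i = i], rule poly_mapping_eqI)
  fix \<phi> :: ften and f :: "nat \<Rightarrow> nat" and x y k
  consider "x = a" | "x = Suc a" | "x < a" | "x > Suc a" by linarith
  moreover consider "y = a" | "y = Suc a" | "y < a" | "y > Suc a" by linarith
  ultimately show "lookup (app (ST q i * (MU i a (Suc a) * DG (\<lambda>f. h (f (Suc i))) + MU (Suc i) a (Suc a))) \<phi> (f(i := x, Suc i := y))) k
    = lookup (app ((MU i a (Suc a) * DG (\<lambda>f. h (f (Suc i))) + MU (Suc i) a (Suc a)) * ST q i) \<phi> (f(i := x, Suc i := y))) k"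
    by cases (cases; use q h in \<open>simp add: app_ften app_ST upd_twist lookup_add lookup_minus field_simps\<close>)+
qed

lemma ST_F_finite:
  assumes q: "q \<noteq> 0" and h: "h a = inverse q" "h (Suc a) = q" "\<And>x. x \<noteq> a \<Longrightarrow> x \<noteq> Suc a \<Longrightarrow> h x = 1"
  shows "ST q i * (MU i (Suc a) a + DG (\<lambda>f. h (f i)) * MU (Suc i) (Suc a) a)
    = (MU i (Suc a) a + DG (\<lambda>f. h (f i)) * MU (Suc i) (Suc a) a) * ST q i"
proof (rule ften_eqI2[where i = i], rule poly_mapping_eqI)
  fix \<phi> :: ften and f :: "nat \<Rightarrow> nat" and x y k
  consider "x = a" | "x = Suc a" | "x < a" | "x > Suc a" by linarith
  moreover consider "y = a" | "y = Suc a" | "y < a" | "y > Suc a" by linarith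
  ultimately show "lookup (app (ST q i * (MU i (Suc a) a + DG (\<lambda>f. h (f i)) * MU (Suc i) (Suc a) a)) \<phi> (f(i := x, Suc i := y))) k
    = lookup (app ((MU i (Suc a) a + DG (\<lambda>f. h (f i)) * MU (Suc i) (Suc a) a) * ST q i) \<phi> (f(i := x, Suc i := y))) k"
    by cases (cases; use q h in \<open>simp add: app_ften app_ST upd_twist lookup_add lookup_minus field_simps\<close>)+
qed

text \<open>Colourings of all of \<open>\<nat>\<close> allow colours beyond \<open>n\<close> and the
  colour \<open>0\<close>, for which \<open>1\<close> and \<open>n\<close> are not extreme. The
  identities for the affine generators are proved for coefficient functions vanishing there.\<close>

definition good_at :: "nat \<Rightarrow> nat \<Rightarrow> ften \<Rightarrow> bool" where
  "good_at n i \<phi> \<longleftrightarrow> (\<forall>f. \<phi> f \<noteq> 0 \<longrightarrow> f i \<in> {1..n} \<and> f (Suc i) \<in> {1..n})"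

text \<open>The affine root vector involves the extreme colours \<open>n\<close> and \<open>1\<close>, and is conjugated by \<open>S\<close> instead.\<close>

lemma good_at_0: "good_at n i \<phi> \<Longrightarrow> \<not> (f i \<in> {1..n} \<and> f (Suc i) \<in> {1..n}) \<Longrightarrow> \<phi> f = 0"
  unfolding good_at_def by blast

lemma good_at_cases:
  assumes g: "good_at n i \<phi>"
  shows "f i = 0 \<Longrightarrow> \<phi> f = 0" "f (Suc i) = 0 \<Longrightarrow> \<phi> f = 0" "f i > n \<Longrightarrow> \<phi> f = 0" "f (Suc i) > n \<Longrightarrow> \<phi> f = 0"
  using good_at_0[OF g, of f] by auto

lemma two_site:
  "lookup (app (ST q i) \<chi> (f(i := u, Suc i := v))) k = (if u = v then - inverse q * lookup (\<chi> (f(i := u, Suc i := v))) k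
     else (if u < v then (q - inverse q) * lookup (\<chi> (f(i := u, Suc i := v))) k else 0) - lookup (\<chi> (f(i := v, Suc i := u))) k)"
  "lookup (app (STi q i) \<chi> (f(i := u, Suc i := v))) k = lookup (app (ST q i) \<chi> (f(i := u, Suc i := v))) k
     - (q - inverse q) * lookup (\<chi> (f(i := u, Suc i := v))) k"
  "lookup (app (MU i a b) \<chi> (f(i := u, Suc i := v))) k = (if u = a then lookup (\<chi> (f(i := b, Suc i := v))) k else 0)"
  "lookup (app (MU (Suc i) a b) \<chi> (f(i := u, Suc i := v))) k = (if v = a then lookup (\<chi> (f(i := u, Suc i := b))) k else 0)"
  "lookup (app (DG (\<lambda>f. h (f i))) \<chi> (f(i := u, Suc i := v))) k = h u * lookup (\<chi> (f(i := u, Suc i := v))) k"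
  "lookup (app (DG (\<lambda>f. h (f (Suc i)))) \<chi> (f(i := u, Suc i := v))) k = h v * lookup (\<chi> (f(i := u, Suc i := v))) k"
  by (simp_all add: app_ST app_MU app_DG upd_twist lookup_minus STi_def app_op_minus app_scF)

lemma two_site_ext:
  assumes "\<And>f u v k. lookup (\<chi> (f(i := u, Suc i := v))) k = lookup (\<chi>' (f(i := u, Suc i := v))) k"
  shows "\<chi> = (\<chi>' :: ften)"
proof (rule ext, rule poly_mapping_eqI)
  fix f :: "nat \<Rightarrow> nat" and k
  show "lookup (\<chi> f) k = lookup (\<chi>' f) k" using assms[of f "f i" "f (Suc i)" k] by simp
qed

lemma ST_E_affine:
  assumes q: "q \<noteq> 0" and n: "n \<ge> 2" and h: "h n = q" "h 1 = inverse q" "\<And>x. x \<noteq> 1 \<Longrightarrow> x \<noteq> n \<Longrightarrow> h x = 1"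
    and g: "good_at n i \<phi>"
  shows "app (MU (Suc i) n 1) \<phi> = app (ST q i * (MU i n 1 * DG (\<lambda>f. h (f (Suc i)))) * STi q i) \<phi>"
proof (rule two_site_ext[where i = i])
  fix f :: "nat \<Rightarrow> nat" and x y k
  define G where "G u v = lookup (\<phi> (f(i := u, Suc i := v))) k" for u v
  have z: "u = 0 \<or> v = 0 \<or> u > n \<or> v > n \<Longrightarrow> G u v = 0" for u v
    using good_at_cases[OF g, of "f(i := u, Suc i := v)"] by (auto simp: G_def)
  have h': "h x = 1" if "x = 0 \<or> x > n" for x using h(3)[of x] that n by auto
  have gz: "G 0 v = 0" "G v 0 = 0" "u > n \<Longrightarrow> G u v = 0" "u > n \<Longrightarrow> G v u = 0" for u v using z by auto
  show "lookup (app (MU (Suc i) n 1) \<phi> (f(i := x, Suc i := y))) k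
     = lookup (app (ST q i * (MU i n 1 * DG (\<lambda>f. h (f (Suc i)))) * STi q i) \<phi> (f(i := x, Suc i := y))) k"
  proof -
    have out: "G x v = 0" "G v x = 0" if "x = 0 \<or> x > n" for x v using z that by auto
    \<comment> \<open>Only the position relative to \<open>1\<close> and \<open>n\<close> matters:
      strictly between them the weight is \<open>1\<close>, and outside the range the coefficient
      vanishes.\<close>
    have c: "x = 0 \<or> x > n \<or> x = 1 \<or> x = n \<or> (1 < x \<and> x < n \<and> h x = 1)" for x using h(3)[of x] by linarith
    have n1: "n \<noteq> 1" "n \<noteq> 0" "\<not> n < 1" "1 < n" using n by auto
    show ?thesis
      unfolding app_mult two_site G_def[symmetric]
      using c[of x] c[of y]
    proof (elim disjE conjE)
    qed (use q n1 in \<open>simp_all add: out h(1,2) del: One_nat_def\<close>, simp_all add: field_simps)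
  qed
qed

lemma ST_F_affine:
  assumes q: "q \<noteq> 0" and n: "n \<ge> 2" and h: "h n = inverse q" "h 1 = q" "\<And>x. x \<noteq> 1 \<Longrightarrow> x \<noteq> n \<Longrightarrow> h x = 1"
    and g: "good_at n i \<phi>"
  shows "app (DG (\<lambda>f. h (f i)) * MU (Suc i) 1 n) \<phi> = app (STi q i * MU i 1 n * ST q i) \<phi>"
proof (rule two_site_ext[where i = i])
  fix f :: "nat \<Rightarrow> nat" and x y k
  define G where "G u v = lookup (\<phi> (f(i := u, Suc i := v))) k" for u v
  have z: "u = 0 \<or> v = 0 \<or> u > n \<or> v > n \<Longrightarrow> G u v = 0" for u v
    using good_at_cases[OF g, of "f(i := u, Suc i := v)"] by (auto simp: G_def)
  have h': "h x = 1" if "x = 0 \<or> x > n" for x using h(3)[of x] that n by auto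
  have gz: "G 0 v = 0" "G v 0 = 0" "u > n \<Longrightarrow> G u v = 0" "u > n \<Longrightarrow> G v u = 0" for u v using z by auto
  show "lookup (app (DG (\<lambda>f. h (f i)) * MU (Suc i) 1 n) \<phi> (f(i := x, Suc i := y))) k
     = lookup (app (STi q i * MU i 1 n * ST q i) \<phi> (f(i := x, Suc i := y))) k"
  proof -
    have out: "G x v = 0" "G v x = 0" if "x = 0 \<or> x > n" for x v using z that by auto
    have c: "x = 0 \<or> x > n \<or> x = 1 \<or> x = n \<or> (1 < x \<and> x < n \<and> h x = 1)" for x using h(3)[of x] by linarith
    have n1: "n \<noteq> 1" "n \<noteq> 0" "\<not> n < 1" "1 < n" using n by auto
    show ?thesis
      unfolding app_mult two_site G_def[symmetric]
      using c[of x] c[of y]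
    proof (elim disjE conjE)
    qed (use q n1 in \<open>simp_all add: out h(1,2) del: One_nat_def\<close>, simp_all add: field_simps)
  qed
qed

section \<open>The wedge relations are preserved\<close>

text \<open>Since \<open>g\<close> and \<open>S\<close> commute, the kernel of
  \<open>g + S^-1\<close> is the eigenspace of \<open>g S\<close> for the eigenvalue
  \<open>-1\<close>. This removes the inverse and turns the wedge relations into eigenvalue
  equations for operators satisfying the braid relations.\<close>

definition XO :: "complex \<Rightarrow> nat \<Rightarrow> ften endo" where "XO q i = lft (gL q i (Suc i)) * ST q i"

lemma lft_gL_comm: "lft (gL q i (Suc i)) * ST q j = ST q j * lft (gL q i (Suc i))"
  "lft (giL q i (Suc i)) * ST q j = ST q j * lft (giL q i (Suc i))"
  by (rule lft_ST; simp)+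

lemma XO_braid:
  assumes "q \<noteq> 0"
  shows "XO q i * XO q (Suc i) * XO q i = XO q (Suc i) * XO q i * XO q (Suc i)"
proof -
  let ?g = "\<lambda>i. lft (gL q i (Suc i))"
  have r: "XO q a * XO q b * XO q c = ?g a * ?g b * ?g c * (ST q a * ST q b * ST q c)" for a b c
    unfolding XO_def mult.assoc
    by (simp only: comm_left[OF lft_gL_comm(1)[symmetric]])
  have "?g i * ?g (Suc i) * ?g i = ?g (Suc i) * ?g i * ?g (Suc i)"
    using gL_braid[of i "Suc i" "Suc (Suc i)" q] by (simp flip: lft_mult)
  then show ?thesis unfolding r ST_braid[OF assms] by simp
qed

lemma XO_far: "Suc i < j \<Longrightarrow> XO q i * XO q j = XO q j * XO q i"
proof -
  assume ij: "Suc i < j"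
  have "lft (gL q i (Suc i)) * lft (gL q j (Suc j)) = lft (gL q j (Suc j)) * lft (gL q i (Suc i))"
    using gL_far[of i "Suc i" j "Suc j" q] ij by (simp flip: lft_mult)
  then show ?thesis unfolding XO_def
    by (intro commute_mult_left commute_mult_right lft_gL_comm lft_gL_comm[symmetric] ST_far ij)
qed

text \<open>Three operators with image in the \<open>-1\<close> eigenspace of \<open>X\<close>, by
  the two quadratic relations. The first two absorb the affine generators \<open>E_0\<close> and
  \<open>F_0\<close>; the third yields the straightening rule.\<close>

lemma XO_annihilates:
  assumes q: "q \<noteq> 0"
  shows "XO q i * (1 - lft (giL q i (Suc i)) * ST q i) = - (1 - lft (giL q i (Suc i)) * ST q i)"
    and "XO q i * (1 - lft (gL q i (Suc i)) * STi q i) = - (1 - lft (gL q i (Suc i)) * STi q i)"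
    and "XO q i * (lft (gL q i (Suc i)) - ST q i) = - (lft (gL q i (Suc i)) - ST q i)"
proof -
  let ?g = "lft (gL q i (Suc i))" and ?s = "ST q i" and ?k = "scF (q - inverse q)"
  have gi: "lft (giL q i (Suc i)) = ?g - ?k" by (simp add: giL_def lft_minus lft_sc)
  have gg: "?g * ?g = 1 + ?k * ?g" using gL_quadratic[of i "Suc i" q] q by (simp flip: lft_mult lft_sc lft_add lft_1)
  have ss: "?s * ?s = 1 + ?k * ?s" by (rule ST_quadratic[OF q])
  have c: "?s * ?g = ?g * ?s" "?s * ?k = ?k * ?s" "?g * ?k = ?k * ?g"
    using lft_gL_comm(1)[of q i i] ST_scF lft_scF[of "gL q i (Suc i)"] by auto
  have gg': "?g * (?g * x) = x + ?k * (?g * x)" and ss': "?s * (?s * x) = x + ?k * (?s * x)" for x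
    using gg ss by (simp_all flip: mult.assoc add: distrib_right)
  note r = c c[THEN comm_left] gg ss gg' ss'
  show "XO q i * (1 - lft (giL q i (Suc i)) * ST q i) = - (1 - lft (giL q i (Suc i)) * ST q i)"
    "XO q i * (1 - lft (gL q i (Suc i)) * STi q i) = - (1 - lft (gL q i (Suc i)) * STi q i)"
    "XO q i * (lft (gL q i (Suc i)) - ST q i) = - (lft (gL q i (Suc i)) - ST q i)"
    unfolding XO_def gi STi_def
    by (simp_all add: left_diff_distrib right_diff_distrib distrib_left distrib_right mult.assoc r)
qed

lemma app_annihilated: "X * T = - T \<Longrightarrow> app X (app T x) = - app T x"
  by (simp flip: app_mult app_op_uminus)

lemma XO_commuting:
  assumes "T * XO q j = XO q j * T" "app (XO q j) \<phi> = - \<phi>"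
  shows "app (XO q j) (app T \<phi>) = - app T \<phi>"
  by (simp only: app_mult[symmetric] assms(1)[symmetric]) (simp only: app_mult assms(2) app_arg_uminus)

lemma XO_DG: "(\<And>f. c (swf j f) = c f) \<Longrightarrow> DG c * XO q j = XO q j * DG c"
  unfolding XO_def by (intro commute_mult_right lft_DG[symmetric] ST_DG[symmetric]) auto

lemma XO_site:
  assumes "i \<noteq> j" "i \<noteq> Suc j" "y * gL q j (Suc j) = gL q j (Suc j) * y" "linop y"
  shows "eS n y i \<epsilon> * XO q j = XO q j * eS n y i \<epsilon>" "fS n y i \<epsilon> * XO q j = XO q j * fS n y i \<epsilon>"
proof -
  have "lft (if \<epsilon> = 0 then y else 1) * lft (gL q j (Suc j)) = lft (gL q j (Suc j)) * lft (if \<epsilon> = 0 then y else 1)"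
    using assms(3) by (simp flip: lft_mult)
  moreover have "lft (if \<epsilon> = 0 then y else 1) * ST q j = ST q j * lft (if \<epsilon> = 0 then y else 1)"
    by (rule lft_ST) (use assms in auto)
  ultimately show "eS n y i \<epsilon> * XO q j = XO q j * eS n y i \<epsilon>" "fS n y i \<epsilon> * XO q j = XO q j * fS n y i \<epsilon>"
    unfolding eS_def fS_def XO_def
    by (intro commute_mult_left commute_mult_right lft_MU[symmetric] ST_MU[symmetric] assms; simp)+
qed

lemma sum_swap_invariant:
  assumes "j \<in> A \<longleftrightarrow> Suc j \<in> A" "finite A"
  shows "(\<Sum>k\<in>A. w ((swf j f) k)) = (\<Sum>k\<in>A. w (f k) :: int)"
proof (cases "j \<in> A")
  case True
  then have A: "A = insert j (insert (Suc j) (A - {j, Suc j}))" using assms by auto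
  have "(\<Sum>k\<in>A - {j, Suc j}. w ((swf j f) k)) = (\<Sum>k\<in>A - {j, Suc j}. w (f k))" by (rule sum.cong) auto
  then show ?thesis using assms(2) by (subst (1 2) A) (simp add: sum.insert_remove)
next
  case False
  then show ?thesis using assms by (intro sum.cong) auto
qed

lemma sum_split_pair:
  assumes "1 \<le> j" "j < N"
  shows "(\<Sum>i\<in>{1..N}. T i) = (\<Sum>i\<in>{1..N} - {j, Suc j}. T i) + (T j + T (Suc j) :: 'a::comm_monoid_add)"
proof -
  have "{1..N} = insert j (insert (Suc j) ({1..N} - {j, Suc j}))" using assms by auto
  then have "(\<Sum>i\<in>{1..N}. T i) = (\<Sum>i\<in>insert j (insert (Suc j) ({1..N} - {j, Suc j})). T i)" by simp
  then show ?thesis by (simp add: ac_simps)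
qed

lemma cyc_Suc: "1 \<le> \<epsilon> \<Longrightarrow> \<epsilon> < n \<Longrightarrow> cyc n \<epsilon> = \<epsilon>" "\<epsilon> < n \<Longrightarrow> cyc n (Suc \<epsilon>) = Suc \<epsilon>" "cyc n 0 = n" "n \<ge> 2 \<Longrightarrow> cyc n (Suc 0) = 1"
  by (auto simp: cyc_def mod_Suc)

lemma good_at_DG: "good_at n j \<phi> \<Longrightarrow> good_at n j (app (DG c) \<phi>)"
  unfolding good_at_def by (metis app_DG smul_0r)

text \<open>Only the sites \<open>j\<close> and \<open>j + 1\<close> fail to commute with
  \<open>X_j\<close> individually. For \<open>\<epsilon> \<noteq> 0\<close> their sum commutes with
  \<open>X_j\<close>; for \<open>\<epsilon> = 0\<close> the second term is \<open>- g^-1 S\<close>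
  times the first on the eigenspace, so the sum lies in the image of \<open>1 - g^-1 S\<close>. The
  recursion for \<open>y\<close> is that of the inverses, as \<open>E_0\<close> contains
  \<open>y^-1\<close>.\<close>

lemma EF_preserves:
  assumes n: "n \<ge> 2" and q: "q \<noteq> 0" and j: "1 \<le> j" "j < N" and eps: "\<epsilon> < n"
    and y: "y (Suc j) = giL q j (Suc j) * y j * giL q j (Suc j)"
    and yc: "\<And>i. i \<in> {1..N} - {j, Suc j} \<Longrightarrow> y i * gL q j (Suc j) = gL q j (Suc j) * y i"
    and lin: "\<And>i. i \<in> {1..N} \<Longrightarrow> linop (y i)"
    and k: "app (XO q j) \<phi> = - \<phi>" and good: "good_at n j \<phi>"
  shows "app (XO q j) (app (EF n q y N \<epsilon>) \<phi>) = - app (EF n q y N \<epsilon>) \<phi>"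
proof -
  let ?X = "XO q j" and ?s = "Suc j" and ?W = "\<lambda>i. DG (\<lambda>f. q powi (\<Sum>k\<in>{i<..N}. wt n \<epsilon> (f k)))"
  let ?G = "lft (gL q j ?s)" and ?Gi = "lft (giL q j ?s)" and ?S = "ST q j" and ?Si = "STi q j"
  \<comment> \<open>The Cartan factors to the right of both sites are symmetric in the pair and are
    absorbed into the vector.\<close>
  define \<psi> where "\<psi> = app (?W ?s) \<phi>"
  define P where "P = eS n (y j) j \<epsilon> * kS n q ?s \<epsilon>"
  define P' where "P' = eS n (y ?s) ?s \<epsilon>"
  have W: "?W i * ?X = ?X * ?W i" if "i < j \<or> i > j" for i
  proof (rule XO_DG)
    fix f
    show "q powi (\<Sum>k\<in>{i<..N}. wt n \<epsilon> ((swf j f) k)) = q powi (\<Sum>k\<in>{i<..N}. wt n \<epsilon> (f k))"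
      using that j by (subst sum_swap_invariant) auto
  qed
  have \<psi>: "app ?X \<psi> = - \<psi>" "good_at n j \<psi>"
    unfolding \<psi>_def using XO_commuting[OF W[of ?s] k] good good_at_DG by auto
  have "{j<..N} = insert ?s {?s<..N}" using j by auto
  then have Wj: "?W j = kS n q ?s \<epsilon> * ?W ?s" using q by (simp add: kS_def DG_DG power_int_add)
  have c1: "(\<Sum>i\<in>{1..N} - {j, ?s}. eS n (y i) i \<epsilon> * ?W i) * ?X = ?X * (\<Sum>i\<in>{1..N} - {j, ?s}. eS n (y i) i \<epsilon> * ?W i)"
    unfolding sum_distrib_left sum_distrib_right
    by (intro sum.cong refl commute_mult_left XO_site W yc lin) auto
  have split: "app (EF n q y N \<epsilon>) \<phi> = app (\<Sum>i\<in>{1..N} - {j, ?s}. eS n (y i) i \<epsilon> * ?W i) \<phi> + app (P + P') \<psi>"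
    unfolding EF_def sum_split_pair[OF j] app_op_add Wj P_def P'_def \<psi>_def by (simp add: app_mult)
  have key: "app ?X (app (P + P') \<psi>) = - app (P + P') \<psi>"
  proof (cases "\<epsilon> = 0")
    case False
    define h where "h x = q powi wt n \<epsilon> x" for x
    have h: "h \<epsilon> = q" "h (Suc \<epsilon>) = inverse q" "x \<noteq> \<epsilon> \<Longrightarrow> x \<noteq> Suc \<epsilon> \<Longrightarrow> h x = 1" for x
      using False eps by (auto simp: h_def wt_def cyc_Suc power_int_minus)
    have PP: "P + P' = MU j \<epsilon> (Suc \<epsilon>) * DG (\<lambda>f. h (f ?s)) + MU ?s \<epsilon> (Suc \<epsilon>)"
      unfolding P_def P'_def eS_def kS_def h_def using False eps by (simp add: cyc_Suc)
    have "(P + P') * ?X = ?X * (P + P')"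
    proof -
      have "(P + P') * ?S = ?S * (P + P')" unfolding PP by (rule ST_E_finite[OF q h, symmetric])
      moreover have "(P + P') * ?G = ?G * (P + P')"
        unfolding PP distrib_left distrib_right
        by (intro arg_cong2[of _ _ _ _ "(+)"] commute_mult_left lft_MU[symmetric] lft_DG[symmetric]) simp
      ultimately show ?thesis unfolding XO_def by (simp add: commute_mult_right)
    qed
    from XO_commuting[OF this \<psi>(1)] show ?thesis .
  next
    case True
    define h where "h x = q powi wt n \<epsilon> x" for x
    have h: "h n = q" "h 1 = inverse q" "x \<noteq> 1 \<Longrightarrow> x \<noteq> n \<Longrightarrow> h x = 1" for x
      using True n by (auto simp: h_def wt_def cyc_Suc power_int_minus)
    let ?a = "lft (y j)" and ?e = "MU j n 1 * DG (\<lambda>f. h (f ?s))"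
    have P: "P = ?a * ?e" "P' = ?Gi * ?a * ?Gi * MU ?s n 1"
      unfolding P_def P'_def eS_def kS_def h_def y using True n by (simp_all add: cyc_Suc lft_mult mult.assoc)
    \<comment> \<open>The inverse of \<open>X\<close>, namely \<open>g^-1 S^-1\<close>, acts as
      \<open>-1\<close> on the eigenspace too.\<close>
    have GiS: "app (?Gi * ?Si) \<psi> = - \<psi>"
    proof -
      have "?Gi * ?Si * ?X = 1"
        unfolding XO_def using ST_inv[OF q, of j] gL_inv[of j ?s q] q lft_gL_comm(1)[of q j j]
        by (metis (no_types, lifting) lft_1 lft_mult mult.assoc mult_1_right n_not_Suc_n)
      then have "app (?Gi * ?Si) (app ?X \<psi>) = \<psi>" by (simp flip: app_mult)
      then show ?thesis using \<psi>(1) by (metis app_arg_uminus minus_minus)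
    qed
    have "app P' \<psi> = app (?Gi * ?a * ?Gi) (app (?S * ?e * ?Si) \<psi>)"
      unfolding P(2) app_mult[of "?Gi * ?a * ?Gi"] by (rule arg_cong[OF ST_E_affine[OF q n h \<psi>(2)]])
    also have "\<dots> = app (?Gi * ?a * ?Gi * (?S * ?e * ?Si)) \<psi>" by (simp only: app_mult)
    also have "?Gi * ?a * ?Gi * (?S * ?e * ?Si) = ?Gi * ?S * (?a * ?e) * (?Gi * ?Si)"
    proof -
      have c: "?Gi * ?S = ?S * ?Gi" "?a * ?S = ?S * ?a" "?Gi * ?e = ?e * ?Gi"
        by (rule lft_gL_comm, rule lft_ST, use lin j in simp)
           (intro commute_mult_right lft_MU lft_DG, simp)
      have "?Gi * ?a * ?Gi * (?S * ?e * ?Si) = ?Gi * (?a * ?S) * (?Gi * ?e) * ?Si"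
        unfolding mult.assoc comm_left[OF c(1)] ..
      also have "\<dots> = ?Gi * ?S * (?a * ?e) * (?Gi * ?Si)" unfolding c(2,3) by (simp only: mult.assoc)
      finally show ?thesis .
    qed
    also have "app (?Gi * ?S * (?a * ?e) * (?Gi * ?Si)) \<psi> = - app (?Gi * ?S) (app P \<psi>)"
      unfolding app_mult[of _ "?Gi * ?Si"] GiS P by (simp add: app_mult app_arg_uminus)
    finally have "app (P + P') \<psi> = app (1 - ?Gi * ?S) (app P \<psi>)"
      by (simp add: app_op_add app_op_minus)
    then show ?thesis by (simp only: app_annihilated[OF XO_annihilates(1)[OF q]])
  qed
  show ?thesis unfolding split app_arg_add XO_commuting[OF c1 k] key by simp
qed

text \<open>The mirror image of the argument for \<open>E\<close>: the Cartan factors stand to the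
  left, \<open>y\<close> itself occurs, and for \<open>\<epsilon> = 0\<close> the sum lies in the
  image of \<open>1 - g S^-1\<close>.\<close>

lemma FF_preserves:
  assumes n: "n \<ge> 2" and q: "q \<noteq> 0" and j: "1 \<le> j" "j < N" and eps: "\<epsilon> < n"
    and y: "y (Suc j) = gL q j (Suc j) * y j * gL q j (Suc j)"
    and yc: "\<And>i. i \<in> {1..N} - {j, Suc j} \<Longrightarrow> y i * gL q j (Suc j) = gL q j (Suc j) * y i"
    and lin: "\<And>i. i \<in> {1..N} \<Longrightarrow> linop (y i)"
    and k: "app (XO q j) \<phi> = - \<phi>" and good: "good_at n j \<phi>"
  shows "app (XO q j) (app (FF n q y N \<epsilon>) \<phi>) = - app (FF n q y N \<epsilon>) \<phi>"
proof -
  let ?X = "XO q j" and ?s = "Suc j" and ?W = "\<lambda>i. DG (\<lambda>f. q powi - (\<Sum>k\<in>{1..<i}. wt n \<epsilon> (f k)))"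
  let ?G = "lft (gL q j ?s)" and ?S = "ST q j" and ?Si = "STi q j"
  define P where "P = fS n (y j) j \<epsilon>"
  define P' where "P' = lS n q j \<epsilon> * fS n (y ?s) ?s \<epsilon>"
  have W: "?W i * ?X = ?X * ?W i" if "i \<noteq> ?s" for i
  proof (rule XO_DG)
    fix f
    show "q powi - (\<Sum>k\<in>{1..<i}. wt n \<epsilon> ((swf j f) k)) = q powi - (\<Sum>k\<in>{1..<i}. wt n \<epsilon> (f k))"
      using that j by (subst sum_swap_invariant) auto
  qed
  have "{1..<?s} = insert j {1..<j}" using j by auto
  then have Wj: "?W ?s = ?W j * lS n q j \<epsilon>" using q
    by (simp add: lS_def DG_DG power_int_add[symmetric] add.commute)
  have c1: "(\<Sum>i\<in>{1..N} - {j, ?s}. ?W i * fS n (y i) i \<epsilon>) * ?X = ?X * (\<Sum>i\<in>{1..N} - {j, ?s}. ?W i * fS n (y i) i \<epsilon>)"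
    unfolding sum_distrib_left sum_distrib_right
    by (intro sum.cong refl commute_mult_left XO_site W yc lin) auto
  have split: "app (FF n q y N \<epsilon>) \<phi> = app (\<Sum>i\<in>{1..N} - {j, ?s}. ?W i * fS n (y i) i \<epsilon>) \<phi> + app (?W j) (app (P + P') \<phi>)"
    unfolding FF_def sum_split_pair[OF j] app_op_add Wj P_def P'_def by (simp add: app_mult app_arg_add)
  have key: "app ?X (app (P + P') \<phi>) = - app (P + P') \<phi>"
  proof (cases "\<epsilon> = 0")
    case False
    define h where "h x = q powi - wt n \<epsilon> x" for x
    have h: "h \<epsilon> = inverse q" "h (Suc \<epsilon>) = q" "x \<noteq> \<epsilon> \<Longrightarrow> x \<noteq> Suc \<epsilon> \<Longrightarrow> h x = 1" for x
      using False eps by (auto simp: h_def wt_def cyc_Suc power_int_minus)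
    have PP: "P + P' = MU j (Suc \<epsilon>) \<epsilon> + DG (\<lambda>f. h (f j)) * MU ?s (Suc \<epsilon>) \<epsilon>"
      unfolding P_def P'_def fS_def lS_def h_def using False eps by (simp add: cyc_Suc)
    have "(P + P') * ?X = ?X * (P + P')"
    proof -
      have "(P + P') * ?S = ?S * (P + P')" unfolding PP by (rule ST_F_finite[OF q h, symmetric])
      moreover have "(P + P') * ?G = ?G * (P + P')"
        unfolding PP distrib_left distrib_right
        by (intro arg_cong2[of _ _ _ _ "(+)"] commute_mult_left lft_MU[symmetric] lft_DG[symmetric]) simp
      ultimately show ?thesis unfolding XO_def by (simp add: commute_mult_right)
    qed
    from XO_commuting[OF this k] show ?thesis .
  next
    case True
    define h where "h x = q powi - wt n \<epsilon> x" for x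
    have h: "h n = inverse q" "h 1 = q" "x \<noteq> 1 \<Longrightarrow> x \<noteq> n \<Longrightarrow> h x = 1" for x
      using True n by (auto simp: h_def wt_def cyc_Suc power_int_minus)
    let ?a = "lft (y j)" and ?f = "MU j 1 n"
    have P: "P = ?a * ?f" "P' = ?G * ?a * ?G * (DG (\<lambda>f. h (f j)) * MU ?s 1 n)"
    proof -
      show "P = ?a * ?f" unfolding P_def fS_def using True n by (simp add: cyc_Suc)
      have "DG (\<lambda>f. h (f j)) * lft (y ?s) = lft (y ?s) * DG (\<lambda>f. h (f j))"
        by (rule lft_DG[symmetric]) (use lin j in simp)
      note c = comm_left[OF this]
      have "P' = DG (\<lambda>f. h (f j)) * (lft (y ?s) * MU ?s 1 n)"
        unfolding P'_def fS_def lS_def h_def[symmetric] using True n by (simp add: cyc_Suc)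
      also have "\<dots> = ?G * ?a * ?G * (DG (\<lambda>f. h (f j)) * MU ?s 1 n)"
        unfolding c unfolding y lft_mult ..
      finally show "P' = ?G * ?a * ?G * (DG (\<lambda>f. h (f j)) * MU ?s 1 n)" .
    qed
    have "app P' \<phi> = app (?G * ?a * ?G) (app (?Si * ?f * ?S) \<phi>)"
      unfolding P(2) app_mult[of "?G * ?a * ?G"] by (rule arg_cong[OF ST_F_affine[OF q n h good]])
    also have "\<dots> = app (?G * ?a * ?G * (?Si * ?f * ?S)) \<phi>" by (simp only: app_mult)
    also have "?G * ?a * ?G * (?Si * ?f * ?S) = ?G * ?Si * (?a * ?f) * ?X"
    proof -
      have s: "lft T * ?Si = ?Si * lft T" if "linop T" for T
        using that by (simp add: STi_def left_diff_distrib right_diff_distrib lft_ST lft_scF)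
      have c: "?G * ?Si = ?Si * ?G" "?a * ?Si = ?Si * ?a" "?G * ?f = ?f * ?G"
        by (rule s, simp, rule s, use lin j in simp) (rule lft_MU)
      have "?G * ?a * ?G * (?Si * ?f * ?S) = ?G * (?a * ?Si) * (?G * ?f) * ?S"
        unfolding mult.assoc comm_left[OF c(1)] ..
      also have "\<dots> = ?G * ?Si * (?a * ?f) * ?X" unfolding c(2,3) XO_def by (simp only: mult.assoc)
      finally show ?thesis .
    qed
    also have "app (?G * ?Si * (?a * ?f) * ?X) \<phi> = - app (?G * ?Si) (app P \<phi>)"
      unfolding app_mult[of _ ?X] k P by (simp add: app_mult app_arg_uminus)
    finally have "app (P + P') \<phi> = app (1 - ?G * ?Si) (app P \<phi>)"
      by (simp add: app_op_add app_op_minus)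
    then show ?thesis by (simp only: app_annihilated[OF XO_annihilates(2)[OF q]])
  qed
  have "app ?X (app (?W j) (app (P + P') \<phi>)) = - app (?W j) (app (P + P') \<phi>)"
    by (rule XO_commuting[OF W key]) simp
  then show ?thesis unfolding split app_arg_add XO_commuting[OF c1 k] by simp
qed

text \<open>\<open>g\<close> commutes with the symmetric elements \<open>a + b\<close> and
  \<open>a b\<close>, and Newton's recursion in two variables generates all power sums from
  these.\<close>

lemma power_sums_commute:
  fixes a :: "'a::ring_1"
  assumes b: "b = g * a * g" and ab: "a * b = b * a" and gg: "g * g = 1 + \<kappa> * g"
    and \<kappa>: "g * \<kappa> = \<kappa> * g" "a * \<kappa> = \<kappa> * a"
  shows "g * (a ^ l + b ^ l) = (a ^ l + b ^ l) * g"
proof -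
  have gg': "g * (g * x) = x + \<kappa> * (g * x)" for x using gg by (simp flip: mult.assoc add: distrib_right)
  have s: "g * (a + b) = (a + b) * g"
    unfolding b by (simp add: distrib_left distrib_right mult.assoc gg gg' \<kappa> comm_left[OF \<kappa>(1)] comm_left[OF \<kappa>(2)])
  have p: "g * (a * b) = (a * b) * g"
  proof -
    have e: "a * (g * (a * g)) = g * (a * (g * a))" using ab unfolding b by (simp add: mult.assoc)
    have "a * b * g = b * a * g" by (simp only: ab)
    also have "\<dots> = g * (a * (g * (a * g)))" unfolding b by (simp only: mult.assoc)
    also have "\<dots> = g * (a * b)" unfolding b by (simp only: mult.assoc)
    finally show ?thesis by simp
  qed
  have rec: "a ^ Suc (Suc l) + b ^ Suc (Suc l) = (a + b) * (a ^ Suc l + b ^ Suc l) - a * b * (a ^ l + b ^ l)" for l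
  proof -
    have "b * (a * x) = a * (b * x)" for x using comm_left[OF ab] by simp
    then show ?thesis by (simp add: distrib_left distrib_right mult.assoc)
  qed
  \<comment> \<open>The recursion reaches back two steps, so two consecutive exponents are carried
    along.\<close>
  have "g * (a ^ l + b ^ l) = (a ^ l + b ^ l) * g \<and> g * (a ^ Suc l + b ^ Suc l) = (a ^ Suc l + b ^ Suc l) * g"
  proof (induction l)
    case 0
    show ?case using s by (simp add: distrib_left distrib_right mult_2 mult_2_right)
  next
    case (Suc l)
    have "g * (a ^ Suc (Suc l) + b ^ Suc (Suc l)) = (a ^ Suc (Suc l) + b ^ Suc (Suc l)) * g"
      unfolding rec right_diff_distrib left_diff_distrib
      by (intro arg_cong2[of _ _ _ _ "(-)"] commute_mult_right s p Suc[THEN conjunct1] Suc[THEN conjunct2])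
    then show ?case using Suc by blast
  qed
  then show ?thesis ..
qed

lemma linop_commutes: "linop T \<Longrightarrow> T * scL c = scL c * T" by (simp add: linop_def)

text \<open>Negative powers are positive powers of the inverses, which satisfy the same hypotheses
  with \<open>g^-1\<close> for \<open>g\<close> and \<open>- (q - q^-1)\<close> for
  \<open>q - q^-1\<close>.\<close>

lemma zpw_sums_commute:
  assumes q: "q \<noteq> 0" and ij: "i \<noteq> j" and b: "b = gL q i j * a * gL q i j" and ab: "a * b = b * a"
    and inv: "a * a' = 1" "a' * a = 1" "b * b' = 1" "b' * b = 1" and lin: "linop a" "linop a'"
  shows "gL q i j * (zpw a a' l + zpw b b' l) = (zpw a a' l + zpw b b' l) * gL q i j"
proof -
  let ?g = "gL q i j" and ?g' = "giL q i j"
  note gi = gL_inv[OF ij q]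
  have g'g': "?g' * ?g' = 1 + scL (- (q - inverse q)) * ?g'"
  proof -
    have "?g' * ?g' = (?g - scL (q - inverse q)) * ?g'" by (simp only: giL_def)
    also have "\<dots> = 1 - scL (q - inverse q) * ?g'" by (simp add: left_diff_distrib gi)
    also have "scL (q - inverse q) = - scL (- (q - inverse q))"
      using scL_add[of "q - inverse q" "- (q - inverse q)"] by (simp add: eq_neg_iff_add_eq_0)
    finally show ?thesis by simp
  qed
  have b': "b' = ?g' * a' * ?g'"
  proof -
    have "b * (?g' * a' * ?g') = 1"
      unfolding b by (simp add: mult.assoc cancel_left[OF gi(1)] cancel_left[OF inv(1)] gi)
    then have "b' * (b * (?g' * a' * ?g')) = b'" by simp
    then show ?thesis by (simp add: cancel_left[OF inv(4)])
  qed
  have ab': "a' * b' = b' * a'"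
    using commute_inverse[OF commute_inverse[OF ab inv(3,4), symmetric] inv(1,2)] by simp
  show ?thesis
  proof (cases "0 \<le> l")
    case True
    then show ?thesis using power_sums_commute[OF b ab gL_quadratic[OF ij q]] lin ij
      by (simp add: zpw_def linop_commutes)
  next
    case False
    have "?g' * (a' ^ nat (- l) + b' ^ nat (- l)) = (a' ^ nat (- l) + b' ^ nat (- l)) * ?g'"
      by (rule power_sums_commute[OF b' ab' g'g']) (use lin ij in \<open>simp_all add: linop_commutes\<close>)
    then have "(a' ^ nat (- l) + b' ^ nat (- l)) * ?g' = ?g' * (a' ^ nat (- l) + b' ^ nat (- l))" by simp
    from commute_inverse[OF this gi(2,1)] show ?thesis using False by (simp add: zpw_def)
  qed
qed

lemma zpw_commute:
  fixes a :: "'a::monoid_mult"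
  assumes "a * x = x * a" "a * a' = 1" "a' * a = 1"
  shows "zpw a a' l * x = x * zpw a a' l"
proof -
  have p: "u ^ k * x = x * u ^ k" if "u * x = x * u" for u :: 'a and k
    using that by (induction k) (simp_all add: commute_mult_left)
  have "a' * x = x * a'" using commute_inverse[OF assms(1)[symmetric] assms(2,3)] by simp
  then show ?thesis using p assms by (simp add: zpw_def)
qed

abbreviation "yzp q p N i \<equiv> zpw (yL q p N i) (yiL q p N i)"

lemma linop_yzp: "q \<noteq> 0 \<Longrightarrow> p \<noteq> 0 \<Longrightarrow> linop (yzp q p N i l)"
  using zpw_commute[OF _ yL_inv, of q p N i "scL c" l for c] linop_yL(1)[of q p N i] by (auto simp: linop_def)

definition HF :: "complex \<Rightarrow> complex \<Rightarrow> int \<Rightarrow> nat \<Rightarrow> ften endo" where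
  "HF q p l N = (\<Sum>i\<in>{1..N}. lft (yzp q p N i l))"

text \<open>The sites other than \<open>j\<close> and \<open>j + 1\<close> commute with
  \<open>g_j\<close>; the remaining pair is a power sum.\<close>

lemma HF_preserves:
  assumes q: "q \<noteq> 0" and p: "p \<noteq> 0" and j: "1 \<le> j" "j < N"
  shows "HF q p l N * XO q j = XO q j * HF q p l N"
proof -
  let ?z = "\<lambda>i. yzp q p N i l"
  note lz = linop_yzp[OF q p]
  have c: "(\<Sum>i\<in>{1..N} - {j, Suc j}. ?z i) * gL q j (Suc j) = gL q j (Suc j) * (\<Sum>i\<in>{1..N} - {j, Suc j}. ?z i)"
    unfolding sum_distrib_left sum_distrib_right
    by (intro sum.cong refl zpw_commute yL_inv q p yL_gL) (use j in auto)
  have c2: "gL q j (Suc j) * (?z j + ?z (Suc j)) = (?z j + ?z (Suc j)) * gL q j (Suc j)"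
    by (rule zpw_sums_commute) (use q p j in \<open>auto intro!: yL_inv linop_yL yL_Suc yL_yL\<close>)
  have lsum: "lft (\<Sum>i\<in>A. T i) = (\<Sum>i\<in>A. lft (T i))" if "finite A" for A and T :: "nat \<Rightarrow> laurent endo"
    using that by induction (auto simp: lft_add intro!: ften_eqI simp: app_ften)
  have H: "HF q p l N = lft (\<Sum>i\<in>{1..N}. ?z i)" by (simp add: HF_def lsum)
  have "(\<Sum>i\<in>{1..N}. ?z i) * gL q j (Suc j) = gL q j (Suc j) * (\<Sum>i\<in>{1..N}. ?z i)"
    unfolding sum_split_pair[OF j] distrib_left distrib_right c using c2 by (simp add: distrib_left distrib_right)
  then have "HF q p l N * lft (gL q j (Suc j)) = lft (gL q j (Suc j)) * HF q p l N"
    unfolding H by (simp flip: lft_mult)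
  moreover have "HF q p l N * ST q j = ST q j * HF q p l N"
    unfolding HF_def sum_distrib_left sum_distrib_right by (intro sum.cong refl lft_ST lz)
  ultimately show ?thesis unfolding XO_def by (rule commute_mult_right)
qed

section \<open>Transfer to the tensor product\<close>

text \<open>Pulls a tensor back to colourings of all of \<open>\<nat>\<close> by restricting them to
  the first \<open>N\<close> sites. It is injective on \<open>tensors n N\<close>, so equations
  proved for endomorphisms transfer back.\<close>

definition Ext :: "nat \<Rightarrow> tensor \<Rightarrow> ften" where "Ext N \<phi> = (\<lambda>f. \<phi> (map f [1..<Suc N]))"

lemma Ext_add: "Ext N (\<phi> + \<psi>) = Ext N \<phi> + Ext N \<psi>" by (auto simp: Ext_def)
lemma Ext_diff: "Ext N (\<phi> - \<psi>) = Ext N \<phi> - Ext N \<psi>" by (auto simp: Ext_def)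
lemma Ext_0: "Ext N 0 = 0" by (auto simp: Ext_def)
lemma Ext_sum: "Ext N (\<Sum>i\<in>I. \<phi> i) = (\<Sum>i\<in>I. Ext N (\<phi> i))"
  by (rule ext) (simp add: Ext_def sum_apply)
lemma Ext_tsmul: "Ext N (tsmul c \<phi>) = app (scF c) (Ext N \<phi>)"
  by (auto simp: Ext_def tsmul_def app_scF)
lemma Ext_on_laurent: "Ext N (on_laurent (app T) \<phi>) = app (lft T) (Ext N \<phi>)"
  by (auto simp: Ext_def on_laurent_def app_lft)

lemma map_nth1: "1 \<le> i \<Longrightarrow> i \<le> N \<Longrightarrow> map f [1..<Suc N] ! (i - 1) = f i"
  by (subst nth_map) (auto simp del: upt_Suc)

lemma map_upd1: "1 \<le> i \<Longrightarrow> i \<le> N \<Longrightarrow> (map f [1..<Suc N])[i - 1 := b] = map (f(i := b)) [1..<Suc N]"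
  by (rule nth_equalityI) (auto simp: nth_list_update simp del: upt_Suc)

lemma Ext_munit: "1 \<le> i \<Longrightarrow> i \<le> N \<Longrightarrow> Ext N (munit i a b \<phi>) = app (MU i a b) (Ext N \<phi>)"
  unfolding Ext_def munit_def by (rule ext) (simp add: app_MU map_nth1 map_upd1 del: upt_Suc One_nat_def)

lemma Kloc_wt: "Kloc_op q n i \<epsilon> \<phi> = (\<lambda>e. smul (q powi wt n \<epsilon> (e ! (i - 1))) (\<phi> e))"
  by (simp add: Kloc_op_def wt_def)

lemma inv_scaling:
  fixes c :: "'b \<Rightarrow> complex"
  assumes "\<And>e. c e \<noteq> 0"
  shows "inv_into UNIV (\<lambda>\<phi> e. smul (c e) (\<phi> e)) = (\<lambda>\<phi> e. smul (inverse (c e)) (\<phi> e :: 'a \<Rightarrow>\<^sub>0 complex))"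
  by (rule inv_equality) (simp_all add: assms fun_eq_iff)

lemma inv_Kloc: "q \<noteq> 0 \<Longrightarrow> inv_into UNIV (Kloc_op q n i \<epsilon>) = (\<lambda>\<phi> e. smul (q powi - wt n \<epsilon> (e ! (i - 1))) (\<phi> e))"
  unfolding Kloc_wt[abs_def] by (subst inv_scaling) (simp_all add: power_int_minus)

lemma op_prod_scaling: "q \<noteq> 0 \<Longrightarrow> op_prod (map (\<lambda>j \<phi> e. smul (q powi w j e) (\<phi> e)) js) \<phi> = (\<lambda>e. smul (q powi (\<Sum>j\<leftarrow>js. w j e)) (\<phi> e))"
  by (induction js) (simp_all add: op_prod_def power_int_add)

lemma sum_list_upt: "(\<Sum>j\<leftarrow>[a..<b]. w j) = (\<Sum>j\<in>{a..<b}. w j)" for w :: "nat \<Rightarrow> int"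
  by (simp add: sum_list_distinct_conv_sum_set)

lemma K_op_eq: "q \<noteq> 0 \<Longrightarrow> K_op q n N \<epsilon> = (\<lambda>\<phi> e. smul (q powi (\<Sum>j\<in>{1..N}. wt n \<epsilon> (e ! (j - 1)))) (\<phi> e))"
  unfolding K_op_def Kloc_wt[abs_def]
  by (subst fun_eq_iff, subst op_prod_scaling) (simp_all add: sum_list_upt atLeastLessThanSuc_atLeastAtMost del: upt_Suc)

definition GX :: "complex \<Rightarrow> complex \<Rightarrow> nat \<Rightarrow> gen \<Rightarrow> nat \<Rightarrow> ften endo" where
  "GX q p n x N = (case x of
       GenE \<epsilon> \<Rightarrow> EF n q (yiL q p N) N \<epsilon>
     | GenF \<epsilon> \<Rightarrow> FF n q (yL q p N) N \<epsilon>
     | GenK \<epsilon> \<Rightarrow> KF n q N \<epsilon>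
     | GenKinv \<epsilon> \<Rightarrow> LF n q N \<epsilon>)"

lemma y_zpow:
  assumes "q \<noteq> 0" "p \<noteq> 0" "1 \<le> i"
  shows "op_zpow (y_op q p N i) l = app (yzp q p N i l)"
  unfolding y_op_app[OF assms(1,3)] by (rule op_zpow_app) (simp_all add: yL_inv assms)

lemma Ext_gen_op:
  assumes q: "q \<noteq> 0" and p: "p \<noteq> 0"
  shows "Ext N (gen_op q p n x N \<phi>) = app (GX q p n x N) (Ext N \<phi>)"
proof (cases x)
  case (GenE \<epsilon>)
  have "Ext N (on_laurent (op_zpow (y_op q p N i) (if \<epsilon> = 0 then - 1 else 0)) (munit i (cyc n \<epsilon>) (cyc n (\<epsilon> + 1))
         (op_prod (map (\<lambda>j. Kloc_op q n j \<epsilon>) [i + 1..<N + 1]) \<phi>)))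
    = app (eS n (yiL q p N i) i \<epsilon> * DG (\<lambda>f. q powi (\<Sum>k\<in>{i<..N}. wt n \<epsilon> (f k)))) (Ext N \<phi>)" if i: "i \<in> {1..N}" for i
  proof -
    have z: "op_zpow (y_op q p N i) (if \<epsilon> = 0 then - 1 else 0) = app (if \<epsilon> = 0 then yiL q p N i else 1)"
      using i by (simp add: y_zpow q p zpw_def)
    have "Ext N (op_prod (map (\<lambda>j. Kloc_op q n j \<epsilon>) [i + 1..<N + 1]) \<phi>) = app (DG (\<lambda>f. q powi (\<Sum>k\<in>{i<..N}. wt n \<epsilon> (f k)))) (Ext N \<phi>)"
    proof (rule ext)
      fix f
      have "(\<Sum>j\<in>{i + 1..<N + 1}. wt n \<epsilon> (map f [1..<Suc N] ! (j - 1))) = (\<Sum>k\<in>{i<..N}. wt n \<epsilon> (f k))"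
        by (rule sum.cong) (auto simp: map_nth1 simp del: upt_Suc)
      then show "Ext N (op_prod (map (\<lambda>j. Kloc_op q n j \<epsilon>) [i + 1..<N + 1]) \<phi>) f
         = app (DG (\<lambda>f. q powi (\<Sum>k\<in>{i<..N}. wt n \<epsilon> (f k)))) (Ext N \<phi>) f"
        unfolding Kloc_wt[abs_def] op_prod_scaling[OF q] Ext_def by (simp add: sum_list_upt app_DG del: upt_Suc)
    qed
    then show ?thesis using i by (simp add: z Ext_on_laurent Ext_munit eS_def app_mult)
  qed
  then show ?thesis
    unfolding GenE gen_op_def GX_def by (simp add: E_op_def EF_def Ext_sum app_op_sum)
next
  case (GenF \<epsilon>)
  have "Ext N (on_laurent (op_zpow (y_op q p N i) (if \<epsilon> = 0 then 1 else 0))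
       (op_prod (map (\<lambda>j. inv_into UNIV (Kloc_op q n j \<epsilon>)) [1..<i])
         (munit i (cyc n (\<epsilon> + 1)) (cyc n \<epsilon>) \<phi>)))
    = app (DG (\<lambda>f. q powi - (\<Sum>k\<in>{1..<i}. wt n \<epsilon> (f k))) * fS n (yL q p N i) i \<epsilon>) (Ext N \<phi>)" if i: "i \<in> {1..N}" for i
  proof -
    have z: "op_zpow (y_op q p N i) (if \<epsilon> = 0 then 1 else 0) = app (if \<epsilon> = 0 then yL q p N i else 1)"
      using i by (simp add: y_zpow q p zpw_def)
    have D: "Ext N (op_prod (map (\<lambda>j. inv_into UNIV (Kloc_op q n j \<epsilon>)) [1..<i]) \<psi>) = app (DG (\<lambda>f. q powi - (\<Sum>k\<in>{1..<i}. wt n \<epsilon> (f k)))) (Ext N \<psi>)" for \<psi>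
    proof (rule ext)
      fix f
      have "(\<Sum>j\<in>{1..<i}. - wt n \<epsilon> (map f [1..<Suc N] ! (j - 1))) = - (\<Sum>k\<in>{1..<i}. wt n \<epsilon> (f k))"
        unfolding sum_negf[symmetric] using i by (intro sum.cong) (auto simp: map_nth1 simp del: upt_Suc)
      then show "Ext N (op_prod (map (\<lambda>j. inv_into UNIV (Kloc_op q n j \<epsilon>)) [1..<i]) \<psi>) f
         = app (DG (\<lambda>f. q powi - (\<Sum>k\<in>{1..<i}. wt n \<epsilon> (f k)))) (Ext N \<psi>) f"
        unfolding inv_Kloc[OF q] op_prod_scaling[OF q] Ext_def by (simp add: sum_list_upt app_DG del: upt_Suc)
    qed
    have "lft (if \<epsilon> = 0 then yL q p N i else 1) * DG (\<lambda>f. q powi - (\<Sum>k\<in>{1..<i}. wt n \<epsilon> (f k)))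
      = DG (\<lambda>f. q powi - (\<Sum>k\<in>{1..<i}. wt n \<epsilon> (f k))) * lft (if \<epsilon> = 0 then yL q p N i else 1)"
      by (rule lft_DG) (simp add: linop_yL)
    note c = arg_cong[OF this, of "\<lambda>T. app T x" for x, unfolded app_mult]
    have i': "1 \<le> i" "i \<le> N" using i by auto
    show ?thesis unfolding z Ext_on_laurent D Ext_munit[OF i'] fS_def by (simp only: app_mult c)
  qed
  then show ?thesis
    unfolding GenF gen_op_def GX_def by (simp add: F_op_def FF_def Ext_sum app_op_sum)
next
  case (GenK \<epsilon>)
  have "(\<Sum>j\<in>{1..N}. wt n \<epsilon> (map f [1..<Suc N] ! (j - 1))) = (\<Sum>j\<in>{1..N}. wt n \<epsilon> (f j))" for f
    by (rule sum.cong) (auto simp: map_nth1 simp del: upt_Suc)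
  then show ?thesis unfolding GenK gen_op_def GX_def
    by (simp add: K_op_eq q KF_def Ext_def fun_eq_iff app_DG del: upt_Suc)
next
  case (GenKinv \<epsilon>)
  have "(\<Sum>j\<in>{1..N}. wt n \<epsilon> (map f [1..<Suc N] ! (j - 1))) = (\<Sum>j\<in>{1..N}. wt n \<epsilon> (f j))" for f
    by (rule sum.cong) (auto simp: map_nth1 simp del: upt_Suc)
  then show ?thesis unfolding GenKinv gen_op_def GX_def gen.simps K_op_eq[OF q]
    by (subst inv_scaling) (simp_all add: q LF_def Ext_def fun_eq_iff app_DG power_int_minus del: upt_Suc)
qed

lemma Ext_h_op:
  assumes q: "q \<noteq> 0" and p: "p \<noteq> 0"
  shows "Ext N (h_op q p l N \<phi>) = app (HF q p l N) (Ext N \<phi>)"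
  unfolding h_op_def HF_def app_op_sum Ext_sum
  by (rule sum.cong) (auto simp: y_zpow q p Ext_on_laurent)


section \<open>Exponent sets\<close>

definition LS :: "exps set \<Rightarrow> laurent set" where "LS D = {f. keys f \<subseteq> D}"

lemma LS_0 [simp]: "0 \<in> LS D" by (simp add: LS_def)
lemma LS_add: "f \<in> LS D \<Longrightarrow> g \<in> LS D \<Longrightarrow> f + g \<in> LS D"
  using keys_add[of f g] by (auto simp: LS_def)
lemma LS_smul: "f \<in> LS D \<Longrightarrow> smul c f \<in> LS D"
  by (auto simp: LS_def in_keys_iff)
lemma LS_uminus: "f \<in> LS D \<Longrightarrow> - f \<in> LS D"
  by (auto simp: LS_def in_keys_iff)
lemma LS_diff: "f \<in> LS D \<Longrightarrow> g \<in> LS D \<Longrightarrow> f - g \<in> LS D"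
  using LS_add[OF _ LS_uminus, of f D g] by simp
lemma LS_sum: "(\<And>i. i \<in> I \<Longrightarrow> f i \<in> LS D) \<Longrightarrow> (\<Sum>i\<in>I. f i) \<in> LS D"
  by (induction I rule: infinite_finite_induct) (auto intro: LS_add)
lemma LS_Z: "single m c \<in> LS D \<longleftrightarrow> c = 0 \<or> m \<in> D"
  by (auto simp: LS_def)

text \<open>
  Exponent sets closed under all interpolations \<open>z\<^sub>i\<^sup>a z\<^sub>j\<^sup>b \<mapsto> z\<^sub>i\<^sup>c z\<^sub>j\<^sup>a\<^sup>+\<^sup>b\<^sup>-\<^sup>c\<close> with \<open>c\<close> between \<open>a\<close> and \<open>b\<close>.
\<close>

definition closed_exps :: "nat \<Rightarrow> exps set \<Rightarrow> bool" where
  "closed_exps N D \<longleftrightarrow> (\<forall>m\<in>D. \<forall>i\<in>{1..N}. \<forall>j\<in>{1..N}. \<forall>t. i \<noteq> j \<longrightarrow>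
     (let d = lookup m j - lookup m i in min 0 d \<le> t \<and> t \<le> max 0 d) \<longrightarrow> shift i j t m \<in> D)"

definition pres :: "exps set \<Rightarrow> laurent endo \<Rightarrow> bool" where
  "pres D T \<longleftrightarrow> (\<forall>f\<in>LS D. app T f \<in> LS D)"

lemma presI:
  assumes "linop T" "\<And>m. m \<in> D \<Longrightarrow> app T (Z m) \<in> LS D"
  shows "pres D T"
  unfolding pres_def
proof
  fix f assume f: "f \<in> LS D"
  have "app T f = (\<Sum>k\<in>keys f. app T (smul (lookup f k) (Z k)))"
    by (subst pm_sum_singles[of f]) (simp add: app_arg_sum)
  also have "\<dots> \<in> LS D"
    unfolding linop_smul[OF assms(1)] using f by (intro LS_sum LS_smul assms(2)) (auto simp: LS_def)
  finally show "app T f \<in> LS D" .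
qed

lemma pres_1 [simp]: "pres D 1" by (simp add: pres_def)
lemma pres_mult: "pres D S \<Longrightarrow> pres D T \<Longrightarrow> pres D (S * T)" by (simp add: pres_def app_mult)
lemma pres_power: "pres D S \<Longrightarrow> pres D (S ^ k)" by (induction k) (auto intro: pres_mult)
lemma pres_sc: "pres D (scL c)" by (simp add: pres_def LS_smul)
lemma pres_diff: "pres D S \<Longrightarrow> pres D T \<Longrightarrow> pres D (S - T)" by (simp add: pres_def app_op_minus LS_diff)
lemma pres_prod_list: "(\<And>x. x \<in> set xs \<Longrightarrow> pres D (f x)) \<Longrightarrow> pres D (prod_list (map f xs))"
  by (induction xs) (auto intro: pres_mult)
lemma pres_zpw: "pres D S \<Longrightarrow> pres D T \<Longrightarrow> pres D (zpw S T l)"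
  by (simp add: zpw_def pres_power)

lemma linop_pL: "linop (pL p i)" by (simp add: linop_def scL_comm)

lemma pres_pL: "pres D (pL p i)"
  by (rule presI) (auto simp: linop_pL LS_Z)

context
  fixes N D assumes D: "closed_exps N D"
begin

lemma closedD:
  assumes "m \<in> D" "i \<in> {1..N}" "j \<in> {1..N}" "i \<noteq> j"
    "min 0 (lookup m j - lookup m i) \<le> t" "t \<le> max 0 (lookup m j - lookup m i)"
  shows "shift i j t m \<in> D"
  using D assms unfolding closed_exps_def Let_def by blast

lemma closed_swap: "m \<in> D \<Longrightarrow> i \<in> {1..N} \<Longrightarrow> j \<in> {1..N} \<Longrightarrow> i \<noteq> j \<Longrightarrow> pmswap i j m \<in> D"
  by (simp add: pmswap_shift closedD)

text \<open>By the monomial formula, \<open>g z^m\<close> involves only interpolations between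
  \<open>m\<close> and its transposition, and these stay in a closed set.\<close>

lemma pres_ops:
  assumes ij: "i \<in> {1..N}" "j \<in> {1..N}" "i \<noteq> j"
  shows "pres D (gL q i j)" "pres D (giL q i j)" "pres D (KL i j)" "pres D (xiL q i j)" "pres D (xiiL q i j)"
proof -
  show g: "pres D (gL q i j)"
  proof (rule presI)
    fix m assume m: "m \<in> D"
    have s: "(\<Sum>t\<in>T. Z (shift i j t m)) \<in> LS D"
      if "\<And>t. t \<in> T \<Longrightarrow> min 0 (lookup m j - lookup m i) \<le> t \<and> t \<le> max 0 (lookup m j - lookup m i)" for T
      using that closedD[OF m ij] by (intro LS_sum) (auto simp: LS_Z)
    show "app (gL q i j) (Z m) \<in> LS D"
      unfolding app_gL[OF ij(3)] g_op_Z[OF ij(3)] Let_def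
      using m closed_swap[OF m ij]
      by (auto simp: LS_Z simp del: smul_single intro!: LS_add LS_smul s)
  qed (use ij in simp)
  show k: "pres D (KL i j)"
    by (rule presI) (use ij closed_swap in \<open>auto simp: LS_Z\<close>)
  show gi: "pres D (giL q i j)" unfolding giL_def by (intro pres_diff g pres_sc)
  show "pres D (xiL q i j)" "pres D (xiiL q i j)" unfolding xiL_def xiiL_def by (intro pres_mult g gi k)+
qed

lemma pres_y:
  assumes "i \<in> {1..N}"
  shows "pres D (yL q p N i)" "pres D (yiL q p N i)"
  unfolding yL_def yiL_def YL_def YiL_def
  by (intro pres_mult pres_sc pres_prod_list pres_pL pres_ops; use assms in \<open>auto simp del: upt_Suc\<close>)+

end

text \<open>Tensors with exponents in a prescribed set. \<open>Dall N\<close> gives all tensors;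
  smaller closed sets give homogeneous pieces and spaces of error terms that the operators
  preserve.\<close>

definition TS :: "nat \<Rightarrow> nat \<Rightarrow> exps set \<Rightarrow> tensor set" where
  "TS n N D = {\<phi>. (\<forall>e. \<phi> e \<in> LS D) \<and> (\<forall>e. e \<notin> colours n N \<longrightarrow> \<phi> e = 0)}"

definition Dall :: "nat \<Rightarrow> exps set" where "Dall N = {m. keys m \<subseteq> {1..N}}"

lemma tensors_TS: "tensors n N = TS n N (Dall N)"
proof -
  have "laurents N = LS (Dall N)" by (auto simp: laurents_def LS_def Dall_def)
  then show ?thesis unfolding tensors_def TS_def using LS_0 by fastforce
qed

lemma TS_mono: "D \<subseteq> D' \<Longrightarrow> TS n N D \<subseteq> TS n N D'" by (auto simp: TS_def LS_def)

lemma closed_Dall: "closed_exps N (Dall N)"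
  unfolding closed_exps_def Dall_def Let_def by (auto simp: in_keys_iff lookup_shift split: if_splits)

lemma TS_0 [simp]: "0 \<in> TS n N D" by (simp add: TS_def)
lemma TS_add: "\<phi> \<in> TS n N D \<Longrightarrow> \<psi> \<in> TS n N D \<Longrightarrow> \<phi> + \<psi> \<in> TS n N D" by (auto simp: TS_def LS_add)
lemma TS_diff: "\<phi> \<in> TS n N D \<Longrightarrow> \<psi> \<in> TS n N D \<Longrightarrow> \<phi> - \<psi> \<in> TS n N D" by (auto simp: TS_def LS_diff)
lemma TS_smul: "\<phi> \<in> TS n N D \<Longrightarrow> tsmul c \<phi> \<in> TS n N D" by (auto simp: TS_def LS_smul tsmul_def)
lemma TS_sum: "(\<And>i. i \<in> I \<Longrightarrow> \<phi> i \<in> TS n N D) \<Longrightarrow> (\<Sum>i\<in>I. \<phi> i) \<in> TS n N D"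
  by (induction I rule: infinite_finite_induct) (auto intro: TS_add)
lemma TS_scaling: "\<phi> \<in> TS n N D \<Longrightarrow> (\<lambda>e. smul (c e) (\<phi> e)) \<in> TS n N D" by (auto simp: TS_def LS_smul)
lemma TS_on_laurent: "pres D T \<Longrightarrow> \<phi> \<in> TS n N D \<Longrightarrow> on_laurent (app T) \<phi> \<in> TS n N D"
  by (auto simp: TS_def pres_def on_laurent_def)

lemma TS_munit:
  assumes "a \<in> {1..n}" "b \<in> {1..n}" "\<phi> \<in> TS n N D"
  shows "munit i a b \<phi> \<in> TS n N D"
proof -
  have "\<phi> (e[i - 1 := b]) = 0" if "e \<notin> colours n N" "e ! (i - 1) = a" for e
  proof (cases "i - 1 < length e")
    case True
    have "e[i - 1 := b] \<notin> colours n N"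
    proof
      assume "e[i - 1 := b] \<in> colours n N"
      moreover have "e = (e[i - 1 := b])[i - 1 := a]" by (metis list_update_id list_update_overwrite that(2))
      moreover have "set ((e[i - 1 := b])[i - 1 := a]) \<subseteq> insert a (set (e[i - 1 := b]))" by (rule set_update_subset_insert)
      ultimately have "e \<in> colours n N" using assms(1) by (auto simp: colours_def)
      then show False using that by simp
    qed
    then show ?thesis using assms by (auto simp: TS_def)
  next
    case False
    then show ?thesis using that assms by (auto simp: TS_def list_update_beyond)
  qed
  then show ?thesis using assms by (auto simp: TS_def munit_def)
qed

lemma TS_gen_op:
  assumes n: "n \<ge> 2" and q: "q \<noteq> 0" and p: "p \<noteq> 0" and D: "closed_exps N D" and \<phi>: "\<phi> \<in> TS n N D"
  shows "gen_op q p n x N \<phi> \<in> TS n N D"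
proof -
  have cr: "cyc n a \<in> {1..n}" for a using cyc_range[of n a] n by simp
  have z: "pres D (yzp q p N i l)" if "i \<in> {1..N}" for i l
    by (intro pres_zpw pres_y D that)
  have E: "E_op q p n N \<epsilon> \<phi> \<in> TS n N D" for \<epsilon>
    unfolding E_op_def
  proof (rule TS_sum)
    fix i assume i: "i \<in> {1..N}"
    then have i1: "1 \<le> i" by simp
    show "on_laurent (op_zpow (y_op q p N i) (if \<epsilon> = 0 then - 1 else 0)) (munit i (cyc n \<epsilon>) (cyc n (\<epsilon> + 1))
         (op_prod (map (\<lambda>j. Kloc_op q n j \<epsilon>) [i + 1..<N + 1]) \<phi>)) \<in> TS n N D"
      unfolding y_zpow[OF q p i1] Kloc_wt[abs_def] op_prod_scaling[OF q]
      by (intro TS_on_laurent z i TS_munit cr TS_scaling \<phi>)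
  qed
  have F: "F_op q p n N \<epsilon> \<phi> \<in> TS n N D" for \<epsilon>
    unfolding F_op_def
  proof (rule TS_sum)
    fix i assume i: "i \<in> {1..N}"
    then have i1: "1 \<le> i" by simp
    show "on_laurent (op_zpow (y_op q p N i) (if \<epsilon> = 0 then 1 else 0))
       (op_prod (map (\<lambda>j. inv_into UNIV (Kloc_op q n j \<epsilon>)) [1..<i])
         (munit i (cyc n (\<epsilon> + 1)) (cyc n \<epsilon>) \<phi>)) \<in> TS n N D"
      unfolding y_zpow[OF q p i1] inv_Kloc[OF q] op_prod_scaling[OF q]
      by (intro TS_on_laurent z i TS_munit cr TS_scaling \<phi>)
  qed
  have K: "K_op q n N \<epsilon> \<phi> \<in> TS n N D" "inv_into UNIV (K_op q n N \<epsilon>) \<phi> \<in> TS n N D" for \<epsilon>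
  proof -
    show "K_op q n N \<epsilon> \<phi> \<in> TS n N D" unfolding K_op_eq[OF q] by (rule TS_scaling[OF \<phi>])
    show "inv_into UNIV (K_op q n N \<epsilon>) \<phi> \<in> TS n N D" unfolding K_op_eq[OF q]
      by (subst inv_scaling) (simp_all add: q TS_scaling[OF \<phi>])
  qed
  show ?thesis using E F K by (cases x) (simp_all add: gen_op_def)
qed

lemma TS_h_op:
  assumes q: "q \<noteq> 0" and p: "p \<noteq> 0" and D: "closed_exps N D" and \<phi>: "\<phi> \<in> TS n N D"
  shows "h_op q p l N \<phi> \<in> TS n N D"
  unfolding h_op_def
proof (rule TS_sum)
  fix i assume i: "i \<in> {1..N}"
  then have i1: "1 \<le> i" by simp
  show "on_laurent (op_zpow (y_op q p N i) l) \<phi> \<in> TS n N D"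
    unfolding y_zpow[OF q p i1] by (intro TS_on_laurent pres_zpw pres_y D i \<phi>)
qed

lemma TS_ham_op:
  assumes "q \<noteq> 0" "p \<noteq> 0" "closed_exps N D" "\<phi> \<in> TS n N D"
  shows "ham_op q p n s M l N \<phi> \<in> TS n N D"
  unfolding ham_op_def by (intro TS_diff TS_smul TS_h_op assms)

lemma Ext_inj:
  assumes "\<phi> \<in> tensors n N" "\<psi> \<in> tensors n N" "Ext N \<phi> = Ext N \<psi>"
  shows "\<phi> = \<psi>"
proof
  fix e
  show "\<phi> e = \<psi> e"
  proof (cases "e \<in> colours n N")
    case True
    then have "map (\<lambda>i. e ! (i - 1)) [1..<Suc N] = e"
      by (intro nth_equalityI) (auto simp: colours_def simp del: upt_Suc)
    then show ?thesis using fun_cong[OF assms(3), of "\<lambda>i. e ! (i - 1)"] by (simp add: Ext_def del: upt_Suc)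
  next
    case False
    then show ?thesis using assms by (simp add: tensors_def)
  qed
qed

lemma Ext_colours:
  assumes "\<phi> \<in> tensors n N" "i \<in> {1..N}" "Ext N \<phi> f \<noteq> 0"
  shows "f i \<in> {1..n}"
proof -
  have "map f [1..<Suc N] \<in> colours n N" using assms by (auto simp: Ext_def tensors_def simp del: upt_Suc)
  then have "f ` {1..<Suc N} \<subseteq> {1..n}" by (auto simp: colours_def simp del: upt_Suc)
  moreover have "f i \<in> f ` {1..<Suc N}" using assms(2) by auto
  ultimately show ?thesis by blast
qed

lemma good_at_Ext: "\<phi> \<in> tensors n N \<Longrightarrow> 1 \<le> i \<Longrightarrow> i < N \<Longrightarrow> good_at n i (Ext N \<phi>)"
  using Ext_colours[of \<phi> n N] unfolding good_at_def by auto

lemma Ext_S_op: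
  assumes \<phi>: "\<phi> \<in> tensors n N" and i: "1 \<le> i" "i < N"
  shows "Ext N (S_op q n i \<phi>) = app (ST q i) (Ext N \<phi>)"
proof
  fix f
  let ?\<phi> = "Ext N \<phi>"
  have E: "Ext N (munit i a b (munit (i + 1) c d \<phi>)) f = (if f i = a \<and> f (Suc i) = c then ?\<phi> (f(i := b, Suc i := d)) else 0)" for a b c d
    using i by (simp add: Ext_munit app_MU)
  let ?I = "f i \<in> {1..n} \<and> f (Suc i) \<in> {1..n}"
  have z: "?\<phi> f = 0" "?\<phi> (swf i f) = 0" if "\<not> ?I"
    using Ext_colours[OF \<phi>, of i f] Ext_colours[OF \<phi>, of "Suc i" f] Ext_colours[OF \<phi>, of i "swf i f"]
      Ext_colours[OF \<phi>, of "Suc i" "swf i f"] i that by auto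
  have fin: "finite {(a, b). a \<in> {1..n} \<and> b \<in> {1..n} \<and> P a b}" for P
    by (rule finite_subset[of _ "{1..n} \<times> {1..n}"]) auto
  have 1: "(\<Sum>a\<in>{1..n}. Ext N (munit i a a (munit (i + 1) a a \<phi>)) f) = (if f i = f (Suc i) then ?\<phi> f else 0)"
  proof -
    have "(\<Sum>a\<in>{1..n}. Ext N (munit i a a (munit (i + 1) a a \<phi>)) f) = (\<Sum>a\<in>{1..n}. if f i = a then (if f (Suc i) = a then ?\<phi> f else 0) else 0)"
      unfolding E by (intro sum.cong) (auto simp: fun_upd_idem)
    also have "\<dots> = (if f i = f (Suc i) then ?\<phi> f else 0)" using z by (subst sum.delta') auto
    finally show ?thesis .
  qed
  have 2: "(\<Sum>(a, b)\<in>{(a, b). a \<in> {1..n} \<and> b \<in> {1..n} \<and> P a b}. Ext N (munit i a (u a b) (munit (i + 1) b (v a b) \<phi>)) f)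
     = (if ?I \<and> P (f i) (f (Suc i)) then ?\<phi> (f(i := u (f i) (f (Suc i)), Suc i := v (f i) (f (Suc i)))) else 0)" for P u v
  proof -
    have "(\<Sum>(a, b)\<in>{(a, b). a \<in> {1..n} \<and> b \<in> {1..n} \<and> P a b}. Ext N (munit i a (u a b) (munit (i + 1) b (v a b) \<phi>)) f)
       = (\<Sum>x\<in>{(a, b). a \<in> {1..n} \<and> b \<in> {1..n} \<and> P a b}. if (f i, f (Suc i)) = x then ?\<phi> (f(i := u (f i) (f (Suc i)), Suc i := v (f i) (f (Suc i)))) else 0)"
      unfolding E by (intro sum.cong) (auto split: if_splits)
    also have "\<dots> = (if ?I \<and> P (f i) (f (Suc i)) then ?\<phi> (f(i := u (f i) (f (Suc i)), Suc i := v (f i) (f (Suc i)))) else 0)"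
      by (subst sum.delta'[OF fin]) auto
    finally show ?thesis .
  qed
  have "Ext N (S_op q n i \<phi>) f = smul (- inverse q) (\<Sum>a\<in>{1..n}. Ext N (munit i a a (munit (i + 1) a a \<phi>)) f)
    + smul (q - inverse q) (\<Sum>(a, b)\<in>{(a, b). a \<in> {1..n} \<and> b \<in> {1..n} \<and> a < b}. Ext N (munit i a a (munit (i + 1) b b \<phi>)) f)
    - (\<Sum>(a, b)\<in>{(a, b). a \<in> {1..n} \<and> b \<in> {1..n} \<and> a \<noteq> b}. Ext N (munit i a b (munit (i + 1) b a \<phi>)) f)"
    unfolding S_op_def by (simp add: Ext_def tsmul_def sum_apply case_prod_unfold)
  also have "\<dots> = app (ST q i) ?\<phi> f"
    unfolding 1 2[where P = "\<lambda>a b. a < b" and u = "\<lambda>a b. a" and v = "\<lambda>a b. b"] 2[where P = "\<lambda>a b. a \<noteq> b" and u = "\<lambda>a b. b" and v = "\<lambda>a b. a"] app_ST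
    using z by (cases ?I) auto
  finally show "Ext N (S_op q n i \<phi>) f = app (ST q i) ?\<phi> f" .
qed

lemma TS_S_op: "\<phi> \<in> TS n N D \<Longrightarrow> S_op q n i \<phi> \<in> TS n N D"
  unfolding S_op_def by (intro TS_diff TS_add TS_smul TS_sum) (auto intro!: TS_munit)

definition kerX :: "complex \<Rightarrow> nat \<Rightarrow> nat \<Rightarrow> nat \<Rightarrow> tensor set" where
  "kerX q n N i = {\<phi> \<in> tensors n N. app (XO q i) (Ext N \<phi>) = - Ext N \<phi>}"

text \<open>Multiplying \<open>g + S^-1\<close> by \<open>S\<close> gives \<open>g S + 1\<close>.
  For this, the inverse of \<open>S_op\<close> on tensors is first identified with the explicit
  \<open>S_op - (q - q^-1)\<close>.\<close>

lemma gS_kernel_eq: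
  assumes q: "q \<noteq> 0" and i: "1 \<le> i" "i < N"
  shows "gS_kernel q n N i = kerX q n N i"
proof -
  define Si where "Si \<phi> = S_op q n i \<phi> - tsmul (q - inverse q) \<phi>" for \<phi>
  have Si: "Si \<phi> \<in> tensors n N" if "\<phi> \<in> tensors n N" for \<phi>
    using that unfolding tensors_TS Si_def by (intro TS_diff TS_smul TS_S_op)
  have S: "S_op q n i \<phi> \<in> tensors n N" if "\<phi> \<in> tensors n N" for \<phi>
    using that unfolding tensors_TS by (rule TS_S_op)
  have ESi: "Ext N (Si \<phi>) = app (STi q i) (Ext N \<phi>)" if "\<phi> \<in> tensors n N" for \<phi>
    using that i by (simp add: Si_def Ext_diff Ext_S_op Ext_tsmul STi_def app_op_minus)
  have SSi: "S_op q n i (Si \<phi>) = \<phi>" "Si (S_op q n i \<phi>) = \<phi>" if "\<phi> \<in> tensors n N" for \<phi>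
    using that S[OF that] Si[OF that] i
    by (auto intro!: Ext_inj[of _ n N] S Si simp: Ext_S_op ESi ST_inv[OF q] simp flip: app_mult)
  have inv: "inv_into (tensors n N) (S_op q n i) \<phi> = Si \<phi>" if "\<phi> \<in> tensors n N" for \<phi>
    using that by (intro inv_into_f_eq) (auto intro!: Si SSi inj_on_inverseI)
  have "on_laurent (g_op q i (i + 1)) \<phi> + inv_into (tensors n N) (S_op q n i) \<phi> = 0 \<longleftrightarrow> app (XO q i) (Ext N \<phi>) = - Ext N \<phi>"
    if \<phi>: "\<phi> \<in> tensors n N" for \<phi>
  proof -
    let ?g = "lft (gL q i (Suc i))" and ?x = "Ext N \<phi>"
    have g: "g_op q i (i + 1) = app (gL q i (Suc i))" by (simp add: app_gL)
    have gt: "on_laurent (app (gL q i (Suc i))) \<phi> \<in> tensors n N"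
      unfolding tensors_TS by (rule TS_on_laurent[OF pres_ops(1)[OF closed_Dall]]) (use i \<phi> tensors_TS in auto)
    have "on_laurent (g_op q i (i + 1)) \<phi> + inv_into (tensors n N) (S_op q n i) \<phi> = 0 \<longleftrightarrow>
       Ext N (on_laurent (app (gL q i (Suc i))) \<phi> + Si \<phi>) = Ext N 0"
    proof -
      have t: "on_laurent (app (gL q i (Suc i))) \<phi> + Si \<phi> \<in> tensors n N" "0 \<in> tensors n N"
        using gt Si[OF \<phi>] unfolding tensors_TS by (simp_all add: TS_add)
      show ?thesis unfolding inv[OF \<phi>] g by (rule iffI, simp only:, rule Ext_inj[OF t])
    qed
    also have "\<dots> \<longleftrightarrow> app (?g + STi q i) ?x = 0"
      unfolding Ext_add Ext_on_laurent ESi[OF \<phi>] Ext_0 app_op_add ..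
    also have "\<dots> \<longleftrightarrow> app (ST q i) (app (?g + STi q i) ?x) = 0"
    proof
      assume "app (ST q i) (app (?g + STi q i) ?x) = 0"
      then have "app (STi q i * ST q i) (app (?g + STi q i) ?x) = 0" by (simp only: app_mult app_arg_0)
      then show "app (?g + STi q i) ?x = 0" by (simp only: ST_inv(2)[OF q] app_1)
    qed (simp only: app_arg_0)
    also have "app (ST q i) (app (?g + STi q i) ?x) = app (XO q i) ?x + ?x"
      unfolding XO_def lft_gL_comm(1) by (simp only: app_mult[symmetric] distrib_left ST_inv[OF q]) (simp only: app_op_add app_1)
    finally show ?thesis unfolding eq_neg_iff_add_eq_0 .
  qed
  then show ?thesis by (auto simp: gS_kernel_def kerX_def)
qed

lemma kerX_0: "0 \<in> kerX q n N i" by (simp add: kerX_def tensors_TS Ext_0)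

lemma kerX_lin: "\<phi> \<in> kerX q n N i \<Longrightarrow> \<psi> \<in> kerX q n N i \<Longrightarrow> \<phi> + \<psi> \<in> kerX q n N i" "\<phi> \<in> kerX q n N i \<Longrightarrow> tsmul c \<phi> \<in> kerX q n N i"
proof -
  show "\<phi> \<in> kerX q n N i \<Longrightarrow> \<psi> \<in> kerX q n N i \<Longrightarrow> \<phi> + \<psi> \<in> kerX q n N i"
    by (simp add: kerX_def Ext_add app_arg_add tensors_TS TS_add)
  have "scF c * XO q i = XO q i * scF c" unfolding scF_def by (rule XO_DG) simp
  from XO_commuting[OF this] show "\<phi> \<in> kerX q n N i \<Longrightarrow> tsmul c \<phi> \<in> kerX q n N i"
    by (simp add: kerX_def Ext_tsmul tensors_TS TS_smul)
qed

lemma Omega_eq: "q \<noteq> 0 \<Longrightarrow> Omega q n N = {(\<Sum>i\<in>{1..<N}. \<omega> i) | \<omega>. \<forall>i\<in>{1..<N}. \<omega> i \<in> kerX q n N i}"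
  unfolding Omega_def using gS_kernel_eq[of q _ N n] by auto

lemma Omega_add: "q \<noteq> 0 \<Longrightarrow> \<phi> \<in> Omega q n N \<Longrightarrow> \<psi> \<in> Omega q n N \<Longrightarrow> \<phi> + \<psi> \<in> Omega q n N"
  unfolding Omega_eq
proof clarify
  fix \<omega> \<omega>' assume "\<forall>i\<in>{1..<N}. \<omega> i \<in> kerX q n N i" "\<forall>i\<in>{1..<N}. \<omega>' i \<in> kerX q n N i"
  then show "\<exists>\<omega>''. sum \<omega> {1..<N} + sum \<omega>' {1..<N} = sum \<omega>'' {1..<N} \<and> (\<forall>i\<in>{1..<N}. \<omega>'' i \<in> kerX q n N i)"
    by (intro exI[of _ "\<lambda>i. \<omega> i + \<omega>' i"]) (auto simp: sum.distrib kerX_lin)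
qed

lemma tsmul_sum: "tsmul c (\<Sum>i\<in>I. \<phi> i) = (\<Sum>i\<in>I. tsmul c (\<phi> i))"
  by (auto simp: tsmul_def sum_apply smul_sum)

lemma Omega_smul: "q \<noteq> 0 \<Longrightarrow> \<phi> \<in> Omega q n N \<Longrightarrow> tsmul c \<phi> \<in> Omega q n N"
  unfolding Omega_eq
proof clarify
  fix \<omega> assume "\<forall>i\<in>{1..<N}. \<omega> i \<in> kerX q n N i"
  then show "\<exists>\<omega>''. tsmul c (sum \<omega> {1..<N}) = sum \<omega>'' {1..<N} \<and> (\<forall>i\<in>{1..<N}. \<omega>'' i \<in> kerX q n N i)"
    by (intro exI[of _ "\<lambda>i. tsmul c (\<omega> i)"]) (auto simp: tsmul_sum kerX_lin)
qed

lemma Omega_0: "q \<noteq> 0 \<Longrightarrow> 0 \<in> Omega q n N"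
  unfolding Omega_eq by (rule CollectI, rule exI[of _ "\<lambda>_. 0"]) (simp add: kerX_0)

lemma tsmul_m1: "tsmul (- 1) \<phi> = - \<phi>" by (auto simp: tsmul_def smul_minus_left)

lemma Omega_diff: "q \<noteq> 0 \<Longrightarrow> \<phi> \<in> Omega q n N \<Longrightarrow> \<psi> \<in> Omega q n N \<Longrightarrow> \<phi> - \<psi> \<in> Omega q n N"
  using Omega_add[of q \<phi> n N "tsmul (- 1) \<psi>"] Omega_smul[of q \<psi> n N "- 1"] by (simp add: tsmul_m1)

lemma Omega_sum: "q \<noteq> 0 \<Longrightarrow> (\<And>i. i \<in> I \<Longrightarrow> \<phi> i \<in> Omega q n N) \<Longrightarrow> (\<Sum>i\<in>I. \<phi> i) \<in> Omega q n N"
  by (induction I rule: infinite_finite_induct) (auto intro: Omega_add Omega_0)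

lemma kerX_Omega:
  assumes "q \<noteq> 0" "1 \<le> i" "i < N" "\<phi> \<in> kerX q n N i"
  shows "\<phi> \<in> Omega q n N"
  unfolding Omega_eq[OF assms(1)]
proof (rule CollectI, rule exI[of _ "\<lambda>j. if j = i then \<phi> else 0"], intro conjI)
  show "\<phi> = (\<Sum>j\<in>{1..<N}. if j = i then \<phi> else 0)" by (subst sum.delta) (use assms in auto)
qed (use assms kerX_0 in auto)

lemma Omega_tensors: "q \<noteq> 0 \<Longrightarrow> \<phi> \<in> Omega q n N \<Longrightarrow> \<phi> \<in> tensors n N"
  unfolding Omega_eq tensors_TS by (auto intro!: TS_sum simp: kerX_def tensors_TS)

text \<open>The straightening rule: in the wedge product \<open>g_i\<close> may be replaced by
  \<open>S_i\<close>. It holds since \<open>g - S\<close> maps into the \<open>-1\<close> eigenspace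
  of \<open>g S\<close>.\<close>

lemma gS_relation:
  assumes q: "q \<noteq> 0" and i: "1 \<le> i" "i < N" and \<phi>: "\<phi> \<in> tensors n N"
  shows "on_laurent (app (gL q i (Suc i))) \<phi> - S_op q n i \<phi> \<in> Omega q n N"
proof (rule kerX_Omega[OF q i])
  have "on_laurent (app (gL q i (Suc i))) \<phi> - S_op q n i \<phi> \<in> tensors n N"
    using \<phi> i unfolding tensors_TS by (intro TS_diff TS_on_laurent TS_S_op pres_ops[OF closed_Dall]) auto
  then show "on_laurent (app (gL q i (Suc i))) \<phi> - S_op q n i \<phi> \<in> kerX q n N i"
    using app_annihilated[OF XO_annihilates(3)[OF q]]
    by (simp only: kerX_def mem_Collect_eq Ext_diff Ext_on_laurent Ext_S_op[OF \<phi> i] app_op_minus[symmetric])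
qed

lemma kerX_preserved_Omega:
  assumes q: "q \<noteq> 0" and X: "\<And>i \<phi>. i \<in> {1..<N} \<Longrightarrow> \<phi> \<in> kerX q n N i \<Longrightarrow> X \<phi> \<in> kerX q n N i"
    and add: "\<And>\<phi> \<psi>. \<phi> \<in> tensors n N \<Longrightarrow> \<psi> \<in> tensors n N \<Longrightarrow> X (\<phi> + \<psi>) = X \<phi> + X \<psi>"
    and \<phi>: "\<phi> \<in> Omega q n N"
  shows "X \<phi> \<in> Omega q n N"
proof -
  obtain \<omega> where \<omega>: "\<phi> = (\<Sum>i\<in>{1..<N}. \<omega> i)" "\<forall>i\<in>{1..<N}. \<omega> i \<in> kerX q n N i" using \<phi> Omega_eq[OF q] by auto
  have "X 0 + X 0 = X 0 + 0" using add[of 0 0] by (simp add: tensors_TS)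
  then have X0: "X 0 = 0" by (rule add_left_imp_eq)
  have "X (\<Sum>i\<in>I. \<omega> i) = (\<Sum>i\<in>I. X (\<omega> i)) \<and> (\<Sum>i\<in>I. \<omega> i) \<in> tensors n N" if "finite I" "I \<subseteq> {1..<N}" for I
    using that
  proof (induction I)
    case (insert i I)
    then have "\<omega> i \<in> tensors n N" using \<omega> by (auto simp: kerX_def)
    moreover have "(\<Sum>i\<in>I. \<omega> i) \<in> tensors n N" "X (\<Sum>i\<in>I. \<omega> i) = (\<Sum>i\<in>I. X (\<omega> i))" using insert by auto
    ultimately show ?case using TS_add add unfolding sum.insert[OF insert.hyps] tensors_TS by metis
  qed (simp add: X0 tensors_TS)
  then have "X \<phi> = (\<Sum>i\<in>{1..<N}. X (\<omega> i))" using \<omega> by simp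
  then show ?thesis using \<omega> X unfolding Omega_eq[OF q] by (auto intro!: exI[of _ "\<lambda>i. X (\<omega> i)"])
qed

lemma gen_op_linear:
  assumes n: "n \<ge> 2" and q: "q \<noteq> 0" and p: "p \<noteq> 0" and \<phi>: "\<phi> \<in> tensors n N" and \<psi>: "\<psi> \<in> tensors n N"
  shows "gen_op q p n x N (\<phi> + \<psi>) = gen_op q p n x N \<phi> + gen_op q p n x N \<psi>"
proof (rule Ext_inj[of _ n N])
  show "gen_op q p n x N (\<phi> + \<psi>) \<in> tensors n N" "gen_op q p n x N \<phi> + gen_op q p n x N \<psi> \<in> tensors n N"
    using \<phi> \<psi> unfolding tensors_TS by (auto intro!: TS_add TS_gen_op n q p closed_Dall)
qed (simp only: Ext_gen_op[OF q p] Ext_add app_arg_add)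

lemma GX_scF: "q \<noteq> 0 \<Longrightarrow> GX q p n x N * scF c = scF c * GX q p n x N"
proof -
  assume "q \<noteq> 0"
  have "EF n q y m i * scF c = scF c * EF n q y m i" "FF n q y m i * scF c = scF c * FF n q y m i"
    if "\<And>i. linop (y i)" for y m i
    unfolding EF_def FF_def sum_distrib_left sum_distrib_right
    by (intro sum.cong refl commute_mult_left scF_DG eS_cent that)+
  then show ?thesis by (auto simp: GX_def KF_def LF_def scF_DG linop_yL split: gen.split)
qed

lemma gen_op_smul:
  assumes n: "n \<ge> 2" and q: "q \<noteq> 0" and p: "p \<noteq> 0" and \<phi>: "\<phi> \<in> tensors n N"
  shows "gen_op q p n x N (tsmul c \<phi>) = tsmul c (gen_op q p n x N \<phi>)"
proof (rule Ext_inj[of _ n N])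
  show "gen_op q p n x N (tsmul c \<phi>) \<in> tensors n N" "tsmul c (gen_op q p n x N \<phi>) \<in> tensors n N"
    using \<phi> unfolding tensors_TS by (auto intro!: TS_smul TS_gen_op n q p closed_Dall)
qed (simp only: Ext_gen_op[OF q p] Ext_tsmul GX_scF[OF q] app_mult[symmetric])

lemma HF_scF: "q \<noteq> 0 \<Longrightarrow> p \<noteq> 0 \<Longrightarrow> HF q p l N * scF c = scF c * HF q p l N"
  unfolding HF_def sum_distrib_left sum_distrib_right
proof (intro sum.cong refl lft_scF)
  fix i assume "q \<noteq> 0" "p \<noteq> 0"
  then show "linop (yzp q p N i l)"
    by (rule linop_yzp)
qed

definition HX :: "complex \<Rightarrow> complex \<Rightarrow> nat \<Rightarrow> nat \<Rightarrow> int \<Rightarrow> int \<Rightarrow> nat \<Rightarrow> ften endo" where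
  "HX q p n s M l N = HF q p l N - scF (\<Sum>j\<in>{1..N}. p powi (l * m0 n s M j) * q powi (2 * l * (1 - int j)))"

lemma Ext_ham_op: "q \<noteq> 0 \<Longrightarrow> p \<noteq> 0 \<Longrightarrow> Ext N (ham_op q p n s M l N \<phi>) = app (HX q p n s M l N) (Ext N \<phi>)"
  by (simp add: ham_op_def HX_def Ext_diff Ext_h_op Ext_tsmul app_op_minus)

lemma ham_op_linear:
  assumes "q \<noteq> 0" "p \<noteq> 0" "\<phi> \<in> tensors n N" "\<psi> \<in> tensors n N"
  shows "ham_op q p n s M l N (\<phi> + \<psi>) = ham_op q p n s M l N \<phi> + ham_op q p n s M l N \<psi>"
proof (rule Ext_inj[of _ n N])
  show "ham_op q p n s M l N (\<phi> + \<psi>) \<in> tensors n N" "ham_op q p n s M l N \<phi> + ham_op q p n s M l N \<psi> \<in> tensors n N"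
    using assms unfolding tensors_TS by (auto intro!: TS_add TS_ham_op closed_Dall)
qed (simp only: Ext_ham_op[OF assms(1,2)] Ext_add app_arg_add)

lemma ham_op_smul:
  assumes "q \<noteq> 0" "p \<noteq> 0" "\<phi> \<in> tensors n N"
  shows "ham_op q p n s M l N (tsmul c \<phi>) = tsmul c (ham_op q p n s M l N \<phi>)"
proof -
  have "HX q p n s M l N * scF c = scF c * HX q p n s M l N"
    using assms scF_DG[of "\<lambda>_. d" c for d, folded scF_def]
    by (simp add: HX_def left_diff_distrib right_diff_distrib HF_scF)
  note c = this
  show ?thesis
  proof (rule Ext_inj[of _ n N])
    show "ham_op q p n s M l N (tsmul c \<phi>) \<in> tensors n N" "tsmul c (ham_op q p n s M l N \<phi>) \<in> tensors n N"
      using assms unfolding tensors_TS by (auto intro!: TS_smul TS_ham_op closed_Dall)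
  qed (simp only: Ext_ham_op[OF assms(1,2)] Ext_tsmul c app_mult[symmetric])
qed

lemma gen_op_Omega:
  assumes n: "n \<ge> 2" and q: "q \<noteq> 0" and p: "p \<noteq> 0" and x: "x \<in> gens n" and \<phi>: "\<phi> \<in> Omega q n N"
  shows "gen_op q p n x N \<phi> \<in> Omega q n N"
proof (rule kerX_preserved_Omega[OF q _ _ \<phi>])
  fix j \<phi> assume j: "j \<in> {1..<N}" and \<phi>: "\<phi> \<in> kerX q n N j"
  then have j': "1 \<le> j" "j < N" by auto
  have \<phi>': "\<phi> \<in> tensors n N" "app (XO q j) (Ext N \<phi>) = - Ext N \<phi>" using \<phi> by (auto simp: kerX_def)
  have good: "good_at n j (Ext N \<phi>)" by (rule good_at_Ext[OF \<phi>'(1) j'])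
  have gt: "gen_op q p n x N \<phi> \<in> tensors n N"
    using \<phi>'(1) unfolding tensors_TS by (rule TS_gen_op[OF n q p closed_Dall])
  \<comment> \<open>The inverted recursion, needed because \<open>E_0\<close> uses the inverses of
    the \<open>y_i\<close>.\<close>
  have yi: "yiL q p N (Suc j) = giL q j (Suc j) * yiL q p N j * giL q j (Suc j)"
  proof -
    have gi: "gL q j (Suc j) * giL q j (Suc j) = 1" using gL_inv q by simp
    have "yL q p N (Suc j) * (giL q j (Suc j) * yiL q p N j * giL q j (Suc j)) = 1"
      unfolding yL_Suc[OF j' q p] by (simp add: mult.assoc cancel_left[OF gi] cancel_left[OF yL_inv(1)[OF q p]] gi)
    then have "yiL q p N (Suc j) * (yL q p N (Suc j) * (giL q j (Suc j) * yiL q p N j * giL q j (Suc j))) = yiL q p N (Suc j)" by simp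
    then show ?thesis by (simp add: cancel_left[OF yL_inv(2)[OF q p]])
  qed
  have yc: "yL q p N i * gL q j (Suc j) = gL q j (Suc j) * yL q p N i"
    "yiL q p N i * gL q j (Suc j) = gL q j (Suc j) * yiL q p N i" if "i \<in> {1..N} - {j, Suc j}" for i
  proof -
    show c: "yL q p N i * gL q j (Suc j) = gL q j (Suc j) * yL q p N i"
      using yL_gL[OF q p, of i N j] that j' by auto
    show "yiL q p N i * gL q j (Suc j) = gL q j (Suc j) * yiL q p N i"
      using commute_inverse[OF c[symmetric] yL_inv[OF q p]] by simp
  qed
  have K: "KF n q N \<epsilon> * XO q j = XO q j * KF n q N \<epsilon>" "LF n q N \<epsilon> * XO q j = XO q j * LF n q N \<epsilon>" for \<epsilon>
    unfolding KF_def LF_def using j' by (intro XO_DG; subst sum_swap_invariant; auto)+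
  have "app (XO q j) (app (GX q p n x N) (Ext N \<phi>)) = - app (GX q p n x N) (Ext N \<phi>)"
    using x EF_preserves[OF n q j' _ yi yc(2) linop_yL(2) \<phi>'(2) good] FF_preserves[OF n q j' _ yL_Suc[OF j' q p] yc(1) linop_yL(1) \<phi>'(2) good]
      XO_commuting[OF K(1) \<phi>'(2)] XO_commuting[OF K(2) \<phi>'(2)]
    by (cases x) (auto simp: GX_def gens_def)
  then show "gen_op q p n x N \<phi> \<in> kerX q n N j"
    using gt by (simp add: kerX_def Ext_gen_op q p)
qed (use gen_op_linear n q p in blast)

lemma ham_op_Omega:
  assumes q: "q \<noteq> 0" and p: "p \<noteq> 0" and \<phi>: "\<phi> \<in> Omega q n N"
  shows "ham_op q p n s M l N \<phi> \<in> Omega q n N"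
proof (rule kerX_preserved_Omega[OF q _ _ \<phi>])
  fix j \<phi> assume j: "j \<in> {1..<N}" and \<phi>: "\<phi> \<in> kerX q n N j"
  then have j': "1 \<le> j" "j < N" by auto
  have \<phi>': "\<phi> \<in> tensors n N" "app (XO q j) (Ext N \<phi>) = - Ext N \<phi>" using \<phi> by (auto simp: kerX_def)
  have t: "ham_op q p n s M l N \<phi> \<in> tensors n N"
    using \<phi>'(1) unfolding tensors_TS by (rule TS_ham_op[OF q p closed_Dall])
  have "scF c * XO q j = XO q j * scF c" for c unfolding scF_def by (rule XO_DG) simp
  then have "HX q p n s M l N * XO q j = XO q j * HX q p n s M l N"
    by (simp add: HX_def left_diff_distrib right_diff_distrib HF_preserves[OF q p j'])
  from XO_commuting[OF this \<phi>'(2)] show "ham_op q p n s M l N \<phi> \<in> kerX q n N j"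
    using t by (simp add: kerX_def Ext_ham_op q p)
qed (use ham_op_linear q p in blast)

section \<open>Straightening\<close>

definition mono :: "exps \<Rightarrow> nat list \<Rightarrow> tensor" where
  "mono m e = (\<lambda>e'. if e' = e then Z m else 0)"

definition expo :: "nat \<Rightarrow> int list \<Rightarrow> exps" where
  "expo n ks = (\<Sum>i<length ks. single (i + 1) (zexp n (ks ! i)))"

lemma u_tensor_mono: "u_tensor n ks = mono (expo n ks) (map (col n) ks)"
  unfolding u_tensor_def mono_def expo_def ..

lemma lookup_expo: "lookup (expo n ks) j = (if 1 \<le> j \<and> j \<le> length ks then zexp n (ks ! (j - 1)) else 0)"
proof -
  have "lookup (expo n ks) j = (\<Sum>i<length ks. if i = j - 1 \<and> 1 \<le> j then zexp n (ks ! i) else 0)"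
    unfolding expo_def lookup_sum lookup_single when_def by (intro sum.cong) auto
  also have "\<dots> = (\<Sum>i<length ks. if i = j - 1 then (if 1 \<le> j then zexp n (ks ! i) else 0) else 0)"
    by (intro sum.cong) auto
  also have "\<dots> = (if 1 \<le> j \<and> j \<le> length ks then zexp n (ks ! (j - 1)) else 0)"
    by (subst sum.delta) auto
  finally show ?thesis .
qed

lemma expo_Dall: "length ks = N \<Longrightarrow> expo n ks \<in> Dall N"
  by (auto simp: Dall_def in_keys_iff lookup_expo split: if_splits)

lemma col_zexp:
  assumes "n > 0"
  shows "k = int (col n k) - int n * zexp n k" "col n k \<in> {1..n}"
proof -
  have "int (col n k) = (k - 1) mod int n + 1" using assms by (simp add: col_def)
  then have "int (col n k) - k = int n * - ((k - 1) div int n)"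
    using div_mult_mod_eq[of "k - 1" "int n"] by (simp add: algebra_simps)
  then show "k = int (col n k) - int n * zexp n k" using assms unfolding zexp_def by simp
  show "col n k \<in> {1..n}" using assms by (simp add: col_def) (metis int_nat_eq nat_less_iff of_nat_0_less_iff pos_mod_bound pos_mod_sign Suc_le_eq)
qed

lemma col_zexp_unique:
  assumes "n > 0" "e \<in> {1..n}"
  shows "col n (int e - int n * m) = e" "zexp n (int e - int n * m) = m"
proof -
  have "(int e - int n * m - 1) mod int n = (int e - 1) mod int n"
    using mod_mult_self2[of "int e - 1" "int n" "- m"] by (simp add: algebra_simps)
  also have "\<dots> = int e - 1" using assms by (intro mod_pos_pos_trivial) auto
  finally have r: "(int e - int n * m - 1) mod int n = int e - 1" .
  obtain k where k: "e = Suc k" using assms by (cases e) auto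
  show c: "col n (int e - int n * m) = e" using r unfolding k by (simp add: col_def)
  show "zexp n (int e - int n * m) = m" using assms by (simp add: zexp_def c)
qed

lemma col_map_colours: "n > 0 \<Longrightarrow> length ks = N \<Longrightarrow> map (col n) ks \<in> colours n N"
  using col_zexp(2)[of n] by (auto simp: colours_def)

text \<open>Recovers the integers \<open>k = \<epsilon> - n m\<close> from exponents and colours;
  positions are counted from \<open>0\<close>, variables from \<open>1\<close>.\<close>

definition ksof :: "nat \<Rightarrow> nat \<Rightarrow> exps \<Rightarrow> nat list \<Rightarrow> int list" where
  "ksof n N m e = map (\<lambda>i. int (e ! i) - int n * lookup m (i + 1)) [0..<N]"

lemma ksof:
  assumes "n > 0" "m \<in> Dall N" "e \<in> colours n N"
  shows "length (ksof n N m e) = N" "expo n (ksof n N m e) = m" "map (col n) (ksof n N m e) = e"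
proof -
  have e: "e ! i \<in> {1..n}" if "i < N" for i using assms(3) that by (auto simp: colours_def dest!: nth_mem)
  show l: "length (ksof n N m e) = N" by (simp add: ksof_def)
  show "expo n (ksof n N m e) = m"
  proof (rule poly_mapping_eqI)
    fix j
    have "lookup m j = 0" if "\<not> (1 \<le> j \<and> j \<le> N)"
      using assms(2) that by (auto simp: Dall_def in_keys_iff)
    moreover have "zexp n (ksof n N m e ! (j - 1)) = lookup m j" if "1 \<le> j" "j \<le> N"
    proof -
      have "j - 1 < N" "Suc (j - 1) = j" using that by auto
      then show ?thesis using col_zexp_unique(2)[OF assms(1) e[of "j - 1"]] by (simp add: ksof_def del: One_nat_def)
    qed
    ultimately show "lookup (expo n (ksof n N m e)) j = lookup m j"
      by (auto simp: lookup_expo l)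
  qed
  show "map (col n) (ksof n N m e) = e"
    by (rule nth_equalityI) (use assms in \<open>auto simp: l ksof_def colours_def intro!: col_zexp_unique e[unfolded colours_def]\<close>)
qed

lemma normal_adjacent:
  "ks \<in> normal_lists N \<longleftrightarrow> length ks = N \<and> (\<forall>i. Suc i < N \<longrightarrow> ks ! Suc i < ks ! i)"
proof -
  have "transp ((>) :: int \<Rightarrow> int \<Rightarrow> bool)" by (auto simp: transp_def)
  from sorted_wrt_iff_nth_Suc_transp[OF this] show ?thesis by (auto simp: normal_lists_def)
qed

text \<open>The residue part ranges over an interval of length below \<open>n\<close>, so the order
  of the \<open>k\<close> is lexicographic: smaller exponent first, then larger colour.\<close>

lemma k_less:
  assumes "n > 0" "e \<in> {1..n}" "e' \<in> {1..n}"
  shows "int e' - int n * m' < int e - int n * m \<longleftrightarrow> m < m' \<or> (m = m' \<and> e' < e)"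
proof -
  have h: "int n * m + int n \<le> int n * m'" if "m < m'" for m m' :: int
    using mult_left_mono[of "m + 1" m' "int n"] that by (simp add: distrib_left)
  consider "m < m'" | "m = m'" | "m' < m" by linarith
  then show ?thesis using h[of m m'] h[of m' m] assms by cases auto
qed

definition cmb :: "nat \<Rightarrow> (int list \<Rightarrow>\<^sub>0 complex) \<Rightarrow> tensor" where
  "cmb n c = (\<Sum>ks\<in>keys c. tsmul (lookup c ks) (u_tensor n ks))"

lemma tsmul_simps: "tsmul 0 \<phi> = 0" "tsmul (a + b) \<phi> = tsmul a \<phi> + tsmul b \<phi>" "tsmul a (\<phi> + \<psi>) = tsmul a \<phi> + tsmul a \<psi>"
  "tsmul a (tsmul b \<phi>) = tsmul (a * b) \<phi>" "tsmul 1 \<phi> = \<phi>" "tsmul a 0 = 0" "tsmul a (\<phi> - \<psi>) = tsmul a \<phi> - tsmul a \<psi>"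
  by (auto simp: tsmul_def smul_add_left smul_add smul_diff fun_eq_iff)

lemma cmb_superset:
  assumes "finite A" "keys c \<subseteq> A"
  shows "cmb n c = (\<Sum>ks\<in>A. tsmul (lookup c ks) (u_tensor n ks))"
  unfolding cmb_def
  by (rule sum.mono_neutral_left) (use assms in \<open>auto simp: in_keys_iff tsmul_def\<close>)

lemma cmb_add: "cmb n (c + d) = cmb n c + cmb n d"
proof -
  let ?A = "keys c \<union> keys d"
  have "cmb n (c + d) = (\<Sum>ks\<in>?A. tsmul (lookup (c + d) ks) (u_tensor n ks))"
    by (rule cmb_superset) (auto dest: subsetD[OF keys_add])
  then show ?thesis
    using cmb_superset[of ?A c n] cmb_superset[of ?A d n]
    by (simp only: lookup_add tsmul_simps(2) sum.distrib finite_UnI finite_keys Un_upper1 Un_upper2)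
qed

lemma cmb_smul: "cmb n (smul a c) = tsmul a (cmb n c)"
proof -
  have "cmb n (smul a c) = (\<Sum>ks\<in>keys c. tsmul (lookup (smul a c) ks) (u_tensor n ks))"
    by (rule cmb_superset) (auto simp: in_keys_iff)
  then show ?thesis by (simp add: cmb_def tsmul_sum tsmul_simps)
qed

lemma cmb_0 [simp]: "cmb n 0 = 0" by (simp add: cmb_def)

lemma cmb_diff: "cmb n (c - d) = cmb n c - cmb n d"
  using cmb_add[of n "c - d" d] by (simp add: algebra_simps)

lemma cmb_single: "cmb n (single ks a) = tsmul a (u_tensor n ks)"
  by (cases "a = 0") (simp_all add: cmb_def tsmul_simps)

lemma cmb_sum: "cmb n (\<Sum>i\<in>I. c i) = (\<Sum>i\<in>I. cmb n (c i))"
  by (induction I rule: infinite_finite_induct) (simp_all add: cmb_add del: plus_fun_apply)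

definition NL :: "nat \<Rightarrow> nat \<Rightarrow> exps set \<Rightarrow> int list set" where
  "NL n N D = {ks \<in> normal_lists N. expo n ks \<in> D}"

definition Str :: "complex \<Rightarrow> nat \<Rightarrow> nat \<Rightarrow> exps set \<Rightarrow> tensor \<Rightarrow> bool" where
  "Str q n N D \<phi> \<longleftrightarrow> (\<exists>c. keys c \<subseteq> NL n N D \<and> \<phi> - cmb n c \<in> Omega q n N)"

lemma finite_colours: "finite (colours n N)"
proof -
  have "finite {e. set e \<subseteq> {1..n} \<and> length e = N}" by (rule finite_lists_length_eq) simp
  then show ?thesis by (rule finite_subset[rotated]) (auto simp: colours_def)
qed

lemma on_laurent_mono: "app T 0 = 0 \<Longrightarrow> on_laurent (app T) (mono m e) = (\<lambda>e'. if e' = e then app T (Z m) else 0)"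
  by (auto simp: on_laurent_def mono_def)

lemma TS_mono_iff: "e \<in> colours n N \<Longrightarrow> m \<in> D \<Longrightarrow> mono m e \<in> TS n N D"
  by (auto simp: TS_def mono_def LS_Z)

lemma TS_decomp:
  assumes "\<phi> \<in> TS n N D"
  shows "\<phi> = (\<Sum>e\<in>colours n N. \<Sum>m\<in>keys (\<phi> e). tsmul (lookup (\<phi> e) m) (mono m e))"
proof
  fix e'
  have "(\<Sum>e\<in>colours n N. \<Sum>m\<in>keys (\<phi> e). tsmul (lookup (\<phi> e) m) (mono m e)) e'
    = (\<Sum>e\<in>colours n N. if e' = e then \<phi> e' else 0)"
    unfolding sum_apply
  proof (rule sum.cong)
    fix e assume "e \<in> colours n N"
    show "(\<Sum>m\<in>keys (\<phi> e). tsmul (lookup (\<phi> e) m) (mono m e) e') = (if e' = e then \<phi> e' else 0)"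
      using pm_sum_singles[of "\<phi> e"] by (auto simp: tsmul_def mono_def)
  qed simp
  also have "\<dots> = \<phi> e'" using assms by (subst sum.delta'[OF finite_colours]) (auto simp: TS_def)
  finally show "\<phi> e' = (\<Sum>e\<in>colours n N. \<Sum>m\<in>keys (\<phi> e). tsmul (lookup (\<phi> e) m) (mono m e)) e'" ..
qed

definition swl :: "nat \<Rightarrow> nat list \<Rightarrow> nat list" where "swl i e = e[i - 1 := e ! i, i := e ! (i - 1)]"

lemma swl_colours: "e \<in> colours n N \<Longrightarrow> 1 \<le> i \<Longrightarrow> i < N \<Longrightarrow> swl i e \<in> colours n N"
proof -
  assume a: "e \<in> colours n N" "1 \<le> i" "i < N"
  then have "set (swl i e) = set e" unfolding swl_def by (intro set_swap) (auto simp: colours_def)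
  then show "swl i e \<in> colours n N" using a by (simp add: colours_def swl_def)
qed

lemma swl_invol: "length e = N \<Longrightarrow> 1 \<le> i \<Longrightarrow> i < N \<Longrightarrow> swl i (swl i e) = e"
  by (rule nth_equalityI) (auto simp: swl_def nth_list_update)

lemma S_op_apply:
  assumes \<phi>: "\<phi> \<in> tensors n N" and i: "1 \<le> i" "i < N" and e: "e \<in> colours n N"
  shows "S_op q n i \<phi> e = (if e ! (i - 1) = e ! i then smul (- inverse q) (\<phi> e)
     else (if e ! (i - 1) < e ! i then smul (q - inverse q) (\<phi> e) else 0) - \<phi> (swl i e))"
proof -
  let ?f = "\<lambda>j. e ! (j - 1)"
  have l: "length e = N" using e by (simp add: colours_def)
  have 1: "map ?f [1..<Suc N] = e" using l by (intro nth_equalityI) (auto simp del: upt_Suc)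
  have 2: "map (swf i ?f) [1..<Suc N] = swl i e"
    using l i by (intro nth_equalityI) (auto simp: swl_def nth_list_update simp del: upt_Suc)
  have E1: "Ext N \<psi> ?f = \<psi> e" for \<psi> unfolding Ext_def 1 ..
  have E2: "Ext N \<phi> (swf i ?f) = \<phi> (swl i e)" unfolding Ext_def 2 ..
  show ?thesis
    using fun_cong[OF Ext_S_op[OF \<phi> i, of q], of ?f] i unfolding app_ST E1 E2 by simp
qed

lemma S_op_mono:
  assumes i: "1 \<le> i" "i < N" and e: "e \<in> colours n N" and m: "m \<in> Dall N"
  shows "e ! (i - 1) = e ! i \<Longrightarrow> S_op q n i (mono m e) = tsmul (- inverse q) (mono m e)"
    and "e ! i < e ! (i - 1) \<Longrightarrow> S_op q n i (mono m e) = - mono m (swl i e)"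
proof -
  have l: "length e = N" using e by (simp add: colours_def)
  have t: "mono m e \<in> tensors n N" unfolding tensors_TS by (rule TS_mono_iff[OF e m])
  have z: "S_op q n i (mono m e) e' = 0" if "e' \<notin> colours n N" for e'
    using TS_S_op[of "mono m e" n N "Dall N" q i] t that unfolding tensors_TS by (auto simp: TS_def)
  have inv: "swl i e' = e \<longleftrightarrow> e' = swl i e" if "e' \<in> colours n N" for e'
    using swl_invol[OF l i] swl_invol[of e' N i] that i by (auto simp: colours_def)
  have nth: "swl i e ! (i - 1) = e ! i" "swl i e ! i = e ! (i - 1)" using l i by (auto simp: swl_def nth_list_update)
  show "S_op q n i (mono m e) = tsmul (- inverse q) (mono m e)" if eq: "e ! (i - 1) = e ! i"
  proof
    fix e'
    have "swl i e = e" using eq l i by (intro nth_equalityI) (auto simp: swl_def nth_list_update)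
    then show "S_op q n i (mono m e) e' = tsmul (- inverse q) (mono m e) e'"
      using S_op_apply[OF t i, of e' q] inv[of e'] z[of e'] e eq
      by (cases "e' \<in> colours n N") (auto simp: mono_def tsmul_def)
  qed
  show "S_op q n i (mono m e) = - mono m (swl i e)" if lt: "e ! i < e ! (i - 1)"
  proof
    fix e'
    have ne: "swl i e \<noteq> e" using nth lt by auto
    show "S_op q n i (mono m e) e' = (- mono m (swl i e)) e'"
      using S_op_apply[OF t i, of e' q] inv[of e'] z[of e'] swl_colours[OF e i] lt nth ne
      by (cases "e' \<in> colours n N") (auto simp: mono_def)
  qed
qed

context
  fixes q :: complex and n N :: nat and D :: "exps set"
  assumes n: "n > 0" and q: "generic_q q" and D: "closed_exps N D" "D \<subseteq> Dall N"
begin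

private lemma q_ne0: "q \<noteq> 0" using q by (simp add: generic_q_def)

lemma Str_Omega: "\<phi> \<in> Omega q n N \<Longrightarrow> Str q n N D \<phi>"
  unfolding Str_def by (rule exI[of _ 0]) (simp only: cmb_0 diff_zero keys_zero empty_subsetI)

lemma Str_add: "Str q n N D \<phi> \<Longrightarrow> Str q n N D \<psi> \<Longrightarrow> Str q n N D (\<phi> + \<psi>)"
  unfolding Str_def
proof (elim exE conjE)
  fix c d assume a: "keys c \<subseteq> NL n N D" "\<phi> - cmb n c \<in> Omega q n N"
    "keys d \<subseteq> NL n N D" "\<psi> - cmb n d \<in> Omega q n N"
  have "\<phi> + \<psi> - cmb n (c + d) = (\<phi> - cmb n c) + (\<psi> - cmb n d)" unfolding cmb_add by (simp only: add_diff_add)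
  then have "\<phi> + \<psi> - cmb n (c + d) \<in> Omega q n N" using Omega_add[OF q_ne0 a(2,4)] by (simp only:)
  then show "\<exists>c. keys c \<subseteq> NL n N D \<and> \<phi> + \<psi> - cmb n c \<in> Omega q n N"
    using a keys_add[of c d] by (intro exI[of _ "c + d"]) blast
qed

lemma Str_smul: "Str q n N D \<phi> \<Longrightarrow> Str q n N D (tsmul a \<phi>)"
  unfolding Str_def
proof (elim exE conjE)
  fix c assume c: "keys c \<subseteq> NL n N D" "\<phi> - cmb n c \<in> Omega q n N"
  have "tsmul a \<phi> - cmb n (smul a c) = tsmul a (\<phi> - cmb n c)" by (simp only: cmb_smul tsmul_simps)
  then have "tsmul a \<phi> - cmb n (smul a c) \<in> Omega q n N" using Omega_smul[OF q_ne0 c(2)] by (simp only:)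
  then show "\<exists>c. keys c \<subseteq> NL n N D \<and> tsmul a \<phi> - cmb n c \<in> Omega q n N"
    using c by (intro exI[of _ "smul a c"]) (auto simp: in_keys_iff)
qed

lemma Str_sum: "(\<And>i. i \<in> I \<Longrightarrow> Str q n N D (\<phi> i)) \<Longrightarrow> Str q n N D (\<Sum>i\<in>I. \<phi> i)"
  by (induction I rule: infinite_finite_induct) (simp_all add: Str_add Str_Omega Omega_0 q_ne0 del: plus_fun_apply zero_fun_apply)

lemma Str_cong: "\<phi> - \<psi> \<in> Omega q n N \<Longrightarrow> Str q n N D \<psi> \<Longrightarrow> Str q n N D \<phi>"
  using Str_add[of "\<phi> - \<psi>" \<psi>] Str_Omega by (simp only: diff_add_cancel)

lemma Str_TS:
  assumes "\<And>m e. m \<in> D' \<Longrightarrow> e \<in> colours n N \<Longrightarrow> Str q n N D (mono m e)" "\<phi> \<in> TS n N D'"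
  shows "Str q n N D \<phi>"
  using assms(2) by (subst TS_decomp[OF assms(2)]) (intro Str_sum Str_smul assms(1); auto simp: TS_def LS_def)

text \<open>Termination measure, compared lexicographically. \<open>Qm\<close> drops for strict
  interpolations; \<open>Pm\<close> drops when a decreasing adjacent pair of exponents is exchanged;
  \<open>Rm\<close> drops when an increasing adjacent pair of colours is exchanged. Inside
  \<open>Pm\<close> the summand \<open>Qm\<close> makes every term nonnegative, since an integer is
  bounded by its square, and it does not change under exchanges.\<close>

private definition "Qm m = nat (\<Sum>i\<in>{1..N}. lookup m i ^ 2)"
private definition "Pm m = nat (\<Sum>i\<in>{1..N}. (int N - int i) * (lookup m i + int (Qm m)))"
private definition "Rm e = (\<Sum>i<N. i * e ! i :: nat)"

private lemma sum_two:
  assumes "1 \<le> i" "i < N" "\<And>j. j \<in> {1..N} \<Longrightarrow> j \<noteq> i \<Longrightarrow> j \<noteq> Suc i \<Longrightarrow> f j = (g j :: int)"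
  shows "(\<Sum>j\<in>{1..N}. f j) - (\<Sum>j\<in>{1..N}. g j) = f i + f (Suc i) - g i - g (Suc i)"
proof -
  have "(\<Sum>j\<in>{1..N} - {i, Suc i}. f j) = (\<Sum>j\<in>{1..N} - {i, Suc i}. g j)" by (rule sum.cong) (use assms in auto)
  then show ?thesis unfolding sum_split_pair[OF assms(1,2)] by simp
qed

private lemma Qm_shift:
  assumes i: "1 \<le> i" "i < N" and t: "0 < t" "t < lookup m (Suc i) - lookup m i"
  shows "Qm (shift i (Suc i) t m) < Qm m"
proof -
  let ?a = "lookup m i" and ?b = "lookup m (Suc i)"
  have "(\<Sum>j\<in>{1..N}. lookup (shift i (Suc i) t m) j ^ 2) - (\<Sum>j\<in>{1..N}. lookup m j ^ 2)
     = (?a + t)^2 + (?b - t)^2 - ?a^2 - ?b^2"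
    using i by (subst sum_two[OF i]) (auto simp: lookup_shift)
  also have "\<dots> = 2 * (t * (t - (?b - ?a)))" by (simp add: power2_eq_square algebra_simps)
  also have "\<dots> < 0" using t by (simp add: mult_pos_neg)
  finally have "(\<Sum>j\<in>{1..N}. lookup (shift i (Suc i) t m) j ^ 2) < (\<Sum>j\<in>{1..N}. lookup m j ^ 2)" by simp
  moreover have "0 \<le> (\<Sum>j\<in>{1..N}. lookup (shift i (Suc i) t m) j ^ 2)" by (simp add: sum_nonneg)
  ultimately show ?thesis unfolding Qm_def by (simp add: nat_less_eq_zless)
qed

private lemma Qm_swap:
  assumes i: "1 \<le> i" "i < N"
  shows "Qm (pmswap i (Suc i) m) = Qm m"
proof -
  have "(\<Sum>j\<in>{1..N}. lookup (pmswap i (Suc i) m) j ^ 2) - (\<Sum>j\<in>{1..N}. lookup m j ^ 2) = 0"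
    by (subst sum_two[OF i]) (auto simp: lookup_pmswap transpose_def)
  then show ?thesis unfolding Qm_def by simp
qed

private lemma Pm_swap:
  assumes i: "1 \<le> i" "i < N" and lt: "lookup m (Suc i) < lookup m i"
  shows "Pm (pmswap i (Suc i) m) < Pm m"
proof -
  let ?a = "lookup m i" and ?b = "lookup m (Suc i)" and ?m = "pmswap i (Suc i) m"
  define s where "s m = (\<Sum>j\<in>{1..N}. (int N - int j) * (lookup m j + int (Qm m)))" for m
  have nn: "0 \<le> s m" for m
    unfolding s_def
  proof (intro sum_nonneg mult_nonneg_nonneg)
    fix j assume j: "j \<in> {1..N}"
    have "\<bar>x\<bar> * 1 \<le> \<bar>x\<bar> * \<bar>x\<bar>" for x :: int using mult_left_mono[of 1 "\<bar>x\<bar>" "\<bar>x\<bar>"] by (cases "x = 0") auto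
    then have "\<bar>lookup m j\<bar> \<le> (lookup m j)^2" by (simp add: power2_eq_square)
    also have "\<dots> \<le> (\<Sum>j\<in>{1..N}. (lookup m j)^2)" using j by (intro member_le_sum) auto
    also have "\<dots> = int (Qm m)" unfolding Qm_def by (simp add: sum_nonneg)
    finally show "0 \<le> lookup m j + int (Qm m)" by linarith
  qed auto
  have "s ?m - s m = (int N - int i) * (?b + int (Qm m)) + (int N - int (Suc i)) * (?a + int (Qm m))
     - (int N - int i) * (?a + int (Qm m)) - (int N - int (Suc i)) * (?b + int (Qm m))"
    unfolding s_def Qm_swap[OF i] by (subst sum_two[OF i]) (auto simp: lookup_pmswap transpose_def)
  also have "\<dots> = ?b - ?a" by (simp add: algebra_simps)
  finally have "s ?m < s m" using lt by simp
  then show ?thesis using nn[of ?m] unfolding Pm_def s_def[symmetric] by (simp add: nat_less_eq_zless)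
qed

private lemma Rm_swap:
  assumes i: "1 \<le> i" "i < N" and l: "length e = N" and lt: "e ! (i - 1) < e ! i"
  shows "Rm (swl i e) < Rm e"
proof -
  have s: "(\<Sum>j<N. f j) = (\<Sum>j\<in>{..<N} - {i - 1, i}. f j) + (f (i - 1) + f i)" for f :: "nat \<Rightarrow> nat"
  proof -
    have "{..<N} = insert (i - 1) (insert i ({..<N} - {i - 1, i}))" using i by auto
    then have "(\<Sum>j<N. f j) = (\<Sum>j\<in>insert (i - 1) (insert i ({..<N} - {i - 1, i})). f j)" by simp
    then show ?thesis using i by (simp add: ac_simps)
  qed
  have "(\<Sum>j\<in>{..<N} - {i - 1, i}. j * swl i e ! j) = (\<Sum>j\<in>{..<N} - {i - 1, i}. j * e ! j)"
    by (rule sum.cong) (use l in \<open>auto simp: swl_def nth_list_update\<close>)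
  moreover have "(i - 1) * swl i e ! (i - 1) + i * swl i e ! i < (i - 1) * e ! (i - 1) + i * e ! i"
  proof -
    obtain k where k: "i = Suc k" using i by (cases i) auto
    show ?thesis using lt l i unfolding k by (simp add: swl_def nth_list_update)
  qed
  ultimately show ?thesis unfolding Rm_def s by simp
qed

lemma Str_mono:
  assumes "m \<in> D" "e \<in> colours n N"
  shows "Str q n N D (mono m e)"
  using assms
proof (induction "(m, e)" arbitrary: m e rule: wf_induct[OF wf_measures[of "[\<lambda>(m, e). Qm m, \<lambda>(m, e). Pm m, \<lambda>(m, e). Rm e]"]])
  case (1 m e)
  have IH: "Str q n N D (mono m' e')"
    if "Qm m' < Qm m \<or> (Qm m' = Qm m \<and> (Pm m' < Pm m \<or> (Pm m' = Pm m \<and> Rm e' < Rm e)))" "m' \<in> D" "e' \<in> colours n N" for m' e'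
    using 1(1) that by (simp add: in_measures) blast
  have m: "m \<in> D" "m \<in> Dall N" and e: "e \<in> colours n N" "length e = N" using 1 D by (auto simp: colours_def)
  have er: "e ! i \<in> {1..n}" if "i < N" for i using e that by (auto simp: colours_def dest!: nth_mem)
  show ?case
  proof (cases "ksof n N m e \<in> normal_lists N")
    case True
    let ?ks = "ksof n N m e"
    have "cmb n (single ?ks 1) = mono m e"
      unfolding cmb_single tsmul_simps u_tensor_mono ksof[OF n m(2) e(1)] ..
    then show ?thesis unfolding Str_def using True m ksof[OF n m(2) e(1)]
      by (intro exI[of _ "single ?ks 1"]) (auto simp: NL_def Omega_0[OF q_ne0] simp del: minus_apply)
  next
    case False
    then obtain j where j: "Suc j < N" "\<not> ksof n N m e ! Suc j < ksof n N m e ! j"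
      unfolding normal_adjacent using ksof(1)[OF n m(2) e(1)] by auto
    define i where "i = Suc j"
    have i: "1 \<le> i" "i < N" "i - 1 = j" using j by (auto simp: i_def)
    let ?a = "lookup m i" and ?b = "lookup m (Suc i)"
    have nn: "\<not> (?a < ?b \<or> (?a = ?b \<and> e ! i < e ! (i - 1)))"
      using j k_less[OF n er[of j] er[of i], of ?b ?a] i by (auto simp: ksof_def i_def nth_append)
    have ij: "i \<in> {1..N}" "Suc i \<in> {1..N}" "i \<noteq> Suc i" using i by auto
    have rel: "on_laurent (app (gL q i (Suc i))) (mono m' e') - S_op q n i (mono m' e') \<in> Omega q n N"
      if "m' \<in> D" "e' \<in> colours n N" for m' e'
      by (rule gS_relation[OF q_ne0 i(1,2)]) (use that D in \<open>auto simp: tensors_TS intro: TS_mono_iff\<close>)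
    show ?thesis
    proof (cases "?a = ?b")
      case False
      then have lt: "?b < ?a" using nn by auto
      \<comment> \<open>The rule is applied to the transposed monomial, whose exponents increase:
        there \<open>g\<close> returns \<open>q^-1\<close> times the wanted monomial plus strict
        interpolations with smaller \<open>Qm\<close>, while \<open>S\<close> keeps the transposed
        exponents, with smaller \<open>Pm\<close>.\<close>
      let ?m = "pmswap i (Suc i) m" and ?g = "gL q i (Suc i)"
      have mD: "?m \<in> D" by (rule closed_swap[OF D(1) m(1) ij])
      let ?T = "{0<..<?a - ?b}"
      have lm: "lookup ?m i = ?b" "lookup ?m (Suc i) = ?a" by (simp_all add: lookup_pmswap)
      have g: "app ?g (Z ?m) = smul (inverse q) (Z m) + smul (inverse q - q) (\<Sum>t\<in>?T. Z (shift i (Suc i) t ?m))"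
        unfolding app_gL[OF ij(3)] g_op_Z[OF ij(3)] Let_def lm using lt by simp
      have gm: "on_laurent (app ?g) (mono ?m e) = tsmul (inverse q) (mono m e)
          + tsmul (inverse q - q) (\<Sum>t\<in>?T. mono (shift i (Suc i) t ?m) e)"
        unfolding on_laurent_mono[OF app_arg_0] g by (rule ext) (simp add: tsmul_def mono_def sum_apply del: smul_single)
      have s1: "Str q n N D (\<Sum>t\<in>?T. mono (shift i (Suc i) t ?m) e)"
      proof (rule Str_sum, rule IH)
        fix t assume t: "t \<in> ?T"
        show "Qm (shift i (Suc i) t ?m) < Qm m \<or> (Qm (shift i (Suc i) t ?m) = Qm m \<and> (Pm (shift i (Suc i) t ?m) < Pm m \<or> (Pm (shift i (Suc i) t ?m) = Pm m \<and> Rm e < Rm e)))"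
          using Qm_shift[OF i(1,2), of t ?m] Qm_swap[OF i(1,2), of m] t lm by simp
        show "shift i (Suc i) t ?m \<in> D" by (rule closedD[OF D(1) mD ij]) (use t lm in auto)
      qed (rule e)
      have s2: "Str q n N D (S_op q n i (mono ?m e))"
      proof (rule Str_TS[where D' = "{?m}"])
        show "Str q n N D (mono m' e')" if "m' \<in> {?m}" "e' \<in> colours n N" for m' e'
          using that mD Pm_swap[OF i(1,2) lt] Qm_swap[OF i(1,2), of m] by (intro IH) auto
        show "S_op q n i (mono ?m e) \<in> TS n N {?m}" by (intro TS_S_op TS_mono_iff e) simp
      qed
      have "Str q n N D (on_laurent (app ?g) (mono ?m e))"
        by (rule Str_cong[OF rel[OF mD e(1)] s2])
      then have "Str q n N D (tsmul q (on_laurent (app ?g) (mono ?m e)) + tsmul (- (q * (inverse q - q))) (\<Sum>t\<in>?T. mono (shift i (Suc i) t ?m) e))"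
        by (intro Str_add Str_smul s1)
      moreover have "tsmul q (on_laurent (app ?g) (mono ?m e)) + tsmul (- (q * (inverse q - q))) (\<Sum>t\<in>?T. mono (shift i (Suc i) t ?m) e) = mono m e"
        unfolding gm tsmul_simps using q_ne0
        by (simp only: add.assoc tsmul_simps(2)[symmetric] right_inverse tsmul_simps(5)) (simp add: tsmul_simps del: plus_fun_apply)
      ultimately show ?thesis by (simp only:)
    next
      case True
      then have le: "e ! (i - 1) \<le> e ! i" using nn by auto
      have gm: "on_laurent (app (gL q i (Suc i))) (mono m e') = tsmul q (mono m e')" for e'
        unfolding on_laurent_mono[OF app_arg_0] using True
        by (intro ext) (simp add: app_gL[OF ij(3)] g_op_Z Let_def tsmul_def mono_def)
      show ?thesis
      proof (cases "e ! (i - 1) = e ! i")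
        case True
        have "on_laurent (app (gL q i (Suc i))) (mono m e) - S_op q n i (mono m e) = tsmul (q + inverse q) (mono m e)"
          unfolding gm S_op_mono(1)[OF i(1,2) e(1) m(2) True] by (auto simp: tsmul_def smul_add_left smul_minus_left simp del: smul_single)
        then have "tsmul (inverse (q + inverse q)) (tsmul (q + inverse q) (mono m e)) \<in> Omega q n N"
          using rel[OF m(1) e(1)] Omega_smul[OF q_ne0] by simp
        then have "mono m e \<in> Omega q n N" unfolding tsmul_simps(4) left_inverse[OF qints(1)[OF q]] tsmul_simps(5) .
        then show ?thesis by (rule Str_Omega)
      next
        case False
        then have lt: "e ! (i - 1) < e ! i" using le by simp
        \<comment> \<open>The colours are exchanged first, because on a decreasing pair
          \<open>S\<close> yields a single basis vector.\<close>
        let ?e = "swl i e"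
        have ec: "?e \<in> colours n N" by (rule swl_colours[OF e(1) i(1,2)])
        have se: "swl i ?e = e" by (rule swl_invol[OF e(2) i(1,2)])
        have lt': "?e ! i < ?e ! (i - 1)" using lt e(2) i by (simp add: swl_def nth_list_update)
        have "on_laurent (app (gL q i (Suc i))) (mono m ?e) - S_op q n i (mono m ?e) = mono m e - tsmul (- q) (mono m ?e)"
          unfolding gm S_op_mono(2)[OF i(1,2) ec m(2) lt'] se by (auto simp: tsmul_def smul_minus_left simp del: smul_single)
        then have c: "mono m e - tsmul (- q) (mono m ?e) \<in> Omega q n N" using rel[OF m(1) ec] by simp
        have "Str q n N D (mono m ?e)" using Rm_swap[OF i(1,2) e(2) lt] m ec by (intro IH) auto
        then show ?thesis by (intro Str_cong[OF c] Str_smul)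
      qed
    qed
  qed
qed

text \<open>The normally ordered expansion keeps its exponents inside any closed \<open>D\<close>.
  This refinement yields compatibility with degrees, and it yields zero when \<open>D\<close>
  contains no exponents of normally ordered wedges.\<close>

theorem straightening: "\<phi> \<in> TS n N D \<Longrightarrow> \<exists>c. keys c \<subseteq> NL n N D \<and> \<phi> - cmb n c \<in> Omega q n N"
  using Str_TS[of D \<phi>] Str_mono unfolding Str_def by blast

end

section \<open>Independence of the normally ordered wedges\<close>

text \<open>
  \<open>AO l\<close> is the sum of \<open>X\<^sub>w\<close> over the symmetric group on the first \<open>l\<close> factors, built from minimal coset
  representatives. By the braid relations alone it kills the kernel of each \<open>1 + X\<^sub>i\<close>.
\<close>

definition DO :: "complex \<Rightarrow> nat \<Rightarrow> nat \<Rightarrow> ften endo" where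
  "DO q l j = prod_list (map (XO q) (rev [j..<Suc l]))"

fun AO :: "complex \<Rightarrow> nat \<Rightarrow> ften endo" where
  "AO q 0 = 1"
| "AO q (Suc l) = AO q l * (\<Sum>j\<in>{1..Suc l}. DO q l j)"

lemma DO_Suc: "j \<le> Suc l \<Longrightarrow> DO q (Suc l) j = XO q (Suc l) * DO q l j"
  by (simp add: DO_def)

lemma DO_self: "DO q l (Suc l) = 1"
  by (simp add: DO_def)

lemma DO_right: "j \<le> l \<Longrightarrow> DO q l j = DO q l (Suc j) * XO q j"
  by (simp add: DO_def upt_conv_Cons del: upt_Suc)

lemma XO_DO_far: "i + 2 \<le> j \<Longrightarrow> XO q i * DO q l j = DO q l j * XO q i"
  unfolding DO_def by (rule commute_prod_list) (auto intro!: XO_far)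

lemma XO_DO_far': "XO q (Suc (Suc l)) * DO q l j = DO q l j * XO q (Suc (Suc l))"
  unfolding DO_def by (rule commute_prod_list) (auto intro!: XO_far[symmetric])

text \<open>A generator passes through the descending product with its index raised by one: a braid
  move at the letters \<open>i, i - 1\<close>, and distant commutation elsewhere.\<close>

lemma XO_DO_braid:
  assumes q: "q \<noteq> 0" and "1 \<le> j" "j < i" "i \<le> l"
  shows "XO q (i - 1) * DO q l j = DO q l j * XO q i"
  using assms(4)
proof (induction l rule: dec_induct)
  case base
  obtain k where k: "i = Suc (Suc k)" "j \<le> Suc k" using assms by (cases i; cases "i - 1") auto
  have D: "DO q i j = XO q (Suc (Suc k)) * (XO q (Suc k) * DO q k j)"
    using k by (simp add: DO_Suc)
  have c: "XO q (Suc (Suc k)) * DO q k j = DO q k j * XO q (Suc (Suc k))" by (rule XO_DO_far')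
  have "XO q (Suc k) * DO q i j = XO q (Suc k) * XO q (Suc (Suc k)) * XO q (Suc k) * DO q k j"
    unfolding D by (simp only: mult.assoc)
  also have "\<dots> = XO q (Suc (Suc k)) * XO q (Suc k) * (XO q (Suc (Suc k)) * DO q k j)"
    unfolding XO_braid[OF q, of "Suc k"] by (simp only: mult.assoc)
  also have "\<dots> = DO q i j * XO q i" unfolding c D by (simp only: mult.assoc k(1))
  finally show ?case using k by simp
next
  case (step l)
  have c: "XO q (i - 1) * XO q (Suc l) = XO q (Suc l) * XO q (i - 1)" by (rule XO_far) (use step assms in auto)
  have D: "DO q (Suc l) j = XO q (Suc l) * DO q l j" using step assms by (simp add: DO_Suc)
  show ?case unfolding D comm_left[OF c] step.IH by (simp only: mult.assoc)
qed

text \<open>The coset representatives for \<open>j = i\<close> and \<open>j = i + 1\<close> differ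
  by a right factor \<open>X_i\<close>, so their contributions cancel on \<open>t\<close>. Each
  other representative turns \<open>t\<close> into an eigenvector of \<open>X_i\<close> or
  \<open>X_(i-1)\<close>, which the symmetriser on fewer factors kills by induction.\<close>

lemma AO_kills:
  assumes q: "q \<noteq> 0"
  shows "1 \<le> i \<Longrightarrow> i < l \<Longrightarrow> app (XO q i) t = - t \<Longrightarrow> app (AO q l) t = 0"
proof (induction l arbitrary: i t)
  case (Suc l)
  have i: "1 \<le> i" "i \<le> l" and t: "app (XO q i) t = - t" using Suc.prems by auto
  have far: "app (AO q l) (app (DO q l j) t) = 0" if "j \<in> {1..Suc l} - {i, Suc i}" for j
  proof (cases "i < j")
    case True
    then have "app (XO q i) (app (DO q l j) t) = - app (DO q l j) t"
      using XO_commuting[OF XO_DO_far[of i j q l, symmetric] t] that by auto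
    then show ?thesis using Suc.IH i that True by auto
  next
    case False
    then have ji: "1 \<le> j" "j < i" using that by auto
    have "app (XO q (i - 1)) (app (DO q l j) t) = app (DO q l j) (app (XO q i) t)"
      using XO_DO_braid[OF q ji i(2)] by (simp flip: app_mult)
    also have "\<dots> = - app (DO q l j) t" unfolding t by (rule app_arg_uminus)
    finally show ?thesis using Suc.IH[of "i - 1"] i ji by auto
  qed
  have pair: "app (AO q l) (app (DO q l i) t) + app (AO q l) (app (DO q l (Suc i)) t) = 0"
    unfolding DO_right[OF i(2)] app_mult t app_arg_uminus by (rule add.left_inverse)
  have "app (AO q (Suc l)) t = (\<Sum>j\<in>{1..Suc l}. app (AO q l) (app (DO q l j) t))"
    by (simp only: AO.simps app_mult app_op_sum app_arg_sum)
  also have "\<dots> = (\<Sum>j\<in>{1..Suc l} - {i, Suc i}. app (AO q l) (app (DO q l j) t))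
     + (app (AO q l) (app (DO q l i) t) + app (AO q l) (app (DO q l (Suc i)) t))"
    by (rule sum_split_pair) (use i in auto)
  also have "\<dots> = 0" unfolding pair by (simp add: far del: plus_fun_apply zero_fun_apply)
  finally show ?case .
qed simp

lemma g_op_expand:
  assumes "i \<noteq> j"
  shows "lookup (g_op q i j h) m = (\<Sum>k\<in>keys h. lookup h k * lookup (g_op q i j (Z k)) m)"
proof -
  have "app (gL q i j) h = (\<Sum>k\<in>keys h. app (gL q i j) (smul (lookup h k) (Z k)))"
    by (subst pm_sum_singles[of h]) (simp add: app_arg_sum)
  also have "\<dots> = (\<Sum>k\<in>keys h. smul (lookup h k) (app (gL q i j) (Z k)))"
    using assms by (intro sum.cong refl linop_smul) simp
  finally show ?thesis using assms by (simp add: app_gL lookup_sum)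
qed

definition sq :: "nat \<Rightarrow> exps \<Rightarrow> int" where
  "sq N m = (\<Sum>i\<in>{1..N}. lookup m i ^ 2)"

lemma sq_shift:
  assumes i: "1 \<le> i" "i < N"
  shows "sq N (shift i (Suc i) t m) = sq N m + 2 * (t * (t - (lookup m (Suc i) - lookup m i)))"
proof -
  have "(\<Sum>j\<in>{1..N} - {i, Suc i}. lookup (shift i (Suc i) t m) j ^ 2) = (\<Sum>j\<in>{1..N} - {i, Suc i}. lookup m j ^ 2)"
    by (rule sum.cong) (auto simp: lookup_shift)
  then show ?thesis unfolding sq_def sum_split_pair[OF i]
    by (simp add: lookup_shift power2_eq_square algebra_simps)
qed

lemma sq_swap: "1 \<le> i \<Longrightarrow> i < N \<Longrightarrow> sq N (pmswap i (Suc i) m) = sq N m"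
  by (simp add: pmswap_shift sq_shift)

text \<open>Modulo smaller sums of squares, \<open>g\<close> acts on a monomial through its transposition only.\<close>

lemma g_op_top:
  assumes i: "1 \<le> i" "i < N" and nz: "lookup (g_op q i (Suc i) (Z k)) m \<noteq> 0"
  shows "sq N m \<le> sq N k" and "sq N k = sq N m \<Longrightarrow>
    (k = m \<and> lookup m (Suc i) \<le> lookup m i) \<or> k = pmswap i (Suc i) m"
proof -
  define d where "d = lookup k (Suc i) - lookup k i"
  have inner: "sq N (shift i (Suc i) t k) < sq N k" if "(0 < t \<and> t < d) \<or> (d < t \<and> t < 0)" for t
    unfolding sq_shift[OF i] d_def[symmetric] using that by (auto simp: mult_pos_neg mult_neg_pos)
  have "(m = k \<and> d \<le> 0) \<or> m = pmswap i (Suc i) k \<or> (\<exists>t. ((0 < t \<and> t < d) \<or> (d < t \<and> t < 0)) \<and> m = shift i (Suc i) t k)"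
  proof (rule ccontr)
    assume n: "\<not> ?thesis"
    then have "(\<Sum>t\<in>T. lookup (Z (shift i (Suc i) t k)) m) = 0" if "T = {0<..<d} \<or> T = {d<..<0}" for T
      using that by (intro sum.neutral) (auto simp: lookup_single when_def)
    then show False using nz n
      by (auto simp: g_op_Z Let_def d_def[symmetric] lookup_add lookup_sum lookup_single when_def split: if_splits)
  qed
  then consider "m = k" "d \<le> 0" | "m = pmswap i (Suc i) k" | t where "(0 < t \<and> t < d) \<or> (d < t \<and> t < 0)" "m = shift i (Suc i) t k" by blast
  note cs = this
  show "sq N m \<le> sq N k" using cs by cases (auto simp: sq_swap[OF i] intro: less_imp_le inner)
  show "(k = m \<and> lookup m (Suc i) \<le> lookup m i) \<or> k = pmswap i (Suc i) m" if "sq N k = sq N m"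
    using cs
  proof cases
    case (3 t)
    then show ?thesis using inner[OF 3(1)] that by simp
  qed (use that in \<open>auto simp: d_def\<close>)
qed

text \<open>Control of leading terms: exponents have sum of squares at most \<open>Q0\<close>, and
  \<open>P\<close> is required only where this bound is attained.\<close>

definition suppin :: "nat \<Rightarrow> int \<Rightarrow> (exps \<Rightarrow> (nat \<Rightarrow> nat) \<Rightarrow> bool) \<Rightarrow> ften \<Rightarrow> bool" where
  "suppin N Q0 P t \<longleftrightarrow> (\<forall>f m. lookup (t f) m \<noteq> 0 \<longrightarrow> sq N m \<le> Q0 \<and> (sq N m = Q0 \<longrightarrow> P m f))"

text \<open>The order of normally ordered wedges at two positions, in terms of exponents and
  colours; compare \<open>k_less\<close>.\<close>

definition lt :: "exps \<Rightarrow> (nat \<Rightarrow> nat) \<Rightarrow> nat \<Rightarrow> nat \<Rightarrow> bool" where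
  "lt m f a b \<longleftrightarrow> lookup m a < lookup m b \<or> (lookup m a = lookup m b \<and> f b < f a)"

definition nrm :: "nat \<Rightarrow> exps \<Rightarrow> (nat \<Rightarrow> nat) \<Rightarrow> bool" where
  "nrm l m f \<longleftrightarrow> (\<forall>a b. 1 \<le> a \<longrightarrow> a < b \<longrightarrow> b \<le> l \<longrightarrow> lt m f a b)"

text \<open>Invariant of a factor travelling right under \<open>X_j, X_(j+1), ...\<close>: it sits
  at position \<open>i\<close> with an exponent no larger than those to its right and smaller than
  some exponent it must pass. On arrival at \<open>Suc l\<close> its exponent is below its left
  neighbour's, which normal order excludes.\<close>

definition Iinv :: "nat \<Rightarrow> nat \<Rightarrow> exps \<Rightarrow> (nat \<Rightarrow> nat) \<Rightarrow> bool" where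
  "Iinv l i m f \<longleftrightarrow> (\<forall>b\<in>{i<..Suc l}. lookup m i \<le> lookup m b)
     \<and> (if i \<le> l then lookup m i < lookup m (Suc l) else lookup m (Suc l) < lookup m l)"

text \<open>The companion invariant when all exponents to be passed are equal: the travelling factor
  carries a larger colour than those to its right, the others remain in normal order, and on arrival
  the last two colours are in the wrong order.\<close>

definition Jinv :: "nat \<Rightarrow> nat \<Rightarrow> exps \<Rightarrow> (nat \<Rightarrow> nat) \<Rightarrow> bool" where
  "Jinv l i m f \<longleftrightarrow> (\<forall>a b. 1 \<le> a \<longrightarrow> a < b \<longrightarrow> b \<le> Suc l \<longrightarrow> a \<noteq> i \<longrightarrow> b \<noteq> i \<longrightarrow> lt m f a b)
     \<and> (\<forall>b\<in>{i<..Suc l}. lookup m b = lookup m i \<and> f b < f i)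
     \<and> (i = Suc l \<longrightarrow> lookup m l = lookup m (Suc l) \<and> f l < f (Suc l))"

definition restr :: "(exps \<Rightarrow> bool) \<Rightarrow> ften \<Rightarrow> ften" where
  "restr P t = (\<lambda>f. Poly_Mapping.mapp (\<lambda>m c. if P m then c else 0) (t f))"

context
  fixes N :: nat and Q0 :: int and q :: complex
  assumes q: "q \<noteq> 0"
begin

lemma suppin_add: "suppin N Q0 P s \<Longrightarrow> suppin N Q0 P t \<Longrightarrow> suppin N Q0 P (s + t)"
  unfolding suppin_def plus_fun_apply lookup_add by (metis add.right_neutral)

lemma suppin_0: "suppin N Q0 P 0" by (simp add: suppin_def)

lemma suppin_sum: "(\<And>i. i \<in> I \<Longrightarrow> suppin N Q0 P (t i)) \<Longrightarrow> suppin N Q0 P (\<Sum>i\<in>I. t i)"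
  by (induction I rule: infinite_finite_induct) (simp_all add: suppin_0 suppin_add del: plus_fun_apply zero_fun_apply)

lemma suppin_mono: "suppin N Q0 P t \<Longrightarrow> (\<And>m f. sq N m = Q0 \<Longrightarrow> P m f \<Longrightarrow> P' m f) \<Longrightarrow> suppin N Q0 P' t"
  unfolding suppin_def by blast

text \<open>Lists the sources of a leading term of \<open>X_i t\<close>: exponents and colours are
  each kept or exchanged, and keeping is possible only under an order condition. It is phrased
  backwards, from the target \<open>(m, f)\<close> to a source \<open>(m', f')\<close>.\<close>

lemma suppin_XO:
  assumes i: "1 \<le> i" "i < N" and t: "suppin N Q0 P t"
    and P: "\<And>m f m' f'. \<lbrakk>sq N m = Q0; P m' f'; (m' = m \<and> lookup m (Suc i) \<le> lookup m i) \<or> m' = pmswap i (Suc i) m;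
       (f' = f \<and> f i \<le> f (Suc i)) \<or> f' = swf i f\<rbrakk> \<Longrightarrow> P' m f"
  shows "suppin N Q0 P' (app (XO q i) t)"
  unfolding suppin_def
proof (intro allI impI)
  fix f m assume nz: "lookup (app (XO q i) t f) m \<noteq> 0"
  have "app (XO q i) t f = g_op q i (Suc i) (app (ST q i) t f)"
    by (simp add: XO_def app_mult app_lft app_gL)
  with nz have "(\<Sum>k\<in>keys (app (ST q i) t f). lookup (app (ST q i) t f) k *
      lookup (g_op q i (Suc i) (Z k)) m) \<noteq> 0"
    using g_op_expand[OF n_not_Suc_n, of q i "app (ST q i) t f" m] by simp
  then obtain k where k: "lookup (app (ST q i) t f) k \<noteq> 0" "lookup (g_op q i (Suc i) (Z k)) m \<noteq> 0"
    by (elim sum.not_neutral_contains_not_neutral) auto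
  obtain f' where f': "lookup (t f') k \<noteq> 0" "(f' = f \<and> f i \<le> f (Suc i)) \<or> f' = swf i f"
  proof (cases "f i \<le> f (Suc i) \<and> lookup (t f) k \<noteq> 0")
    case False
    then have "lookup (t (swf i f)) k \<noteq> 0"
      using k(1) by (auto simp: app_ST lookup_minus split: if_splits)
    then show ?thesis using that by blast
  qed (use that in blast)
  have kQ: "sq N k \<le> Q0" "sq N k = Q0 \<Longrightarrow> P k f'" using t f'(1) by (auto simp: suppin_def)
  note g = g_op_top[OF i k(2)]
  show "sq N m \<le> Q0 \<and> (sq N m = Q0 \<longrightarrow> P' m f)"
  proof (intro conjI impI)
    show "sq N m \<le> Q0" using g(1) kQ by simp
    assume m: "sq N m = Q0"
    then have "sq N k = Q0" using g(1) kQ(1) by simp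
    then show "P' m f" using P[OF m _ _ f'(2)] g(2) kQ(2) m by simp
  qed
qed

lemma suppin_AO:
  assumes "\<And>i t. 1 \<le> i \<Longrightarrow> i < l \<Longrightarrow> suppin N Q0 P t \<Longrightarrow> suppin N Q0 P (app (XO q i) t)" "suppin N Q0 P t"
  shows "suppin N Q0 P (app (AO q l) t)"
  using assms
proof (induction l arbitrary: t)
  case (Suc l)
  have D: "suppin N Q0 P (app (prod_list (map (XO q) is)) t)" if "set is \<subseteq> {1..l}" for "is"
    using that Suc.prems by (induction "is") (auto simp: app_mult)
  have "app (AO q (Suc l)) t = app (AO q l) (\<Sum>j\<in>{1..Suc l}. app (DO q l j) t)"
    by (simp only: AO.simps app_mult app_op_sum)
  moreover have "suppin N Q0 P (\<Sum>j\<in>{1..Suc l}. app (DO q l j) t)"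
    by (rule suppin_sum, unfold DO_def, rule D) auto
  ultimately show ?case using Suc.IH Suc.prems(1) by simp
qed simp

lemma Iinv_step:
  assumes i: "1 \<le> i" "i \<le> l" "Suc l \<le> N" and t: "suppin N Q0 (Iinv l i) t"
  shows "suppin N Q0 (Iinv l (Suc i)) (app (XO q i) t)"
proof (rule suppin_XO[OF _ _ t])
  fix m f m' f'
  assume I: "Iinv l i m' f'" and m: "(m' = m \<and> lookup m (Suc i) \<le> lookup m i) \<or> m' = pmswap i (Suc i) m"
  \<comment> \<open>Exponents can be kept only if the two are equal, in which case the exchange has
    the same effect; so the factor always moves.\<close>
  have "m' = pmswap i (Suc i) m"
    using m
  proof
    assume a: "m' = m \<and> lookup m (Suc i) \<le> lookup m i"
    then have "lookup m i = lookup m (Suc i)" using I i by (auto simp: Iinv_def intro!: order_antisym)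
    then show ?thesis using a by (simp add: pmswap_shift)
  qed
  then have l: "lookup m' k = lookup m (transpose i (Suc i) k)" for k by (simp add: lookup_pmswap)
  show "Iinv l (Suc i) m f"
  proof (cases "i = l")
    case True
    then show ?thesis using I by (auto simp: Iinv_def l)
  next
    case False
    then have "lookup m (Suc i) \<le> lookup m b" if "b \<in> {Suc i<..Suc l}" for b
      using I that i unfolding Iinv_def l by (auto simp: transpose_def dest!: bspec[of _ _ b])
    then show ?thesis using I False i by (auto simp: Iinv_def l transpose_def)
  qed
qed (use i in auto)

lemma Jinv_step:
  assumes i: "1 \<le> i" "i \<le> l" "Suc l \<le> N" and t: "suppin N Q0 (Jinv l i) t"
  shows "suppin N Q0 (Jinv l (Suc i)) (app (XO q i) t)"
proof (rule suppin_XO[OF _ _ t])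
  fix m f m' f'
  assume J: "Jinv l i m' f'" and m: "(m' = m \<and> lookup m (Suc i) \<le> lookup m i) \<or> m' = pmswap i (Suc i) m"
    and f: "(f' = f \<and> f i \<le> f (Suc i)) \<or> f' = swf i f"
  have b: "lookup m' (Suc i) = lookup m' i" "f' (Suc i) < f' i" using J i by (auto simp: Jinv_def)
  have "m' = m"
    using m
  proof
    assume a: "m' = pmswap i (Suc i) m"
    then have "m = pmswap i (Suc i) m'" by simp
    also have "\<dots> = m'" using b(1) by (simp add: pmswap_shift)
    finally show "m' = m" ..
  qed simp
  \<comment> \<open>Keeping the colours would require the smaller one on the left, against the
    invariant.\<close>
  moreover have ff: "f' = swf i f" using f b(2) by auto
  ultimately have J: "Jinv l i m (swf i f)" and bm: "lookup m (Suc i) = lookup m i" using J b by auto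
  have *: "lt m (swf i f) a b \<longleftrightarrow> lt m f (transpose i (Suc i) a) (transpose i (Suc i) b)" for a b
    using bm by (auto simp: lt_def transpose_def)
  have 1: "lt m f a b" if ab: "1 \<le> a" "a < b" "b \<le> Suc l" "a \<noteq> Suc i" "b \<noteq> Suc i" for a b
  proof -
    let ?a = "transpose i (Suc i) a" and ?b = "transpose i (Suc i) b"
    have "1 \<le> ?a" "?a < ?b" "?b \<le> Suc l" "?a \<noteq> i" "?b \<noteq> i" using ab i by (auto simp: transpose_def)
    then have "lt m (swf i f) ?a ?b" using J unfolding Jinv_def by blast
    then show ?thesis unfolding * by simp
  qed
  have 2: "lookup m b = lookup m (Suc i) \<and> f b < f (Suc i)" if "b \<in> {Suc i<..Suc l}" for b
    using J that bm i unfolding Jinv_def by (auto dest!: bspec[of _ _ b])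
  have 3: "lookup m l = lookup m (Suc l) \<and> f l < f (Suc l)" if "Suc i = Suc l"
    using J that bm i unfolding Jinv_def by auto
  show "Jinv l (Suc i) m f" unfolding Jinv_def using 1 2 3 by blast
qed (use i in auto)

lemma DO_suppin:
  assumes step: "\<And>i t. 1 \<le> i \<Longrightarrow> i \<le> l \<Longrightarrow> suppin N Q0 (P i) t \<Longrightarrow> suppin N Q0 (P (Suc i)) (app (XO q i) t)"
    and j: "1 \<le> j" "j \<le> Suc l" and t: "suppin N Q0 (P j) t"
  shows "suppin N Q0 (P (Suc l)) (app (DO q l j) t)"
proof -
  have "suppin N Q0 (P (Suc k)) (app (DO q k j) t)" if "j \<le> Suc k" "k \<le> l" for k
    using that
  proof (induction k)
    case 0
    then have "j = Suc 0" using j by simp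
    then show ?case using t by (simp add: DO_self)
  next
    case (Suc k)
    show ?case
    proof (cases "j = Suc (Suc k)")
      case True
      then show ?thesis using t by (simp add: DO_self)
    next
      case False
      then show ?thesis using Suc step[of "Suc k"] by (simp add: DO_Suc app_mult)
    qed
  qed
  then show ?thesis using j by simp
qed

lemma lookup_restr: "lookup (restr P t f) m = (if P m then lookup (t f) m else 0)"
  by (auto simp: restr_def lookup_mapp when_def in_keys_iff)

lemma restr_split: "t = restr P t + restr (\<lambda>m. \<not> P m) t"
  by (rule ext, rule poly_mapping_eqI) (simp add: lookup_add lookup_restr)

lemma suppin_restr: "suppin N Q0 R t \<Longrightarrow> (\<And>m f. R m f \<Longrightarrow> P m \<Longrightarrow> R' m f) \<Longrightarrow> suppin N Q0 R' (restr P t)"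
  unfolding suppin_def lookup_restr by auto

text \<open>On normally ordered leading terms the symmetriser acts as the identity: among the coset
  representatives only the trivial one contributes to a coefficient in normal order.\<close>

lemma AO_coefficient:
  assumes "l \<le> N" "suppin N Q0 (nrm l) t" "sq N m = Q0" "nrm l m f"
  shows "lookup (app (AO q l) t f) m = lookup (t f) m"
  using assms
proof (induction l arbitrary: t)
  case (Suc l)
  note t = Suc.prems(2)
  have nl: "nrm l m f" using Suc.prems(4) by (auto simp: nrm_def)
  have sub: "suppin N Q0 (nrm l) t" using t by (rule suppin_mono) (auto simp: nrm_def)
  have zero: "lookup (app (AO q l) (app (DO q l j) t) f) m = 0" if j: "j \<in> {1..l}" for j
  proof -
    \<comment> \<open>Either some exponent beyond \<open>j\<close> is larger, and the travelling
      factor ends with too small an exponent, or all of them equal that at \<open>j\<close>, and it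
      ends with a wrongly ordered colour.\<close>
    let ?P = "\<lambda>m. lookup m j < lookup m (Suc l)"
    define t1 where "t1 = restr ?P t"
    define t2 where "t2 = restr (\<lambda>m. \<not> ?P m) t"
    have tt: "t = t1 + t2" unfolding t1_def t2_def by (rule restr_split)
    have n1: "lookup m' a \<le> lookup m' b" if "nrm (Suc l) m' f'" "1 \<le> a" "a < b" "b \<le> Suc l" for m' f' a b
      using that unfolding nrm_def lt_def by (metis order_less_imp_le order_refl)
    have "suppin N Q0 (Iinv l j) t1" unfolding t1_def
      by (rule suppin_restr[OF t]) (use j n1 in \<open>auto simp: Iinv_def\<close>)
    then have I: "suppin N Q0 (Iinv l (Suc l)) (app (DO q l j) t1)"
      by (intro DO_suppin[where P = "Iinv l"] Iinv_step) (use j Suc.prems in auto)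
    have "suppin N Q0 (\<lambda>m f. \<exists>i\<in>{1..l}. lookup m (Suc l) < lookup m i) (app (AO q l) (app (DO q l j) t1))"
    proof (rule suppin_AO)
      show "suppin N Q0 (\<lambda>m f. \<exists>i\<in>{1..l}. lookup m (Suc l) < lookup m i) (app (DO q l j) t1)"
        using I by (rule suppin_mono) (use j in \<open>auto simp: Iinv_def\<close>)
      fix i t assume i: "1 \<le> i" "i < l" and s: "suppin N Q0 (\<lambda>m f. \<exists>i\<in>{1..l}. lookup m (Suc l) < lookup m i) t"
      show "suppin N Q0 (\<lambda>m f. \<exists>i\<in>{1..l}. lookup m (Suc l) < lookup m i) (app (XO q i) t)"
      proof (rule suppin_XO[OF _ _ s])
        fix m m' assume "\<exists>i\<in>{1..l}. lookup m' (Suc l) < lookup m' i"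
          and m: "(m' = m \<and> lookup m (Suc i) \<le> lookup m i) \<or> m' = pmswap i (Suc i) m"
        then obtain k where k: "k \<in> {1..l}" "lookup m' (Suc l) < lookup m' k" by auto
        from m show "\<exists>i\<in>{1..l}. lookup m (Suc l) < lookup m i"
        proof
          assume "m' = pmswap i (Suc i) m"
          then have "lookup m (Suc l) < lookup m (transpose i (Suc i) k)" using k i by (auto simp: lookup_pmswap transpose_def)
          moreover have "transpose i (Suc i) k \<in> {1..l}" using k i by (auto simp: transpose_def)
          ultimately show ?thesis by blast
        qed (use k in auto)
      qed (use i Suc.prems in auto)
    qed
    moreover have "\<not> (\<exists>i\<in>{1..l}. lookup m (Suc l) < lookup m i)"
      using n1[OF Suc.prems(4), of _ "Suc l"] by (auto simp: not_less)
    ultimately have z1: "lookup (app (AO q l) (app (DO q l j) t1) f) m = 0"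
      using Suc.prems(3) unfolding suppin_def by blast
    have "suppin N Q0 (Jinv l j) t2" unfolding t2_def
    proof (rule suppin_restr[OF t])
      fix m' f' assume n: "nrm (Suc l) m' f'" and P: "\<not> ?P m'"
      have eq: "lookup m' b = lookup m' j" if "b \<in> {j<..Suc l}" for b
        using n1[OF n, of j b] n1[OF n, of b "Suc l"] P j that by (cases "b = Suc l") auto
      have lt: "f' b < f' j" if "b \<in> {j<..Suc l}" for b
      proof -
        have "lt m' f' j b" using n j that unfolding nrm_def by auto
        then show ?thesis using eq[OF that] unfolding lt_def by auto
      qed
      have "\<forall>a b. 1 \<le> a \<longrightarrow> a < b \<longrightarrow> b \<le> Suc l \<longrightarrow> a \<noteq> j \<longrightarrow> b \<noteq> j \<longrightarrow> lt m' f' a b"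
        using n unfolding nrm_def by blast
      moreover have "j \<noteq> Suc l" using j by auto
      ultimately show "Jinv l j m' f'" unfolding Jinv_def using eq lt by blast
    qed
    then have J: "suppin N Q0 (Jinv l (Suc l)) (app (DO q l j) t2)"
      by (intro DO_suppin[where P = "Jinv l"] Jinv_step) (use j Suc.prems in auto)
    then have "suppin N Q0 (nrm l) (app (DO q l j) t2)"
      by (rule suppin_mono) (auto simp: Jinv_def nrm_def)
    then have "lookup (app (AO q l) (app (DO q l j) t2) f) m = lookup (app (DO q l j) t2 f) m"
      using Suc.IH Suc.prems nl by auto
    also have "\<dots> = 0"
    proof (rule ccontr)
      assume "lookup (app (DO q l j) t2 f) m \<noteq> 0"
      then have "Jinv l (Suc l) m f" using J Suc.prems(3) unfolding suppin_def by blast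
      then have "lookup m l = lookup m (Suc l)" "f l < f (Suc l)" by (auto simp: Jinv_def)
      moreover have "lt m f l (Suc l)" using Suc.prems(4) j unfolding nrm_def by auto
      ultimately show False by (auto simp: lt_def)
    qed
    finally show ?thesis using z1 unfolding tt app_arg_add plus_fun_apply lookup_add by simp
  qed
  have "app (AO q (Suc l)) t = (\<Sum>j\<in>{1..Suc l}. app (AO q l) (app (DO q l j) t))"
    by (simp only: AO.simps app_mult app_op_sum app_arg_sum)
  also have "\<dots> = (\<Sum>j\<in>{1..l}. app (AO q l) (app (DO q l j) t)) + app (AO q l) t"
    by (simp add: DO_self del: plus_fun_apply)
  finally have "lookup (app (AO q (Suc l)) t f) m = lookup (app (AO q l) t f) m"
    by (simp add: sum_apply lookup_add lookup_sum zero del: AO.simps)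
  also have "\<dots> = lookup (t f) m" using Suc.IH[OF _ sub Suc.prems(3) nl] Suc.prems(1) by simp
  finally show ?case .
qed simp

end

lemma AO_Omega:
  assumes q: "q \<noteq> 0" and \<phi>: "\<phi> \<in> Omega q n N"
  shows "app (AO q N) (Ext N \<phi>) = 0"
proof -
  obtain \<omega> where \<omega>: "\<phi> = (\<Sum>i\<in>{1..<N}. \<omega> i)" "\<forall>i\<in>{1..<N}. \<omega> i \<in> kerX q n N i" using \<phi> Omega_eq[OF q] by auto
  have "app (AO q N) (Ext N (\<omega> i)) = 0" if "i \<in> {1..<N}" for i
    using \<omega> that by (intro AO_kills[OF q, of i]) (auto simp: kerX_def)
  then show ?thesis unfolding \<omega>(1) Ext_sum app_arg_sum by (intro sum.neutral) blast
qed

text \<open>With \<open>Q0\<close> maximal among the wedges that occur, \<open>AO\<close> preserves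
  the coefficient of a wedge attaining it, yet \<open>AO\<close> vanishes on
  \<open>Omega\<close>.\<close>

theorem normal_wedges_independent:
  assumes n: "n > 0" and q: "q \<noteq> 0" and c: "keys c \<subseteq> normal_lists N" and O: "cmb n c \<in> Omega q n N"
  shows "c = 0"
proof (rule ccontr)
  assume "c \<noteq> 0"
  then have K: "finite (keys c)" "keys c \<noteq> {}" by auto
  define Q0 where "Q0 = Max ((\<lambda>ks. sq N (expo n ks)) ` keys c)"
  obtain ks0 where ks0: "ks0 \<in> keys c" "sq N (expo n ks0) = Q0"
  proof -
    have "Q0 \<in> (\<lambda>ks. sq N (expo n ks)) ` keys c"
      unfolding Q0_def by (rule Max_in) (use K in auto)
    then show ?thesis using that by blast
  qed
  have le: "sq N (expo n ks) \<le> Q0" if "ks \<in> keys c" for ks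
    unfolding Q0_def using K that by (intro Max_ge) auto
  have len: "length ks = N" if "ks \<in> keys c" for ks using that c by (auto simp: normal_lists_def)
  have val: "lookup (Ext N (cmb n c) f) m
      = (\<Sum>ks\<in>keys c. if map f [1..<Suc N] = map (col n) ks \<and> expo n ks = m then lookup c ks else 0)" for f m
    unfolding Ext_def cmb_def sum_apply lookup_sum
    by (intro sum.cong refl) (auto simp: tsmul_def u_tensor_mono mono_def lookup_single when_def)
  have nrm: "nrm N (expo n ks) f" if ks: "ks \<in> keys c" and f: "map f [1..<Suc N] = map (col n) ks" for ks f
    unfolding nrm_def
  proof (intro allI impI)
    fix a b assume ab: "1 \<le> a" "a < b" "b \<le> N"
    have fa: "f k = col n (ks ! (k - 1))" if "1 \<le> k" "k \<le> N" for k
      using map_nth1[OF that, of f] that len[OF ks] unfolding f by simp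
    have "ks ! (b - 1) < ks ! (a - 1)"
      using ks c ab sorted_wrt_nth_less[of "(>)" ks "a - 1" "b - 1"] by (auto simp: normal_lists_def)
    then have "int (col n (ks ! (b - 1))) - int n * zexp n (ks ! (b - 1)) < int (col n (ks ! (a - 1))) - int n * zexp n (ks ! (a - 1))"
      using col_zexp(1)[OF n] by metis
    then have "zexp n (ks ! (a - 1)) < zexp n (ks ! (b - 1)) \<or> (zexp n (ks ! (a - 1)) = zexp n (ks ! (b - 1)) \<and> col n (ks ! (b - 1)) < col n (ks ! (a - 1)))"
      using k_less[OF n col_zexp(2)[OF n] col_zexp(2)[OF n]] by blast
    then show "lt (expo n ks) f a b" unfolding lt_def using ab fa len[OF ks] by (auto simp: lookup_expo)
  qed
  have supp: "suppin N Q0 (nrm N) (Ext N (cmb n c))"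
    unfolding suppin_def
  proof (intro allI impI)
    fix f m assume "lookup (Ext N (cmb n c) f) m \<noteq> 0"
    then obtain ks where "ks \<in> keys c" "map f [1..<Suc N] = map (col n) ks" "expo n ks = m"
      unfolding val by (elim sum.not_neutral_contains_not_neutral) (auto split: if_splits)
    then show "sq N m \<le> Q0 \<and> (sq N m = Q0 \<longrightarrow> nrm N m f)" using le nrm by blast
  qed
  define f where "f i = col n (ks0 ! (i - 1))" for i
  have f: "map f [1..<Suc N] = map (col n) ks0"
    using len[OF ks0(1)] by (intro nth_equalityI) (auto simp: f_def simp del: upt_Suc)
  have "ks = ks0" if "ks \<in> keys c" "map (col n) ks0 = map (col n) ks" "expo n ks = expo n ks0" for ks
  proof (rule nth_equalityI)
    show "length ks = length ks0" using len that ks0 by simp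
    fix i assume "i < length ks"
    then have "col n (ks ! i) = col n (ks0 ! i)" "zexp n (ks ! i) = zexp n (ks0 ! i)"
      using arg_cong[OF that(2), of "\<lambda>xs. xs ! i"] arg_cong[OF that(3), of "\<lambda>m. lookup m (Suc i)"] len[OF that(1)] len[OF ks0(1)]
      by (auto simp: lookup_expo)
    then show "ks ! i = ks0 ! i" using col_zexp(1)[OF n] by metis
  qed
  then have "lookup (Ext N (cmb n c) f) (expo n ks0) = (\<Sum>ks\<in>keys c. if ks = ks0 then lookup c ks else 0)"
    unfolding val f by (intro sum.cong) auto
  also have "\<dots> = lookup c ks0" using ks0 by (subst sum.delta) auto
  also have "\<dots> \<noteq> 0" using ks0 by (simp add: in_keys_iff)
  finally have "lookup (app (AO q N) (Ext N (cmb n c)) f) (expo n ks0) \<noteq> 0"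
    using AO_coefficient[OF q order_refl supp ks0(2) nrm[OF ks0(1) f]] by simp
  then show False unfolding AO_Omega[OF q O] by simp
qed

section \<open>Adjoining a vacuum block\<close>

definition Dsum :: "nat \<Rightarrow> int \<Rightarrow> int \<Rightarrow> exps set" where
  "Dsum N c S = {m \<in> Dall N. (\<forall>i\<in>{1..N}. lookup m i \<le> c) \<and> (\<Sum>i\<in>{1..N}. lookup m i) = S}"

text \<open>The space of errors: exponents bounded by \<open>c\<close> of which too few equal
  \<open>c\<close> to form a complete block.\<close>

definition Bsum :: "nat \<Rightarrow> int \<Rightarrow> int \<Rightarrow> nat \<Rightarrow> exps set" where
  "Bsum N c S n = {m \<in> Dsum N c S. card {i \<in> {1..N}. lookup m i = c} < n}"

lemma sum_shift:
  assumes "i \<in> {1..N}" "j \<in> {1..N}" "i \<noteq> j"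
  shows "(\<Sum>k\<in>{1..N}. lookup (shift i j t m) k) = (\<Sum>k\<in>{1..N}. lookup m k)"
proof -
  have "(\<Sum>k\<in>{1..N}. if k = i then t else if k = j then - t else 0) = (\<Sum>k\<in>{1..N}. (if k = i then t else 0) + (if k = j then - t else 0))"
    using assms(3) by (intro sum.cong) auto
  also have "\<dots> = 0" using assms by (simp add: sum.distrib)
  finally show ?thesis by (simp add: lookup_shift assms(3) sum.distrib)
qed

lemma closed_Dsum: "closed_exps N (Dsum N c S)"
  unfolding closed_exps_def Let_def
proof (intro ballI allI impI)
  fix m i j t assume m: "m \<in> Dsum N c S" and ij: "i \<in> {1..N}" "j \<in> {1..N}" "i \<noteq> j"
    and t: "min 0 (lookup m j - lookup m i) \<le> t \<and> t \<le> max 0 (lookup m j - lookup m i)"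
  have le: "lookup m i \<le> c" "lookup m j \<le> c" using m ij by (auto simp: Dsum_def)
  have "shift i j t m \<in> Dall N"
    using closed_Dall[of N] m ij t unfolding closed_exps_def Let_def Dsum_def by blast
  moreover have "lookup (shift i j t m) k \<le> c" if "k \<in> {1..N}" for k
    using m le t that by (auto simp: lookup_shift[OF ij(3)] Dsum_def)
  ultimately show "shift i j t m \<in> Dsum N c S" using m sum_shift[OF ij, of t m] unfolding Dsum_def by simp
qed

lemma shift_full: "i \<noteq> j \<Longrightarrow> shift i j (lookup m j - lookup m i) m = pmswap i j m"
  by (simp add: pmswap_shift)

lemma max_count_shift:
  assumes m: "m \<in> Dsum N c S" and ij: "i \<in> {1..N}" "j \<in> {1..N}" "i \<noteq> j"
    and t: "min 0 (lookup m j - lookup m i) < t" "t < max 0 (lookup m j - lookup m i)"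
  shows "{k \<in> {1..N}. lookup (shift i j t m) k = c} \<subseteq> {k \<in> {1..N}. lookup m k = c} - {i, j}"
proof -
  have "lookup m i \<le> c" "lookup m j \<le> c" using m ij by (auto simp: Dsum_def)
  then show ?thesis using t by (auto simp: lookup_shift[OF ij(3)] split: if_splits)
qed

text \<open>As \<open>c\<close> is the maximum, a strict interpolation creates no new exponent
  \<open>c\<close>; at the end points of an interpolation the exponents are merely permuted.\<close>

lemma closed_Bsum: "closed_exps N (Bsum N c S n)"
  unfolding closed_exps_def Let_def
proof (intro ballI allI impI)
  fix m i j t assume m: "m \<in> Bsum N c S n" and ij: "i \<in> {1..N}" "j \<in> {1..N}" "i \<noteq> j"
    and t: "min 0 (lookup m j - lookup m i) \<le> t \<and> t \<le> max 0 (lookup m j - lookup m i)"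
  let ?d = "lookup m j - lookup m i"
  have mD: "m \<in> Dsum N c S" and cm: "card {k \<in> {1..N}. lookup m k = c} < n" using m by (auto simp: Bsum_def)
  have D: "shift i j t m \<in> Dsum N c S" by (rule closedD[OF closed_Dsum mD ij]) (use t in auto)
  have "card {k \<in> {1..N}. lookup (shift i j t m) k = c} < n"
  proof -
    have "t = 0 \<or> t = ?d \<or> (min 0 ?d < t \<and> t < max 0 ?d)" using t by linarith
    then consider "t = 0" | "t = ?d" | "min 0 ?d < t" "t < max 0 ?d" by blast
    then show ?thesis
    proof cases
      case 2
      have "{k \<in> {1..N}. lookup (pmswap i j m) k = c} = transpose i j ` {k \<in> {1..N}. lookup m k = c}"
      proof (intro Set.set_eqI iffI)
        fix x assume "x \<in> {k \<in> {1..N}. lookup (pmswap i j m) k = c}"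
        then have "transpose i j x \<in> {k \<in> {1..N}. lookup m k = c}" "x = transpose i j (transpose i j x)"
          using ij by (auto simp: lookup_pmswap transpose_def)
        then show "x \<in> transpose i j ` {k \<in> {1..N}. lookup m k = c}" by blast
      qed (use ij in \<open>auto simp: lookup_pmswap transpose_def\<close>)
      moreover have "inj_on (transpose i j) X" for X by (rule inj_on_inverseI[of _ "transpose i j"]) simp
      ultimately show ?thesis using cm 2 by (simp only: shift_full[OF ij(3)] card_image)
    next
      case 3
      have "card {k \<in> {1..N}. lookup (shift i j t m) k = c} \<le> card {k \<in> {1..N}. lookup m k = c}"
        by (rule card_mono) (use max_count_shift[OF mD ij 3] in auto)
      then show ?thesis using cm by simp
    qed (use cm in simp)
  qed
  then show "shift i j t m \<in> Bsum N c S n" using D by (simp add: Bsum_def)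
qed

section \<open>Attaching a block \<open>z^c ... z^c\<close> of \<open>n\<close> factors, modulo the
  space of errors\<close>

context
  fixes q p :: complex and n N :: nat and c S :: int
  assumes q: "q \<noteq> 0" and p: "p \<noteq> 0" and n: "n \<ge> 1"
begin

definition vm :: "nat \<Rightarrow>\<^sub>0 int" where "vm = (\<Sum>j\<in>{N<..N + n}. single j c)"

private abbreviation (input) "N' \<equiv> N + n"
text \<open>The bound \<open>c - 1\<close> makes the exponents of the block strictly larger than all
  earlier ones.\<close>

private abbreviation (input) "D0 \<equiv> Dsum N (c - 1) S"
private abbreviation (input) "D1 \<equiv> Dsum N' c (S + int n * c)"
private abbreviation (input) "B1 \<equiv> Bsum N' c (S + int n * c) n"

lemma lookup_vm: "lookup vm k = (if N < k \<and> k \<le> N + n then c else 0)"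
proof -
  have "lookup vm k = (\<Sum>j\<in>{N<..N + n}. if j = k then c else 0)"
    by (simp add: vm_def lookup_sum lookup_single when_def)
  then show ?thesis by simp
qed

lemma D0_vm:
  assumes "m \<in> D0"
  shows "m + vm \<in> D1" "{k \<in> {1..N'}. lookup (m + vm) k = c} = {N<..N'}"
proof -
  have k: "lookup m k = 0" if "k \<notin> {1..N}" for k using assms that by (auto simp: Dsum_def Dall_def in_keys_iff)
  have l: "lookup (m + vm) k = (if k \<le> N then lookup m k else if k \<le> N' then c else 0)" for k
    using k[of k] by (auto simp: lookup_add lookup_vm)
  have "{1..N'} = {1..N} \<union> {N<..N'}" by auto
  moreover have "(\<Sum>k\<in>{1..N}. lookup (m + vm) k) = S" using assms by (simp add: l Dsum_def)
  moreover have "(\<Sum>k\<in>{N<..N'}. lookup (m + vm) k) = int n * c" by (simp add: l)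
  ultimately have "(\<Sum>k\<in>{1..N'}. lookup (m + vm) k) = S + int n * c"
    by (metis (no_types, lifting) sum.union_disjoint finite_atLeastAtMost finite_greaterThanAtMost ivl_disj_int_two(8))
  moreover have "lookup (m + vm) k \<le> c" if "k \<in> {1..N'}" for k
  proof (cases "k \<le> N")
    case True
    then have "lookup m k \<le> c - 1" using assms that by (auto simp: Dsum_def)
    then show ?thesis using True by (simp add: l)
  qed (use that in \<open>simp add: l\<close>)
  moreover have "m + vm \<in> Dall N'"
  proof -
    have "keys vm \<subseteq> {1..N'}" "keys m \<subseteq> {1..N}"
      using assms by (auto simp: in_keys_iff lookup_vm Dsum_def Dall_def split: if_splits)
    then show ?thesis using keys_add[of m vm] by (fastforce simp: Dall_def)
  qed
  ultimately show "m + vm \<in> D1" by (auto simp: Dsum_def)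
  have "lookup m k \<noteq> c" if "k \<in> {1..N}" for k using assms that by (auto simp: Dsum_def)
  then have "lookup (m + vm) k = c \<longleftrightarrow> N < k" if "k \<in> {1..N'}" for k
    using that by (cases "k \<le> N") (auto simp: l)
  then show "{k \<in> {1..N'}. lookup (m + vm) k = c} = {N<..N'}" by auto
qed

text \<open>\<open>T\<close> on \<open>N + n\<close> variables restricts to \<open>T'\<close> on the
  first \<open>N\<close>, modulo errors. Since \<open>T\<close> preserves the errors, the relation
  is multiplicative and can be verified on the factors of \<open>y_i\<close>.\<close>

definition appr :: "laurent endo \<Rightarrow> laurent endo \<Rightarrow> bool" where
  "appr T T' \<longleftrightarrow> pres B1 T \<and> pres D0 T' \<and> (\<forall>h\<in>LS D0. app T (h * Z vm) - app T' h * Z vm \<in> LS B1)"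

lemma appr_mult:
  assumes "appr T T'" "appr U U'"
  shows "appr (T * U) (T' * U')"
  unfolding appr_def
proof (intro conjI ballI)
  show "pres B1 (T * U)" "pres D0 (T' * U')" using assms by (auto simp: appr_def pres_mult)
  fix h assume h: "h \<in> LS D0"
  have U: "app U (h * Z vm) - app U' h * Z vm \<in> LS B1" "app U' h \<in> LS D0" using assms(2) h by (auto simp: appr_def pres_def)
  have "app T (app U (h * Z vm) - app U' h * Z vm) \<in> LS B1" using assms(1) U(1) by (auto simp: appr_def pres_def)
  moreover have "app T (app U' h * Z vm) - app T' (app U' h) * Z vm \<in> LS B1" using assms(1) U(2) by (auto simp: appr_def)
  ultimately have "app T (app U (h * Z vm) - app U' h * Z vm) + (app T (app U' h * Z vm) - app T' (app U' h) * Z vm) \<in> LS B1" by (rule LS_add)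
  then show "app (T * U) (h * Z vm) - app (T' * U') h * Z vm \<in> LS B1" by (simp add: app_mult app_arg_minus)
qed

lemma appr_1: "appr 1 1" by (simp add: appr_def)

lemma appr_prod_list: "(\<And>x. x \<in> set xs \<Longrightarrow> appr (f x) (g x)) \<Longrightarrow> appr (prod_list (map f xs)) (prod_list (map g xs))"
  by (induction xs) (simp_all add: appr_1 appr_mult)

lemma appr_power: "appr T T' \<Longrightarrow> appr (T ^ k) (T' ^ k)"
  by (induction k) (simp_all add: appr_1 appr_mult)

text \<open>Applying \<open>Ti\<close> to the approximation of \<open>T\<close> at
  \<open>Ti' h\<close> gives the claim, as \<open>Ti\<close> preserves the errors.\<close>

lemma appr_inverse:
  assumes "appr T T'" "Ti * T = 1" "T' * Ti' = 1" "pres B1 Ti" "pres D0 Ti'"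
  shows "appr Ti Ti'"
  unfolding appr_def
proof (intro conjI ballI assms(4,5))
  fix h assume h: "h \<in> LS D0"
  then have h': "app Ti' h \<in> LS D0" using assms(5) by (simp add: pres_def)
  have "app T' (app Ti' h) = h" using assms(3) by (simp flip: app_mult)
  then have "app T (app Ti' h * Z vm) - h * Z vm \<in> LS B1" using assms(1) h' by (auto simp: appr_def)
  then have "app Ti (app T (app Ti' h * Z vm) - h * Z vm) \<in> LS B1" using assms(4) by (simp add: pres_def)
  then have "app (Ti * T) (app Ti' h * Z vm) - app Ti (h * Z vm) \<in> LS B1" by (simp add: app_mult app_arg_minus)
  then have "- (app Ti' h * Z vm - app Ti (h * Z vm)) \<in> LS B1" unfolding assms(2) by (simp add: LS_uminus del: minus_diff_eq)
  then show "app Ti (h * Z vm) - app Ti' h * Z vm \<in> LS B1" by simp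
qed

lemma appr_zpw: "appr T T' \<Longrightarrow> appr U U' \<Longrightarrow> appr (zpw T U l) (zpw T' U' l)"
  by (simp add: zpw_def appr_power)

lemma appr_sc: "appr (scL a) (scL a)"
proof -
  have "smul a (h * Z vm) = smul a h * Z vm" for h :: laurent by (simp add: smul_conv mult.assoc)
  then show ?thesis by (simp add: appr_def pres_sc)
qed

lemma appr_linI:
  assumes T: "linop T" "linop T'" "pres B1 T" "pres D0 T'"
    and m: "\<And>m. m \<in> D0 \<Longrightarrow> app T (Z (m + vm)) - app T' (Z m) * Z vm \<in> LS B1"
  shows "appr T T'"
  unfolding appr_def
proof (intro conjI ballI T)
  fix h assume h: "h \<in> LS D0"
  have "h = (\<Sum>k\<in>keys h. smul (lookup h k) (Z k))" using pm_sum_singles[of h] by simp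
  then have "app T (h * Z vm) - app T' h * Z vm
     = app T ((\<Sum>k\<in>keys h. smul (lookup h k) (Z k)) * Z vm)
       - app T' (\<Sum>k\<in>keys h. smul (lookup h k) (Z k)) * Z vm" by (simp del: smul_single)
  also have "\<dots> = (\<Sum>k\<in>keys h. smul (lookup h k) (app T (Z (k + vm)) - app T' (Z k) * Z vm))"
  proof -
    have 1: "app T (smul a (Z k) * Z vm) = smul a (app T (Z (k + vm)))" for a k
    proof -
      have "smul a (Z k) * Z vm = smul a (Z (k + vm))" by (simp add: mult_single)
      then show ?thesis using T by (simp add: linop_smul del: smul_single)
    qed
    have 2: "app T' (smul a (Z k)) * Z vm = smul a (app T' (Z k) * Z vm)" for a k
      unfolding linop_smul[OF T(2)] by (simp add: smul_conv mult.assoc)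
    show ?thesis by (simp only: sum_distrib_right app_arg_sum 1 2 sum_subtractf[symmetric] smul_diff[symmetric])
  qed
  also have "\<dots> \<in> LS B1" by (intro LS_sum LS_smul m) (use h in \<open>auto simp: LS_def\<close>)
  finally show "app T (h * Z vm) - app T' h * Z vm \<in> LS B1" .
qed

lemma vm_swap: "i \<in> {1..N} \<Longrightarrow> j \<in> {1..N} \<Longrightarrow> pmswap i j vm = vm"
  by (rule poly_mapping_eqI) (auto simp: lookup_pmswap lookup_vm transpose_def)

text \<open>The block monomial is symmetric in the two variables, so here the approximation is exact
  for \<open>xi\<close>.\<close>

lemma appr_inner:
  assumes ij: "i \<in> {1..N}" "j \<in> {1..N}" "i \<noteq> j"
  shows "appr (xiL q i j) (xiL q i j)" "appr (xiiL q i j) (xiiL q i j)"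
proof -
  have ij': "i \<in> {1..N'}" "j \<in> {1..N'}" using ij by auto
  note P = pres_ops[OF closed_Bsum ij' ij(3)] pres_ops[OF closed_Dsum ij]
  have K: "swap_op i j (Z vm) = Z vm" using ij by (simp add: vm_swap)
  have "app (xiL q i j) (h * Z vm) = app (xiL q i j) h * Z vm" for h
    using g_op_lin[OF ij(3) K, of q h] K by (simp add: xiL_def app_mult app_gL[OF ij(3)] swap_op_mult mult.commute)
  then show 1: "appr (xiL q i j) (xiL q i j)" using P by (simp add: appr_def)
  show "appr (xiiL q i j) (xiiL q i j)"
    by (rule appr_inverse[OF 1]) (use xi_inv q ij P in auto)
qed

text \<open>The old exponent is below \<open>c\<close>, so \<open>g\<close> gives
  \<open>q^-1\<close> times the transposed monomial and strict interpolations. The transposition in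
  \<open>xi\<close> undoes the exchange, and the interpolations have lost an exponent
  \<open>c\<close>.\<close>

lemma appr_mixed:
  assumes i: "i \<in> {1..N}" and j: "j \<in> {N<..N'}"
  shows "appr (xiL q i j) (scL (inverse q))" "appr (xiiL q i j) (scL q)"
proof -
  have ij: "i \<in> {1..N'}" "j \<in> {1..N'}" "i \<noteq> j" using i j by auto
  note P = pres_ops[OF closed_Bsum ij]
  show 1: "appr (xiL q i j) (scL (inverse q))"
  proof (rule appr_linI)
    show "linop (xiL q i j)" using ij by (simp add: xiL_def linop_mult)
    fix m assume m: "m \<in> D0"
    let ?m = "m + vm"
    have v: "lookup ?m j = c" "lookup ?m i \<le> c - 1"
      using m i j by (auto simp: lookup_add lookup_vm Dsum_def Dall_def in_keys_iff)
    define d where "d = lookup ?m j - lookup ?m i"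
    have d: "d > 0" using v by (simp add: d_def)
    have g: "g_op q i j (Z ?m) = smul (inverse q) (Z (pmswap i j ?m)) + smul (inverse q - q) (\<Sum>t\<in>{0<..<d}. Z (shift i j t ?m))"
      unfolding g_op_Z[OF ij(3)] Let_def d_def[symmetric] using d by simp
    have B: "(\<Sum>t\<in>{0<..<d}. Z (shift i j t ?m)) \<in> LS B1"
    proof (rule LS_sum)
      fix t assume t: "t \<in> {0<..<d}"
      have "shift i j t ?m \<in> D1" by (rule closedD[OF closed_Dsum D0_vm(1)[OF m] ij]) (use t d_def in auto)
      moreover have "card {k \<in> {1..N'}. lookup (shift i j t ?m) k = c} < n"
      proof -
        have "{k \<in> {1..N'}. lookup (shift i j t ?m) k = c} \<subseteq> {N<..N'} - {j}"
          using max_count_shift[OF D0_vm(1)[OF m] ij, of t] t d unfolding D0_vm(2)[OF m] d_def by auto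
        then have "card {k \<in> {1..N'}. lookup (shift i j t ?m) k = c} \<le> card ({N<..N'} - {j})" by (intro card_mono) auto
        also have "\<dots> = n - 1" using j by simp
        finally show ?thesis using n by simp
      qed
      ultimately show "Z (shift i j t ?m) \<in> LS B1" by (simp add: LS_Z Bsum_def)
    qed
    have "app (xiL q i j) (Z ?m) - app (scL (inverse q)) (Z m) * Z vm = swap_op i j (smul (inverse q - q) (\<Sum>t\<in>{0<..<d}. Z (shift i j t ?m)))"
      by (simp add: xiL_def app_mult app_gL[OF ij(3)] g swap_op_add swap_op_smul mult_single)
    also have "\<dots> \<in> LS B1" using P(3) LS_smul[OF B] by (simp add: pres_def)
    finally show "app (xiL q i j) (Z ?m) - app (scL (inverse q)) (Z m) * Z vm \<in> LS B1" .
  qed (simp_all add: P pres_sc)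
  show "appr (xiiL q i j) (scL q)"
    by (rule appr_inverse[OF 1]) (use xi_inv q ij P in \<open>auto simp: scL_mult pres_sc\<close>)
qed

text \<open>Both exponents equal \<open>c\<close>, where \<open>g\<close> is multiplication by
  \<open>q\<close>.\<close>

lemma appr_outer:
  assumes ij: "i \<in> {N<..N'}" "j \<in> {N<..N'}" "i \<noteq> j"
  shows "appr (xiL q i j) (scL q)" "appr (xiiL q i j) (scL (inverse q))"
proof -
  have ij': "i \<in> {1..N'}" "j \<in> {1..N'}" using ij by auto
  note P = pres_ops[OF closed_Bsum ij' ij(3)]
  show 1: "appr (xiL q i j) (scL q)"
  proof (rule appr_linI)
    show "linop (xiL q i j)" using ij by (simp add: xiL_def linop_mult)
    fix m assume m: "m \<in> D0"
    have "lookup m k = 0" if "k \<in> {N<..N'}" for k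
      using m that by (auto simp: Dsum_def Dall_def in_keys_iff)
    then have v: "lookup (m + vm) i = c" "lookup (m + vm) j = c"
      using ij by (auto simp: lookup_add lookup_vm)
    have "app (xiL q i j) (Z (m + vm)) = smul q (Z (m + vm))"
      using v by (simp add: xiL_def app_mult app_gL[OF ij(3)] g_op_Z[OF ij(3)] pmswap_shift[OF ij(3)])
    then show "app (xiL q i j) (Z (m + vm)) - app (scL q) (Z m) * Z vm \<in> LS B1" by (simp add: mult_single)
  qed (simp_all add: P pres_sc)
  show "appr (xiiL q i j) (scL (inverse q))"
    by (rule appr_inverse[OF 1]) (use xi_inv q ij P in \<open>auto simp: scL_mult pres_sc\<close>)
qed

lemma appr_pL:
  shows "i \<in> {1..N} \<Longrightarrow> appr (pL p i) (pL p i)" "i \<in> {N<..N'} \<Longrightarrow> appr (pL p i) (scL (p powi c))"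
proof -
  show "appr (pL p i) (pL p i)" if "i \<in> {1..N}"
    using that by (intro appr_linI linop_pL pres_pL) (simp add: lookup_add lookup_vm mult_single)
  show "appr (pL p i) (scL (p powi c))" if i: "i \<in> {N<..N'}"
  proof (intro appr_linI linop_pL pres_pL pres_sc)
    fix m assume m: "m \<in> D0"
    have "lookup m i = 0" using m i by (auto simp: Dsum_def Dall_def in_keys_iff)
    then show "app (pL p i) (Z (m + vm)) - app (scL (p powi c)) (Z m) * Z vm \<in> LS B1"
      using i by (simp add: lookup_add lookup_vm mult_single)
  qed simp
qed

lemma prod_list_scL: "prod_list (map (\<lambda>_. scL a) xs) = scL (a ^ length xs)"
  by (induction xs) (simp_all add: scL_mult)

text \<open>The \<open>n\<close> additional factors \<open>xi^-1\<close> contribute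
  \<open>q^n\<close>, which is exactly the change in the normalisation
  \<open>q^(1-N)\<close>.\<close>

lemma appr_yL_inner:
  assumes i: "i \<in> {1..N}"
  shows "appr (yL q p N' i) (yL q p N i)" "appr (yiL q p N' i) (yiL q p N i)"
proof -
  have u: "[i + 1..<N' + 1] = [i + 1..<N + 1] @ [N + 1..<N' + 1]" using i upt_add_eq_append[of "i + 1" "N + 1" n] by simp
  have Y: "yL q p N' i = scL (q powi (1 - int N')) * (prod_list (map (\<lambda>j. xiiL q i j) [i + 1..<N + 1]) * prod_list (map (\<lambda>j. xiiL q i j) [N + 1..<N' + 1])
     * pL p i * prod_list (map (\<lambda>j. xiL q j i) [1..<i]))"
    unfolding yL_def YL_def u by (simp only: map_append prod_list.append)
  let ?A = "prod_list (map (\<lambda>j. xiiL q i j) [i + 1..<N + 1])" and ?B = "prod_list (map (\<lambda>j. xiL q j i) [1..<i])"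
  have "appr (prod_list (map (\<lambda>j. xiiL q i j) [N + 1..<N' + 1])) (prod_list (map (\<lambda>_. scL q) [N + 1..<N' + 1]))"
    by (rule appr_prod_list, rule appr_mixed(2)[OF i]) auto
  then have "appr (yL q p N' i) (scL (q powi (1 - int N')) * (?A * scL (q ^ n) * pL p i * ?B))"
    unfolding Y prod_list_scL using i
    by (intro appr_mult appr_sc appr_prod_list appr_inner appr_pL) (auto simp del: upt_Suc)
  moreover have "scL (q powi (1 - int N')) * (?A * scL (q ^ n) * pL p i * ?B) = yL q p N i"
  proof -
    have c: "scL (q ^ n) * ?A = ?A * scL (q ^ n)" by (rule commute_prod_list, rule sc_xi) auto
    have "q powi (1 - int N') * q ^ n = q powi (1 - int N)"
      using q by (simp add: power_int_add[symmetric] flip: power_int_of_nat)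
    then show ?thesis unfolding yL_def YL_def c[symmetric]
      by (simp only: mult.assoc[symmetric] scL_mult)
  qed
  ultimately show 1: "appr (yL q p N' i) (yL q p N i)" by simp
  show "appr (yiL q p N' i) (yiL q p N i)"
    by (rule appr_inverse[OF 1]) (use i in \<open>auto intro!: yL_inv q p pres_y closed_Bsum closed_Dsum\<close>)
qed

text \<open>The eigenvalue of \<open>y_i\<close> at a block site: the normalisation,
  \<open>q^-1\<close> for each later site, \<open>p^c\<close>, \<open>q^-1\<close> for each old
  site, and \<open>q\<close> for each earlier block site.\<close>

definition lam :: "nat \<Rightarrow> complex" where
  "lam i = q powi (1 - int N') * (inverse q ^ (N' - i) * p powi c * (inverse q ^ N * q ^ (i - N - 1)))"

lemma lam_nz: "lam i \<noteq> 0" using q p by (simp add: lam_def)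

lemma appr_yL_outer:
  assumes i: "i \<in> {N<..N'}"
  shows "appr (yL q p N' i) (scL (lam i))" "appr (yiL q p N' i) (scL (inverse (lam i)))"
proof -
  have u: "[1..<i] = [1..<N + 1] @ [N + 1..<i]" using i upt_add_eq_append[of 1 "N + 1" "i - N - 1"] by simp
  have 1: "appr (prod_list (map (\<lambda>j. xiiL q i j) [i + 1..<N' + 1])) (prod_list (map (\<lambda>_. scL (inverse q)) [i + 1..<N' + 1]))"
    by (rule appr_prod_list, rule appr_outer(2)[OF i]) (use i in auto)
  have 2: "appr (prod_list (map (\<lambda>j. xiL q j i) [1..<N + 1])) (prod_list (map (\<lambda>_. scL (inverse q)) [1..<N + 1]))"
    by (rule appr_prod_list, rule appr_mixed(1)[OF _ i]) auto
  have 3: "appr (prod_list (map (\<lambda>j. xiL q j i) [N + 1..<i])) (prod_list (map (\<lambda>_. scL q) [N + 1..<i]))"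
    by (rule appr_prod_list, rule appr_outer(1)[OF _ i]) (use i in auto)
  have "appr (yL q p N' i) (scL (q powi (1 - int N')) * (scL (inverse q ^ (N' - i)) * scL (p powi c) * (scL (inverse q ^ N) * scL (q ^ (i - N - 1)))))"
  proof -
    have l: "length [i + 1..<N' + 1] = N' - i" "length [1..<N + 1] = N" "length [N + 1..<i] = i - N - 1" by (auto simp del: upt_Suc)
    show ?thesis unfolding yL_def YL_def u map_append prod_list.append
      by (rule appr_mult[OF appr_sc appr_mult[OF appr_mult[OF 1 appr_pL(2)[OF i]] appr_mult[OF 2 3]], unfolded prod_list_scL l])
  qed
  then show a: "appr (yL q p N' i) (scL (lam i))" by (simp add: scL_mult lam_def)
  show "appr (yiL q p N' i) (scL (inverse (lam i)))"
    by (rule appr_inverse[OF a]) (use i lam_nz in \<open>auto intro!: yL_inv q p pres_y closed_Bsum pres_sc simp: scL_mult\<close>)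
qed

text \<open>The block eigenvalues are the constants subtracted in \<open>g_l\<close>, in reversed
  order: site \<open>i\<close> matches the constant with index
  \<open>N + N' + 1 - i\<close>.\<close>

lemma lam_eq:
  assumes "i \<in> {N<..N'}"
  shows "lam i = p powi c * q powi (2 * (1 - int (N + N' + 1 - i)))"
proof -
  have e: "inverse q ^ k = q powi (- int k)" "q ^ k = q powi (int k)" for k by (simp_all add: power_int_minus power_inverse)
  have "2 * (1 - int (N + N' + 1 - i)) = 1 - int N' + (- int (N' - i) + (- int N + int (i - N - 1)))"
    using assms by (simp add: of_nat_diff)
  then have "q powi (2 * (1 - int (N + N' + 1 - i))) = q powi (1 - int N') * (q powi (- int (N' - i)) * (q powi (- int N) * q powi int (i - N - 1)))"
    by (simp only: power_int_add[OF disjI1[OF q]])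
  then show ?thesis unfolding lam_def e by (simp only: mult_ac)
qed

text \<open>\<open>attg \<tau> \<phi>\<close> is \<open>\<phi> \<otimes> (z\<^sup>c \<dots> z\<^sup>c \<otimes> v\<^sub>\<tau>)\<close> with \<open>n\<close> new factors.\<close>

definition attg :: "nat list \<Rightarrow> tensor \<Rightarrow> tensor" where
  "attg \<tau> \<phi> = (\<lambda>e. if drop N e = \<tau> then \<phi> (take N e) * Z vm else 0)"

lemma attg_add: "attg \<tau> (\<phi> + \<psi>) = attg \<tau> \<phi> + attg \<tau> \<psi>" by (auto simp: attg_def distrib_right)
lemma attg_diff: "attg \<tau> (\<phi> - \<psi>) = attg \<tau> \<phi> - attg \<tau> \<psi>" by (auto simp: attg_def left_diff_distrib)
lemma attg_smul: "attg \<tau> (tsmul a \<phi>) = tsmul a (attg \<tau> \<phi>)" by (auto simp: attg_def tsmul_def smul_conv mult.assoc)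
lemma attg_0: "attg \<tau> 0 = 0" by (auto simp: attg_def)
lemma attg_sum: "attg \<tau> (\<Sum>i\<in>I. \<phi> i) = (\<Sum>i\<in>I. attg \<tau> (\<phi> i))"
  by (induction I rule: infinite_finite_induct) (simp_all add: attg_add attg_0 del: plus_fun_apply zero_fun_apply)

lemma colours_append: "e \<in> colours n' (N + n) \<longleftrightarrow> take N e \<in> colours n' N \<and> drop N e \<in> colours n' n"
proof -
  have "set e = set (take N e) \<union> set (drop N e)" by (metis append_take_drop_id set_append)
  then show ?thesis using n by (auto simp: colours_def)
qed

lemma TS_attg:
  assumes \<phi>: "\<phi> \<in> TS n' N D0" and \<tau>: "\<tau> \<in> colours n' n"
  shows "attg \<tau> \<phi> \<in> TS n' N' D1"
proof -
  have "f * Z vm \<in> LS D1" if "f \<in> LS D0" for f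
  proof -
    have "keys (f * Z vm) \<subseteq> {a + b | a b. a \<in> keys f \<and> b \<in> keys (Z vm)}" by (rule keys_mult)
    also have "\<dots> \<subseteq> D1" using that D0_vm(1) by (auto simp: LS_def)
    finally show ?thesis by (simp add: LS_def)
  qed
  then show ?thesis using assms by (auto simp: TS_def attg_def colours_append)
qed

lemma attg_tensors: "\<phi> \<in> tensors n' N \<Longrightarrow> \<tau> \<in> colours n' n \<Longrightarrow> attg \<tau> \<phi> \<in> tensors n' N'"
proof -
  assume a: "\<phi> \<in> tensors n' N" "\<tau> \<in> colours n' n"
  have "f * Z vm \<in> LS (Dall N')" if "f \<in> LS (Dall N)" for f
  proof -
    have "keys vm \<subseteq> {1..N'}" by (auto simp: in_keys_iff lookup_vm split: if_splits)
    then have "a + vm \<in> Dall N'" if "a \<in> Dall N" for a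
      using that keys_add[of a vm] by (fastforce simp: Dall_def)
    moreover have "keys (f * Z vm) \<subseteq> {a + b | a b. a \<in> keys f \<and> b \<in> keys (Z vm)}" by (rule keys_mult)
    ultimately show ?thesis using that by (fastforce simp: LS_def)
  qed
  then show ?thesis using a unfolding tensors_TS by (auto simp: TS_def attg_def colours_append)
qed

lemma Ext_attg: "Ext N' (attg \<tau> \<phi>) f = (if map f [N + 1..<N' + 1] = \<tau> then Ext N \<phi> f * Z vm else 0)"
proof -
  have "[1..<Suc N'] = [1..<Suc N] @ [N + 1..<N' + 1]" using upt_add_eq_append[of 1 "N + 1" n] by simp
  then have "map f [1..<Suc N'] = map f [1..<Suc N] @ map f [N + 1..<N' + 1]" by simp
  then show ?thesis unfolding Ext_def attg_def by (simp del: upt_Suc)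
qed

text \<open>For \<open>i < N\<close> both \<open>g_i\<close> and \<open>S_i\<close> act on the old
  factors only, and the block monomial is symmetric in \<open>z_i\<close> and
  \<open>z_(i+1)\<close>.\<close>

lemma kerX_attg:
  assumes i: "1 \<le> i" "i < N" and \<phi>: "\<phi> \<in> kerX q n' N i" and \<tau>: "\<tau> \<in> colours n' n"
  shows "attg \<tau> \<phi> \<in> kerX q n' N' i"
proof -
  have \<phi>': "\<phi> \<in> tensors n' N" "app (XO q i) (Ext N \<phi>) = - Ext N \<phi>" using \<phi> by (auto simp: kerX_def)
  have K: "swap_op i (Suc i) (Z vm) = Z vm" using i by (simp add: vm_swap)
  have m: "map (swf i f) [N + 1..<N' + 1] = map f [N + 1..<N' + 1]" for f using i by (auto simp del: upt_Suc)
  have ST: "app (ST q i) (Ext N' (attg \<tau> \<phi>)) f = (if map f [N + 1..<N' + 1] = \<tau> then app (ST q i) (Ext N \<phi>) f * Z vm else 0)" for f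
    unfolding app_ST Ext_attg m by (auto simp: left_diff_distrib smul_conv mult.assoc)
  have "app (XO q i) (Ext N' (attg \<tau> \<phi>)) = - Ext N' (attg \<tau> \<phi>)"
  proof
    fix f
    have "g_op q i (Suc i) (h * Z vm) = g_op q i (Suc i) h * Z vm" for h
      using g_op_lin[OF n_not_Suc_n K, of q h] by (simp add: mult.commute)
    moreover have "g_op q i (Suc i) 0 = 0" by (metis app_gL app_arg_0 n_not_Suc_n)
    ultimately have "app (XO q i) (Ext N' (attg \<tau> \<phi>)) f = (if map f [N + 1..<N' + 1] = \<tau> then app (XO q i) (Ext N \<phi>) f * Z vm else 0)"
      unfolding XO_def app_mult app_lft ST app_gL[OF n_not_Suc_n] by simp
    then show "app (XO q i) (Ext N' (attg \<tau> \<phi>)) f = (- Ext N' (attg \<tau> \<phi>)) f"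
      unfolding \<phi>'(2) by (simp add: Ext_attg)
  qed
  then show ?thesis using attg_tensors[OF \<phi>'(1) \<tau>] by (simp add: kerX_def)
qed

lemma Omega_attg:
  assumes \<phi>: "\<phi> \<in> Omega q n' N" and \<tau>: "\<tau> \<in> colours n' n"
  shows "attg \<tau> \<phi> \<in> Omega q n' N'"
proof -
  obtain \<omega> where \<omega>: "\<phi> = (\<Sum>i\<in>{1..<N}. \<omega> i)" "\<forall>i\<in>{1..<N}. \<omega> i \<in> kerX q n' N i" using \<phi> Omega_eq[OF q] by auto
  show ?thesis unfolding \<omega>(1) attg_sum
  proof (intro Omega_sum q)
    fix i assume i: "i \<in> {1..<N}"
    then have "attg \<tau> (\<omega> i) \<in> kerX q n' N' i" using \<omega>(2) \<tau> by (intro kerX_attg) auto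
    then show "attg \<tau> (\<omega> i) \<in> Omega q n' N'" using i by (intro kerX_Omega[OF q, of i]) auto
  qed
qed

text \<open>At two neighbouring block sites the coefficients are symmetric in the variables, so
  \<open>g\<close> acts as \<open>q\<close> and the wedge relation reduces to \<open>q = S\<close>
  on colours.\<close>

lemma attg_exchange:
  assumes j: "Suc j < n" and \<tau>: "\<tau> \<in> colours n' n" and \<phi>: "\<phi> \<in> tensors n' N"
  shows "\<tau> ! j = \<tau> ! Suc j \<Longrightarrow> tsmul (q + inverse q) (attg \<tau> \<phi>) \<in> Omega q n' N'"
    and "\<tau> ! Suc j < \<tau> ! j \<Longrightarrow> tsmul q (attg \<tau> \<phi>) + attg (swl (Suc j) \<tau>) \<phi> \<in> Omega q n' N'"
proof -
  let ?i = "N + Suc j" and ?\<psi> = "attg \<tau> \<phi>"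
  have i: "1 \<le> ?i" "?i < N'" using j by auto
  have t: "?\<psi> \<in> tensors n' N'" by (rule attg_tensors[OF \<phi> \<tau>])
  have g: "on_laurent (app (gL q ?i (Suc ?i))) ?\<psi> = tsmul q ?\<psi>"
  proof
    fix e
    have kf: "pmswap ?i (Suc ?i) m = m" if "m \<in> Dall N" for m
    proof -
      have "lookup m k = 0" if "N < k" for k
        using \<open>m \<in> Dall N\<close> that by (auto simp: Dall_def in_keys_iff)
      then show ?thesis by (intro poly_mapping_eqI) (simp add: lookup_pmswap transpose_def)
    qed
    have kv: "pmswap ?i (Suc ?i) vm = vm" using j by (intro poly_mapping_eqI) (auto simp: lookup_pmswap lookup_vm transpose_def)
    have "swap_op ?i (Suc ?i) f = f" if "f \<in> LS (Dall N)" for f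
    proof -
      have "swap_op ?i (Suc ?i) f = app (KL ?i (Suc ?i)) (\<Sum>k\<in>keys f. single k (lookup f k))"
        using pm_sum_singles[of f] by simp
      also have "\<dots> = (\<Sum>k\<in>keys f. single k (lookup f k))"
        unfolding app_arg_sum by (intro sum.cong refl) (use that kf in \<open>auto simp: LS_def\<close>)
      finally show ?thesis using pm_sum_singles[of f] by simp
    qed
    then have K: "swap_op ?i (Suc ?i) (?\<psi> e) = ?\<psi> e"
      using \<phi> kv unfolding tensors_TS by (auto simp: attg_def TS_def swap_op_mult additive.zero[of "swap_op ?i (Suc ?i)"] additive_def swap_op_add)
    have *: "(x - y) * (a * f) = (a - b) * x * f + (b * x - a * y) * f" for x y a b f :: laurent
      by (simp add: algebra_simps)
    have "smul q (?\<psi> e) = g_op q ?i (Suc ?i) (?\<psi> e)"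
      unfolding g_op_char[OF n_not_Suc_n] K smul_conv single_diff by (rule *)
    then show "on_laurent (app (gL q ?i (Suc ?i))) ?\<psi> e = tsmul q ?\<psi> e"
      by (simp add: on_laurent_def tsmul_def app_gL)
  qed
  have l: "length \<tau> = n" using \<tau> by (simp add: colours_def)
  have rel: "tsmul q ?\<psi> - S_op q n' ?i ?\<psi> \<in> Omega q n' N'" using gS_relation[OF q i t] unfolding g .
  have S0: "S_op q n' ?i ?\<psi> e = 0" if "e \<notin> colours n' N'" for e
    using TS_S_op[of ?\<psi> n' N' "Dall N'" q ?i] t that unfolding tensors_TS by (auto simp: TS_def)
  have sw: "take N (swl ?i e) = take N e" "drop N (swl ?i e) = swl (Suc j) (drop N e)" if "length e = N'" for e
    using that j by (auto simp: swl_def take_update_cancel drop_update_swap nth_drop)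
  have nth: "e ! (?i - 1) = drop N e ! j" "e ! ?i = drop N e ! Suc j" if "length e = N'" for e using that by auto
  have inv: "swl (Suc j) \<tau>' = \<tau> \<longleftrightarrow> \<tau>' = swl (Suc j) \<tau>" if "length \<tau>' = n" for \<tau>'
    using swl_invol[of \<tau> n "Suc j"] swl_invol[of \<tau>' n "Suc j"] l that j by auto
  have at: "attg \<tau> \<phi> (swl ?i e) = (if drop N e = swl (Suc j) \<tau> then \<phi> (take N e) * Z vm else 0)" if "length e = N'" for e
    unfolding attg_def sw[OF that] using inv[of "drop N e"] that by simp
  show "tsmul (q + inverse q) ?\<psi> \<in> Omega q n' N'" if eq: "\<tau> ! j = \<tau> ! Suc j"
  proof -
    have sf: "swl (Suc j) \<tau> = \<tau>" using eq l j by (intro nth_equalityI) (auto simp: swl_def nth_list_update)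
    have "S_op q n' ?i ?\<psi> = tsmul (- inverse q) ?\<psi>"
    proof
      fix e
      show "S_op q n' ?i ?\<psi> e = tsmul (- inverse q) ?\<psi> e"
      proof (cases "e \<in> colours n' N'")
        case True
        then have e: "length e = N'" by (simp add: colours_def)
        show ?thesis unfolding S_op_apply[OF t i True] nth[OF e] at[OF e] sf using eq
          by (cases "drop N e = \<tau>") (auto simp: attg_def tsmul_def)
      qed (use S0 t in \<open>auto simp: tsmul_def tensors_def\<close>)
    qed
    then have "tsmul q ?\<psi> - S_op q n' ?i ?\<psi> = tsmul (q + inverse q) ?\<psi>"
      by (auto simp: tsmul_def smul_add_left smul_minus_left)
    then show ?thesis using rel by simp
  qed
  show "tsmul q ?\<psi> + attg (swl (Suc j) \<tau>) \<phi> \<in> Omega q n' N'" if lt: "\<tau> ! Suc j < \<tau> ! j"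
  proof -
    have sn: "swl (Suc j) \<tau> ! j = \<tau> ! Suc j" "swl (Suc j) \<tau> ! Suc j = \<tau> ! j" using l j by (auto simp: swl_def nth_list_update)
    then have ne: "swl (Suc j) \<tau> \<noteq> \<tau>" using lt by auto
    have "S_op q n' ?i ?\<psi> = - attg (swl (Suc j) \<tau>) \<phi>"
    proof
      fix e
      show "S_op q n' ?i ?\<psi> e = (- attg (swl (Suc j) \<tau>) \<phi>) e"
      proof (cases "e \<in> colours n' N'")
        case True
        then have e: "length e = N'" by (simp add: colours_def)
        show ?thesis unfolding S_op_apply[OF t i True] nth[OF e] at[OF e] using sn ne lt
          by (cases "drop N e = \<tau>"; cases "drop N e = swl (Suc j) \<tau>") (auto simp: attg_def)
      next
        case False
        have "attg (swl (Suc j) \<tau>) \<phi> \<in> tensors n' N'" by (rule attg_tensors[OF \<phi> swl_colours[OF \<tau>]]) (use j in auto)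
        then show ?thesis using S0[OF False] False by (simp add: tensors_def)
      qed
    qed
    then show ?thesis using rel by (simp add: diff_minus_eq_add del: plus_fun_apply)
  qed
qed

text \<open>Exchanges, which modulo \<open>Omega\<close> cost only a nonzero scalar, bring the equal
  colours next to each other; there the factor \<open>q + q^-1\<close> is invertible.\<close>

lemma attg_repeated:
  assumes gq: "generic_q q" and \<phi>: "\<phi> \<in> tensors n' N"
  shows "\<tau> \<in> colours n' n \<Longrightarrow> a < b \<Longrightarrow> b < n \<Longrightarrow> \<tau> ! a = \<tau> ! b \<Longrightarrow> attg \<tau> \<phi> \<in> Omega q n' N'"
proof (induction "b - a" arbitrary: \<tau> b rule: less_induct)
  case less
  have unit: "\<psi> \<in> Omega q n' N'" if "tsmul x \<psi> \<in> Omega q n' N'" "x \<noteq> 0" for x \<psi>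
    using Omega_smul[OF q that(1), of "inverse x"] that(2) by (simp add: tsmul_simps)
  obtain b' where b: "b = Suc b'" using less.prems by (cases b) auto
  show ?case
  proof (cases "a = b'")
    case True
    then show ?thesis using attg_exchange(1)[of b', OF _ less.prems(1) \<phi>] less.prems b unit qints(1)[OF gq] by auto
  next
    case False
    let ?\<tau> = "swl (Suc b') \<tau>"
    have l: "length \<tau> = n" using less.prems by (simp add: colours_def)
    have c: "?\<tau> \<in> colours n' n" by (rule swl_colours[OF less.prems(1)]) (use less.prems b in auto)
    have n1: "?\<tau> ! b' = \<tau> ! b" "?\<tau> ! a = \<tau> ! a" "?\<tau> ! Suc b' = \<tau> ! b'" "swl (Suc b') ?\<tau> = \<tau>"
      using less.prems b False l swl_invol[OF l, of "Suc b'"] by (auto simp: swl_def nth_list_update)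
    have O: "attg ?\<tau> \<phi> \<in> Omega q n' N'"
      by (rule less.hyps[of b']) (use less.prems b False c n1 in auto)
    consider "\<tau> ! b' = \<tau> ! b" | "\<tau> ! b < \<tau> ! b'" | "\<tau> ! b' < \<tau> ! b" by linarith
    then show ?thesis
    proof cases
      case 1
      then show ?thesis using attg_exchange(1)[of b', OF _ less.prems(1) \<phi>] less.prems b unit qints(1)[OF gq] by auto
    next
      case 2
      then have "tsmul q (attg \<tau> \<phi>) + attg ?\<tau> \<phi> \<in> Omega q n' N'"
        using attg_exchange(2)[of b', OF _ less.prems(1) \<phi>] less.prems b by simp
      from Omega_diff[OF q this O] have "tsmul q (attg \<tau> \<phi>) \<in> Omega q n' N'" by (simp only: add_diff_cancel_right')
      then show ?thesis using unit q by blast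
    next
      case 3
      then have "tsmul q (attg ?\<tau> \<phi>) + attg (swl (Suc b') ?\<tau>) \<phi> \<in> Omega q n' N'"
        using attg_exchange(2)[of b', OF _ c \<phi>] less.prems b n1 by simp
      from Omega_diff[OF q this Omega_smul[OF q O, of q]] show ?thesis unfolding n1 by (simp only: add_diff_cancel_left')
    qed
  qed
qed

lemma attg_on_laurent:
  assumes "appr T T'" "\<phi> \<in> TS n' N D0" "\<tau> \<in> colours n' n"
  shows "on_laurent (app T) (attg \<tau> \<phi>) - attg \<tau> (on_laurent (app T') \<phi>) \<in> TS n' N' B1"
  using assms by (auto simp: TS_def appr_def on_laurent_def attg_def colours_append)

lemma attg_munit: "1 \<le> i \<Longrightarrow> i \<le> N \<Longrightarrow> munit i a b (attg \<tau> \<phi>) = attg \<tau> (munit i a b \<phi>)"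
  by (rule ext) (simp add: munit_def attg_def take_update_swap)

text \<open>A matrix unit at a block site sees a single colour, so it either replaces this colour or
  gives zero.\<close>

lemma attg_munit_outer:
  assumes i: "i \<in> {N<..N'}" and \<tau>: "length \<tau> = n"
  shows "munit i a b (attg \<tau> \<phi>) = (if \<tau> ! (i - N - 1) = b then attg (\<tau>[i - N - 1 := a]) \<phi> else 0)"
proof
  fix e
  let ?j = "i - N - 1"
  have j: "?j < n" "i - 1 = N + ?j" using i by auto
  have t: "take N (e[i - 1 := b]) = take N e" "drop N (e[i - 1 := b]) = (drop N e)[?j := b]"
    unfolding j(2) by (simp_all add: drop_update_swap)
  have "(e ! (i - 1) = a \<and> (drop N e)[?j := b] = \<tau>) \<longleftrightarrow> (\<tau> ! ?j = b \<and> drop N e = \<tau>[?j := a])" if "length e = N'"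
  proof -
    define d where "d = drop N e"
    have "e ! (i - 1) = d ! ?j" unfolding j(2) d_def using that j by simp
    moreover have "length d = n" using that by (simp add: d_def)
    ultimately show ?thesis using \<tau> j(1) unfolding d_def[symmetric]
      by (metis list_update_id list_update_overwrite nth_list_update_eq)
  qed
  moreover have "(drop N e)[?j := b] \<noteq> \<tau>" "drop N e \<noteq> \<tau>[?j := a]" if "length e \<noteq> N'"
    using that \<tau> n by (auto dest!: arg_cong[of _ _ length])
  ultimately show "munit i a b (attg \<tau> \<phi>) e = (if \<tau> ! ?j = b then attg (\<tau>[?j := a]) \<phi> else 0) e"
    unfolding munit_def attg_def t by (cases "length e = N'") auto
qed

lemma attg_scaling:
  assumes "\<And>e. drop N e = \<tau> \<Longrightarrow> length (take N e) = N \<Longrightarrow> w e = w' (take N e)" and \<phi>: "\<phi> \<in> tensors n' N"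
  shows "(\<lambda>e. smul (w e) (attg \<tau> \<phi> e)) = attg \<tau> (\<lambda>e. smul (w' e) (\<phi> e))"
proof
  fix e
  show "smul (w e) (attg \<tau> \<phi> e) = attg \<tau> (\<lambda>e. smul (w' e) (\<phi> e)) e"
  proof (cases "drop N e = \<tau> \<and> take N e \<in> colours n' N")
    case True
    then have "w e = w' (take N e)" using assms(1) by (simp add: colours_def)
    then show ?thesis by (simp add: attg_def smul_conv mult.assoc)
  next
    case False
    then show ?thesis using \<phi> by (auto simp: attg_def tensors_def)
  qed
qed

end

section \<open>Coordinates in the wedge product\<close>

text \<open>Coordinates of the wedge represented by a tensor; this avoids handling cosets until the
  end.\<close>

definition nf :: "complex \<Rightarrow> nat \<Rightarrow> nat \<Rightarrow> tensor \<Rightarrow> (int list \<Rightarrow>\<^sub>0 complex)" where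
  "nf q n N \<phi> = (THE c. keys c \<subseteq> normal_lists N \<and> \<phi> - cmb n c \<in> Omega q n N)"

definition push :: "int \<Rightarrow> (int list \<Rightarrow>\<^sub>0 complex) \<Rightarrow> fock" where
  "push M' c = (\<Sum>ks\<in>keys c. single (ks @- vac M') (lookup c ks))"

lemma snth_ext: "(\<And>i. xs !! i = ys !! i) \<Longrightarrow> xs = ys"
  by (metis stream_smap_nats ext)

lemma snth_vac: "vac M !! i = M - int i"
proof -
  have "((\<lambda>k. k - 1) ^^ i) M = M - int i" for M :: int by (induction i) auto
  then show ?thesis by (simp add: vac_def)
qed

text \<open>All lists have the same length \<open>N\<close>, so different lists give different
  streams and no coefficients are merged.\<close>

lemma lookup_push:
  assumes c: "keys c \<subseteq> normal_lists N"
  shows "lookup (push M' c) w = (if sdrop N w = vac M' then lookup c (stake N w) else 0)"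
proof -
  have eq: "ks @- vac M' = w \<longleftrightarrow> sdrop N w = vac M' \<and> ks = stake N w" if "ks \<in> keys c" for ks
  proof -
    have l: "length ks = N" using that c by (auto simp: normal_lists_def)
    then have "sdrop N (ks @- vac M') = vac M'" "stake N (ks @- vac M') = ks" by (simp_all add: sdrop_shift stake_shift)
    then show ?thesis using stake_sdrop[of N w] by auto
  qed
  have "lookup (push M' c) w = (\<Sum>ks\<in>keys c. if ks @- vac M' = w then lookup c ks else 0)"
    by (simp add: push_def lookup_sum lookup_single when_def)
  also have "\<dots> = (\<Sum>ks\<in>keys c. if ks = stake N w then (if sdrop N w = vac M' then lookup c ks else 0) else 0)"
    by (intro sum.cong refl) (simp add: eq)
  also have "\<dots> = (if sdrop N w = vac M' then lookup c (stake N w) else 0)"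
    by (simp add: in_keys_iff)
  finally show ?thesis .
qed

lemma keys_normal_add: "keys c \<subseteq> A \<Longrightarrow> keys d \<subseteq> A \<Longrightarrow> keys (c + d) \<subseteq> A"
  using keys_add[of c d] by blast

lemma keys_smul_subset: "keys c \<subseteq> A \<Longrightarrow> keys (smul a c) \<subseteq> A"
  by (auto simp: in_keys_iff)

lemma zexp_div: "n > 0 \<Longrightarrow> zexp n k = - ((k - 1) div int n)"
proof -
  assume n: "n > 0"
  have "k - 1 = int n * (- zexp n k) + (int (col n k) - 1)" using col_zexp(1)[OF n, of k] by simp
  moreover have "0 \<le> int (col n k) - 1" "int (col n k) - 1 < int n" using col_zexp(2)[OF n, of k] by auto
  ultimately have "(k - 1) div int n = - zexp n k" by (rule int_div_pos_eq)
  then show ?thesis by simp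
qed

lemma zexp_antimono: "n > 0 \<Longrightarrow> k \<le> k' \<Longrightarrow> zexp n k' \<le> zexp n k"
  by (simp add: zexp_div zdiv_mono1)

lemma decreasing_ge:
  fixes a :: "nat \<Rightarrow> int"
  assumes "\<And>i. i < j \<Longrightarrow> a (Suc i) < a i" "i \<le> j"
  shows "a i \<ge> a j + int (j - i)"
  using assms(2)
proof (induction rule: inc_induct)
  case (step m)
  then show ?case using assms(1)[of m] by (simp add: Suc_diff_Suc)
qed simp

locale fock_setting =
  fixes n s :: nat and q :: complex and M t0 :: int
  assumes n2: "n \<ge> 2" and gq: "generic_q q" and sn: "s < n" and M_eq: "M = int s + int n * t0"
begin

lemma n0: "n > 0" using n2 by simp
lemma q0: "q \<noteq> 0" using gq by (simp add: generic_q_def)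

lemma nf_unique:
  assumes "keys c \<subseteq> normal_lists N" "\<phi> - cmb n c \<in> Omega q n N"
  shows "nf q n N \<phi> = c"
  unfolding nf_def
proof (rule the_equality, use assms in blast)
  fix d assume d: "keys d \<subseteq> normal_lists N \<and> \<phi> - cmb n d \<in> Omega q n N"
  have "cmb n (d - c) = (\<phi> - cmb n c) - (\<phi> - cmb n d)" unfolding cmb_diff by (simp only: diff_diff_eq2 diff_add_cancel add_diff_cancel_left' diff_diff_add) (simp only: algebra_simps)
  then have "cmb n (d - c) \<in> Omega q n N" using Omega_diff[OF q0 assms(2)] d by (simp only:)
  moreover have "keys (d - c) \<subseteq> normal_lists N" using d assms(1) keys_diff[of d c] by blast
  ultimately have "d - c = 0" using normal_wedges_independent[OF n0 q0] by blast
  then show "d = c" by simp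
qed

lemma nf_closed:
  assumes "closed_exps N D" "D \<subseteq> Dall N" "\<phi> \<in> TS n N D"
  shows "keys (nf q n N \<phi>) \<subseteq> NL n N D" "\<phi> - cmb n (nf q n N \<phi>) \<in> Omega q n N"
proof -
  obtain c where c: "keys c \<subseteq> NL n N D" "\<phi> - cmb n c \<in> Omega q n N"
    using straightening[OF n0 gq assms] by blast
  then have "nf q n N \<phi> = c" by (intro nf_unique) (auto simp: NL_def)
  then show "keys (nf q n N \<phi>) \<subseteq> NL n N D" "\<phi> - cmb n (nf q n N \<phi>) \<in> Omega q n N" using c by auto
qed

lemma nf:
  assumes "\<phi> \<in> tensors n N"
  shows "keys (nf q n N \<phi>) \<subseteq> normal_lists N" "\<phi> - cmb n (nf q n N \<phi>) \<in> Omega q n N"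
  using nf_closed[OF closed_Dall subset_refl assms[unfolded tensors_TS]] by (auto simp: NL_def)

lemma nf_add:
  assumes "\<phi> \<in> tensors n N" "\<psi> \<in> tensors n N"
  shows "nf q n N (\<phi> + \<psi>) = nf q n N \<phi> + nf q n N \<psi>"
proof (rule nf_unique)
  have "\<phi> + \<psi> - cmb n (nf q n N \<phi> + nf q n N \<psi>) = (\<phi> - cmb n (nf q n N \<phi>)) + (\<psi> - cmb n (nf q n N \<psi>))"
    unfolding cmb_add by (simp only: add_diff_add)
  then show "\<phi> + \<psi> - cmb n (nf q n N \<phi> + nf q n N \<psi>) \<in> Omega q n N"
    using Omega_add[OF q0 nf(2)[OF assms(1)] nf(2)[OF assms(2)]] by (simp only:)
qed (intro keys_normal_add nf assms)

lemma nf_smul: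
  assumes "\<phi> \<in> tensors n N"
  shows "nf q n N (tsmul a \<phi>) = smul a (nf q n N \<phi>)"
proof (rule nf_unique)
  have "tsmul a \<phi> - cmb n (smul a (nf q n N \<phi>)) = tsmul a (\<phi> - cmb n (nf q n N \<phi>))"
    unfolding cmb_smul by (simp only: tsmul_simps)
  then show "tsmul a \<phi> - cmb n (smul a (nf q n N \<phi>)) \<in> Omega q n N"
    using Omega_smul[OF q0 nf(2)[OF assms]] by (simp only:)
qed (intro keys_smul_subset nf assms)

lemma nf_Omega: "\<phi> \<in> Omega q n N \<Longrightarrow> nf q n N \<phi> = 0"
  by (rule nf_unique) (simp_all del: minus_apply zero_fun_apply)

lemma Lam_eq_iff:
  assumes "\<phi> \<in> tensors n N" "\<psi> \<in> tensors n N"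
  shows "Lam q n N \<phi> = Lam q n N \<psi> \<longleftrightarrow> \<phi> - \<psi> \<in> Omega q n N"
proof
  assume "Lam q n N \<phi> = Lam q n N \<psi>"
  moreover have "\<phi> \<in> Lam q n N \<phi>" using assms Omega_0[OF q0] by (simp add: Lam_def del: minus_apply zero_fun_apply)
  ultimately show "\<phi> - \<psi> \<in> Omega q n N" by (auto simp: Lam_def)
next
  assume o: "\<phi> - \<psi> \<in> Omega q n N"
  have 1: "\<chi> - \<psi> = (\<chi> - \<phi>) + (\<phi> - \<psi>)" "\<chi> - \<phi> = (\<chi> - \<psi>) - (\<phi> - \<psi>)" for \<chi> :: tensor
    by (simp_all add: fun_eq_iff)
  have "\<chi> - \<phi> \<in> Omega q n N \<longleftrightarrow> \<chi> - \<psi> \<in> Omega q n N" for \<chi>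
    using Omega_add[OF q0 _ o, of "\<chi> - \<phi>"] Omega_diff[OF q0 _ o, of "\<chi> - \<psi>"] 1[of \<chi>] by metis
  then show "Lam q n N \<phi> = Lam q n N \<psi>" by (auto simp: Lam_def)
qed

lemma cmb_tensors:
  assumes "keys c \<subseteq> normal_lists N"
  shows "cmb n c \<in> tensors n N"
  unfolding cmb_def tensors_TS
proof (intro TS_sum TS_smul)
  fix ks assume "ks \<in> keys c"
  then have l: "length ks = N" using assms by (auto simp: normal_lists_def)
  then show "u_tensor n ks \<in> TS n N (Dall N)"
    unfolding u_tensor_mono mono_def using expo_Dall[OF l] col_map_colours[OF n0 l] by (auto simp: TS_def LS_Z LS_0)
qed

lemma wedge_coords_Lam:
  assumes "\<phi> \<in> tensors n N"
  shows "wedge_coords q n N (Lam q n N \<phi>) = nf q n N \<phi>"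
proof -
  have "wedge_comb q n N c = Lam q n N \<phi> \<longleftrightarrow> \<phi> - cmb n c \<in> Omega q n N" if "keys c \<subseteq> normal_lists N" for c
    using Lam_eq_iff[OF assms cmb_tensors[OF that]] by (auto simp: wedge_comb_def cmb_def)
  then have "(\<lambda>c. keys c \<subseteq> normal_lists N \<and> wedge_comb q n N c = Lam q n N \<phi>)
     = (\<lambda>c. keys c \<subseteq> normal_lists N \<and> \<phi> - cmb n c \<in> Omega q n N)" by (intro ext) blast
  then show ?thesis by (simp add: wedge_coords_def nf_def)
qed

definition W :: "nat \<Rightarrow> tensor \<Rightarrow> fock" where
  "W r \<phi> = push (M - int (s + n * r)) (nf q n (s + n * r) \<phi>)"

lemma wedge_vac_Lam: "\<phi> \<in> tensors n (s + n * r) \<Longrightarrow> wedge_vac q n (s + n * r) (Lam q n (s + n * r) \<phi>) (M - int (s + n * r)) = W r \<phi>"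
  by (simp add: wedge_vac_def wedge_coords_Lam W_def push_def)

lemma lookup_W:
  "\<phi> \<in> tensors n (s + n * r) \<Longrightarrow> lookup (W r \<phi>) w =
    (if sdrop (s + n * r) w = vac (M - int (s + n * r)) then lookup (nf q n (s + n * r) \<phi>) (stake (s + n * r) w) else 0)"
  unfolding W_def by (rule lookup_push) (rule nf)

lemma W_add: "\<phi> \<in> tensors n (s + n * r) \<Longrightarrow> \<psi> \<in> tensors n (s + n * r) \<Longrightarrow> W r (\<phi> + \<psi>) = W r \<phi> + W r \<psi>"
  by (rule poly_mapping_eqI)
    (simp add: lookup_W nf_add lookup_add TS_add[folded tensors_TS] tensors_TS TS_add del: plus_fun_apply)

lemma W_smul: "\<phi> \<in> tensors n (s + n * r) \<Longrightarrow> W r (tsmul a \<phi>) = smul a (W r \<phi>)"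
  by (rule poly_mapping_eqI) (simp add: lookup_W nf_smul tensors_TS TS_smul)

lemma W_diff:
  assumes "\<phi> \<in> tensors n (s + n * r)" "\<psi> \<in> tensors n (s + n * r)"
  shows "W r (\<phi> - \<psi>) = W r \<phi> - W r \<psi>"
proof -
  have "\<phi> - \<psi> \<in> tensors n (s + n * r)" using assms by (simp only: tensors_TS TS_diff)
  from W_add[OF this assms(2)] show ?thesis by (simp only: diff_add_cancel eq_diff_eq)
qed

lemma W_Omega: "\<phi> \<in> Omega q n (s + n * r) \<Longrightarrow> W r \<phi> = 0"
  by (simp add: W_def nf_Omega push_def)

lemma W_sum:
  assumes "\<And>i. i \<in> I \<Longrightarrow> \<psi> i \<in> tensors n (s + n * r)"
  shows "W r (\<Sum>i\<in>I. tsmul (a i) (\<psi> i)) = (\<Sum>i\<in>I. smul (a i) (W r (\<psi> i)))"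
  using assms
proof (induction I rule: infinite_finite_induct)
  case (insert i I)
  have "tsmul (a i) (\<psi> i) \<in> tensors n (s + n * r)" "(\<Sum>i\<in>I. tsmul (a i) (\<psi> i)) \<in> tensors n (s + n * r)"
    using insert.prems by (auto simp: tensors_TS intro!: TS_smul TS_sum)
  then show ?case using insert by (simp add: W_add W_smul del: plus_fun_apply)
qed (use W_Omega[OF Omega_0[OF q0]] in \<open>simp_all del: zero_fun_apply\<close>)

text \<open>By linearity it suffices that \<open>W r\<close> vanishes only on \<open>Omega\<close>,
  and a list of length \<open>N\<close> is recovered from its stream.\<close>

lemma W_eq_iff:
  assumes "\<phi> \<in> tensors n (s + n * r)" "\<psi> \<in> tensors n (s + n * r)"
  shows "W r \<phi> = W r \<psi> \<longleftrightarrow> \<phi> - \<psi> \<in> Omega q n (s + n * r)"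
proof
  let ?N = "s + n * r"
  have d: "\<phi> - \<psi> \<in> tensors n ?N" using assms by (simp only: tensors_TS TS_diff)
  show "W r \<phi> = W r \<psi>" if "\<phi> - \<psi> \<in> Omega q n ?N" using W_Omega[OF that] W_diff[OF assms] by simp
  assume "W r \<phi> = W r \<psi>"
  then have z: "W r (\<phi> - \<psi>) = 0" using W_diff[OF assms] by simp
  have "nf q n ?N (\<phi> - \<psi>) = 0"
  proof (rule poly_mapping_eqI)
    fix ks
    show "lookup (nf q n ?N (\<phi> - \<psi>)) ks = lookup 0 ks"
    proof (cases "length ks = ?N")
      case True
      then show ?thesis using lookup_W[OF d, of "ks @- vac (M - int ?N)"] z by (simp add: sdrop_shift stake_shift)
    next
      case False
      then have "ks \<notin> keys (nf q n ?N (\<phi> - \<psi>))" using nf(1)[OF d] by (auto simp: normal_lists_def)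
      then show ?thesis by (simp add: in_keys_iff)
    qed
  qed
  then show "\<phi> - \<psi> \<in> Omega q n ?N" using nf(2)[OF d] by (simp del: minus_apply)
qed

lemma W_u:
  assumes "ks \<in> normal_lists (s + n * r)"
  shows "W r (u_tensor n ks) = single (ks @- vac (M - int (s + n * r))) 1"
proof -
  have "nf q n (s + n * r) (u_tensor n ks) = single ks 1"
    by (rule nf_unique) (use assms in \<open>simp_all add: cmb_single tsmul_simps Omega_0[OF q0] del: minus_apply zero_fun_apply\<close>)
  then show ?thesis by (simp add: W_def push_def)
qed

section \<open>Vacuum exponents, degrees and the truncated spaces\<close>

lemma mbase: "(int s - M) div int n = - t0"
proof -
  have "int s - M = int n * (- t0)" by (simp add: M_eq)
  then show ?thesis using n0 by (simp only: nonzero_mult_div_cancel_left of_nat_eq_0_iff)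
qed

text \<open>The sequence of the \<open>m_i^0\<close> consists of the exponents of the vacuum, whose
  entry at position \<open>i\<close>, counted from \<open>0\<close>, is \<open>u\<close> with index
  \<open>M - i\<close>. Degrees therefore measure the deviation from the vacuum.\<close>

lemma m0_zexp: "m0 n s M (Suc i) = zexp n (M - int i)"
proof (cases "i < s")
  case True
  have "(M - int i - 1) div int n = t0"
    by (rule int_div_pos_eq[of _ _ _ "int s - int i - 1"]) (use True sn in \<open>auto simp: M_eq\<close>)
  then show ?thesis using True by (simp add: m0_def mbase zexp_div[OF n0])
next
  case False
  define a b where "a = (i - s) div n" and "b = (i - s) mod n"
  have "i - s = n * a + b" "b < n" using n0 by (simp_all add: a_def b_def)
  then have "int i = int s + int n * int a + int b" using False by (metis diff_add_inverse le_add_diff_inverse not_less of_nat_add of_nat_mult add.assoc)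
  then have "(M - int i - 1) div int n = t0 - 1 - int a"
    by (intro int_div_pos_eq[of _ _ _ "int n - 1 - int b"]) (use \<open>b < n\<close> in \<open>auto simp: M_eq algebra_simps\<close>)
  then show ?thesis using False by (simp add: m0_def mbase zexp_div[OF n0] a_def)
qed

text \<open>The exponent \<open>m^0 + r + 1\<close> of the block that leads from level
  \<open>r\<close> to level \<open>r + 1\<close>.\<close>

definition cr :: "nat \<Rightarrow> int" where "cr r = int r + 1 - t0"

text \<open>\<open>M - s - n r\<close> is a multiple of \<open>n\<close>, so the bound on
  \<open>k\<close> falls on a jump of the exponent.\<close>

lemma zexp_le_cr: "zexp n k \<le> cr r - 1 \<longleftrightarrow> M - int (s + n * r) < k"
proof -
  have "zexp n k \<le> cr r - 1 \<longleftrightarrow> t0 - int r \<le> (k - 1) div int n" by (auto simp: zexp_div[OF n0] cr_def)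
  also have "\<dots> \<longleftrightarrow> (t0 - int r) * int n \<le> k - 1"
  proof
    have "0 < int n" using n0 by simp
    show "(t0 - int r) * int n \<le> k - 1" if "t0 - int r \<le> (k - 1) div int n"
    proof -
      have "(t0 - int r) * int n \<le> (k - 1) div int n * int n" using that by (rule mult_right_mono) simp
      also have "\<dots> \<le> k - 1" using pos_mod_sign[OF \<open>0 < int n\<close>, of "k - 1"] div_mult_mod_eq[of "k - 1" "int n"] by linarith
      finally show ?thesis .
    qed
    show "t0 - int r \<le> (k - 1) div int n" if "(t0 - int r) * int n \<le> k - 1"
      using zdiv_mono1[OF that \<open>0 < int n\<close>] n0 by simp
  qed
  also have "\<dots> \<longleftrightarrow> M - int (s + n * r) < k" by (auto simp: M_eq algebra_simps)
  finally show ?thesis .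
qed

lemma cr_Suc: "cr (Suc r) - 1 = cr r" by (simp add: cr_def)

text \<open>At the positions \<open>s + n j\<close> the vacuum entry has colour \<open>n\<close>, so
  any larger integer has a strictly smaller exponent. There are \<open>r + 1\<close> such positions
  up to \<open>s + n r\<close>, each costing at least \<open>1\<close>, and no position contributes
  negatively.\<close>

lemma deficit:
  assumes ge: "\<And>i. i < L \<Longrightarrow> a i \<ge> M - int i" and i0: "i0 < L" "s + n * r \<le> i0" and gt: "\<And>i. i \<le> i0 \<Longrightarrow> a i > M - int i"
  shows "(\<Sum>i<L. m0 n s M (Suc i) - zexp n (a i)) \<ge> int r + 1"
proof -
  let ?A = "(\<lambda>j. s + n * j) ` {..r}"
  have inj: "inj_on (\<lambda>j. s + n * j) {..r}" using n0 by (auto simp: inj_on_def)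
  have le: "i \<le> i0" if "i \<in> ?A" for i
  proof -
    obtain j where "i = s + n * j" "j \<in> {..r}" using \<open>i \<in> ?A\<close> by (rule imageE)
    moreover have "n * j \<le> n * r" using \<open>j \<in> {..r}\<close> by simp
    ultimately show ?thesis using i0(2) by linarith
  qed
  have one: "1 \<le> m0 n s M (Suc i) - zexp n (a i)" if "i \<in> ?A" for i
  proof -
    obtain j where j: "i = s + n * j" using \<open>i \<in> ?A\<close> by (rule imageE)
    have "zexp n (a i) \<le> cr j - 1"
    proof -
      have "zexp n (a i) \<le> zexp n (M - int i + 1)" using gt[OF le[OF that]] by (intro zexp_antimono n0) simp
      also have "\<dots> = - (t0 - int j)" unfolding zexp_div[OF n0]
      proof -
        have "M - int i + 1 - 1 = int n * (t0 - int j)" by (simp add: j M_eq right_diff_distrib)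
        then have "(M - int i + 1 - 1) div int n = int n * (t0 - int j) div int n" by (rule arg_cong)
        also have "\<dots> = t0 - int j" using n0 by simp
        finally show "- ((M - int i + 1 - 1) div int n) = - (t0 - int j)" by (rule arg_cong)
      qed
      finally show ?thesis by (simp add: cr_def)
    qed
    moreover have "\<not> m0 n s M (Suc i) \<le> cr j - 1" unfolding m0_zexp zexp_le_cr by (simp add: j)
    ultimately show ?thesis by simp
  qed
  have nonneg: "0 \<le> m0 n s M (Suc i) - zexp n (a i)" if "i < L" for i
    using zexp_antimono[OF n0 ge[OF that]] by (simp add: m0_zexp)
  have "int r + 1 = (\<Sum>i\<in>?A. 1)" using inj by (simp add: card_image)
  also have "\<dots> \<le> (\<Sum>i\<in>?A. m0 n s M (Suc i) - zexp n (a i))" by (rule sum_mono) (rule one)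
  also have "\<dots> \<le> (\<Sum>i<L. m0 n s M (Suc i) - zexp n (a i))"
  proof (rule sum_mono2)
    show "?A \<subseteq> {..<L}" using le i0(1) by (meson lessThan_iff le_less_trans subsetI)
  qed (use nonneg in auto)
  finally show ?thesis .
qed

text \<open>For normally ordered wedges the degree is a condition on the sum of the exponents, and
  the truncation is an upper bound on each. Both make sense for arbitrary monomials and define a
  closed set.\<close>

definition DK :: "nat \<Rightarrow> nat \<Rightarrow> exps set" where
  "DK r k = Dsum (s + n * r) (cr r - 1) ((\<Sum>i<s + n * r. m0 n s M (Suc i)) - int k)"

lemma closed_DK: "closed_exps (s + n * r) (DK r k)" unfolding DK_def by (rule closed_Dsum)

lemma DK_Dall: "DK r k \<subseteq> Dall (s + n * r)" by (auto simp: DK_def Dsum_def)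

lemma DK_tensors: "\<phi> \<in> TS n (s + n * r) (DK r k) \<Longrightarrow> \<phi> \<in> tensors n (s + n * r)"
  unfolding tensors_TS using TS_mono DK_Dall by blast

lemma expo_Dsum:
  assumes "length ks = N"
  shows "expo n ks \<in> Dsum N c S \<longleftrightarrow> (\<forall>i<N. zexp n (ks ! i) \<le> c) \<and> (\<Sum>i<N. zexp n (ks ! i)) = S"
proof -
  have "(\<Sum>i\<in>{1..N}. lookup (expo n ks) i) = (\<Sum>i<N. zexp n (ks ! i))"
    by (rule sum.reindex_bij_witness[of _ Suc "\<lambda>i. i - 1"]) (auto simp: lookup_expo assms)
  moreover have "(\<forall>i\<in>{1..N}. lookup (expo n ks) i \<le> c) \<longleftrightarrow> (\<forall>i<N. zexp n (ks ! i) \<le> c)"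
  proof (intro iffI allI ballI impI)
    fix i assume "\<forall>i\<in>{1..N}. lookup (expo n ks) i \<le> c" "i < N"
    then have "lookup (expo n ks) (Suc i) \<le> c" by simp
    then show "zexp n (ks ! i) \<le> c" using \<open>i < N\<close> assms by (simp add: lookup_expo)
  qed (auto simp: lookup_expo assms)
  ultimately show ?thesis using expo_Dall[OF assms, of n] by (auto simp: Dsum_def)
qed

lemma NL_DK:
  "ks \<in> NL n (s + n * r) (DK r k) \<longleftrightarrow> ks \<in> normal_lists (s + n * r) \<and> (\<forall>i<s + n * r. M - int (s + n * r) < ks ! i)
     \<and> (\<Sum>i<s + n * r. m0 n s M (Suc i) - zexp n (ks ! i)) = int k"
proof (cases "ks \<in> normal_lists (s + n * r)")
  case True
  then have l: "length ks = s + n * r" by (simp add: normal_lists_def)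
  show ?thesis using True unfolding NL_def DK_def mem_Collect_eq expo_Dsum[OF l] zexp_le_cr sum_subtractf by auto
qed (simp add: NL_def)

lemma fock_degree_tail:
  assumes "\<And>i. i \<ge> N \<Longrightarrow> ks !! i = M - int i"
  shows "fock_degree n s M ks = (\<Sum>i<N. m0 n s M (Suc i) - zexp n (ks !! i))"
proof -
  have "m0 n s M (Suc i) - zexp n (ks !! i) = 0" if "\<not> i < N" for i
    using assms[of i] that by (simp add: m0_zexp)
  then show ?thesis unfolding fock_degree_def by (intro Sum_any.expand_superset) auto
qed

text \<open>A deviation at a position from \<open>s + n r\<close> on propagates to all earlier ones,
  since the entries decrease strictly; then \<open>deficit\<close> makes the degree exceed
  \<open>r\<close>.\<close>

lemma normal_stream_tail:
  assumes ks: "ks \<in> normal_streams M" and deg: "fock_degree n s M ks = int k" and kr: "k \<le> r" and i: "i \<ge> s + n * r"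
  shows "ks !! i = M - int i"
proof (rule ccontr)
  assume ne: "ks !! i \<noteq> M - int i"
  obtain i1 where i1: "\<And>i. i \<ge> i1 \<Longrightarrow> ks !! i = M - int i" using ks by (auto simp: normal_streams_def)
  have dec: "ks !! Suc i < ks !! i" for i using ks by (auto simp: normal_streams_def)
  have ge: "ks !! i \<ge> M - int i" for i
    using decreasing_ge[of "max i i1" "snth ks" i] dec i1[of "max i i1"] by simp
  have ii: "i < i1" using ne i1[of i] by (meson not_less)
  have gt: "ks !! j > M - int j" if "j \<le> i" for j
    using decreasing_ge[of i "snth ks" j] dec ge[of i] ne that by (simp add: of_nat_diff)
  have "int r + 1 \<le> (\<Sum>i<i1. m0 n s M (Suc i) - zexp n (ks !! i))"
    by (rule deficit[OF ge ii i gt])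
  then show False using deg fock_degree_tail[of i1 ks] i1 kr by simp
qed

lemma stake_NL:
  assumes ks: "ks \<in> normal_streams M" and deg: "fock_degree n s M ks = int k" and kr: "k \<le> r"
  shows "stake (s + n * r) ks \<in> NL n (s + n * r) (DK r k)" "ks = stake (s + n * r) ks @- vac (M - int (s + n * r))"
proof -
  let ?N = "s + n * r"
  note tail = normal_stream_tail[OF ks deg kr]
  have dec: "ks !! Suc i < ks !! i" for i using ks by (auto simp: normal_streams_def)
  have tl: "M - int N < ks !! i" if "i < N" "N = s + n * r" for i N
  proof -
    have "snth ks N + int (N - i) \<le> snth ks i" by (rule decreasing_ge) (use dec that in auto)
    moreover have "int (N - i) > 0" using that(1) by simp
    moreover have "ks !! N = M - int N" by (rule tail) (simp add: that)
    ultimately show ?thesis by linarith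
  qed
  show "stake ?N ks \<in> NL n ?N (DK r k)"
    unfolding NL_DK using tl[OF _ refl] dec deg fock_degree_tail[of ?N ks] tail by (auto simp: normal_adjacent)
  have "sdrop ?N ks = vac (M - int ?N)" by (rule snth_ext) (simp add: sdrop_snth snth_vac tail)
  then show "ks = stake ?N ks @- vac (M - int ?N)" by (metis stake_sdrop)
qed

lemma NL_normal_stream:
  assumes ks: "ks \<in> NL n (s + n * r) (DK r k)"
  shows "ks @- vac (M - int (s + n * r)) \<in> normal_streams M" "fock_degree n s M (ks @- vac (M - int (s + n * r))) = int k"
proof -
  define N where "N = s + n * r"
  define w where "w = ks @- vac (M - int N)"
  have l: "ks \<in> normal_lists N" "length ks = N" and gt: "\<And>i. i < N \<Longrightarrow> M - int N < ks ! i"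
    and deg: "(\<Sum>i<N. m0 n s M (Suc i) - zexp n (ks ! i)) = int k"
    using ks[unfolded NL_DK, folded N_def] by (auto simp: normal_lists_def)
  have w: "w !! i = (if i < N then ks ! i else M - int i)" for i
    by (simp add: w_def shift_snth l(2) snth_vac of_nat_diff)
  have "w !! Suc i < w !! i" for i
  proof -
    consider "Suc i < N" | "Suc i = N" | "i \<ge> N" by linarith
    then show ?thesis
    proof cases
      case 2
      then show ?thesis unfolding w using gt[of i] by simp
    qed (use l in \<open>simp_all only: w normal_adjacent\<close>, auto)
  qed
  moreover have "\<forall>i\<ge>N. w !! i = M - int i" by (simp add: w)
  ultimately show "ks @- vac (M - int (s + n * r)) \<in> normal_streams M"
    unfolding normal_streams_def N_def[symmetric] w_def[symmetric] by blast
  have "fock_degree n s M w = (\<Sum>i<N. m0 n s M (Suc i) - zexp n (w !! i))" by (rule fock_degree_tail) (simp add: w)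
  also have "\<dots> = (\<Sum>i<N. m0 n s M (Suc i) - zexp n (ks ! i))" by (intro sum.cong refl) (simp add: w)
  finally show "fock_degree n s M (ks @- vac (M - int (s + n * r))) = int k" using deg unfolding N_def[symmetric] w_def[symmetric] by simp
qed

lemma TS_cmb: "keys c \<subseteq> NL n N D \<Longrightarrow> cmb n c \<in> TS n N D"
  unfolding cmb_def
proof (intro TS_sum TS_smul)
  fix ks assume "keys c \<subseteq> NL n N D" "ks \<in> keys c"
  then have "expo n ks \<in> D" "map (col n) ks \<in> colours n N"
    using col_map_colours[OF n0, of ks N] by (auto simp: NL_def normal_lists_def)
  then show "u_tensor n ks \<in> TS n N D" unfolding u_tensor_mono mono_def by (auto simp: TS_def LS_Z LS_0)
qed

text \<open>By straightening inside \<open>DK\<close>, representatives may be taken arbitrarily with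
  exponents in this set, so operators can be applied to them without restoring normal order.\<close>

lemma trunc_space_eq: "trunc_space q n s M (s + n * r) k = Lam q n (s + n * r) ` TS n (s + n * r) (DK r k)"
proof -
  let ?N = "s + n * r"
  have m0N: "m0 n s M ?N = cr r - 1" if "?N \<noteq> 0"
  proof (cases "r = 0")
    case False
    then have "s + n * r - s - 1 = (n - 1) + (r - 1) * n" using n0 by (cases r) (auto simp: mult.commute)
    moreover have "((n - 1) + (r - 1) * n) div n = r - 1" using n0 by (subst div_mult_self1) auto
    ultimately have "(s + n * r - s - 1) div n = r - 1" by (simp only:)
    then show ?thesis using False n0 by (simp add: m0_def mbase cr_def)
  qed (use that in \<open>simp add: m0_def mbase cr_def\<close>)
  have "ks \<in> normal_lists ?N \<and> (ks \<noteq> [] \<longrightarrow> zexp n (last ks) \<le> m0 n s M ?N) \<and> fin_degree n s M ks = int k \<longleftrightarrow> ks \<in> NL n ?N (DK r k)" for ks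
  proof (cases "ks \<in> normal_lists ?N")
    case True
    then have l: "length ks = ?N" and dec: "\<And>i. Suc i < ?N \<Longrightarrow> ks ! Suc i < ks ! i" by (auto simp: normal_adjacent)
    have "(ks \<noteq> [] \<longrightarrow> zexp n (last ks) \<le> m0 n s M ?N) \<longleftrightarrow> (\<forall>i<?N. M - int ?N < ks ! i)"
    proof (cases "?N = 0")
      case False
      then have ne: "ks \<noteq> []" using l by auto
      have la: "last ks = ks ! (?N - 1)" unfolding last_conv_nth[OF ne] l ..
      have "last ks \<le> ks ! i" if "i < ?N" for i
      proof -
        have "ks ! (?N - 1) + int (?N - 1 - i) \<le> ks ! i" by (rule decreasing_ge) (use dec that in auto)
        then show ?thesis unfolding la using of_nat_0_le_iff[of "?N - 1 - i"] by linarith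
      qed
      then have "M - int ?N < last ks \<longleftrightarrow> (\<forall>i<?N. M - int ?N < ks ! i)" using la False by (fastforce intro: less_le_trans)
      moreover have m: "m0 n s M ?N = cr r - 1" using m0N False by blast
      ultimately show ?thesis unfolding m zexp_le_cr using ne by blast
    next
      case True
      then have "ks = []" using l by (simp only: length_0_conv)
      then show ?thesis unfolding True by simp
    qed
    moreover have "fin_degree n s M ks = (\<Sum>i<?N. m0 n s M (Suc i) - zexp n (ks ! i))"
      unfolding fin_degree_def l by (rule sum.reindex_bij_witness[of _ Suc "\<lambda>i. i - 1"]) auto
    ultimately show ?thesis using True unfolding NL_DK by simp
  qed (simp add: NL_def)
  then have T: "trunc_space q n s M ?N k = wedge_comb q n ?N ` {c. keys c \<subseteq> NL n ?N (DK r k)}"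
    unfolding trunc_space_def by (simp add: subset_eq)
  have C: "wedge_comb q n ?N c = Lam q n ?N (cmb n c)" for c by (simp add: wedge_comb_def cmb_def)
  show ?thesis unfolding T
  proof (intro subset_antisym image_subsetI)
    fix c :: "int list \<Rightarrow>\<^sub>0 complex" assume "c \<in> {c. keys c \<subseteq> NL n ?N (DK r k)}"
    then show "wedge_comb q n ?N c \<in> Lam q n ?N ` TS n ?N (DK r k)" unfolding C using TS_cmb by blast
  next
    fix \<phi> assume \<phi>: "\<phi> \<in> TS n ?N (DK r k)"
    note nf' = nf_closed[OF closed_DK DK_Dall \<phi>]
    have "Lam q n ?N \<phi> = wedge_comb q n ?N (nf q n ?N \<phi>)"
      unfolding C using nf' Lam_eq_iff[OF DK_tensors[OF \<phi>] DK_tensors[OF TS_cmb[OF nf'(1)]]] by simp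
    then show "Lam q n ?N \<phi> \<in> wedge_comb q n ?N ` {c. keys c \<subseteq> NL n ?N (DK r k)}" using nf'(1) by blast
  qed
qed

lemma W_surj:
  assumes w: "w \<in> Fock_deg n s M k" and kr: "k \<le> r"
  obtains \<phi> where "\<phi> \<in> TS n (s + n * r) (DK r k)" "w = W r \<phi>"
proof -
  let ?N = "s + n * r"
  define c where "c = (\<Sum>ks\<in>keys w. single (stake ?N ks) (lookup w ks))"
  have ks: "stake ?N ks \<in> NL n ?N (DK r k)" "ks = stake ?N ks @- vac (M - int ?N)" if "ks \<in> keys w" for ks
    using stake_NL[OF _ _ kr, of ks] that w by (auto simp: Fock_deg_def Fock_def)
  have "cmb n c = (\<Sum>ks\<in>keys w. tsmul (lookup w ks) (u_tensor n (stake ?N ks)))"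
    by (simp add: c_def cmb_sum cmb_single)
  have u: "u_tensor n (stake ?N ks) \<in> TS n ?N (DK r k)" if "ks \<in> keys w" for ks
    using TS_cmb[of "single (stake ?N ks) 1" ?N "DK r k"] ks(1)[OF that] by (simp add: cmb_single tsmul_simps)
  define \<phi> where "\<phi> A = (\<Sum>ks\<in>A. tsmul (lookup w ks) (u_tensor n (stake ?N ks)))" for A
  have T: "\<phi> A \<in> TS n ?N (DK r k)" if "A \<subseteq> keys w" for A
    unfolding \<phi>_def by (intro TS_sum TS_smul u) (use that in auto)
  have "W r (\<phi> A) = (\<Sum>ks\<in>A. single ks (lookup w ks))" if "A \<subseteq> keys w" for A
  proof -
    have "W r (u_tensor n (stake ?N ks)) = single ks 1" if "ks \<in> keys w" for ks
      using W_u[of "stake ?N ks" r] ks[OF that] by (simp add: NL_def)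
    moreover have "W r (\<phi> A) = (\<Sum>ks\<in>A. smul (lookup w ks) (W r (u_tensor n (stake ?N ks))))"
      unfolding \<phi>_def by (rule W_sum) (use DK_tensors[OF u] that in blast)
    ultimately show ?thesis using that by (auto intro!: sum.cong)
  qed
  from this[of "keys w"] have "W r (\<phi> (keys w)) = w" using pm_sum_singles[of w] by simp
  then show thesis using that[OF T[of "keys w"]] by simp
qed

lemma W_deg:
  assumes \<phi>: "\<phi> \<in> TS n (s + n * r) (DK r k)"
  shows "W r \<phi> \<in> Fock_deg n s M k"
proof -
  let ?N = "s + n * r"
  have "ks \<in> normal_streams M \<and> fock_degree n s M ks = int k" if "ks \<in> keys (W r \<phi>)" for ks
  proof -
    have "sdrop ?N ks = vac (M - int ?N)" "stake ?N ks \<in> keys (nf q n ?N \<phi>)"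
      using that lookup_W[OF DK_tensors[OF \<phi>], of ks] by (auto simp: in_keys_iff split: if_splits)
    then have "stake ?N ks \<in> NL n ?N (DK r k)" "ks = stake ?N ks @- vac (M - int ?N)"
      using nf_closed(1)[OF closed_DK DK_Dall \<phi>] stake_sdrop[of ?N ks] by auto
    then show ?thesis using NL_normal_stream[of "stake ?N ks" r k] by auto
  qed
  then show ?thesis by (auto simp: Fock_deg_def Fock_def)
qed

lemma unique_representative:
  assumes w: "w \<in> Fock_deg n s M k" and kr: "k \<le> r"
  shows "\<exists>!f. f \<in> trunc_space q n s M (s + n * r) k \<and> w = wedge_vac q n (s + n * r) f (M - int (s + n * r))"
proof -
  obtain \<phi> where \<phi>: "\<phi> \<in> TS n (s + n * r) (DK r k)" "w = W r \<phi>" by (rule W_surj[OF w kr])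
  show ?thesis
  proof (rule ex1I[of _ "Lam q n (s + n * r) \<phi>"])
    show "Lam q n (s + n * r) \<phi> \<in> trunc_space q n s M (s + n * r) k \<and> w = wedge_vac q n (s + n * r) (Lam q n (s + n * r) \<phi>) (M - int (s + n * r))"
      unfolding trunc_space_eq wedge_vac_Lam[OF DK_tensors[OF \<phi>(1)]] using \<phi> by blast
    fix f assume f: "f \<in> trunc_space q n s M (s + n * r) k \<and> w = wedge_vac q n (s + n * r) f (M - int (s + n * r))"
    then obtain \<psi> where \<psi>: "\<psi> \<in> TS n (s + n * r) (DK r k)" "f = Lam q n (s + n * r) \<psi>" unfolding trunc_space_eq by blast
    then have "W r \<psi> = W r \<phi>" using f \<phi>(2) wedge_vac_Lam[OF DK_tensors[OF \<psi>(1)]] by simp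
    then show "f = Lam q n (s + n * r) \<phi>"
      unfolding \<psi>(2) using W_eq_iff Lam_eq_iff DK_tensors[OF \<phi>(1)] DK_tensors[OF \<psi>(1)] by blast
  qed
qed

text \<open>The description in \<open>level_op\<close> selects the coset of \<open>\<phi>\<close>,
  and since \<open>X\<close> preserves \<open>Omega\<close> the image of this coset under the
  induced map is a single coset.\<close>

lemma level_op_W:
  assumes kr: "k \<le> r" and \<phi>: "\<phi> \<in> TS n (s + n * r) (DK r k)"
    and X: "\<And>\<phi>. \<phi> \<in> tensors n (s + n * r) \<Longrightarrow> X (s + n * r) \<phi> \<in> tensors n (s + n * r)"
      "\<And>\<phi> \<psi>. \<phi> \<in> tensors n (s + n * r) \<Longrightarrow> \<psi> \<in> tensors n (s + n * r) \<Longrightarrow> X (s + n * r) (\<phi> + \<psi>) = X (s + n * r) \<phi> + X (s + n * r) \<psi>"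
      "\<And>\<phi>. \<phi> \<in> Omega q n (s + n * r) \<Longrightarrow> X (s + n * r) \<phi> \<in> Omega q n (s + n * r)"
  shows "level_op q n s M X k r (W r \<phi>) = W r (X (s + n * r) \<phi>)"
proof -
  let ?N = "s + n * r"
  note t = DK_tensors[OF \<phi>]
  have "(THE f. f \<in> trunc_space q n s M ?N k \<and> W r \<phi> = wedge_vac q n ?N f (M - int ?N)) = Lam q n ?N \<phi>"
    by (rule the1_equality[OF unique_representative[OF W_deg[OF \<phi>] kr]])
      (use \<phi> wedge_vac_Lam[OF t] in \<open>auto simp: trunc_space_eq\<close>)
  moreover have "(\<lambda>\<psi>. Lam q n ?N (X ?N \<psi>)) ` Lam q n ?N \<phi> = {Lam q n ?N (X ?N \<phi>)}"
  proof -
    have "Lam q n ?N (X ?N \<psi>) = Lam q n ?N (X ?N \<phi>)" if "\<psi> \<in> Lam q n ?N \<phi>" for \<psi>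
    proof -
      have \<psi>: "\<psi> \<in> tensors n ?N" "\<psi> - \<phi> \<in> Omega q n ?N" using that by (auto simp: Lam_def)
      have "X ?N \<psi> = X ?N (\<psi> - \<phi>) + X ?N \<phi>" using X(2)[OF Omega_tensors[OF q0 \<psi>(2)] t] by (simp only: diff_add_cancel)
      then have "X ?N \<psi> - X ?N \<phi> = X ?N (\<psi> - \<phi>)" by (simp only: add_diff_cancel_right')
      then show ?thesis using Lam_eq_iff[OF X(1)[OF \<psi>(1)] X(1)[OF t]] X(3)[OF \<psi>(2)] by (simp only:)
    qed
    moreover have "\<phi> \<in> Lam q n ?N \<phi>" using t Omega_0[OF q0] by (simp add: Lam_def del: minus_apply zero_fun_apply)
    ultimately show ?thesis by blast
  qed
  ultimately show ?thesis unfolding level_op_def Let_def induced_def by (simp only: the_elem_eq wedge_vac_Lam[OF X(1)[OF t]])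
qed

end

section \<open>Stability\<close>

lemma on_laurent_sc: "on_laurent (app (scL a)) \<phi> = tsmul a \<phi>"
  by (simp add: on_laurent_def tsmul_def)

lemma zpw_sc: "a \<noteq> 0 \<Longrightarrow> zpw (scL a) (scL (inverse a)) l = scL (a powi l)"
proof -
  have "scL b ^ k = scL (b ^ k)" for b k
    by (induction k) (auto simp: scL_mult intro: endo_eqI)
  then show ?thesis by (simp add: zpw_def power_int_def)
qed

locale fock_ops = fock_setting +
  fixes p :: complex
  assumes p0: "p \<noteq> 0"
begin

lemma n1: "n \<ge> 1" using n0 by simp
lemmas qpn = q0 p0 n1

definition NN :: "nat \<Rightarrow> nat" where "NN r = s + n * r"

lemma NN_Suc: "NN (Suc r) = NN r + n" by (simp add: NN_def)

lemmas DK_tensors' = DK_tensors[folded NN_def]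

text \<open>The colours of a vacuum block in normal order, from \<open>n\<close> down to
  \<open>1\<close>.\<close>

definition tau :: "nat list" where "tau = map (\<lambda>j. n - j) [0..<n]"

abbreviation att :: "nat \<Rightarrow> nat list \<Rightarrow> tensor \<Rightarrow> tensor" where "att r \<equiv> attg n (NN r) (cr r)"
abbreviation ext :: "nat \<Rightarrow> tensor \<Rightarrow> tensor" where "ext r \<equiv> att r tau"

lemma length_tau: "length tau = n" by (simp add: tau_def)
lemma nth_tau: "j < n \<Longrightarrow> tau ! j = n - j" by (simp add: tau_def)
lemma tau_colours: "tau \<in> colours n n" by (auto simp: colours_def tau_def)

lemma vac_block:
  assumes "j < n"
  shows "col n (M - int (NN r) - int j) = n - j" "zexp n (M - int (NN r) - int j) = cr r"
proof -
  have e: "n - j \<in> {1..n}" using assms by auto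
  have "M - int (NN r) - int j = int (n - j) - int n * cr r"
    using assms by (simp add: NN_def M_eq cr_def of_nat_diff algebra_simps)
  then show "col n (M - int (NN r) - int j) = n - j" "zexp n (M - int (NN r) - int j) = cr r"
    using col_zexp_unique[OF n0 e] by auto
qed

lemma m0_block: "j < n \<Longrightarrow> m0 n s M (Suc (NN r + j)) = cr r"
  unfolding m0_zexp using vac_block(2)[of j r] by (simp add: algebra_simps)

definition Sd :: "nat \<Rightarrow> nat \<Rightarrow> int" where "Sd r k = (\<Sum>i<NN r. m0 n s M (Suc i)) - int k"

lemma DK_alt: "DK r k = Dsum (NN r) (cr r - 1) (Sd r k)"
  by (simp add: DK_def NN_def Sd_def)

text \<open>The vacuum exponents of the new block are all \<open>cr r\<close>, so attaching the
  block adds \<open>n * cr r\<close> to the sum of exponents and leaves the degree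
  unchanged.\<close>

lemma DK_Suc: "DK (Suc r) k = Dsum (NN r + n) (cr r) (Sd r k + int n * cr r)"
proof -
  have "(\<Sum>i<NN r + m. m0 n s M (Suc i)) = (\<Sum>i<NN r. m0 n s M (Suc i)) + int m * cr r" if "m \<le> n" for m
    using that
  proof (induction m)
    case (Suc m)
    then show ?case using m0_block[of m r] by (simp add: algebra_simps)
  qed simp
  from this[OF order_refl] show ?thesis
    unfolding DK_def NN_def[symmetric] NN_Suc Sd_def cr_Suc by (simp add: algebra_simps)
qed

abbreviation BK :: "nat \<Rightarrow> nat \<Rightarrow> exps set" where
  "BK r k \<equiv> Bsum (NN r + n) (cr r) (Sd r k + int n * cr r) n"

text \<open>With fewer than \<open>n\<close> exponents equal to \<open>cr r\<close>, some entry
  within the last block must differ from the vacuum. By strict decrease all earlier entries exceed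
  the vacuum too, and the degree is at least \<open>r + 1\<close>.\<close>

lemma NL_BK:
  assumes "k \<le> r"
  shows "NL n (NN r + n) (BK r k) = {}"
proof (rule ccontr)
  assume "NL n (NN r + n) (BK r k) \<noteq> {}"
  then obtain ks where ks: "ks \<in> normal_lists (NN r + n)" "expo n ks \<in> BK r k" by (auto simp: NL_def)
  then have "ks \<in> NL n (NN (Suc r)) (DK (Suc r) k)" unfolding NL_def NN_Suc DK_Suc by (auto simp: Bsum_def)
  then have gt: "\<And>i. i < NN r + n \<Longrightarrow> M - int (NN r + n) < ks ! i"
    and deg: "(\<Sum>i<NN r + n. m0 n s M (Suc i) - zexp n (ks ! i)) = int k"
    unfolding NL_DK[folded NN_def] unfolding NN_Suc by auto
  have l: "length ks = NN r + n" and dec: "\<And>i. Suc i < NN r + n \<Longrightarrow> ks ! Suc i < ks ! i"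
    using ks(1) by (auto simp: normal_adjacent)
  have ge: "M - int i \<le> ks ! i" if "i < NN r + n" for i
  proof -
    have "ks ! (NN r + n - 1) + int (NN r + n - 1 - i) \<le> ks ! i" by (rule decreasing_ge) (use dec that in auto)
    then show ?thesis using gt[of "NN r + n - 1"] that n0 by (simp add: of_nat_diff)
  qed
  have "\<exists>i0. NN r \<le> i0 \<and> i0 < NN r + n \<and> ks ! i0 \<noteq> M - int i0"
  proof (rule ccontr)
    assume a: "\<not> ?thesis"
    have "zexp n (ks ! (NN r + j)) = cr r" if "j < n" for j
    proof -
      have "ks ! (NN r + j) = M - int (NN r) - int j" using a that by auto
      then show ?thesis using vac_block(2)[OF that] by simp
    qed
    then have "(\<lambda>j. Suc (NN r + j)) ` {..<n} \<subseteq> {i \<in> {1..NN r + n}. lookup (expo n ks) i = cr r}"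
      by (auto simp: lookup_expo l)
    then have "card ((\<lambda>j. Suc (NN r + j)) ` {..<n}) \<le> card {i \<in> {1..NN r + n}. lookup (expo n ks) i = cr r}"
      by (intro card_mono) auto
    moreover have "card ((\<lambda>j. Suc (NN r + j)) ` {..<n}) = n" by (subst card_image) (auto simp: inj_on_def)
    ultimately show False using ks(2) by (simp add: Bsum_def)
  qed
  then obtain i0 where i0: "NN r \<le> i0" "i0 < NN r + n" "ks ! i0 \<noteq> M - int i0" by blast
  have "int r + 1 \<le> (\<Sum>i<NN r + n. m0 n s M (Suc i) - zexp n (ks ! i))"
  proof (rule deficit[OF ge i0(2) i0(1)[unfolded NN_def]])
    fix j assume j: "j \<le> i0"
    have "ks ! i0 + int (i0 - j) \<le> ks ! j" by (rule decreasing_ge) (use dec i0 j in auto)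
    then show "M - int j < ks ! j" using ge[OF i0(2)] i0(3) j by (simp add: of_nat_diff)
  qed
  then show False using deg assms by simp
qed

text \<open>Straightening an error term stays inside \<open>BK\<close>, where no normally ordered
  wedge is available, so the result is zero.\<close>

lemma TS_BK_Omega:
  assumes "k \<le> r" "\<phi> \<in> TS n (NN r + n) (BK r k)"
  shows "\<phi> \<in> Omega q n (NN r + n)"
proof -
  have D: "BK r k \<subseteq> Dall (NN r + n)" by (auto simp: Bsum_def Dsum_def)
  note a = nf_closed[OF closed_Bsum D assms(2), unfolded NL_BK[OF assms(1)]]
  then have "nf q n (NN r + n) \<phi> = 0" by simp
  then show ?thesis using a(2) by (simp del: minus_apply)
qed

lemma TS_att: "\<phi> \<in> TS n (NN r) (DK r k) \<Longrightarrow> \<sigma> \<in> colours n n \<Longrightarrow> att r \<sigma> \<phi> \<in> TS n (NN r + n) (DK (Suc r) k)"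
  unfolding DK_alt[of r] DK_Suc by (rule TS_attg[OF qpn])

lemma ext_u:
  assumes "length ks = NN r"
  shows "ext r (u_tensor n ks) = u_tensor n (ks @ map (\<lambda>j. M - int (NN r) - int j) [0..<n])"
proof -
  let ?vs = "map (\<lambda>j. M - int (NN r) - int j) [0..<n]"
  have c: "map (col n) ?vs = tau" by (simp add: tau_def vac_block)
  have x: "expo n (ks @ ?vs) = expo n ks + vm n (NN r) (cr r)"
  proof (rule poly_mapping_eqI)
    fix i
    have "(ks @ ?vs) ! (i - 1) = M - int (NN r) - int (i - 1 - NN r)" if "NN r < i" "i \<le> NN r + n"
      using that assms by (auto simp: nth_append)
    then show "lookup (expo n (ks @ ?vs)) i = lookup (expo n ks + vm n (NN r) (cr r)) i"
      using vac_block(2)[of "i - 1 - NN r" r]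
      by (auto simp: lookup_expo lookup_add lookup_vm[OF qpn] assms nth_append)
  qed
  have d: "e = map (col n) ks @ tau \<longleftrightarrow> drop (NN r) e = tau \<and> take (NN r) e = map (col n) ks" for e
  proof
    assume "drop (NN r) e = tau \<and> take (NN r) e = map (col n) ks"
    then show "e = map (col n) ks @ tau" using append_take_drop_id[of "NN r" e] by simp
  qed (simp add: assms)
  show ?thesis unfolding u_tensor_mono mono_def attg_def[OF qpn] x map_append c d
    by (auto simp: mult_single)
qed

text \<open>On normally ordered wedges attaching the block is concatenation with the next
  \<open>n\<close> vacuum entries; the general case follows because attaching preserves
  \<open>Omega\<close>.\<close>

lemma W_ext:
  assumes \<phi>: "\<phi> \<in> TS n (NN r) (DK r k)"
  shows "W (Suc r) (ext r \<phi>) = W r \<phi>"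
proof -
  let ?c = "nf q n (NN r) \<phi>"
  note nf' = nf_closed[OF closed_DK[folded NN_def] DK_Dall[folded NN_def] \<phi>]
  have c: "cmb n ?c \<in> TS n (NN r) (DK r k)" by (rule TS_cmb[OF nf'(1)])
  have k: "ks \<in> NL n (NN r) (DK r k)" if "ks \<in> keys ?c" for ks using nf'(1) that by blast
  have u: "u_tensor n ks \<in> TS n (NN r) (DK r k)" if "ks \<in> NL n (NN r) (DK r k)" for ks
    using TS_cmb[of "single ks 1" "NN r" "DK r k"] that by (simp add: cmb_single tsmul_simps)
  have Wu: "W (Suc r) (ext r (u_tensor n ks)) = W r (u_tensor n ks)" if ks: "ks \<in> NL n (NN r) (DK r k)" for ks
  proof -
    let ?vs = "map (\<lambda>j. M - int (NN r) - int j) [0..<n]"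
    have l: "length ks = NN r" "ks \<in> normal_lists (NN r)" using ks by (auto simp: NL_def normal_lists_def)
    have "\<forall>i<NN r. M - int (NN r) < ks ! i" using ks unfolding NL_DK[folded NN_def] by blast
    then have "\<forall>x\<in>set ks. M - int (NN r) < x" using l(1) by (auto simp: in_set_conv_nth)
    moreover have "sorted_wrt (>) ?vs" by (auto simp: sorted_wrt_iff_nth_less)
    ultimately have "ks @ ?vs \<in> normal_lists (NN (Suc r))"
      using l unfolding normal_lists_def NN_Suc by (fastforce simp: sorted_wrt_append)
    from W_u[of "ks @ ?vs" "Suc r", folded NN_def, OF this]
    have "W (Suc r) (ext r (u_tensor n ks)) = single ((ks @ ?vs) @- vac (M - int (NN (Suc r)))) 1"
      unfolding ext_u[OF l(1)] .
    moreover have "?vs @- vac (M - int (NN (Suc r))) = vac (M - int (NN r))"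
      by (rule snth_ext) (auto simp: shift_snth snth_vac NN_Suc of_nat_diff)
    ultimately show ?thesis using W_u[of ks r, folded NN_def, OF l(2)] by simp
  qed
  have t: "\<phi> \<in> tensors n (NN r)" "cmb n ?c \<in> tensors n (NN r)" using DK_tensors' \<phi> c by blast+
  have e: "ext r \<psi> \<in> tensors n (NN (Suc r))" if "\<psi> \<in> tensors n (NN r)" for \<psi>
    unfolding NN_Suc by (rule attg_tensors[OF qpn that tau_colours])
  have "ext r \<phi> - ext r (cmb n ?c) \<in> Omega q n (NN (Suc r))"
    unfolding attg_diff[OF qpn, symmetric] NN_Suc by (rule Omega_attg[OF qpn nf'(2) tau_colours])
  then have "W (Suc r) (ext r \<phi>) = W (Suc r) (ext r (cmb n ?c))"
    using W_eq_iff[of _ "Suc r", folded NN_def] e t by blast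
  also have "ext r (cmb n ?c) = (\<Sum>ks\<in>keys ?c. tsmul (lookup ?c ks) (ext r (u_tensor n ks)))"
    unfolding cmb_def attg_sum[OF qpn] attg_smul[OF qpn] ..
  also have "W (Suc r) \<dots> = (\<Sum>ks\<in>keys ?c. smul (lookup ?c ks) (W (Suc r) (ext r (u_tensor n ks))))"
    by (rule W_sum[of _ _ "Suc r", folded NN_def]) (use e u k DK_tensors' in blast)
  also have "\<dots> = (\<Sum>ks\<in>keys ?c. smul (lookup ?c ks) (W r (u_tensor n ks)))"
    by (intro sum.cong refl) (simp add: Wu k)
  also have "\<dots> = W r (cmb n ?c)"
    unfolding cmb_def by (rule W_sum[of _ _ r, folded NN_def, symmetric]) (use u k DK_tensors' in blast)
  also have "\<dots> = W r \<phi>"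
  proof -
    have "W r \<phi> = W r (cmb n ?c)" using W_eq_iff[of _ r, folded NN_def, OF t] nf'(2) by blast
    then show ?thesis by simp
  qed
  finally show ?thesis .
qed

definition stable :: "(nat \<Rightarrow> tensor \<Rightarrow> tensor) \<Rightarrow> bool" where
  "stable X \<longleftrightarrow> (\<forall>r k \<phi>. k \<le> r \<longrightarrow> \<phi> \<in> TS n (NN r) (DK r k) \<longrightarrow>
     X (NN r + n) (ext r \<phi>) - ext r (X (NN r) \<phi>) \<in> Omega q n (NN r + n))"

lemma inner_term:
  assumes "i \<in> {1..NN r}" "\<psi> \<in> TS n (NN r) (DK r k)" "k \<le> r"
  shows "on_laurent (app (yzp q p (NN r + n) i l)) (ext r \<psi>)
     - ext r (on_laurent (app (yzp q p (NN r) i l)) \<psi>) \<in> Omega q n (NN r + n)"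
  by (rule TS_BK_Omega[OF assms(3)], rule attg_on_laurent[OF qpn appr_zpw[OF qpn appr_yL_inner[OF qpn assms(1)]] assms(2)[unfolded DK_alt] tau_colours])

text \<open>Stated for arbitrary block colours \<open>\<sigma>\<close>, since the polynomial
  operators do not see them; \<open>E\<close> and \<open>F\<close> need it after a colour has been
  changed.\<close>

lemma outer_term:
  assumes "i \<in> {NN r<..NN r + n}" "\<psi> \<in> TS n (NN r) (DK r k)" "k \<le> r" "\<sigma> \<in> colours n n"
  shows "on_laurent (app (yzp q p (NN r + n) i l)) (att r \<sigma> \<psi>)
     - tsmul (lam q p n (NN r) (cr r) i powi l) (att r \<sigma> \<psi>) \<in> Omega q n (NN r + n)"
proof (rule TS_BK_Omega[OF assms(3)])
  show "on_laurent (app (yzp q p (NN r + n) i l)) (att r \<sigma> \<psi>)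
     - tsmul (lam q p n (NN r) (cr r) i powi l) (att r \<sigma> \<psi>) \<in> TS n (NN r + n) (BK r k)"
    using attg_on_laurent[OF qpn appr_zpw[OF qpn appr_yL_outer[OF qpn assms(1)]] assms(2)[unfolded DK_alt] assms(4), of l]
    unfolding zpw_sc[OF lam_nz[OF qpn]] on_laurent_sc attg_smul[OF qpn] .
qed

lemma attg_wt:
  assumes js: "set js \<subseteq> {1..NN r + n}" and \<phi>: "\<phi> \<in> tensors n (NN r)" and \<sigma>: "length \<sigma> = n"
  shows "(\<lambda>e. smul (h (\<Sum>j\<leftarrow>js. wt n \<epsilon> (e ! (j - 1)))) (att r \<sigma> \<phi> e)) = att r \<sigma> (\<lambda>e. smul (h (\<Sum>j\<leftarrow>js. if j \<le> NN r then wt n \<epsilon> (e ! (j - 1)) else wt n \<epsilon> (\<sigma> ! (j - NN r - 1)))) (\<phi> e))"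
proof (rule attg_scaling[OF qpn _ \<phi>])
  fix e assume e: "drop (NN r) e = \<sigma>" "length (take (NN r) e) = NN r"
  have "e ! (j - 1) = (if j \<le> NN r then take (NN r) e ! (j - 1) else \<sigma> ! (j - NN r - 1))" if "j \<in> set js" for j
  proof -
    have j: "1 \<le> j" "j \<le> NN r + n" using js that by auto
    have l: "NN r \<le> length e" using e(2) by simp
    have "\<sigma> ! (j - NN r - 1) = e ! (j - 1)" if "\<not> j \<le> NN r"
      unfolding e(1)[symmetric] using l that by (simp add: nth_drop)
    then show ?thesis using j by auto
  qed
  then show "h (\<Sum>j\<leftarrow>js. wt n \<epsilon> (e ! (j - 1))) = h (\<Sum>j\<leftarrow>js. if j \<le> NN r then wt n \<epsilon> (take (NN r) e ! (j - 1)) else wt n \<epsilon> (\<sigma> ! (j - NN r - 1)))"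
    by (intro arg_cong[of _ _ h] arg_cong[of _ _ sum_list] map_cong refl) auto
qed

text \<open>Every colour occurs exactly once in the block, so the positive and the negative
  contribution cancel.\<close>

lemma wt_tau: "(\<Sum>j\<leftarrow>[NN r + 1..<NN r + n + 1]. if j \<le> NN r then x j else wt n \<epsilon> (tau ! (j - NN r - 1))) = 0"
proof -
  have "(\<Sum>j\<leftarrow>[NN r + 1..<NN r + n + 1]. if j \<le> NN r then x j else wt n \<epsilon> (tau ! (j - NN r - 1)))
     = (\<Sum>j\<in>{NN r + 1..<NN r + n + 1}. if j \<le> NN r then x j else wt n \<epsilon> (tau ! (j - NN r - 1)))"
    by (simp add: interv_sum_list_conv_sum_set_nat del: upt_Suc)
  also have "\<dots> = (\<Sum>a\<in>{1..n}. wt n \<epsilon> a)"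
    by (rule sum.reindex_bij_witness[of _ "\<lambda>a. NN r + n + 1 - a" "\<lambda>j. NN r + n + 1 - j"]) (auto simp: nth_tau add.commute)
  also have "\<dots> = 0" using cyc_range[of n \<epsilon>] cyc_range[of n "\<epsilon> + 1"] n0 by (simp add: wt_def sum_subtractf)
  finally show ?thesis .
qed

lemma Kloc_list: "op_prod (map (\<lambda>j. Kloc_op q n j \<epsilon>) js) \<phi> = (\<lambda>e. smul (q powi (\<Sum>j\<leftarrow>js. wt n \<epsilon> (e ! (j - 1)))) (\<phi> e))"
  unfolding Kloc_wt by (rule op_prod_scaling[OF q0])

lemma Kloc_inv_list: "op_prod (map (\<lambda>j. inv_into UNIV (Kloc_op q n j \<epsilon>)) js) \<phi> = (\<lambda>e. smul (q powi (- (\<Sum>j\<leftarrow>js. wt n \<epsilon> (e ! (j - 1))))) (\<phi> e))"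
  unfolding inv_Kloc[OF q0] op_prod_scaling[OF q0] by (simp add: uminus_sum_list_map o_def)

lemma upt_block: "[i + 1..<NN r + n + 1] = [i + 1..<NN r + 1] @ [NN r + 1..<NN r + n + 1]" if "i \<le> NN r"
  using upt_add_eq_append[of "i + 1" "NN r + 1" n] that by simp

lemma wt_inner:
  assumes "i \<le> NN r"
  shows "(\<Sum>j\<leftarrow>[i + 1..<NN r + n + 1]. if j \<le> NN r then x j else wt n \<epsilon> (tau ! (j - NN r - 1))) = (\<Sum>j\<leftarrow>[i + 1..<NN r + 1]. x j)"
  unfolding upt_block[OF assms] map_append sum_list_append wt_tau add_0_right
  by (intro arg_cong[of _ _ sum_list] map_cong refl) auto

lemma stable_K: "stable (\<lambda>N. K_op q n N \<epsilon>)" "stable (\<lambda>N. inv_into UNIV (K_op q n N \<epsilon>))"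
proof -
  have S: "K_op q n N \<epsilon> = (\<lambda>\<phi> e. smul (q powi (\<Sum>j\<leftarrow>[0 + 1..<N + 1]. wt n \<epsilon> (e ! (j - 1)))) (\<phi> e))" for N
    by (rule HOL.ext) (simp add: K_op_def Kloc_list del: upt_Suc)
  have I: "inv_into UNIV (K_op q n N \<epsilon>) = (\<lambda>\<phi> e. smul (inverse (q powi (\<Sum>j\<leftarrow>[0 + 1..<N + 1]. wt n \<epsilon> (e ! (j - 1))))) (\<phi> e))" for N
    unfolding S by (rule inv_scaling) (simp add: q0)
  have "(\<lambda>e. smul (h (\<Sum>j\<leftarrow>[0 + 1..<NN r + n + 1]. wt n \<epsilon> (e ! (j - 1)))) (ext r \<phi> e))
     = ext r (\<lambda>e. smul (h (\<Sum>j\<leftarrow>[0 + 1..<NN r + 1]. wt n \<epsilon> (e ! (j - 1)))) (\<phi> e))"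
    if "\<phi> \<in> TS n (NN r) (DK r k)" for h :: "int \<Rightarrow> complex" and r k and \<phi> :: tensor
  proof -
    have "(\<lambda>e. smul (h (\<Sum>j\<leftarrow>[0 + 1..<NN r + n + 1]. wt n \<epsilon> (e ! (j - 1)))) (ext r \<phi> e))
      = ext r (\<lambda>e. smul (h (\<Sum>j\<leftarrow>[0 + 1..<NN r + n + 1]. if j \<le> NN r then wt n \<epsilon> (e ! (j - 1)) else wt n \<epsilon> (tau ! (j - NN r - 1)))) (\<phi> e))"
      by (rule attg_wt) (use DK_tensors'[OF that] length_tau in auto)
    then show ?thesis by (simp only: wt_inner[OF le0])
  qed
  note e = this
  show "stable (\<lambda>N. K_op q n N \<epsilon>)" unfolding stable_def S
    by (auto simp only: e[where h = "\<lambda>x. q powi x"] diff_self Omega_0[OF q0] simp_thms)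
  show "stable (\<lambda>N. inv_into UNIV (K_op q n N \<epsilon>))" unfolding stable_def I
    by (auto simp only: e[where h = "\<lambda>x. inverse (q powi x)"] diff_self Omega_0[OF q0] simp_thms)
qed

lemma Omega_block_sum:
  assumes "\<And>i. i \<in> {1..NN r} \<Longrightarrow> A i - ext r (B i) \<in> Omega q n (NN r + n)"
    and "\<And>i. i \<in> {NN r<..NN r + n} \<Longrightarrow> A i \<in> Omega q n (NN r + n)"
  shows "(\<Sum>i\<in>{1..NN r + n}. A i) - ext r (\<Sum>i\<in>{1..NN r}. B i) \<in> Omega q n (NN r + n)"
proof -
  have "{1..NN r + n} = {1..NN r} \<union> {NN r<..NN r + n}" by auto
  then have "(\<Sum>i\<in>{1..NN r + n}. A i) = (\<Sum>i\<in>{1..NN r}. A i) + (\<Sum>i\<in>{NN r<..NN r + n}. A i)"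
    by (simp only:) (rule sum.union_disjoint, auto)
  then have "(\<Sum>i\<in>{1..NN r + n}. A i) - ext r (\<Sum>i\<in>{1..NN r}. B i) = (\<Sum>i\<in>{1..NN r}. A i - ext r (B i)) + (\<Sum>i\<in>{NN r<..NN r + n}. A i)"
    by (simp only: attg_sum[OF qpn] sum_subtractf) (simp only: algebra_simps)
  then show ?thesis using assms by (simp only:) (intro Omega_add[OF q0] Omega_sum[OF q0])
qed

text \<open>The new colour \<open>a\<close> is already present elsewhere in the block, so the block
  represents zero, and \<open>y_i\<close> acts on it by a scalar modulo errors.\<close>

lemma repeated_outer:
  assumes \<phi>: "\<phi> \<in> TS n (NN r) (DK r k)" "k \<le> r" and i: "i \<in> {NN r<..NN r + n}" and ab: "a \<in> {1..n}" "a \<noteq> b"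
    and j: "j = i - NN r - 1" and t: "tau ! j = b"
  shows "on_laurent (app (yzp q p (NN r + n) i l)) (att r (tau[j := a]) \<phi>) \<in> Omega q n (NN r + n)"
proof -
  have jn: "j < n" using i j by auto
  let ?\<sigma> = "tau[j := a]"
  have \<sigma>: "?\<sigma> \<in> colours n n" using tau_colours ab set_update_subset_insert[of tau j a] by (auto simp: colours_def)
  \<comment> \<open>The position of colour \<open>a\<close> in the descending block.\<close>
  define j' where "j' = n - a"
  have j': "j' < n" "tau ! j' = a" using ab by (auto simp: j'_def nth_tau)
  then have "j' \<noteq> j" using t ab by auto
  then have "?\<sigma> ! j' = ?\<sigma> ! j" using j' jn by (simp add: length_tau)
  then have O: "att r ?\<sigma> \<phi> \<in> Omega q n (NN r + n)"
    using attg_repeated[OF qpn gq DK_tensors'[OF \<phi>(1)] \<sigma>, of j j'] attg_repeated[OF qpn gq DK_tensors'[OF \<phi>(1)] \<sigma>, of j' j] jn j' \<open>j' \<noteq> j\<close>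
    by (metis nat_neq_iff)
  from Omega_add[OF q0 outer_term[OF i \<phi> \<sigma>, of l] Omega_smul[OF q0 O, of "lam q p n (NN r) (cr r) i powi l"]]
  show ?thesis by (simp only: diff_add_cancel)
qed

lemma cyc_in: "cyc n \<epsilon> \<in> {1..n}" using cyc_range[of n \<epsilon>] n0 by auto

lemma cyc_ne: "cyc n \<epsilon> \<noteq> cyc n (\<epsilon> + 1)"
proof
  assume "cyc n \<epsilon> = cyc n (\<epsilon> + 1)"
  moreover have "cyc n a mod n = a mod n" for a by (simp add: cyc_def)
  ultimately have "\<epsilon> mod n = Suc \<epsilon> mod n" by (metis Suc_eq_plus1)
  then show False using n2 by (auto simp: mod_Suc split: if_splits)
qed

lemma on_laurent_zero: "on_laurent (app T) 0 = 0" by (auto simp: on_laurent_def)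

lemma stable_E: "stable (\<lambda>N. E_op q p n N \<epsilon>)"
  unfolding stable_def E_op_def
proof (intro allI impI)
  fix r k \<phi> assume kr: "k \<le> r" and \<phi>: "\<phi> \<in> TS n (NN r) (DK r k)"
  let ?l = "if \<epsilon> = 0 then - 1 else 0 :: int" and ?a = "cyc n \<epsilon>" and ?b = "cyc n (\<epsilon> + 1)"
  let ?S = "\<lambda>N i \<phi>. op_prod (map (\<lambda>j. Kloc_op q n j \<epsilon>) [i + 1..<N + 1]) \<phi>"
  show "(\<Sum>i\<in>{1..NN r + n}. on_laurent (op_zpow (y_op q p (NN r + n) i) ?l) (munit i ?a ?b (?S (NN r + n) i (ext r \<phi>))))
     - ext r (\<Sum>i\<in>{1..NN r}. on_laurent (op_zpow (y_op q p (NN r) i) ?l) (munit i ?a ?b (?S (NN r) i \<phi>))) \<in> Omega q n (NN r + n)"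
  proof (rule Omega_block_sum)
    fix i assume i: "i \<in> {1..NN r}"
    have "?S (NN r + n) i (ext r \<phi>) = ext r (?S (NN r) i \<phi>)"
    proof -
      have "(\<lambda>e. smul (q powi (\<Sum>j\<leftarrow>[i + 1..<NN r + n + 1]. wt n \<epsilon> (e ! (j - 1)))) (ext r \<phi> e))
        = ext r (\<lambda>e. smul (q powi (\<Sum>j\<leftarrow>[i + 1..<NN r + n + 1]. if j \<le> NN r then wt n \<epsilon> (e ! (j - 1)) else wt n \<epsilon> (tau ! (j - NN r - 1)))) (\<phi> e))"
        by (rule attg_wt) (use DK_tensors'[OF \<phi>] length_tau in auto)
      moreover have "i \<le> NN r" using i by simp
      ultimately show ?thesis unfolding Kloc_list by (simp only: wt_inner)
    qed
    then have m: "munit i ?a ?b (?S (NN r + n) i (ext r \<phi>)) = ext r (munit i ?a ?b (?S (NN r) i \<phi>))"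
      using attg_munit[OF qpn, of i "NN r"] i by simp
    have t: "munit i ?a ?b (?S (NN r) i \<phi>) \<in> TS n (NN r) (DK r k)"
      unfolding Kloc_list by (intro TS_munit TS_scaling cyc_in \<phi>)
    have i1: "1 \<le> i" using i by simp
    show "on_laurent (op_zpow (y_op q p (NN r + n) i) ?l) (munit i ?a ?b (?S (NN r + n) i (ext r \<phi>)))
       - ext r (on_laurent (op_zpow (y_op q p (NN r) i) ?l) (munit i ?a ?b (?S (NN r) i \<phi>))) \<in> Omega q n (NN r + n)"
      unfolding y_zpow[OF q0 p0 i1] m by (rule inner_term[OF i t kr])
  next
    fix i assume i: "i \<in> {NN r<..NN r + n}"
    have i1: "1 \<le> i" using i by simp
    define d where "d = q powi (\<Sum>j\<leftarrow>[i + 1..<NN r + n + 1]. wt n \<epsilon> (tau ! (j - NN r - 1)))"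
    have "?S (NN r + n) i (ext r \<phi>) = ext r (\<lambda>e. smul (q powi (\<Sum>j\<leftarrow>[i + 1..<NN r + n + 1]. if j \<le> NN r then wt n \<epsilon> (e ! (j - 1)) else wt n \<epsilon> (tau ! (j - NN r - 1)))) (\<phi> e))"
      unfolding Kloc_list by (rule attg_wt) (use DK_tensors'[OF \<phi>] length_tau in auto)
    also have "\<dots> = ext r (tsmul d \<phi>)"
    proof -
      have "map (\<lambda>j. if j \<le> NN r then wt n \<epsilon> (e ! (j - 1)) else wt n \<epsilon> (tau ! (j - NN r - 1))) [i + 1..<NN r + n + 1]
         = map (\<lambda>j. wt n \<epsilon> (tau ! (j - NN r - 1))) [i + 1..<NN r + n + 1]" for e
        by (intro map_cong refl) (use i in auto)
      then show ?thesis by (simp only: d_def tsmul_def)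
    qed
    finally have m: "munit i ?a ?b (?S (NN r + n) i (ext r \<phi>))
       = (if tau ! (i - NN r - 1) = ?b then att r (tau[i - NN r - 1 := ?a]) (tsmul d \<phi>) else 0)"
      by (simp only: attg_munit_outer[OF qpn i length_tau])
    show "on_laurent (op_zpow (y_op q p (NN r + n) i) ?l) (munit i ?a ?b (?S (NN r + n) i (ext r \<phi>))) \<in> Omega q n (NN r + n)"
      unfolding y_zpow[OF q0 p0 i1] m
      using repeated_outer[OF TS_smul[OF \<phi>] kr i cyc_in cyc_ne refl] Omega_0[OF q0] on_laurent_zero
      by (auto simp del: zero_fun_apply)
  qed
qed

lemma stable_F: "stable (\<lambda>N. F_op q p n N \<epsilon>)"
  unfolding stable_def F_op_def
proof (intro allI impI)
  fix r k \<phi> assume kr: "k \<le> r" and \<phi>: "\<phi> \<in> TS n (NN r) (DK r k)"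
  let ?l = "if \<epsilon> = 0 then 1 else 0 :: int" and ?a = "cyc n (\<epsilon> + 1)" and ?b = "cyc n \<epsilon>"
  let ?S = "\<lambda>i \<phi>. op_prod (map (\<lambda>j. inv_into UNIV (Kloc_op q n j \<epsilon>)) [1..<i]) \<phi>"
  show "(\<Sum>i\<in>{1..NN r + n}. on_laurent (op_zpow (y_op q p (NN r + n) i) ?l) (?S i (munit i ?a ?b (ext r \<phi>))))
     - ext r (\<Sum>i\<in>{1..NN r}. on_laurent (op_zpow (y_op q p (NN r) i) ?l) (?S i (munit i ?a ?b \<phi>))) \<in> Omega q n (NN r + n)"
  proof (rule Omega_block_sum)
    fix i assume i: "i \<in> {1..NN r}"
    let ?\<psi> = "munit i ?a ?b \<phi>"
    have m: "munit i ?a ?b (ext r \<phi>) = ext r ?\<psi>" using attg_munit[OF qpn, of i "NN r"] i by simp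
    have t: "?\<psi> \<in> TS n (NN r) (DK r k)" by (intro TS_munit cyc_in \<phi>)
    have l: "map (\<lambda>j. if j \<le> NN r then wt n \<epsilon> (e ! (j - 1)) else wt n \<epsilon> (tau ! (j - NN r - 1))) [1..<i] = map (\<lambda>j. wt n \<epsilon> (e ! (j - 1))) [1..<i]" for e
      by (intro map_cong refl) (use i in auto)
    have S: "?S i (ext r ?\<psi>) = ext r (?S i ?\<psi>)"
    proof -
      have "(\<lambda>e. smul (q powi - (\<Sum>j\<leftarrow>[1..<i]. wt n \<epsilon> (e ! (j - 1)))) (ext r ?\<psi> e))
        = ext r (\<lambda>e. smul (q powi - (\<Sum>j\<leftarrow>[1..<i]. if j \<le> NN r then wt n \<epsilon> (e ! (j - 1)) else wt n \<epsilon> (tau ! (j - NN r - 1)))) (?\<psi> e))"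
        by (rule attg_wt) (use DK_tensors'[OF t] length_tau i in auto)
      then show ?thesis unfolding Kloc_inv_list by (simp only: l)
    qed
    have t': "?S i ?\<psi> \<in> TS n (NN r) (DK r k)" unfolding Kloc_inv_list by (rule TS_scaling[OF t])
    have i1: "1 \<le> i" using i by simp
    show "on_laurent (op_zpow (y_op q p (NN r + n) i) ?l) (?S i (munit i ?a ?b (ext r \<phi>)))
       - ext r (on_laurent (op_zpow (y_op q p (NN r) i) ?l) (?S i ?\<psi>)) \<in> Omega q n (NN r + n)"
      unfolding y_zpow[OF q0 p0 i1] m S by (rule inner_term[OF i t' kr])
  next
    fix i assume i: "i \<in> {NN r<..NN r + n}"
    have i1: "1 \<le> i" using i by simp
    let ?\<sigma> = "tau[i - NN r - 1 := ?a]"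
    have m: "munit i ?a ?b (ext r \<phi>) = (if tau ! (i - NN r - 1) = ?b then att r ?\<sigma> \<phi> else 0)"
      by (simp only: attg_munit_outer[OF qpn i length_tau])
    \<comment> \<open>The Cartan factors merely rescale coefficients on the old sites. Their value
      is irrelevant, since the block with the repeated colour vanishes for any tensor in front of
      it.\<close>
    obtain w where "?S i (att r ?\<sigma> \<phi>) = att r ?\<sigma> (\<lambda>e. smul (w e) (\<phi> e))"
    proof
      show "?S i (att r ?\<sigma> \<phi>) = att r ?\<sigma> (\<lambda>e. smul (q powi - (\<Sum>j\<leftarrow>[1..<i]. if j \<le> NN r then wt n \<epsilon> (e ! (j - 1)) else wt n \<epsilon> (?\<sigma> ! (j - NN r - 1)))) (\<phi> e))"
        unfolding Kloc_inv_list by (rule attg_wt) (use i DK_tensors'[OF \<phi>] length_tau in auto)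
    qed
    moreover have "?S i 0 = 0" unfolding Kloc_inv_list by auto
    ultimately have m': "?S i (munit i ?a ?b (ext r \<phi>)) = (if tau ! (i - NN r - 1) = ?b then att r ?\<sigma> (\<lambda>e. smul (w e) (\<phi> e)) else 0)"
      unfolding m by (simp del: zero_fun_apply)
    show "on_laurent (op_zpow (y_op q p (NN r + n) i) ?l) (?S i (munit i ?a ?b (ext r \<phi>))) \<in> Omega q n (NN r + n)"
      unfolding y_zpow[OF q0 p0 i1] m'
      using repeated_outer[OF TS_scaling[OF \<phi>] kr i cyc_in cyc_ne[symmetric] refl] Omega_0[OF q0] on_laurent_zero
      by (auto simp del: zero_fun_apply)
  qed
qed

lemma stable_gen: "stable (gen_op q p n x)"
  unfolding gen_op_def using stable_E stable_F stable_K by (cases x) auto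

text \<open>Passing from level \<open>r\<close> to \<open>r + 1\<close> adds the block eigenvalues
  to \<open>h_l\<close> and the matching constants to the subtracted sum.\<close>

lemma stable_ham: "stable (ham_op q p n s M l)"
  unfolding stable_def
proof (intro allI impI)
  fix r k \<phi> assume kr: "k \<le> r" and \<phi>: "\<phi> \<in> TS n (NN r) (DK r k)"
  define C where "C j = p powi (l * m0 n s M j) * q powi (2 * l * (1 - int j))" for j
  let ?la = "\<lambda>i. lam q p n (NN r) (cr r) i powi l"
  have split: "(\<Sum>i\<in>{1..NN r + n}. f i) = (\<Sum>i\<in>{1..NN r}. f i) + (\<Sum>i\<in>{NN r<..NN r + n}. f i)" for f :: "nat \<Rightarrow> complex"
  proof -
    have "{1..NN r + n} = {1..NN r} \<union> {NN r<..NN r + n}" by auto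
    then show ?thesis by (simp only:) (rule sum.union_disjoint, auto)
  qed
  \<comment> \<open>The reversal of the block matches eigenvalues with constants; all constants of
    the block share the exponent \<open>cr r\<close>.\<close>
  have la: "(\<Sum>i\<in>{NN r<..NN r + n}. ?la i) = (\<Sum>j\<in>{NN r<..NN r + n}. C j)"
  proof (rule sum.reindex_bij_witness[of _ "\<lambda>j. NN r + (NN r + n) + 1 - j" "\<lambda>i. NN r + (NN r + n) + 1 - i"])
    fix i assume i: "i \<in> {NN r<..NN r + n}"
    define j where "j = NN r + (NN r + n) + 1 - i"
    have "j - 1 - NN r < n" "j = Suc (NN r + (j - 1 - NN r))" using i by (auto simp: j_def)
    then have "m0 n s M j = cr r" using m0_block by metis
    then show "C (NN r + (NN r + n) + 1 - i) = ?la i"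
      unfolding lam_eq[OF qpn i] C_def j_def[symmetric] by (simp add: power_int_mult_distrib power_int_mult[symmetric] mult_ac)
  qed auto
  \<comment> \<open>Subtracting the eigenvalue term by term makes every block contribution vanish
    modulo \<open>Omega\<close>.\<close>
  define A where "A i = on_laurent (op_zpow (y_op q p (NN r + n) i) l) (ext r \<phi>)
    - (if i \<le> NN r then 0 else tsmul (?la i) (ext r \<phi>))" for i
  define B where "B i = on_laurent (op_zpow (y_op q p (NN r) i) l) \<phi>" for i
  have O: "(\<Sum>i\<in>{1..NN r + n}. A i) - ext r (\<Sum>i\<in>{1..NN r}. B i) \<in> Omega q n (NN r + n)"
  proof (rule Omega_block_sum)
    fix i assume i: "i \<in> {1..NN r}"
    then have i1: "1 \<le> i" and a: "A i = on_laurent (op_zpow (y_op q p (NN r + n) i) l) (ext r \<phi>)" by (auto simp: A_def)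
    show "A i - ext r (B i) \<in> Omega q n (NN r + n)"
      unfolding a B_def y_zpow[OF q0 p0 i1] by (rule inner_term[OF i \<phi> kr])
  next
    fix i assume i: "i \<in> {NN r<..NN r + n}"
    then have i1: "1 \<le> i" and a: "A i = on_laurent (op_zpow (y_op q p (NN r + n) i) l) (ext r \<phi>) - tsmul (?la i) (ext r \<phi>)" by (auto simp: A_def)
    show "A i \<in> Omega q n (NN r + n)"
      unfolding a y_zpow[OF q0 p0 i1] by (rule outer_term[OF i \<phi> kr tau_colours])
  qed
  have "(\<Sum>i\<in>{1..NN r + n}. (if i \<le> NN r then 0 else tsmul (?la i) (ext r \<phi>)) e) = tsmul (\<Sum>i\<in>{NN r<..NN r + n}. ?la i) (ext r \<phi>) e" for e
  proof -
    have "(\<Sum>i\<in>{1..NN r + n}. (if i \<le> NN r then 0 else tsmul (?la i) (ext r \<phi>)) e) = (\<Sum>i\<in>{NN r<..NN r + n}. smul (?la i) (ext r \<phi> e))"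
      by (rule sum.mono_neutral_cong_right) (auto simp: tsmul_def)
    also have "\<dots> = smul (\<Sum>i\<in>{NN r<..NN r + n}. ?la i) (ext r \<phi> e)"
      by (rule smul_sum_left[symmetric])
    finally show ?thesis by (simp add: tsmul_def)
  qed
  then have Z: "(\<Sum>i\<in>{1..NN r + n}. if i \<le> NN r then 0 else tsmul (?la i) (ext r \<phi>)) = tsmul (\<Sum>i\<in>{NN r<..NN r + n}. ?la i) (ext r \<phi>)"
    by (intro HOL.ext) (simp only: sum_apply)
  have A: "(\<Sum>i\<in>{1..NN r + n}. A i) = h_op q p l (NN r + n) (ext r \<phi>) - tsmul (\<Sum>j\<in>{NN r<..NN r + n}. C j) (ext r \<phi>)"
    unfolding A_def sum_subtractf Z la h_op_def ..
  have "ham_op q p n s M l (NN r + n) (ext r \<phi>) - ext r (ham_op q p n s M l (NN r) \<phi>)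
     = (\<Sum>i\<in>{1..NN r + n}. A i) - ext r (\<Sum>i\<in>{1..NN r}. B i)"
    unfolding ham_op_def C_def[symmetric] A split attg_diff[OF qpn] attg_smul[OF qpn] tsmul_simps(2) B_def h_op_def[of q p l "NN r", symmetric]
    by (simp add: fun_eq_iff)
  then show "ham_op q p n s M l (NN r + n) (ext r \<phi>) - ext r (ham_op q p n s M l (NN r) \<phi>) \<in> Omega q n (NN r + n)"
    using O by (simp only:)
qed

end

section \<open>Operators on Fock space\<close>

context fock_ops
begin

abbreviation "FD \<equiv> Fock_deg n s M"
abbreviation "fop \<equiv> fock_op q n s M"
abbreviation "lvl \<equiv> level_op q n s M"
abbreviation "hcomp \<equiv> hom_component n s M"
abbreviation "ham \<equiv> ham_op q p n s M"

text \<open>What a family of operators needs in order to descend to the wedge products, preserve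
  degrees and be independent of the level. The class is closed under composition and linear
  combinations, hence contains all polynomials in the generators.\<close>

definition good :: "(nat \<Rightarrow> tensor \<Rightarrow> tensor) \<Rightarrow> bool" where
  "good X \<longleftrightarrow> (\<forall>r. (\<forall>\<phi>\<in>tensors n (NN r). X (NN r) \<phi> \<in> tensors n (NN r)) \<and>
     (\<forall>\<phi>\<in>tensors n (NN r). \<forall>\<psi>\<in>tensors n (NN r). X (NN r) (\<phi> + \<psi>) = X (NN r) \<phi> + X (NN r) \<psi>) \<and>
     (\<forall>c. \<forall>\<phi>\<in>tensors n (NN r). X (NN r) (tsmul c \<phi>) = tsmul c (X (NN r) \<phi>)) \<and>
     (\<forall>\<phi>\<in>Omega q n (NN r). X (NN r) \<phi> \<in> Omega q n (NN r)) \<and>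
     (\<forall>k. \<forall>\<phi>\<in>TS n (NN r) (DK r k). X (NN r) \<phi> \<in> TS n (NN r) (DK r k))) \<and> stable X"

lemma goodD:
  assumes "good X"
  shows "\<phi> \<in> tensors n (NN r) \<Longrightarrow> X (NN r) \<phi> \<in> tensors n (NN r)"
    "\<phi> \<in> tensors n (NN r) \<Longrightarrow> \<psi> \<in> tensors n (NN r) \<Longrightarrow> X (NN r) (\<phi> + \<psi>) = X (NN r) \<phi> + X (NN r) \<psi>"
    "\<phi> \<in> tensors n (NN r) \<Longrightarrow> X (NN r) (tsmul c \<phi>) = tsmul c (X (NN r) \<phi>)"
    "\<phi> \<in> Omega q n (NN r) \<Longrightarrow> X (NN r) \<phi> \<in> Omega q n (NN r)"
    "\<phi> \<in> TS n (NN r) (DK r k) \<Longrightarrow> X (NN r) \<phi> \<in> TS n (NN r) (DK r k)"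
    "k \<le> r \<Longrightarrow> \<phi> \<in> TS n (NN r) (DK r k) \<Longrightarrow> X (NN (Suc r)) (ext r \<phi>) - ext r (X (NN r) \<phi>) \<in> Omega q n (NN (Suc r))"
  using assms unfolding good_def stable_def NN_Suc by blast+

lemma tensors_closed: "\<phi> \<in> tensors n N \<Longrightarrow> \<psi> \<in> tensors n N \<Longrightarrow> \<phi> + \<psi> \<in> tensors n N"
  "\<phi> \<in> tensors n N \<Longrightarrow> \<psi> \<in> tensors n N \<Longrightarrow> \<phi> - \<psi> \<in> tensors n N" "\<phi> \<in> tensors n N \<Longrightarrow> tsmul c \<phi> \<in> tensors n N"
  "0 \<in> tensors n N"
  unfolding tensors_TS by (intro TS_add TS_diff TS_smul TS_0; assumption)+

lemma good_diff:
  assumes "good X" "\<phi> \<in> tensors n (NN r)" "\<psi> \<in> tensors n (NN r)"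
  shows "X (NN r) (\<phi> - \<psi>) = X (NN r) \<phi> - X (NN r) \<psi>"
  using goodD(2)[OF assms(1) tensors_closed(2)[OF assms(2,3)] assms(3)] by (simp only: diff_add_cancel eq_diff_eq)

lemma good_gen: "x \<in> gens n \<Longrightarrow> good (gen_op q p n x)"
  unfolding good_def tensors_TS
  using stable_gen[of x] gen_op_linear[OF n2 q0 p0, unfolded tensors_TS] gen_op_smul[OF n2 q0 p0, unfolded tensors_TS]
    gen_op_Omega[OF n2 q0 p0] TS_gen_op[OF n2 q0 p0 closed_Dall] TS_gen_op[OF n2 q0 p0 closed_DK[folded NN_def]]
  by (intro conjI allI ballI)

lemma good_ham: "good (ham l)"
  unfolding good_def tensors_TS
  using stable_ham[of l] ham_op_linear[OF q0 p0, unfolded tensors_TS] ham_op_smul[OF q0 p0, unfolded tensors_TS]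
    ham_op_Omega[OF q0 p0] TS_ham_op[OF q0 p0 closed_Dall] TS_ham_op[OF q0 p0 closed_DK[folded NN_def]]
  by (intro conjI allI ballI)

lemma ext_tensors: "\<phi> \<in> tensors n (NN r) \<Longrightarrow> ext r \<phi> \<in> tensors n (NN (Suc r))"
  unfolding NN_Suc by (rule attg_tensors[OF qpn _ tau_colours])

lemma good_id: "good (\<lambda>N \<phi>. \<phi>)"
  unfolding good_def stable_def by (simp add: Omega_0[OF q0] del: minus_apply zero_fun_apply)

text \<open>The stability error of \<open>Y\<close> is carried into \<open>Omega\<close> by
  \<open>X\<close>, and that of \<open>X\<close> is evaluated at \<open>Y \<phi>\<close>, which has
  the same degree.\<close>

lemma good_comp:
  assumes X: "good X" and Y: "good Y"
  shows "good (\<lambda>N \<phi>. X N (Y N \<phi>))"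
proof -
  have "X (NN (Suc r)) (Y (NN (Suc r)) (ext r \<phi>)) - ext r (X (NN r) (Y (NN r) \<phi>)) \<in> Omega q n (NN (Suc r))"
    if kr: "k \<le> r" and \<phi>: "\<phi> \<in> TS n (NN r) (DK r k)" for r k \<phi>
  proof -
    let ?A = "Y (NN (Suc r)) (ext r \<phi>)" and ?B = "ext r (Y (NN r) \<phi>)"
    have t: "?A \<in> tensors n (NN (Suc r))" "?B \<in> tensors n (NN (Suc r))"
      using goodD(1)[OF Y] ext_tensors DK_tensors'[OF \<phi>] by blast+
    have "X (NN (Suc r)) ?A - X (NN (Suc r)) ?B \<in> Omega q n (NN (Suc r))"
      using goodD(4)[OF X goodD(6)[OF Y kr \<phi>]] unfolding good_diff[OF X t] .
    from Omega_add[OF q0 this goodD(6)[OF X kr goodD(5)[OF Y \<phi>]]] show ?thesis by (simp only: diff_add_cancel add_diff_eq)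
  qed
  then have "stable (\<lambda>N \<phi>. X N (Y N \<phi>))" unfolding stable_def NN_Suc by blast
  then show ?thesis unfolding good_def using goodD(1-5)[OF X] goodD(1-5)[OF Y] by (simp del: plus_fun_apply)
qed

lemma good_plus:
  assumes X: "good X" and Y: "good Y"
  shows "good (\<lambda>N \<phi>. X N \<phi> + Y N \<phi>)"
proof -
  have "(X (NN (Suc r)) (ext r \<phi>) + Y (NN (Suc r)) (ext r \<phi>)) - ext r (X (NN r) \<phi> + Y (NN r) \<phi>) \<in> Omega q n (NN (Suc r))"
    if kr: "k \<le> r" and \<phi>: "\<phi> \<in> TS n (NN r) (DK r k)" for r k \<phi>
    using Omega_add[OF q0 goodD(6)[OF X kr \<phi>] goodD(6)[OF Y kr \<phi>]] unfolding attg_add[OF qpn] by (simp only: add_diff_add)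
  then have "stable (\<lambda>N \<phi>. X N \<phi> + Y N \<phi>)" unfolding stable_def NN_Suc by blast
  moreover have "(a + b) + (c + d) = (a + c) + (b + d)" for a b c d :: tensor by (simp only: add_ac)
  ultimately show ?thesis unfolding good_def using goodD(1-5)[OF X] goodD(1-5)[OF Y]
    by (simp add: tensors_closed TS_add Omega_add[OF q0] tsmul_simps(3) del: plus_fun_apply)
qed

lemma good_scale:
  assumes X: "good X"
  shows "good (\<lambda>N \<phi>. tsmul a (X N \<phi>))"
proof -
  have "tsmul a (X (NN (Suc r)) (ext r \<phi>)) - ext r (tsmul a (X (NN r) \<phi>)) \<in> Omega q n (NN (Suc r))"
    if kr: "k \<le> r" and \<phi>: "\<phi> \<in> TS n (NN r) (DK r k)" for r k \<phi>
    using Omega_smul[OF q0 goodD(6)[OF X kr \<phi>], of a] unfolding attg_smul[OF qpn] tsmul_simps(7) .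
  then have "stable (\<lambda>N \<phi>. tsmul a (X N \<phi>))" unfolding stable_def NN_Suc by blast
  then show ?thesis unfolding good_def using goodD(1-5)[OF X]
    by (simp add: tensors_closed TS_smul Omega_smul[OF q0] tsmul_simps(3,4) mult.commute del: plus_fun_apply)
qed

lemma good_sum: "(\<And>i. i \<in> I \<Longrightarrow> good (X i)) \<Longrightarrow> good (\<lambda>N \<phi>. \<Sum>i\<in>I. X i N \<phi>)"
proof (induction I rule: infinite_finite_induct)
  case (insert i I)
  then show ?case using good_plus[of "X i"] by (simp del: plus_fun_apply)
qed (use good_scale[OF good_id, of 0] in \<open>simp_all add: tsmul_simps del: zero_fun_apply\<close>)

lemma level_op_good:
  "good X \<Longrightarrow> k \<le> r \<Longrightarrow> \<phi> \<in> TS n (NN r) (DK r k) \<Longrightarrow> lvl X k r (W r \<phi>) = W r (X (NN r) \<phi>)"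
  unfolding NN_def by (rule level_op_W) (auto simp only: goodD[unfolded NN_def])

text \<open>A representative at level \<open>r + 1\<close> is obtained by attaching the block to one
  at level \<open>r\<close>; stability then compares the two results.\<close>

lemma level_op_Suc:
  assumes X: "good X" and kr: "k \<le> r" and w: "w \<in> FD k"
  shows "lvl X k (Suc r) w = lvl X k r w"
proof -
  obtain \<phi> where \<phi>: "\<phi> \<in> TS n (NN r) (DK r k)" "w = W r \<phi>" using W_surj[OF w kr, folded NN_def] .
  have e: "ext r \<phi> \<in> TS n (NN (Suc r)) (DK (Suc r) k)" unfolding NN_Suc by (rule TS_att[OF \<phi>(1) tau_colours])
  have "lvl X k (Suc r) w = W (Suc r) (X (NN (Suc r)) (ext r \<phi>))"
    unfolding \<phi>(2) W_ext[OF \<phi>(1), symmetric] by (rule level_op_good[OF X _ e]) (use kr in simp)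
  also have "\<dots> = W (Suc r) (ext r (X (NN r) \<phi>))"
    using W_eq_iff[of _ "Suc r", folded NN_def] goodD(6)[OF X kr \<phi>(1)] goodD(1)[OF X] ext_tensors DK_tensors'[OF \<phi>(1)] by blast
  also have "\<dots> = W r (X (NN r) \<phi>)" by (rule W_ext[OF goodD(5)[OF X \<phi>(1)]])
  finally show ?thesis unfolding \<phi>(2) level_op_good[OF X kr \<phi>(1)] .
qed

lemma level_op_indep:
  assumes "good X" "k \<le> r" "w \<in> FD k"
  shows "lvl X k r w = lvl X k k w"
  using assms(2) by (induction rule: dec_induct) (use level_op_Suc[OF assms(1) _ assms(3)] in auto)

section \<open>Homogeneous components and the operators on Fock space\<close>

lemma Fock_closed: "0 \<in> Fock M" "v \<in> Fock M \<Longrightarrow> w \<in> Fock M \<Longrightarrow> v + w \<in> Fock M" "w \<in> Fock M \<Longrightarrow> smul c w \<in> Fock M"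
  using keys_add[of v w] by (auto simp: Fock_def in_keys_iff)

lemma Fock_deg_closed:
  "0 \<in> FD k" "v \<in> FD k \<Longrightarrow> w \<in> FD k \<Longrightarrow> v + w \<in> FD k"
  "w \<in> FD k \<Longrightarrow> smul c w \<in> FD k" "w \<in> FD k \<Longrightarrow> w \<in> Fock M"
  using keys_add[of v w] by (auto simp: Fock_deg_def Fock_def in_keys_iff)

lemma fock_degree_nat:
  assumes "ks \<in> normal_streams M"
  shows "\<exists>k. fock_degree n s M ks = int k"
proof -
  obtain i1 where i1: "\<And>i. i \<ge> i1 \<Longrightarrow> ks !! i = M - int i" using assms by (auto simp: normal_streams_def)
  have "snth ks (max i i1) + int (max i i1 - i) \<le> snth ks i" for i
    by (rule decreasing_ge) (use assms in \<open>auto simp: normal_streams_def\<close>)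
  then have "M - int i \<le> ks !! i" for i using i1[of "max i i1"] by (auto simp: of_nat_diff algebra_simps)
  then have "0 \<le> (\<Sum>i<i1. m0 n s M (Suc i) - zexp n (ks !! i))"
    unfolding m0_zexp by (intro sum_nonneg) (simp add: zexp_antimono[OF n0])
  then show ?thesis using fock_degree_tail[of i1 ks] i1 by (metis nonneg_int_cases)
qed

lemma Fock_induct [consumes 1, case_names deg add]:
  assumes w: "w \<in> Fock M" and deg: "\<And>k w. w \<in> FD k \<Longrightarrow> P w"
    and add: "\<And>v w. v \<in> Fock M \<Longrightarrow> w \<in> Fock M \<Longrightarrow> P v \<Longrightarrow> P w \<Longrightarrow> P (v + w)"
  shows "P w"
proof -
  let ?f = "\<lambda>ks. single ks (lookup w ks)"
  have d: "\<exists>k. ?f ks \<in> FD k" if "ks \<in> keys w" for ks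
    using fock_degree_nat[of ks] that w by (auto simp: Fock_deg_def Fock_def)
  have "P (\<Sum>ks\<in>A. ?f ks) \<and> (\<Sum>ks\<in>A. ?f ks) \<in> Fock M" if "finite A" "A \<subseteq> keys w" for A
    using that
  proof (induction A)
    case empty
    then show ?case using deg[OF Fock_deg_closed(1)] Fock_closed(1) by simp
  next
    case (insert ks A)
    then show ?case using d[of ks] deg add Fock_closed(2) Fock_deg_closed(4) by (auto simp del: plus_fun_apply)
  qed
  from this[of "keys w"] show ?thesis using pm_sum_singles[of w] by simp
qed

lemma lookup_hom:
  "lookup (hcomp k w) ks = (if fock_degree n s M ks = int k then lookup w ks else 0)"
  unfolding hom_component_def by (simp add: lookup_sum lookup_single when_def in_keys_iff)

lemma hom_deg: "w \<in> FD k \<Longrightarrow> hcomp k' w = (if k' = k then w else 0)"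
proof (rule poly_mapping_eqI)
  fix ks assume w: "w \<in> FD k"
  show "lookup (hcomp k' w) ks = lookup (if k' = k then w else 0) ks"
  proof (cases "ks \<in> keys w")
    case True
    then show ?thesis using w by (simp add: lookup_hom Fock_deg_def)
  next
    case False
    then have "lookup w ks = 0" by (simp add: in_keys_iff)
    then show ?thesis by (simp add: lookup_hom)
  qed
qed

lemma hom_add: "hcomp k (v + w) = hcomp k v + hcomp k w"
  by (rule poly_mapping_eqI) (simp add: lookup_hom lookup_add)

lemma hom_in: "w \<in> Fock M \<Longrightarrow> hcomp k w \<in> FD k"
  by (auto simp: Fock_deg_def Fock_def in_keys_iff lookup_hom split: if_splits)

lemma hom_finite: "finite {k. hcomp k w \<noteq> 0}"
proof (rule finite_subset)
  show "{k. hcomp k w \<noteq> 0} \<subseteq> (\<lambda>ks. nat (fock_degree n s M ks)) ` keys w"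
  proof
    fix k assume "k \<in> {k. hcomp k w \<noteq> 0}"
    then obtain ks where "lookup (hcomp k w) ks \<noteq> 0" by (auto simp: poly_mapping_eq_iff fun_eq_iff)
    then have "ks \<in> keys w" "fock_degree n s M ks = int k" by (auto simp: lookup_hom in_keys_iff split: if_splits)
    then show "k \<in> (\<lambda>ks. nat (fock_degree n s M ks)) ` keys w" by force
  qed
qed simp

lemma DKk_surj:
  assumes "w \<in> FD k"
  obtains \<phi> where "\<phi> \<in> TS n (NN k) (DK k k)" "w = W k \<phi>"
  using W_surj[OF assms order_refl, folded NN_def] .

lemma W_add': "\<phi> \<in> tensors n (NN r) \<Longrightarrow> \<psi> \<in> tensors n (NN r) \<Longrightarrow> W r (\<phi> + \<psi>) = W r \<phi> + W r \<psi>"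
  unfolding NN_def by (rule W_add)

lemma level_op_add:
  assumes X: "good X" and "v \<in> FD k" "w \<in> FD k"
  shows "lvl X k k (v + w) = lvl X k k v + lvl X k k w"
proof -
  obtain \<phi> \<psi> where \<phi>: "\<phi> \<in> TS n (NN k) (DK k k)" "v = W k \<phi>" and \<psi>: "\<psi> \<in> TS n (NN k) (DK k k)" "w = W k \<psi>"
    using DKk_surj assms(2,3) by metis
  note t = DK_tensors'[OF \<phi>(1)] DK_tensors'[OF \<psi>(1)]
  show ?thesis unfolding \<phi>(2) \<psi>(2) W_add'[OF t, symmetric] level_op_good[OF X order_refl \<phi>(1)] level_op_good[OF X order_refl \<psi>(1)]
      level_op_good[OF X order_refl TS_add[OF \<phi>(1) \<psi>(1)]] goodD(2)[OF X t]
    by (rule W_add'[OF goodD(1)[OF X t(1)] goodD(1)[OF X t(2)]])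
qed

lemma level_op_0: "good X \<Longrightarrow> lvl X k k 0 = 0"
  using level_op_add[of X 0 k 0] Fock_deg_closed(1) by simp

lemma fock_op_level: "good X \<Longrightarrow> w \<in> FD k \<Longrightarrow> fop X w = lvl X k k w"
  unfolding fock_op_def by (subst Sum_any.expand_superset[of "{k}"]) (auto simp: hom_deg level_op_0 split: if_splits)

lemma fock_op_W: "good X \<Longrightarrow> \<phi> \<in> TS n (NN k) (DK k k) \<Longrightarrow> fop X (W k \<phi>) = W k (X (NN k) \<phi>)"
  using fock_op_level[of X "W k \<phi>" k] W_deg[of \<phi> k k, folded NN_def] level_op_good[of X k k \<phi>] by simp

lemma fock_op_add:
  assumes X: "good X" and v: "v \<in> Fock M" and w: "w \<in> Fock M"
  shows "fop X (v + w) = fop X v + fop X w"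
proof -
  have f: "finite {k. lvl X k k (hcomp k u) \<noteq> 0}" for u
    by (rule finite_subset[OF _ hom_finite[of u]]) (auto simp: level_op_0[OF X])
  show ?thesis unfolding fock_op_def hom_add level_op_add[OF X hom_in[OF v] hom_in[OF w]]
    by (rule Sum_any.distrib[OF f f])
qed

lemma fock_op_deg: "good X \<Longrightarrow> w \<in> FD k \<Longrightarrow> fop X w \<in> FD k"
  by (erule DKk_surj) (simp add: fock_op_W W_deg[folded NN_def] goodD(5))

lemma fock_op_Fock:
  assumes X: "good X" and w: "w \<in> Fock M"
  shows "fop X w \<in> Fock M"
  using w
proof (induction rule: Fock_induct)
  case (deg k w)
  then show ?case using fock_op_deg[OF X] Fock_deg_closed(4) by blast
qed (simp add: fock_op_add X Fock_closed)

lemma W_smul': "\<phi> \<in> tensors n (NN r) \<Longrightarrow> W r (tsmul a \<phi>) = smul a (W r \<phi>)"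
  unfolding NN_def by (rule W_smul)

lemma fock_op_smul:
  assumes X: "good X" and "w \<in> Fock M"
  shows "fop X (smul c w) = smul c (fop X w)"
  using assms(2)
proof (induction rule: Fock_induct)
  case (deg k w)
  then obtain \<phi> where \<phi>: "\<phi> \<in> TS n (NN k) (DK k k)" "w = W k \<phi>" by (rule DKk_surj)
  note t = DK_tensors'[OF \<phi>(1)]
  show ?case unfolding \<phi>(2) W_smul'[OF t, symmetric] fock_op_W[OF X \<phi>(1)] fock_op_W[OF X TS_smul[OF \<phi>(1)]] goodD(3)[OF X t]
    by (rule W_smul'[OF goodD(1)[OF X t]])
qed (simp add: smul_add fock_op_add[OF X] Fock_closed)

lemma fock_op_lin_endo: "good X \<Longrightarrow> lin_endo (Fock M) (fop X)"
  unfolding lin_endo_def by (simp add: fock_op_Fock fock_op_add fock_op_smul)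

text \<open>In degree \<open>k\<close> all three operators can be computed at the same level
  \<open>r = k\<close>, because \<open>Y\<close> preserves the degree.\<close>

lemma fock_op_comp:
  assumes X: "good X" and Y: "good Y" and U: "good U" and w: "w \<in> Fock M"
    and eq: "\<And>r \<phi>. \<phi> \<in> tensors n (NN r) \<Longrightarrow> U (NN r) \<phi> = X (NN r) (Y (NN r) \<phi>)"
  shows "fop X (fop Y w) = fop U w"
  using w
proof (induction rule: Fock_induct)
  case (deg k w)
  then obtain \<phi> where \<phi>: "\<phi> \<in> TS n (NN k) (DK k k)" "w = W k \<phi>" by (rule DKk_surj)
  show ?case unfolding \<phi>(2) fock_op_W[OF Y \<phi>(1)] fock_op_W[OF X goodD(5)[OF Y \<phi>(1)]] fock_op_W[OF U \<phi>(1)] eq[OF DK_tensors'[OF \<phi>(1)]] ..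
qed (simp add: fock_op_add X Y U fock_op_Fock)

lemma fock_op_plus:
  assumes X: "good X" and Y: "good Y" and U: "good U" and w: "w \<in> Fock M"
    and eq: "\<And>r \<phi>. \<phi> \<in> tensors n (NN r) \<Longrightarrow> U (NN r) \<phi> = X (NN r) \<phi> + Y (NN r) \<phi>"
  shows "fop U w = fop X w + fop Y w"
  using w
proof (induction rule: Fock_induct)
  case (deg k w)
  then obtain \<phi> where \<phi>: "\<phi> \<in> TS n (NN k) (DK k k)" "w = W k \<phi>" by (rule DKk_surj)
  note t = DK_tensors'[OF \<phi>(1)]
  show ?case unfolding \<phi>(2) fock_op_W[OF Y \<phi>(1)] fock_op_W[OF X \<phi>(1)] fock_op_W[OF U \<phi>(1)] eq[OF t]
    by (rule W_add'[OF goodD(1)[OF X t] goodD(1)[OF Y t]])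
qed (simp add: fock_op_add X Y U fock_op_Fock)

lemma fock_op_scale:
  assumes U: "good U" and w: "w \<in> Fock M" and eq: "\<And>r \<phi>. \<phi> \<in> tensors n (NN r) \<Longrightarrow> U (NN r) \<phi> = tsmul c \<phi>"
  shows "fop U w = smul c w"
  using w
proof (induction rule: Fock_induct)
  case (deg k w)
  then obtain \<phi> where \<phi>: "\<phi> \<in> TS n (NN k) (DK k k)" "w = W k \<phi>" by (rule DKk_surj)
  note t = DK_tensors'[OF \<phi>(1)]
  show ?case unfolding \<phi>(2) fock_op_W[OF U \<phi>(1)] eq[OF t] W_smul'[OF t] ..
qed (simp add: fock_op_add U smul_add)

lemma fock_op_cong:
  assumes X: "good X" and U: "good U" and w: "w \<in> Fock M" and eq: "\<And>r \<phi>. \<phi> \<in> tensors n (NN r) \<Longrightarrow> U (NN r) \<phi> = X (NN r) \<phi>"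
  shows "fop U w = fop X w"
  using w
proof (induction rule: Fock_induct)
  case (deg k w)
  then obtain \<phi> where \<phi>: "\<phi> \<in> TS n (NN k) (DK k k)" "w = W k \<phi>" by (rule DKk_surj)
  show ?case unfolding \<phi>(2) fock_op_W[OF X \<phi>(1)] fock_op_W[OF U \<phi>(1)] eq[OF DK_tensors'[OF \<phi>(1)]] ..
qed (simp add: fock_op_add X U)

end

section \<open>The quantum affine algebra\<close>

text \<open>Evaluation of a noncommutative polynomial at the generators, as an endomorphism.
  \<open>RO\<close> is the same on tensors, without reference to ring structures.\<close>

definition EV :: "complex \<Rightarrow> complex \<Rightarrow> nat \<Rightarrow> nat \<Rightarrow> free_elt \<Rightarrow> ften endo" where
  "EV q p n N a = (\<Sum>u\<in>keys a. scF (lookup a u) * prod_list (map (\<lambda>x. GX q p n x N) (letters u)))"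

definition RO :: "complex \<Rightarrow> complex \<Rightarrow> nat \<Rightarrow> free_elt \<Rightarrow> nat \<Rightarrow> tensor \<Rightarrow> tensor" where
  "RO q p n a N \<phi> = (\<Sum>u\<in>keys a. tsmul (lookup a u) (foldr (\<lambda>x. gen_op q p n x N) (letters u) \<phi>))"

lemma scF_hom: "scF 1 = 1" "scF 0 = 0" "scF (a + b) = scF a + scF b" "scF (a * b) = scF a * scF b"
proof -
  show h: "scF 1 = 1" "scF (a + b) = scF a + scF b" "scF (a * b) = scF a * scF b" for a b
    using scalar_hom_scF by (auto simp: scalar_hom_def)
  show "scF 0 = 0" using h(2)[of 0 0] by simp
qed

definition CA :: "nat \<Rightarrow> free_elt set" where
  "CA n = {a. \<forall>u\<in>keys a. set (letters u) \<subseteq> gens n}"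

lemma free_alg_simps: "carrier (free_alg n) = CA n" "mult (free_alg n) = (*)" "one (free_alg n) = 1" "zero (free_alg n) = 0" "add (free_alg n) = (+)"
  by (simp_all add: free_alg_def CA_def)

lemma CA_closed:
  "a \<in> CA n \<Longrightarrow> b \<in> CA n \<Longrightarrow> a + b \<in> CA n" "a \<in> CA n \<Longrightarrow> - a \<in> CA n" "a \<in> CA n \<Longrightarrow> b \<in> CA n \<Longrightarrow> a - b \<in> CA n"
  "a \<in> CA n \<Longrightarrow> b \<in> CA n \<Longrightarrow> a * b \<in> CA n" "0 \<in> CA n" "scalar c \<in> CA n" "1 \<in> CA n" "x \<in> gens n \<Longrightarrow> letter x \<in> CA n"
proof -
  show "a \<in> CA n \<Longrightarrow> b \<in> CA n \<Longrightarrow> a + b \<in> CA n" "a \<in> CA n \<Longrightarrow> b \<in> CA n \<Longrightarrow> a - b \<in> CA n"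
    using keys_add[of a b] keys_diff[of a b] by (auto simp: CA_def)
  show "a \<in> CA n \<Longrightarrow> - a \<in> CA n" "0 \<in> CA n" by (auto simp: CA_def)
  show s: "scalar c \<in> CA n" for c by (auto simp: CA_def scalar_def zero_word_def)
  show "1 \<in> CA n" using s[of 1] by (simp add: scalar_def)
  show "x \<in> gens n \<Longrightarrow> letter x \<in> CA n" by (auto simp: CA_def letter_def)
  show "a * b \<in> CA n" if "a \<in> CA n" "b \<in> CA n"
  proof -
    have "set (letters w) \<subseteq> gens n" if w: "w \<in> keys (a * b)" for w
    proof -
      obtain u v where "u \<in> keys a" "v \<in> keys b" "w = u + v" using keys_mult[of a b] w by blast
      then show ?thesis using \<open>a \<in> CA n\<close> \<open>b \<in> CA n\<close> by (auto simp: CA_def plus_word_def)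
    qed
    then show ?thesis by (auto simp: CA_def)
  qed
qed

lemma CA_power: "a \<in> CA n \<Longrightarrow> a ^ k \<in> CA n" by (induction k) (auto intro: CA_closed)
lemma CA_sum: "(\<And>i. i \<in> I \<Longrightarrow> f i \<in> CA n) \<Longrightarrow> sum f I \<in> CA n"
  by (induction I rule: infinite_finite_induct) (auto intro: CA_closed)
lemma CA_prod_list: "(\<And>x. x \<in> set xs \<Longrightarrow> f x \<in> CA n) \<Longrightarrow> prod_list (map f xs) \<in> CA n"
  by (induction xs) (auto intro: CA_closed)
lemma CA_gens: "i < n \<Longrightarrow> gE i \<in> CA n" "i < n \<Longrightarrow> gF i \<in> CA n" "i < n \<Longrightarrow> gK i \<in> CA n" "i < n \<Longrightarrow> gKinv i \<in> CA n"
  by (rule CA_closed, force simp: gens_def)+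

lemma relators_CA: "relators n q \<subseteq> CA n"
proof -
  have "common_relators n q \<subseteq> CA n"
    unfolding common_relators_def serre_def
    by (intro Un_least UN_least insert_subsetI empty_subsetI CA_closed(1-7) CA_gens CA_sum CA_power CA_prod_list) auto
  moreover have "EF_relators n q \<subseteq> CA n"
    unfolding EF_relators_def by (auto intro!: CA_closed(1-7) CA_gens)
  moreover have "classical_relators n \<subseteq> CA n"
    unfolding classical_relators_def gH_def
    by (intro Un_least UN_least insert_subsetI empty_subsetI CA_closed(1-7) CA_gens CA_sum) auto
  ultimately show ?thesis by (simp add: relators_def)
qed

lemma ring_free_alg: "ring (free_alg n)"
proof (rule ringI)
  show "abelian_group (free_alg n)"
  proof (rule abelian_groupI, unfold free_alg_simps)
    fix x assume "x \<in> CA n"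
    then show "\<exists>y\<in>CA n. y + x = 0" using CA_closed(2) by (intro bexI[of _ "- x"]) auto
  qed (auto intro: CA_closed simp: add_ac)
  show "monoid (free_alg n)" by (rule monoidI, unfold free_alg_simps) (auto intro: CA_closed simp: mult.assoc)
qed (auto simp: free_alg_simps distrib_left distrib_right)

lemma relator_idealI:
  assumes K: "K \<subseteq> CA n" and 0: "0 \<in> K" and add: "\<And>a b. a \<in> K \<Longrightarrow> b \<in> K \<Longrightarrow> a + b \<in> K" and neg: "\<And>a. a \<in> K \<Longrightarrow> - a \<in> K"
    and mul: "\<And>a x. a \<in> K \<Longrightarrow> x \<in> CA n \<Longrightarrow> x * a \<in> K \<and> a * x \<in> K"
  shows "ideal K (free_alg n)"
proof (rule idealI[OF ring_free_alg])
  interpret ring "free_alg n" by (rule ring_free_alg)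
  have inv: "inv\<^bsub>add_monoid (free_alg n)\<^esub> a = - a" if "a \<in> K" for a
    using minus_equality[of "- a" a] that K CA_closed(2)[of a n] unfolding a_inv_def by (auto simp: free_alg_simps)
  show "subgroup K (add_monoid (free_alg n))"
    by (rule subgroup.intro) (use K 0 add neg inv in \<open>auto simp: free_alg_simps\<close>)
qed (use mul in \<open>auto simp: free_alg_simps\<close>)

context
  fixes q p :: complex and n :: nat
  assumes q: "q \<noteq> 0" and p: "p \<noteq> 0"
begin

private abbreviation "P N u \<equiv> prod_list (map (\<lambda>x. GX q p n x N) (letters u))"

lemma EV_superset:
  assumes "finite A" "keys a \<subseteq> A"
  shows "EV q p n N a = (\<Sum>u\<in>A. scF (lookup a u) * P N u)"
  unfolding EV_def by (rule sum.mono_neutral_left) (use assms in \<open>auto simp: in_keys_iff scF_hom(2)\<close>)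

lemma EV_add: "EV q p n N (a + b) = EV q p n N a + EV q p n N b"
proof -
  let ?A = "keys a \<union> keys b"
  have "EV q p n N (a + b) = (\<Sum>u\<in>?A. scF (lookup (a + b) u) * P N u)"
    by (rule EV_superset) (auto dest: subsetD[OF keys_add])
  moreover have "EV q p n N a = (\<Sum>u\<in>?A. scF (lookup a u) * P N u)"
    "EV q p n N b = (\<Sum>u\<in>?A. scF (lookup b u) * P N u)" by (rule EV_superset; auto)+
  ultimately show ?thesis by (simp add: lookup_add scF_hom(3) distrib_right sum.distrib)
qed

lemma EV_single: "EV q p n N (single u c) = scF c * P N u"
  by (cases "c = 0") (simp_all add: EV_def scF_hom(2))

lemma scF_P: "P N u * scF c = scF c * P N u"
proof -
  have "prod_list (map (\<lambda>x. GX q p n x N) xs) * scF c = scF c * prod_list (map (\<lambda>x. GX q p n x N) xs)" for xs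
    by (induction xs) (simp_all add: commute_mult_left GX_scF[OF q])
  then show ?thesis .
qed

lemma EV_mult: "EV q p n N (a * b) = EV q p n N a * EV q p n N b"
proof (induction a rule: pm_induct)
  case (single u c)
  show ?case
  proof (induction b rule: pm_induct)
    case (single v d)
    have "P N (u + v) = P N u * P N v" by (simp add: plus_word_def)
    then show ?case by (simp add: mult_single EV_single scF_hom(4) mult.assoc comm_left[OF scF_P])
  qed (simp add: EV_add distrib_left)
qed (simp add: EV_add distrib_right)

lemma EV_0: "EV q p n N 0 = 0" by (simp add: EV_def)
lemma EV_scalar: "EV q p n N (scalar c) = scF c" by (simp add: scalar_def EV_single zero_word_def)
lemma EV_1: "EV q p n N 1 = 1" using EV_scalar[of N 1] by (simp add: scalar_def scF_hom(1))
lemma EV_minus: "EV q p n N (- a) = - EV q p n N a" using EV_add[of N "- a" a] by (simp add: EV_0 eq_neg_iff_add_eq_0)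
lemma EV_diff: "EV q p n N (a - b) = EV q p n N a - EV q p n N b" using EV_add[of N a "- b"] by (simp add: EV_minus)
lemma EV_letter: "EV q p n N (letter x) = GX q p n x N" by (simp add: letter_def EV_single scF_hom(1))
lemma EV_power: "EV q p n N (a ^ k) = EV q p n N a ^ k" by (induction k) (simp_all add: EV_1 EV_mult)
lemma EV_sum: "EV q p n N (sum f I) = (\<Sum>i\<in>I. EV q p n N (f i))"
  by (induction I rule: infinite_finite_induct) (simp_all add: EV_0 EV_add)
lemma EV_prod_list: "EV q p n N (prod_list (map f xs)) = prod_list (map (\<lambda>x. EV q p n N (f x)) xs)"
  by (induction xs) (simp_all add: EV_1 EV_mult)
lemma EV_serre: "EV q p n N (serre q m x y) = serreR scF q m (EV q p n N x) (EV q p n N y)"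
  by (simp add: serre_def serreR_def EV_sum EV_mult EV_power EV_scalar)

text \<open>Each relator evaluates to the difference of the two sides of a relation in
  \<open>Uq_rels_tensor\<close>, once the conjugations are rewritten by means of
  \<open>L i\<close>.\<close>

lemma EV_relators:
  assumes n2: "n \<ge> 2" and gq: "generic_q q" and a: "a \<in> relators n q"
  shows "EV q p n N a = 0"
proof -
  define E F K L where "E i = GX q p n (GenE i) N" and "F i = GX q p n (GenF i) N"
    and "K i = GX q p n (GenK i) N" and "L i = GX q p n (GenKinv i) N" for i
  have eq: "E = EF n q (yiL q p N) N" "F = FF n q (yL q p N) N" "K = KF n q N" "L = LF n q N"
    by (auto simp: E_def F_def K_def L_def GX_def)
  have y: "linop (yL q p N i) \<and> linop (yiL q p N i) \<and> yL q p N i * yiL q p N i = 1 \<and> yiL q p N i * yL q p N i = 1" for i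
    using linop_yL yL_inv[OF q p] by blast
  have yy: "yL q p N i * yL q p N j = yL q p N j * yL q p N i" if "i \<in> {1..N}" "j \<in> {1..N}" for i j
    using that by (intro yL_yL[OF q p]) auto
  have U: "Uq_rels_common n q scF E F K L" "q \<noteq> 1 \<Longrightarrow> Uq_rels_EF n q scF E F K L" "q = 1 \<Longrightarrow> Uq_rels_classical n scF E F K"
    unfolding eq by (rule Uq_rels_tensor[OF n2 gq]; use y yy in blast)+
  have S: "EV q p n N (gE i) = E i" "EV q p n N (gF i) = F i" "EV q p n N (gK i) = K i" "EV q p n N (gKinv i) = L i" for i
    by (simp_all add: EV_letter E_def F_def K_def L_def)
  note ev = S EV_mult EV_diff EV_add EV_1 EV_0 EV_scalar EV_serre EV_prod_list EV_sum
  have c: "\<And>i. i < n \<Longrightarrow> K i * L i = 1 \<and> L i * K i = 1"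
    "\<And>i j. i < n \<Longrightarrow> j < n \<Longrightarrow> K i * K j = K j * K i"
    "\<And>i j. i < n \<Longrightarrow> j < n \<Longrightarrow> K i * E j = scF (q powi cartan n i j) * (E j * K i)"
    "\<And>i j. i < n \<Longrightarrow> j < n \<Longrightarrow> K i * F j = scF (q powi (- cartan n i j)) * (F j * K i)"
    "\<And>i j. i < n \<Longrightarrow> j < n \<Longrightarrow> i \<noteq> j \<Longrightarrow> serreR scF q (nat (1 - cartan n i j)) (E i) (E j) = 0"
    "\<And>i j. i < n \<Longrightarrow> j < n \<Longrightarrow> i \<noteq> j \<Longrightarrow> serreR scF q (nat (1 - cartan n i j)) (F i) (F j) = 0"
    "prod_list (map K [0..<n]) = 1"
    using U(1) unfolding Uq_rels_common_def by blast+
  have KX: "K i * X * L i = scF d * X" if "K i * X = scF d * (X * K i)" "i < n" for X d i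
    using c(1)[OF that(2)] that(1) by (simp add: mult.assoc)
  have common: "EV q p n N a = 0" if "a \<in> common_relators n q"
    using that unfolding common_relators_def
    by (elim UnE UN_E insertE emptyE; simp only: ev; (use c KX[OF c(3)] KX[OF c(4)] in \<open>simp; fail\<close>))
  show ?thesis
  proof (cases "q = 1")
    case True
    have cl: "Uq_rels_classical n scF E F K" by (rule U(3)[OF True])
    have g: "EV q p n N (gH i) = E i * F i - F i * E i" for i unfolding gH_def by (simp only: ev)
    have "EV q p n N a = 0" if "a \<in> classical_relators n"
      using that cl unfolding classical_relators_def Uq_rels_classical_def Let_def
      by (elim UnE UN_E insertE emptyE conjE; simp only: ev g; simp)
    then show ?thesis using a True common by (auto simp: relators_def)
  next
    case False
    have ef: "Uq_rels_EF n q scF E F K L" by (rule U(2)[OF False])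
    have "EV q p n N a = 0" if "a \<in> EF_relators n q"
      using that ef unfolding EF_relators_def Uq_rels_EF_def
      by (elim UN_E insertE emptyE; simp only: ev if_distrib[of "EV q p n N"]; simp)
    then show ?thesis using a False common by (auto simp: relators_def)
  qed
qed

text \<open>Powers of \<open>y_i\<close> commute with every \<open>y_j\<close> and act on
  coefficients only, so they pass each constituent of the generators.\<close>

lemma HX_GX: "HX q p n' s M l N * GX q p n x N = GX q p n x N * HX q p n' s M l N"
proof -
  have T: "lft (yzp q p N i l) * GX q p n x N = GX q p n x N * lft (yzp q p N i l)"
    if i: "i \<in> {1..N}" for i
  proof -
    let ?T = "yzp q p N i l"
    note lin = linop_yzp[OF q p, of N i l]
    have y: "?T * yL q p N j = yL q p N j * ?T" if "j \<in> {1..N}" for j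
      by (rule zpw_commute[OF yL_yL[OF q p] yL_inv[OF q p]]) (use i that in auto)
    have y': "?T * yiL q p N j = yiL q p N j * ?T" if "j \<in> {1..N}" for j
      by (rule commute_inverse[OF y[OF that] yL_inv[OF q p]])
    have l: "lft ?T * lft S = lft S * lft ?T" if "?T * S = S * ?T" for S
      using that by (simp flip: lft_mult)
    have e: "lft ?T * eS n (yiL q p N j) j \<epsilon> = eS n (yiL q p N j) j \<epsilon> * lft ?T" "lft ?T * fS n (yL q p N j) j \<epsilon> = fS n (yL q p N j) j \<epsilon> * lft ?T"
      if "j \<in> {1..N}" for j \<epsilon>
      unfolding eS_def fS_def using y[OF that] y'[OF that] by (auto intro!: commute_mult_right l lft_MU)
    have s: "lft ?T * (\<Sum>j\<in>{1..N}. g j) = (\<Sum>j\<in>{1..N}. g j) * lft ?T" if "\<And>j. j \<in> {1..N} \<Longrightarrow> lft ?T * g j = g j * lft ?T" for g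
      unfolding sum_distrib_left sum_distrib_right using that by (intro sum.cong refl)
    show ?thesis unfolding GX_def EF_def FF_def KF_def LF_def
      by (cases x; simp only: gen.case; intro s commute_mult_right e lft_DG lin; assumption)
  qed
  have "HF q p l N * GX q p n x N = GX q p n x N * HF q p l N"
    unfolding HF_def sum_distrib_left sum_distrib_right using T by (intro sum.cong refl)
  then show ?thesis unfolding HX_def by (simp add: left_diff_distrib right_diff_distrib GX_scF[OF q])
qed

lemma HX_HX: "HX q p n s M l N * HX q p n s M l' N = HX q p n s M l' N * HX q p n s M l N"
proof -
  have T: "lft (yzp q p N i l) * lft (yzp q p N j l') = lft (yzp q p N j l') * lft (yzp q p N i l)"
    if i: "i \<in> {1..N}" "j \<in> {1..N}" for i j
  proof -
    have "yzp q p N j l' * yL q p N i = yL q p N i * yzp q p N j l'"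
      by (rule zpw_commute[OF yL_yL[OF q p] yL_inv[OF q p]]) (use i in auto)
    from zpw_commute[OF this[symmetric] yL_inv[OF q p], of l] show ?thesis by (simp flip: lft_mult)
  qed
  have "HF q p l N * HF q p l' N = HF q p l' N * HF q p l N"
  proof -
    have "HF q p l N * lft (yzp q p N j l') = lft (yzp q p N j l') * HF q p l N" if "j \<in> {1..N}" for j
      unfolding HF_def sum_distrib_left sum_distrib_right using T that by (intro sum.cong refl)
    then show ?thesis unfolding HF_def[of q p l'] sum_distrib_left sum_distrib_right by (intro sum.cong refl)
  qed
  moreover have "scF a * scF b = scF b * scF a" for a b using scF_hom(4)[of a b] scF_hom(4)[of b a] by (simp add: mult.commute)
  ultimately show ?thesis unfolding HX_def by (simp add: left_diff_distrib right_diff_distrib HF_scF[OF q p])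
qed

lemma HX_EV: "HX q p n' s M l N * EV q p n N a = EV q p n N a * HX q p n' s M l N"
proof -
  let ?H = "HX q p n' s M l N"
  have c: "?H * scF d = scF d * ?H" for d
    unfolding HX_def left_diff_distrib right_diff_distrib HF_scF[OF q p] scF_hom(4)[symmetric] by (simp add: mult.commute)
  have "?H * prod_list (map (\<lambda>x. GX q p n x N) xs) = prod_list (map (\<lambda>x. GX q p n x N) xs) * ?H" for xs
    by (induction xs) (simp_all add: commute_mult_right HX_GX)
  then show ?thesis unfolding EV_def sum_distrib_left sum_distrib_right
    by (intro sum.cong refl commute_mult_right c)
qed

lemma Ext_foldr: "Ext N (foldr (\<lambda>x. gen_op q p n x N) xs \<phi>) = app (prod_list (map (\<lambda>x. GX q p n x N) xs)) (Ext N \<phi>)"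
  by (induction xs) (simp_all add: Ext_gen_op[OF q p] app_mult)

lemma Ext_RO: "Ext N (RO q p n a N \<phi>) = app (EV q p n N a) (Ext N \<phi>)"
  unfolding RO_def EV_def Ext_sum app_op_sum by (simp add: Ext_tsmul Ext_foldr app_mult)

end

context fock_ops
begin

lemma good_foldr: "set xs \<subseteq> gens n \<Longrightarrow> good (\<lambda>N. foldr (\<lambda>x. gen_op q p n x N) xs)"
proof (induction xs)
  case Nil
  then show ?case using good_id by (simp add: id_def)
next
  case (Cons x xs)
  then show ?case using good_comp[OF good_gen[of x]] by (simp add: comp_def)
qed

lemma good_RO: "a \<in> CA n \<Longrightarrow> good (RO q p n a)"
  unfolding RO_def[abs_def] by (intro good_sum good_scale good_foldr) (auto simp: CA_def)

lemma RO_eqI: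
  assumes "good X" "good Y" "\<phi> \<in> tensors n (NN r)" "Ext (NN r) (X (NN r) \<phi>) = Ext (NN r) (Y (NN r) \<phi>)"
  shows "X (NN r) \<phi> = Y (NN r) \<phi>"
  by (rule Ext_inj[OF goodD(1)[OF assms(1,3)] goodD(1)[OF assms(2,3)] assms(4)])

lemmas EV_simps = EV_add[OF q0 p0] EV_mult[OF q0 p0] EV_0[OF q0 p0] EV_minus[OF q0 p0] EV_letter[OF q0 p0] EV_scalar[OF q0 p0]

lemma rel_ideal_ideal: "ideal (rel_ideal n q) (free_alg n)"
  unfolding rel_ideal_def using ring.genideal_ideal[OF ring_free_alg] relators_CA by (simp add: free_alg_simps)

text \<open>The elements evaluating to zero for every \<open>N\<close> form an ideal that contains
  the relators.\<close>

lemma rel_ideal_EV: "a \<in> rel_ideal n q \<Longrightarrow> EV q p n N a = 0"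
proof -
  let ?K = "{a \<in> CA n. \<forall>N. EV q p n N a = 0}"
  have "ideal ?K (free_alg n)"
    by (rule relator_idealI) (auto simp: EV_simps intro: CA_closed)
  moreover have "relators n q \<subseteq> ?K" using relators_CA EV_relators[OF q0 p0 n2 gq] by auto
  ultimately have "rel_ideal n q \<subseteq> ?K" unfolding rel_ideal_def by (rule ring.genideal_minimal[OF ring_free_alg])
  then show "a \<in> rel_ideal n q \<Longrightarrow> EV q p n N a = 0" by auto
qed

interpretation I: ideal "rel_ideal n q" "free_alg n" by (rule rel_ideal_ideal)

lemma class_EV:
  assumes "b \<in> CA n" "Uq_class n q a = Uq_class n q b"
  shows "EV q p n N a = EV q p n N b"
proof -
  have "b \<in> Uq_class n q b"
    using additive_subgroup.zero_closed[OF I.is_additive_subgroup] assms(1) unfolding Uq_class_def a_r_coset_def' by (force simp: free_alg_simps)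
  then obtain h where "h \<in> rel_ideal n q" "b = h + a"
    unfolding assms(2)[symmetric] unfolding Uq_class_def a_r_coset_def' by (auto simp: free_alg_simps)
  then show ?thesis using rel_ideal_EV[of h N] by (simp add: EV_simps)
qed

text \<open>Acts through a chosen representative; by \<open>class_EV\<close> representatives of one
  class evaluate equally, so the choice does not affect the action on Fock space.\<close>

definition U0 :: "free_elt set \<Rightarrow> fock \<Rightarrow> fock" where
  "U0 A = fop (RO q p n (SOME a. a \<in> CA n \<and> Uq_class n q a = A))"

lemma U0_class:
  assumes a: "a \<in> CA n" and w: "w \<in> Fock M"
  shows "U0 (Uq_class n q a) w = fop (RO q p n a) w"
proof -
  define b where "b = (SOME b. b \<in> CA n \<and> Uq_class n q b = Uq_class n q a)"
  have b: "b \<in> CA n" "Uq_class n q b = Uq_class n q a"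
    using someI[of "\<lambda>b. b \<in> CA n \<and> Uq_class n q b = Uq_class n q a" a] a unfolding b_def by auto
  have "fop (RO q p n b) w = fop (RO q p n a) w"
    by (rule fock_op_cong[OF good_RO[OF a] good_RO[OF b(1)] w], rule RO_eqI[OF good_RO[OF b(1)] good_RO[OF a]])
      (simp_all add: Ext_RO[OF q0 p0] class_EV[OF a b(2)])
  then show ?thesis by (simp add: U0_def b_def)
qed

lemma Uq_carrier: "A \<in> carrier (Uq n q) \<longleftrightarrow> (\<exists>a\<in>CA n. A = Uq_class n q a)"
  by (simp add: Uq_def FactRing_def A_RCOSETS_def' Uq_class_def free_alg_simps)

lemma Uq_ops:
  assumes "a \<in> CA n" "b \<in> CA n"
  shows "Uq_class n q a \<otimes>\<^bsub>Uq n q\<^esub> Uq_class n q b = Uq_class n q (a * b)"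
    "Uq_class n q a \<oplus>\<^bsub>Uq n q\<^esub> Uq_class n q b = Uq_class n q (a + b)"
  using I.rcoset_mult_add[of a b] I.a_rcos_sum[of a b] assms
  by (simp_all add: Uq_def FactRing_def Uq_class_def free_alg_simps)

lemma U0_letter:
  assumes "x \<in> gens n" "w \<in> Fock M"
  shows "U0 (Uq_class n q (letter x)) w = fop (gen_op q p n x) w"
  unfolding U0_class[OF CA_closed(8)[OF assms(1)] assms(2)]
  by (rule fock_op_cong[OF good_gen[OF assms(1)] good_RO[OF CA_closed(8)[OF assms(1)]] assms(2)])
    (simp add: RO_def letter_def tsmul_simps)

lemma U0_action: "Uq_action n q (Fock M) U0"
  unfolding Uq_action_def
proof (intro conjI ballI allI)
  fix A assume A: "A \<in> carrier (Uq n q)"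
  then obtain a where a: "a \<in> CA n" "A = Uq_class n q a" unfolding Uq_carrier by blast
  show "lin_endo (Fock M) (U0 A)"
    using fock_op_lin_endo[OF good_RO[OF a(1)]] U0_class[OF a(1)] Fock_closed unfolding a(2) lin_endo_def by simp
  fix B w assume B: "B \<in> carrier (Uq n q)" and w: "w \<in> Fock M"
  then obtain b where b: "b \<in> CA n" "B = Uq_class n q b" unfolding Uq_carrier by blast
  note g = good_RO[OF a(1)] good_RO[OF b(1)]
  note ab = CA_closed(4)[OF a(1) b(1)] CA_closed(1)[OF a(1) b(1)]
  show "U0 (A \<otimes>\<^bsub>Uq n q\<^esub> B) w = U0 A (U0 B w)"
    unfolding a(2) b(2) Uq_ops[OF a(1) b(1)] U0_class[OF b(1) w] U0_class[OF ab(1) w] U0_class[OF a(1) fock_op_Fock[OF g(2) w]]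
    by (rule fock_op_comp[OF g good_RO[OF ab(1)] w, symmetric], rule RO_eqI[OF good_RO[OF ab(1)] good_comp[OF g]])
      (simp_all add: Ext_RO[OF q0 p0] EV_simps app_mult)
  show "U0 (A \<oplus>\<^bsub>Uq n q\<^esub> B) w = U0 A w + U0 B w"
    unfolding a(2) b(2) Uq_ops[OF a(1) b(1)] U0_class[OF b(1) w] U0_class[OF ab(2) w] U0_class[OF a(1) w]
    by (rule fock_op_plus[OF g good_RO[OF ab(2)] w], rule RO_eqI[OF good_RO[OF ab(2)] good_plus[OF g]])
      (simp_all add: Ext_RO[OF q0 p0] EV_simps app_op_add Ext_add del: plus_fun_apply)
next
  fix c w assume w: "w \<in> Fock M"
  show "U0 (Uq_class n q (scalar c)) w = smul c w"
    unfolding U0_class[OF CA_closed(6) w]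
    by (rule fock_op_scale[OF good_RO[OF CA_closed(6)] w], rule RO_eqI[OF good_RO[OF CA_closed(6)] good_scale[OF good_id]])
      (simp_all add: Ext_RO[OF q0 p0] EV_simps Ext_tsmul)
qed

lemma U0_deg:
  assumes A: "A \<in> carrier (Uq n q)" and w: "w \<in> FD k"
  shows "U0 A w \<in> FD k"
proof -
  obtain a where a: "a \<in> CA n" "A = Uq_class n q a" using A unfolding Uq_carrier by blast
  show ?thesis unfolding a(2) U0_class[OF a(1) Fock_deg_closed(4)[OF w]] by (rule fock_op_deg[OF good_RO[OF a(1)] w])
qed

lemma ham_U0:
  assumes A: "A \<in> carrier (Uq n q)" and w: "w \<in> Fock M"
  shows "fop (ham l) (U0 A w) = U0 A (fop (ham l) w)"
proof -
  obtain a where a: "a \<in> CA n" "A = Uq_class n q a" using A unfolding Uq_carrier by blast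
  note g = good_RO[OF a(1)] good_ham[of l]
  show ?thesis
    unfolding a(2) U0_class[OF a(1) w] U0_class[OF a(1) fock_op_Fock[OF g(2) w]]
      fock_op_comp[OF g(2,1) good_comp[OF g(2,1)] w refl]
    by (rule fock_op_comp[OF g good_comp[OF g(2,1)] w, symmetric], rule RO_eqI[OF good_comp[OF g(2,1)] good_comp[OF g]])
      (simp_all add: Ext_RO[OF q0 p0] Ext_ham_op[OF q0 p0] HX_EV[OF q0 p0] flip: app_mult)
qed

lemma ham_ham:
  assumes w: "w \<in> Fock M"
  shows "fop (ham l) (fop (ham l') w)
    = fop (ham l') (fop (ham l) w)"
proof -
  note g = good_ham[of l] good_ham[of l']
  show ?thesis
    unfolding fock_op_comp[OF g good_comp[OF g] w refl]
    by (rule fock_op_comp[OF g(2,1) good_comp[OF g] w, symmetric], rule RO_eqI[OF good_comp[OF g] good_comp[OF g(2,1)]])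
      (simp_all add: Ext_ham_op[OF q0 p0] HX_HX[OF q0 p0, of n s M l _ l'] flip: app_mult)
qed

end

theorem mainTheorem1:
  fixes n s :: nat and q p :: complex and M :: int
  assumes n: "n \<ge> 2"
    and q: "q \<noteq> 0" "q = 1 \<or> (\<forall>j>0. q ^ j \<noteq> 1)"
    and p: "p \<noteq> 0"
    and s: "s \<le> n - 1" "int n dvd M - int s"
  shows
    \<comment> \<open>(a)\<close>
    "(\<forall>r k. k \<le> r \<longrightarrow> (\<forall>w\<in>Fock_deg n s M k.
        \<exists>!f. f \<in> trunc_space q n s M (s + n * r) k
             \<and> w = wedge_vac q n (s + n * r) f (M - int s - int n * int r)))
    \<and>
    \<comment> \<open>independence of the level in (b) and (c)\<close>
    (\<forall>x\<in>gens n. \<forall>k r r'. k \<le> r \<longrightarrow> k \<le> r' \<longrightarrow> (\<forall>w\<in>Fock_deg n s M k.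
        level_op q n s M (gen_op q p n x) k r w = level_op q n s M (gen_op q p n x) k r' w))
    \<and>
    (\<forall>l. l \<noteq> 0 \<longrightarrow> (\<forall>k r r'. k \<le> r \<longrightarrow> k \<le> r' \<longrightarrow> (\<forall>w\<in>Fock_deg n s M k.
        level_op q n s M (ham_op q p n s M l) k r w = level_op q n s M (ham_op q p n s M l) k r' w)))
    \<and>
    \<comment> \<open>(c): commuting linear operators\<close>
    (\<forall>l. l \<noteq> 0 \<longrightarrow> lin_endo (Fock M) (fock_op q n s M (ham_op q p n s M l)))
    \<and>
    (\<forall>l l'. l \<noteq> 0 \<longrightarrow> l' \<noteq> 0 \<longrightarrow> (\<forall>w\<in>Fock M.
        fock_op q n s M (ham_op q p n s M l) (fock_op q n s M (ham_op q p n s M l') w)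
        = fock_op q n s M (ham_op q p n s M l') (fock_op q n s M (ham_op q p n s M l) w)))
    \<and>
    \<comment> \<open>(b): the action \<open>U\<^sub>0\<close>, and (c): its commutation with the Hamiltonians\<close>
    (\<exists>U0. Uq_action n q (Fock M) U0
       \<and> (\<forall>x\<in>gens n. \<forall>w\<in>Fock M.
             U0 (Uq_class n q (letter x)) w = fock_op q n s M (gen_op q p n x) w)
       \<and> (\<forall>a\<in>carrier (Uq n q). \<forall>k. \<forall>w\<in>Fock_deg n s M k. U0 a w \<in> Fock_deg n s M k)
       \<and> (\<forall>l. l \<noteq> 0 \<longrightarrow> (\<forall>a\<in>carrier (Uq n q). \<forall>w\<in>Fock M.
             fock_op q n s M (ham_op q p n s M l) (U0 a w)
             = U0 a (fock_op q n s M (ham_op q p n s M l) w))))"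
proof -
  have gq: "generic_q q" using q by (simp add: generic_q_def)
  \<comment> \<open>The divisibility hypothesis makes this quotient exact, which gives
    \<open>M = s + n * t0\<close>.\<close>
  interpret fock_ops n s q M "(M - int s) div int n" p
    by unfold_locales (use n gq p s in auto)
  have vac: "M - int s - int n * int r = M - int (s + n * r)" for r by simp
  have level: "level_op q n s M X k r w = level_op q n s M X k r' w"
    if "good X" "k \<le> r" "k \<le> r'" "w \<in> Fock_deg n s M k" for X k r r' w
    using level_op_indep[OF that(1,2,4)] level_op_indep[OF that(1,3,4)] by simp
  show ?thesis unfolding vac
    by (intro conjI allI impI ballI exI[of _ U0] unique_representative level good_gen good_ham
        fock_op_lin_endo ham_ham U0_action U0_letter U0_deg ham_U0)
qed

end
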